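(* Let $G$ be a finite group. The equivariant $SK^H$-groups, varying over subgroups $H\le G$, form a Mackey functor.
   Context: A dimension $n$ is fixed throughout and omitted from the notation. For a finite group $G$, a $G$-manifold is an unoriented compact smooth manifold (possibly with boundary) equipped with a smooth $G$-action. $G$-$SK$-operation: let $M$ be an $n$-dimensional $G$-manifold and let $\Sigma\subseteq M$ be a $G$-invariant codimension 1 smooth submanifold, disjoint from $\partial M$, with normal bundle given by $\Sigma\times\mathbb{R}$ where $G$ acts trivially on $\mathbb{R}$; without loss of generality, $\Sigma$ separates $M$ into two disjoint manifolds. Cut $M$ along $\Sigma$, obtaining the disjoint union of two $G$-manifolds $M_1$ and $M_2$, each with part of its boundary equivariantly diffeomorphic to $\Sigma$. Then paste the two pieces back together along an equivariant diffeomorphism $\phi\colon\Sigma\to\Sigma$. The manifold $M_1\cup_\phi M_2$ is said to be obtained from $M$ by a $G$-$SK$-operation. (Existing boundaries are not cut, and all boundaries which come from cutting are pasted back together.) Two $G$-manifolds are $G$-$SK$-equivalent if one can be obtained from the other by a finite sequence of $G$-$SK$-operations. Let $\mathcal{M}^{G}$ be the monoid of $G$-diffeomorphism classes of $n$-dimensional $G$-manifolds (possibly with boundary) under disjoint union. The group $SK^G$ is the quotient of the group completion of $\mathcal{M}^{G}$ by the $G$-$SK$-equivalence relation. For a subgroup $H\le G$, $SK^H$ is the same construction with $H$ in place of $G$. Mackey functors: the span category of finite $G$-sets has finite $G$-sets as objects; its morphisms from $X$ to $Y$ are equivalence classes of span diagrams $X\leftarrow U\to Y$ of finite $G$-sets,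 where two spans are equivalent if there is an isomorphism $U\cong U'$ making both triangles commute; composition is given by pullback of spans. Its hom-sets are commutative monoids under disjoint union of the middle objects $U$. The Burnside category $\mathcal{B}_G$ is the additive category obtained by group completing every hom-set. A ($G$-)Mackey functor is an additive functor from $\mathcal{B}_G$ to the category of abelian groups; its value on the orbit $G/H$ is the group it assigns to the subgroup $H\le G$. In the theorem the group assigned to $H$ is $SK^H$. *)

theory Defs
  imports "HOL-Analysis.Analysis" "HOL-Algebra.Group_Action" "HOL-Algebra.Generated_Groups"
begin

section \<open>Smooth functions on subsets of Euclidean space\<close>

text \<open>
  The n-dimensional Euclidean space is the library's \<^const>\<open>Euclidean_space\<close> n, i.e. the real
  sequences vanishing from index n on. This treats all n, including 0, uniformly and allows
  dimensions n and n + 1 to occur in one statement.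
\<close>

text \<open>
  Infinite differentiability on an open set: D is the family of all iterated partial derivatives,
  indexed by the list of coordinate directions in which f has been differentiated.
\<close>

definition smooth_open :: "nat \<Rightarrow> (nat \<Rightarrow> real) set \<Rightarrow> ((nat \<Rightarrow> real) \<Rightarrow> real) \<Rightarrow> bool" where
  "smooth_open n W f \<longleftrightarrow> openin (Euclidean_space n) W \<and>
     (\<exists>D :: nat list \<Rightarrow> (nat \<Rightarrow> real) \<Rightarrow> real.
        (\<forall>x\<in>W. D [] x = f x) \<and>
        (\<forall>js. set js \<subseteq> {..<n} \<longrightarrow>
           continuous_map (subtopology (Euclidean_space n) W) euclideanreal (D js) \<and>
           (\<forall>i<n. \<forall>x\<in>W. ((\<lambda>t. D js (x(i := t))) has_real_derivative D (i # js) x) (at (x i)))))"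

text \<open>
  On an arbitrary subset, smooth means locally the restriction of a smooth function on an open set.
\<close>

definition smooth_coord :: "nat \<Rightarrow> (nat \<Rightarrow> real) set \<Rightarrow> ((nat \<Rightarrow> real) \<Rightarrow> real) \<Rightarrow> bool" where
  "smooth_coord n S f \<longleftrightarrow>
     (\<forall>x\<in>S. \<exists>W h. x \<in> W \<and> smooth_open n W h \<and> (\<forall>y\<in>S \<inter> W. h y = f y))"

definition smooth_vec :: "nat \<Rightarrow> (nat \<Rightarrow> real) set \<Rightarrow> ((nat \<Rightarrow> real) \<Rightarrow> nat \<Rightarrow> real) \<Rightarrow> bool" where
  "smooth_vec n S f \<longleftrightarrow> (\<forall>i. smooth_coord n S (\<lambda>x. f x i))"

section \<open>Smooth manifolds with boundary\<close>

record 'a smfd =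
  mtop :: "'a topology"
  matlas :: "('a set \<times> ('a \<Rightarrow> nat \<Rightarrow> real)) set"
  mdim :: nat

abbreviation mspace :: "('a, 'z) smfd_scheme \<Rightarrow> 'a set" where
  "mspace M \<equiv> topspace (mtop M)"

text \<open>For n = 0 this is the one-point space.\<close>

definition half_space :: "nat \<Rightarrow> (nat \<Rightarrow> real) topology" where
  "half_space n = subtopology (Euclidean_space n) {x. 0 \<le> x 0}"

definition smooth_manifold :: "('a, 'z) smfd_scheme \<Rightarrow> bool" where
  "smooth_manifold M \<longleftrightarrow>
     Hausdorff_space (mtop M) \<and> second_countable (mtop M) \<and>
     (\<Union>(U, c)\<in>matlas M. U) = mspace M \<and>
     (\<forall>(U, c)\<in>matlas M. openin (mtop M) U \<and> openin (half_space (mdim M)) (c ` U) \<and>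
        homeomorphic_map (subtopology (mtop M) U) (subtopology (half_space (mdim M)) (c ` U)) c) \<and>
     (\<forall>(U, c)\<in>matlas M. \<forall>(V, d)\<in>matlas M.
        smooth_vec (mdim M) (c ` (U \<inter> V)) (d \<circ> inv_into U c))"

definition mboundary :: "('a, 'z) smfd_scheme \<Rightarrow> 'a set" where
  "mboundary M = {x. 0 < mdim M \<and> (\<exists>(U, c)\<in>matlas M. x \<in> U \<and> c x 0 = 0)}"

text \<open>
  Smoothness of a map defined on a subset A of M. For A an (embedded) submanifold, or a codimension
  0 submanifold with boundary, this is smoothness for the induced structure on A.
\<close>

definition smooth_map ::
  "('a, 'y) smfd_scheme \<Rightarrow> 'a set \<Rightarrow> ('b, 'z) smfd_scheme \<Rightarrow> ('a \<Rightarrow> 'b) \<Rightarrow> bool" where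
  "smooth_map M A N f \<longleftrightarrow>
     A \<subseteq> mspace M \<and> continuous_map (subtopology (mtop M) A) (mtop N) f \<and>
     (\<forall>(U, c)\<in>matlas M. \<forall>(V, d)\<in>matlas N.
        smooth_vec (mdim M) (c ` {x \<in> A \<inter> U. f x \<in> V}) (d \<circ> f \<circ> inv_into U c))"

definition diffeo ::
  "('a, 'y) smfd_scheme \<Rightarrow> 'a set \<Rightarrow> ('b, 'z) smfd_scheme \<Rightarrow> 'b set \<Rightarrow> ('a \<Rightarrow> 'b) \<Rightarrow> bool" where
  "diffeo M A N B f \<longleftrightarrow>
     bij_betw f A B \<and> smooth_map M A N f \<and> smooth_map N B M (inv_into A f)"

definition euclidean_mfd :: "nat \<Rightarrow> (nat \<Rightarrow> real) smfd" where
  "euclidean_mfd n = \<lparr>mtop = Euclidean_space n,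
     matlas = {(topspace (Euclidean_space n), \<lambda>x. x)}, mdim = n\<rparr>"

text \<open>
  The product with the real line; the new coordinate is the one of index mdim M. (The half-space
  condition of \<^const>\<open>smooth_manifold\<close> is not normalised here; the charts are only used to say which
  maps are smooth.)
\<close>

definition times_line :: "('a, 'z) smfd_scheme \<Rightarrow> ('a \<times> real) smfd" where
  "times_line M = \<lparr>mtop = prod_topology (mtop M) euclideanreal,
     matlas = (\<lambda>(U, c). (U \<times> UNIV, \<lambda>(x, t). (c x)(mdim M := t))) ` matlas M,
     mdim = Suc (mdim M)\<rparr>"

text \<open>
  A closed codimension 1 submanifold disjoint from the boundary, given by slice charts with values
  in open subsets of Euclidean space. In dimension 0 only the empty set qualifies.
\<close>

definition hypersurface :: "('a, 'z) smfd_scheme \<Rightarrow> 'a set \<Rightarrow> bool" where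
  "hypersurface M S \<longleftrightarrow> closedin (mtop M) S \<and> S \<inter> mboundary M = {} \<and>
     (\<forall>p\<in>S. 0 < mdim M \<and>
        (\<exists>U c V. p \<in> U \<and> openin (mtop M) U \<and> openin (Euclidean_space (mdim M)) V \<and>
           diffeo M U (euclidean_mfd (mdim M)) V c \<and> c ` (U \<inter> S) = {x \<in> V. x 0 = 0}))"

section \<open>Manifolds with a smooth action\<close>

record ('a, 'g) gmfd = "'a smfd" +
  mact :: "'g \<Rightarrow> 'a \<Rightarrow> 'a"

definition G_manifold :: "nat \<Rightarrow> ('g, 'b) monoid_scheme \<Rightarrow> ('a, 'g) gmfd \<Rightarrow> bool" where
  "G_manifold n G M \<longleftrightarrow>
     smooth_manifold M \<and> compact_space (mtop M) \<and> mdim M = n \<and>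
     group_action G (mspace M) (mact M) \<and>
     (\<forall>g\<in>carrier G. smooth_map M (mspace M) M (mact M g))"

definition invariant_under :: "('g, 'b) monoid_scheme \<Rightarrow> ('a, 'g) gmfd \<Rightarrow> 'a set \<Rightarrow> bool" where
  "invariant_under G M A \<longleftrightarrow> (\<forall>g\<in>carrier G. \<forall>x\<in>A. mact M g x \<in> A)"

definition G_diffeo ::
  "('g, 'b) monoid_scheme \<Rightarrow> ('a, 'g) gmfd \<Rightarrow> 'a set \<Rightarrow> ('c, 'g) gmfd \<Rightarrow> 'c set \<Rightarrow> ('a \<Rightarrow> 'c) \<Rightarrow> bool" where
  "G_diffeo G M A N B f \<longleftrightarrow>
     invariant_under G M A \<and> invariant_under G N B \<and> diffeo M A N B f \<and>
     (\<forall>g\<in>carrier G. \<forall>x\<in>A. f (mact M g x) = mact N g (f x))"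

section \<open>Cutting and pasting\<close>

text \<open>
  The hypersurface S together with an equivariant identification e of the total space of its normal
  bundle with the product of S and the line, G acting trivially on the line, realised as a tubular
  neighbourhood. The closed pieces M1 and M2 into which M is cut lie on the negative and on the
  positive side.
\<close>

definition cut_along ::
  "('g, 'b) monoid_scheme \<Rightarrow> ('a, 'g) gmfd \<Rightarrow> 'a set \<Rightarrow> 'a set \<Rightarrow> 'a set \<Rightarrow> bool" where
  "cut_along G M S M1 M2 \<longleftrightarrow>
     hypersurface M S \<and> invariant_under G M S \<and>
     closedin (mtop M) M1 \<and> invariant_under G M M1 \<and>
     closedin (mtop M) M2 \<and> invariant_under G M M2 \<and>
     M1 \<union> M2 = mspace M \<and> M1 \<inter> M2 = S \<and>
     (\<exists>e :: 'a \<times> real \<Rightarrow> 'a.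
        openin (mtop M) (e ` (S \<times> UNIV)) \<and>
        diffeo (times_line M) (S \<times> UNIV) M (e ` (S \<times> UNIV)) e \<and>
        (\<forall>s\<in>S. e (s, 0) = s) \<and>
        (\<forall>g\<in>carrier G. \<forall>s\<in>S. \<forall>t. e (mact M g s, t) = mact M g (e (s, t))) \<and>
        (\<forall>s\<in>S. \<forall>t. (t \<le> 0 \<longrightarrow> e (s, t) \<in> M1) \<and> (t \<ge> 0 \<longrightarrow> e (s, t) \<in> M2)))"

text \<open>
  N is M1 and M2 pasted along \<phi>: as a space it is their union with x in S, regarded as a boundary
  point of M1, identified with \<phi> x, regarded as a boundary point of M2, and both pieces are smoothly
  embedded. Such a smooth structure on the pasted space is unique up to equivariant diffeomorphism.
\<close>

definition pasted_along ::
  "('g, 'b) monoid_scheme \<Rightarrow> ('a, 'g) gmfd \<Rightarrow> 'a set \<Rightarrow> 'a set \<Rightarrow> 'a set \<Rightarrow> ('a \<Rightarrow> 'a)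
     \<Rightarrow> ('a, 'g) gmfd \<Rightarrow> bool" where
  "pasted_along G M S M1 M2 \<phi> N \<longleftrightarrow>
     (\<exists>k1 k2. G_diffeo G M M1 N (k1 ` M1) k1 \<and> G_diffeo G M M2 N (k2 ` M2) k2 \<and>
        k1 ` M1 \<union> k2 ` M2 = mspace N \<and>
        (\<forall>x\<in>M1. \<forall>y\<in>M2. k1 x = k2 y \<longleftrightarrow> x \<in> S \<and> y = \<phi> x))"

definition SK_operation ::
  "nat \<Rightarrow> ('g, 'b) monoid_scheme \<Rightarrow> ('a, 'g) gmfd \<Rightarrow> ('a, 'g) gmfd \<Rightarrow> bool" where
  "SK_operation n G M N \<longleftrightarrow> G_manifold n G M \<and> G_manifold n G N \<and>
     (\<exists>S M1 M2 \<phi>. cut_along G M S M1 M2 \<and> G_diffeo G M S M S \<phi> \<and> pasted_along G M S M1 M2 \<phi> N)"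

definition SK_equivalent ::
  "nat \<Rightarrow> ('g, 'b) monoid_scheme \<Rightarrow> ('a, 'g) gmfd \<Rightarrow> ('a, 'g) gmfd \<Rightarrow> bool" where
  "SK_equivalent n G M N \<longleftrightarrow> G_manifold n G M \<and> G_manifold n G N \<and>
     ((SK_operation n G)\<^sup>*\<^sup>* M N \<or> (SK_operation n G)\<^sup>*\<^sup>* N M)"

section \<open>Group completion\<close>

definition completion_rel :: "('a, 'b) monoid_scheme \<Rightarrow> (('a \<times> 'a) \<times> ('a \<times> 'a)) set" where
  "completion_rel A = {((a, b), (c, d)) | a b c d.
     a \<in> carrier A \<and> b \<in> carrier A \<and> c \<in> carrier A \<and> d \<in> carrier A \<and>
     (\<exists>k\<in>carrier A. a \<otimes>\<^bsub>A\<^esub> d \<otimes>\<^bsub>A\<^esub> k = c \<otimes>\<^bsub>A\<^esub> b \<otimes>\<^bsub>A\<^esub> k)}"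

text \<open>The formal difference a - b.\<close>

definition formal_diff :: "('a, 'b) monoid_scheme \<Rightarrow> 'a \<Rightarrow> 'a \<Rightarrow> ('a \<times> 'a) set" where
  "formal_diff A a b = completion_rel A `` {(a, b)}"

definition group_completion :: "('a, 'b) monoid_scheme \<Rightarrow> ('a \<times> 'a) set monoid" where
  "group_completion A = \<lparr>carrier = (carrier A \<times> carrier A) // completion_rel A,
     mult = (\<lambda>P Q. \<Union>(a, b)\<in>P. \<Union>(c, d)\<in>Q. formal_diff A (a \<otimes>\<^bsub>A\<^esub> c) (b \<otimes>\<^bsub>A\<^esub> d)),
     one = formal_diff A \<one>\<^bsub>A\<^esub> \<one>\<^bsub>A\<^esub>\<rparr>"

definition completion_of :: "('a, 'b) monoid_scheme \<Rightarrow> 'a \<Rightarrow> ('a \<times> 'a) set" where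
  "completion_of A a = formal_diff A a \<one>\<^bsub>A\<^esub>"

section \<open>The SK groups\<close>

text \<open>
  Compact manifolds have at most continuum many points, so every one is diffeomorphic to one whose
  underlying set is a set of real numbers (with an unrelated topology); from here on the points are
  taken there, so that the diffeomorphism classes form a set.
\<close>

type_synonym 'g mfd = "(real, 'g) gmfd"
type_synonym 'g sk = "('g mfd set \<times> 'g mfd set) set set"

definition mfd_class :: "nat \<Rightarrow> ('g, 'b) monoid_scheme \<Rightarrow> 'g mfd \<Rightarrow> 'g mfd set" where
  "mfd_class n G M = {N. G_manifold n G N \<and> (\<exists>f. G_diffeo G M (mspace M) N (mspace N) f)}"

definition disjoint_union_of ::
  "('g, 'b) monoid_scheme \<Rightarrow> 'g mfd \<Rightarrow> 'g mfd \<Rightarrow> 'g mfd \<Rightarrow> bool" where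
  "disjoint_union_of G M1 M2 N \<longleftrightarrow>
     (\<exists>U1 U2 f1 f2. openin (mtop N) U1 \<and> openin (mtop N) U2 \<and>
        U1 \<union> U2 = mspace N \<and> U1 \<inter> U2 = {} \<and>
        G_diffeo G M1 (mspace M1) N U1 f1 \<and> G_diffeo G M2 (mspace M2) N U2 f2)"

definition mfd_monoid :: "nat \<Rightarrow> ('g, 'b) monoid_scheme \<Rightarrow> 'g mfd set monoid" where
  "mfd_monoid n G = \<lparr>carrier = {mfd_class n G M | M. G_manifold n G M},
     mult = (\<lambda>A B. {N. G_manifold n G N \<and> (\<exists>M1\<in>A. \<exists>M2\<in>B. disjoint_union_of G M1 M2 N)}),
     one = {N. G_manifold n G N \<and> mspace N = {}}\<rparr>"

definition SK_relators :: "nat \<Rightarrow> ('g, 'b) monoid_scheme \<Rightarrow> ('g mfd set \<times> 'g mfd set) set set" where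
  "SK_relators n G = {formal_diff (mfd_monoid n G) (mfd_class n G M) (mfd_class n G N) | M N.
     SK_equivalent n G M N}"

definition SK_kernel :: "nat \<Rightarrow> ('g, 'b) monoid_scheme \<Rightarrow> ('g mfd set \<times> 'g mfd set) set set" where
  "SK_kernel n G = generate (group_completion (mfd_monoid n G)) (SK_relators n G)"

definition SK :: "nat \<Rightarrow> ('g, 'b) monoid_scheme \<Rightarrow> 'g sk monoid" where
  "SK n G = group_completion (mfd_monoid n G) Mod SK_kernel n G"

text \<open>The element of the SK group represented by a diffeomorphism class.\<close>

definition SK_elem :: "nat \<Rightarrow> ('g, 'b) monoid_scheme \<Rightarrow> 'g mfd set \<Rightarrow> ('g mfd set \<times> 'g mfd set) set set" where
  "SK_elem n G A =
     SK_kernel n G #>\<^bsub>group_completion (mfd_monoid n G)\<^esub> completion_of (mfd_monoid n G) A"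

section \<open>Restriction, induction and conjugation of manifolds\<close>

abbreviation subgrp :: "('g, 'b) monoid_scheme \<Rightarrow> 'g set \<Rightarrow> ('g, 'b) monoid_scheme" where
  "subgrp G H \<equiv> G\<lparr>carrier := H\<rparr>"

text \<open>
  N is the balanced product of H and M over K: M embeds K-equivariantly as an open subset, and the
  translates of it by H cover N and are disjoint for different left cosets of K in H.
\<close>

definition induced_from ::
  "('g, 'b) monoid_scheme \<Rightarrow> 'g set \<Rightarrow> 'g set \<Rightarrow> 'g mfd \<Rightarrow> 'g mfd \<Rightarrow> bool" where
  "induced_from G K H M N \<longleftrightarrow>
     (\<exists>U j. openin (mtop N) U \<and> G_diffeo (subgrp G K) M (mspace M) N U j \<and>
        (\<Union>h\<in>H. mact N h ` U) = mspace N \<and>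
        (\<forall>h\<in>H. mact N h ` U \<inter> U \<noteq> {} \<longrightarrow> h \<in> K))"

definition induced_class ::
  "nat \<Rightarrow> ('g, 'b) monoid_scheme \<Rightarrow> 'g set \<Rightarrow> 'g set \<Rightarrow> 'g mfd \<Rightarrow> 'g mfd set" where
  "induced_class n G K H M = {N. G_manifold n (subgrp G H) N \<and> induced_from G K H M N}"

definition conj_subgroup :: "('g, 'b) monoid_scheme \<Rightarrow> 'g \<Rightarrow> 'g set \<Rightarrow> 'g set" where
  "conj_subgroup G g H = (\<lambda>h. g \<otimes>\<^bsub>G\<^esub> h \<otimes>\<^bsub>G\<^esub> inv\<^bsub>G\<^esub> g) ` H"

definition conj_mfd :: "('g, 'b) monoid_scheme \<Rightarrow> 'g \<Rightarrow> 'g mfd \<Rightarrow> 'g mfd" where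
  "conj_mfd G g M = M\<lparr>mact := \<lambda>x. mact M (inv\<^bsub>G\<^esub> g \<otimes>\<^bsub>G\<^esub> x \<otimes>\<^bsub>G\<^esub> g)\<rparr>"

section \<open>The Burnside category\<close>

record ('g, 'x) gset =
  pts :: "'x set"
  gact :: "'g \<Rightarrow> 'x \<Rightarrow> 'x"

definition finite_gset :: "('g, 'b) monoid_scheme \<Rightarrow> ('g, 'x) gset \<Rightarrow> bool" where
  "finite_gset G X \<longleftrightarrow> finite (pts X) \<and> group_action G (pts X) (gact X)"

definition gset_map ::
  "('g, 'b) monoid_scheme \<Rightarrow> ('g, 'x) gset \<Rightarrow> ('g, 'x) gset \<Rightarrow> ('x \<Rightarrow> 'x) \<Rightarrow> bool" where
  "gset_map G X Y f \<longleftrightarrow> f ` pts X \<subseteq> pts Y \<and>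
     (\<forall>g\<in>carrier G. \<forall>x\<in>pts X. f (gact X g x) = gact Y g (f x))"

record ('g, 'x) span =
  apex :: "('g, 'x) gset"
  lleg :: "'x \<Rightarrow> 'x"
  rleg :: "'x \<Rightarrow> 'x"

definition is_span ::
  "('g, 'b) monoid_scheme \<Rightarrow> ('g, 'x) gset \<Rightarrow> ('g, 'x) gset \<Rightarrow> ('g, 'x) span \<Rightarrow> bool" where
  "is_span G X Y u \<longleftrightarrow>
     finite_gset G (apex u) \<and> gset_map G (apex u) X (lleg u) \<and> gset_map G (apex u) Y (rleg u)"

definition span_class ::
  "('g, 'b) monoid_scheme \<Rightarrow> ('g, 'x) gset \<Rightarrow> ('g, 'x) gset \<Rightarrow> ('g, 'x) span \<Rightarrow> ('g, 'x) span set" where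
  "span_class G X Y u = {v. is_span G X Y v \<and>
     (\<exists>f. gset_map G (apex u) (apex v) f \<and> bij_betw f (pts (apex u)) (pts (apex v)) \<and>
        (\<forall>p\<in>pts (apex u). lleg v (f p) = lleg u p \<and> rleg v (f p) = rleg u p))}"

definition span_sum :: "('g, 'b) monoid_scheme \<Rightarrow> ('g, 'x) span \<Rightarrow> ('g, 'x) span \<Rightarrow> ('g, 'x) span \<Rightarrow> bool" where
  "span_sum G u v w \<longleftrightarrow>
     (\<exists>i j. gset_map G (apex u) (apex w) i \<and> inj_on i (pts (apex u)) \<and>
        gset_map G (apex v) (apex w) j \<and> inj_on j (pts (apex v)) \<and>
        i ` pts (apex u) \<union> j ` pts (apex v) = pts (apex w) \<and>
        i ` pts (apex u) \<inter> j ` pts (apex v) = {} \<and>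
        (\<forall>p\<in>pts (apex u). lleg w (i p) = lleg u p \<and> rleg w (i p) = rleg u p) \<and>
        (\<forall>p\<in>pts (apex v). lleg w (j p) = lleg v p \<and> rleg w (j p) = rleg v p))"

definition span_monoid ::
  "('g, 'b) monoid_scheme \<Rightarrow> ('g, 'x) gset \<Rightarrow> ('g, 'x) gset \<Rightarrow> ('g, 'x) span set monoid" where
  "span_monoid G X Y = \<lparr>carrier = {span_class G X Y u | u. is_span G X Y u},
     mult = (\<lambda>A B. {w. is_span G X Y w \<and> (\<exists>u\<in>A. \<exists>v\<in>B. span_sum G u v w)}),
     one = {u. is_span G X Y u \<and> pts (apex u) = {}}\<rparr>"

text \<open>w is the composite of u from X to Y followed by v from Y to Z.\<close>

definition span_pullback :: "('g, 'b) monoid_scheme \<Rightarrow> ('g, 'x) span \<Rightarrow> ('g, 'x) span \<Rightarrow> ('g, 'x) span \<Rightarrow> bool" where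
  "span_pullback G u v w \<longleftrightarrow>
     (\<exists>p q. gset_map G (apex w) (apex u) p \<and> gset_map G (apex w) (apex v) q \<and>
        bij_betw (\<lambda>z. (p z, q z)) (pts (apex w))
          {(a, b). a \<in> pts (apex u) \<and> b \<in> pts (apex v) \<and> rleg u a = lleg v b} \<and>
        (\<forall>z\<in>pts (apex w). lleg w z = lleg u (p z) \<and> rleg w z = rleg v (q z)))"

definition span_comp ::
  "('g, 'b) monoid_scheme \<Rightarrow> ('g, 'x) gset \<Rightarrow> ('g, 'x) gset
     \<Rightarrow> ('g, 'x) span set \<Rightarrow> ('g, 'x) span set \<Rightarrow> ('g, 'x) span set" where
  "span_comp G X Z B A = {w. is_span G X Z w \<and> (\<exists>u\<in>A. \<exists>v\<in>B. span_pullback G u v w)}"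

type_synonym ('g, 'x) bmor = "(('g, 'x) span set \<times> ('g, 'x) span set) set"

definition burnside_hom ::
  "('g, 'b) monoid_scheme \<Rightarrow> ('g, 'x) gset \<Rightarrow> ('g, 'x) gset \<Rightarrow> ('g, 'x) bmor monoid" where
  "burnside_hom G X Y = group_completion (span_monoid G X Y)"

definition burnside_span ::
  "('g, 'b) monoid_scheme \<Rightarrow> ('g, 'x) gset \<Rightarrow> ('g, 'x) gset \<Rightarrow> ('g, 'x) span \<Rightarrow> ('g, 'x) bmor" where
  "burnside_span G X Y u = completion_of (span_monoid G X Y) (span_class G X Y u)"

definition burnside_id :: "('g, 'b) monoid_scheme \<Rightarrow> ('g, 'x) gset \<Rightarrow> ('g, 'x) bmor" where
  "burnside_id G X = burnside_span G X X \<lparr>apex = X, lleg = (\<lambda>x. x), rleg = (\<lambda>x. x)\<rparr>"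

text \<open>
  The bilinear extension of the composition of spans: (c - d) after (a - b) is
  (ca + db) - (cb + da).
\<close>

definition burnside_comp ::
  "('g, 'b) monoid_scheme \<Rightarrow> ('g, 'x) gset \<Rightarrow> ('g, 'x) gset
     \<Rightarrow> ('g, 'x) bmor \<Rightarrow> ('g, 'x) bmor \<Rightarrow> ('g, 'x) bmor" where
  "burnside_comp G X Z \<beta> \<alpha> =
     (\<Union>(a, b)\<in>\<alpha>. \<Union>(c, d)\<in>\<beta>. formal_diff (span_monoid G X Z)
        (span_comp G X Z c a \<otimes>\<^bsub>span_monoid G X Z\<^esub> span_comp G X Z d b)
        (span_comp G X Z c b \<otimes>\<^bsub>span_monoid G X Z\<^esub> span_comp G X Z d a))"

section \<open>Mackey functors\<close>

text \<open>
  An additive functor from the Burnside category to abelian groups, with object part F and morphism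
  part T. The morphism part takes the source and target as arguments because a class of spans does
  not determine them.
\<close>

definition mackey_functor ::
  "('g, 'b) monoid_scheme \<Rightarrow> (('g, 'x) gset \<Rightarrow> 'v monoid)
     \<Rightarrow> (('g, 'x) gset \<Rightarrow> ('g, 'x) gset \<Rightarrow> ('g, 'x) bmor \<Rightarrow> 'v \<Rightarrow> 'v) \<Rightarrow> bool" where
  "mackey_functor G F T \<longleftrightarrow>
     (\<forall>X. finite_gset G X \<longrightarrow> comm_group (F X)) \<and>
     (\<forall>X Y \<alpha>. finite_gset G X \<longrightarrow> finite_gset G Y \<longrightarrow> \<alpha> \<in> carrier (burnside_hom G X Y) \<longrightarrow>
        T X Y \<alpha> \<in> hom (F X) (F Y)) \<and>
     (\<forall>X Y \<alpha> \<beta> a. finite_gset G X \<longrightarrow> finite_gset G Y \<longrightarrow>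
        \<alpha> \<in> carrier (burnside_hom G X Y) \<longrightarrow> \<beta> \<in> carrier (burnside_hom G X Y) \<longrightarrow>
        a \<in> carrier (F X) \<longrightarrow>
        T X Y (\<alpha> \<otimes>\<^bsub>burnside_hom G X Y\<^esub> \<beta>) a = T X Y \<alpha> a \<otimes>\<^bsub>F Y\<^esub> T X Y \<beta> a) \<and>
     (\<forall>X a. finite_gset G X \<longrightarrow> a \<in> carrier (F X) \<longrightarrow> T X X (burnside_id G X) a = a) \<and>
     (\<forall>X Y Z \<alpha> \<beta> a. finite_gset G X \<longrightarrow> finite_gset G Y \<longrightarrow> finite_gset G Z \<longrightarrow>
        \<alpha> \<in> carrier (burnside_hom G X Y) \<longrightarrow> \<beta> \<in> carrier (burnside_hom G Y Z) \<longrightarrow>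
        a \<in> carrier (F X) \<longrightarrow>
        T X Z (burnside_comp G X Z \<beta> \<alpha>) a = T Y Z \<beta> (T X Y \<alpha> a))"

section \<open>Orbits\<close>

text \<open>
  The underlying sets of finite G-sets are taken in the following infinite type, which contains a
  copy of every finite set as well as the left cosets of the subgroups of G.
\<close>

type_synonym 'g gpt = "'g set \<times> nat"

definition orbit_gset :: "('g, 'b) monoid_scheme \<Rightarrow> 'g set \<Rightarrow> ('g, 'g gpt) gset" where
  "orbit_gset G H =
     (let P = {(a <#\<^bsub>G\<^esub> H, 0) | a. a \<in> carrier G}
      in \<lparr>pts = P, gact = \<lambda>g. \<lambda>(C, k)\<in>P. (g <#\<^bsub>G\<^esub> C, k)\<rparr>)"

text \<open>The projection from G/K to G/H for K contained in H.\<close>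

definition orbit_proj :: "('g, 'b) monoid_scheme \<Rightarrow> 'g set \<Rightarrow> 'g gpt \<Rightarrow> 'g gpt" where
  "orbit_proj G H = (\<lambda>(C, k). (C <#>\<^bsub>G\<^esub> H, k))"

definition restriction_mor :: "('g, 'b) monoid_scheme \<Rightarrow> 'g set \<Rightarrow> 'g set \<Rightarrow> ('g, 'g gpt) bmor" where
  "restriction_mor G H K = burnside_span G (orbit_gset G H) (orbit_gset G K)
     \<lparr>apex = orbit_gset G K, lleg = orbit_proj G H, rleg = (\<lambda>x. x)\<rparr>"

definition transfer_mor :: "('g, 'b) monoid_scheme \<Rightarrow> 'g set \<Rightarrow> 'g set \<Rightarrow> ('g, 'g gpt) bmor" where
  "transfer_mor G K H = burnside_span G (orbit_gset G K) (orbit_gset G H)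
     \<lparr>apex = orbit_gset G K, lleg = (\<lambda>x. x), rleg = orbit_proj G H\<rparr>"

text \<open>
  The isomorphism from the orbit of H to the orbit of the conjugate of H by g, sending the coset aH
  to the coset of a times the inverse of g.
\<close>

definition conjugation_mor :: "('g, 'b) monoid_scheme \<Rightarrow> 'g \<Rightarrow> 'g set \<Rightarrow> ('g, 'g gpt) bmor" where
  "conjugation_mor G g H =
     burnside_span G (orbit_gset G H) (orbit_gset G (conj_subgroup G g H))
       \<lparr>apex = orbit_gset G H, lleg = (\<lambda>x. x),
        rleg = (\<lambda>(C, k). (C #>\<^bsub>G\<^esub> inv\<^bsub>G\<^esub> g, k))\<rparr>"

end

theory Submission
  imports Defs
begin

text \<open>
  For a finite G-set X let SK(X) be the SK group of G-manifolds over X, that is, with an equivariant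
  locally constant map to X. A span from X to Y acts by pulling such a manifold back to the apex and
  then composing with the map to Y. This respects cutting and pasting, since the map to X is constant
  along the normal lines of a hypersurface, and it turns sums of spans into sums and pullbacks into
  composites, so SK is a Mackey functor. Taking the fibre over the base point identifies SK(G/H) with
  the SK group of H-manifolds, with induction from H to G as inverse. Restriction, transfer and
  conjugation are then computed by noting that all these operations send M to a disjoint union of
  fibres of M indexed by a finite set with a cocycle, so that two of them agree once their index
  sets are matched and their cocycles differ by a coboundary.
\<close>

section \<open>Calculus on Euclidean spaces\<close>

text \<open>Working over all finite G-sets avoids the double coset formula: once SK is defined on
  every X, the composition law only says that transporting along two spans in turn is transporting
  along their pullback. Orbit representatives enter only when SK(G/H) is identified with the group
  of H-manifolds; there they produce a cocycle with values in H, and that the two passages are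
  mutually inverse is a coboundary computation. The geometric obstacle is that a transported
  manifold is a new object, a finite disjoint union of fibres placed inside the reals, on which
  boundary, slice charts, tubular neighbourhood and gluing maps have to be rebuilt. Because every
  fibre is open and compact, and smoothness on arbitrary subsets is defined by local extension, all
  of this reduces to gluing maps piece by piece. The calculus underneath rests on a chain rule
  derived from continuous partial derivatives.\<close>

lemma Euclidean_space_eq_top_of_set:
  "Euclidean_space n = top_of_set (topspace (Euclidean_space n))"
  by (simp add: Euclidean_space_def euclidean_product_topology)

lemma continuous_map_Euclidean_subset_iff:
  assumes "W \<subseteq> topspace (Euclidean_space n)"
  shows "continuous_map (subtopology (Euclidean_space n) W) euclidean f \<longleftrightarrow> continuous_on W f"
  using assms
  by (subst Euclidean_space_eq_top_of_set) (simp add: subtopology_subtopology Int_absorb1)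

text \<open>Basic open sets of the product restrict coordinates separately. On
  \<open>Euclidean_space n\<close> all coordinates from \<open>n\<close> on vanish, so a common
  radius for the first \<open>n\<close> of them suffices.\<close>

lemma openin_Euclidean_box:
  assumes "openin (Euclidean_space n) W" "a \<in> W"
  obtains e where "0 < e" "\<And>y. y \<in> topspace (Euclidean_space n) \<Longrightarrow> (\<And>i. i < n \<Longrightarrow> \<bar>y i - a i\<bar> < e) \<Longrightarrow> y \<in> W"
proof -
  obtain T where T: "openin (powertop_real UNIV) T" "W = T \<inter> {x. \<forall>i\<ge>n. x i = 0}"
    using assms(1) unfolding Euclidean_space_def openin_subtopology by blast
  have "a \<in> T" using assms T by auto
  from product_topology_open_contains_basis[OF T(1) this]
  obtain X where X: "a \<in> (\<Pi>\<^sub>E i\<in>UNIV. X i)" "\<And>i. open (X i)" "(\<Pi>\<^sub>E i\<in>UNIV. X i) \<subseteq> T"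
    by auto
  have "\<exists>e>0. \<forall>r. \<bar>r - a i\<bar> < e \<longrightarrow> r \<in> X i" for i
  proof -
    have "a i \<in> X i" using X(1) by (auto simp: PiE_iff)
    then obtain e where "e > 0" "ball (a i) e \<subseteq> X i" using X(2)[of i] openE by blast
    then show ?thesis by (intro exI[of _ e]) (auto simp: subset_iff dist_real_def abs_minus_commute)
  qed
  then obtain e where e: "\<And>i. e i > 0" "\<And>i r. \<bar>r - a i\<bar> < e i \<Longrightarrow> r \<in> X i"
    by metis
  \<comment> \<open>The inserted 1 keeps the minimum meaningful when \<open>n = 0\<close>.\<close>
  define d where "d = Min (insert 1 (e ` {..<n}))"
  have d: "d > 0" "\<And>i. i < n \<Longrightarrow> d \<le> e i"
    unfolding d_def using e(1) by auto
  show thesis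
  proof (rule that[OF d(1)])
    fix y assume y: "y \<in> topspace (Euclidean_space n)" "\<And>i. i < n \<Longrightarrow> \<bar>y i - a i\<bar> < d"
    have "y i \<in> X i" for i
    proof (cases "i < n")
      case True then show ?thesis using y(2) d(2) e(2) by (meson less_le_trans)
    next
      case False
      moreover have "a i = 0" using T assms(2) False by auto
      ultimately have "y i = a i" using y(1) by (auto simp: topspace_Euclidean_space)
      then show ?thesis using e by auto
    qed
    then show "y \<in> W" using X(3) y(1) unfolding T(2) topspace_Euclidean_space by (auto simp: PiE_iff)
  qed
qed

text \<open>The point \<open>\<xi>\<close> is located only by its distance from \<open>a\<close>.
  Thus both orders of \<open>a\<close> and \<open>b\<close> and the case \<open>a = b\<close> share
  one statement, and convergence of \<open>\<xi>\<close> to \<open>a\<close> will follow by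
  comparison.\<close>

lemma mean_value_between:
  fixes f :: "real \<Rightarrow> real"
  assumes "\<And>s. \<bar>s - a\<bar> \<le> \<bar>b - a\<bar> \<Longrightarrow> (f has_real_derivative f' s) (at s)"
  shows "\<exists>\<xi>. \<bar>\<xi> - a\<bar> \<le> \<bar>b - a\<bar> \<and> f b - f a = f' \<xi> * (b - a)"
proof -
  consider "a < b" | "b < a" | "a = b" by linarith
  then show ?thesis
  proof cases
    case 1
    have "\<exists>z>a. z < b \<and> f b - f a = (b - a) * f' z" by (rule MVT2[OF 1]) (auto intro: assms)
    then obtain z where "z > a" "z < b" "f b - f a = (b - a) * f' z" by auto
    then show ?thesis by (intro exI[of _ z]) (auto simp: algebra_simps)
  next
    case 2
    have "\<exists>z>b. z < a \<and> f a - f b = (a - b) * f' z" by (rule MVT2[OF 2]) (auto intro: assms)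
    then obtain z where "z > b" "z < a" "f a - f b = (a - b) * f' z" by auto
    then show ?thesis by (intro exI[of _ z]) (auto simp: algebra_simps)
  qed (auto intro: exI[of _ a])
qed

text \<open>The argument moves from \<open>\<gamma> t0\<close> to \<open>\<gamma> t\<close> one
  coordinate at a time. Each increment is a one-variable mean value, and continuity of the
  corresponding partial derivative gives its limit.\<close>

lemma has_derivative_along_curve:
  assumes W: "openin (Euclidean_space m) W"
    and cont: "\<And>i. i < m \<Longrightarrow> continuous_on W (D i)"
    and part: "\<And>i y. i < m \<Longrightarrow> y \<in> W \<Longrightarrow> ((\<lambda>t. f (y(i := t))) has_real_derivative D i y) (at (y i))"
    and \<gamma>: "\<And>t. \<gamma> t \<in> topspace (Euclidean_space m)" "\<gamma> t0 \<in> W"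
    and d\<gamma>: "\<And>i. i < m \<Longrightarrow> ((\<lambda>t. \<gamma> t i) has_real_derivative \<gamma>' i) (at t0)"
  shows "((\<lambda>t. f (\<gamma> t)) has_real_derivative (\<Sum>i<m. D i (\<gamma> t0) * \<gamma>' i)) (at t0)"
proof -
  obtain e where e: "0 < e"
    "\<And>y. y \<in> topspace (Euclidean_space m) \<Longrightarrow> (\<And>i. i < m \<Longrightarrow> \<bar>y i - \<gamma> t0 i\<bar> < e) \<Longrightarrow> y \<in> W"
    using openin_Euclidean_box[OF W \<gamma>(2)] by metis
  have zero: "\<gamma> t i = 0" if "i \<ge> m" for t i using \<gamma>(1)[of t] that by (auto simp: topspace_Euclidean_space)
  \<comment> \<open>\<open>z k t\<close> has its first \<open>k\<close> coordinates at time
    \<open>t\<close> and the others still at time \<open>t0\<close>, so \<open>z 0\<close> is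
    constant and \<open>z m\<close> is the curve.\<close>
  define z where "z k t = (\<lambda>i. if i < k then \<gamma> t i else \<gamma> t0 i)" for k t
  have lim: "((\<lambda>t. \<gamma> t i) \<longlongrightarrow> \<gamma> t0 i) (at t0)" for i
  proof (cases "i < m")
    case True then show ?thesis using DERIV_isCont[OF d\<gamma>[OF True]] by (simp add: isCont_def)
  qed (simp add: zero)
  have "eventually (\<lambda>t. \<bar>\<gamma> t i - \<gamma> t0 i\<bar> < e) (at t0)" for i
    using tendstoD[OF lim e(1)] by (simp add: dist_real_def)
  then have near: "eventually (\<lambda>t. \<forall>i\<in>{..<m}. \<bar>\<gamma> t i - \<gamma> t0 i\<bar> < e) (at t0)"
    by (intro eventually_ball_finite) auto
  have "k \<le> m \<Longrightarrow> ((\<lambda>t. f (z k t)) has_real_derivative (\<Sum>i<k. D i (\<gamma> t0) * \<gamma>' i)) (at t0)" for k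
  proof (induction k)
    case 0
    then show ?case by (simp add: z_def)
  next
    case (Suc k)
    then have k: "k < m" by simp
    define \<Delta> where "\<Delta> t = f (z (Suc k) t) - f (z k t)" for t
    have zS: "z (Suc k) t = (z k t)(k := \<gamma> t k)" "z k t = (z k t)(k := \<gamma> t0 k)" for t
      by (auto simp: z_def fun_eq_iff)
    \<comment> \<open>The box around \<open>\<gamma> t0\<close> contains the whole segment on which
      the mean value theorem is applied.\<close>
    have inW: "(z k t)(k := s) \<in> W" if "\<forall>i\<in>{..<m}. \<bar>\<gamma> t i - \<gamma> t0 i\<bar> < e" "\<bar>s - \<gamma> t0 k\<bar> \<le> \<bar>\<gamma> t k - \<gamma> t0 k\<bar>" for t s
    proof (rule e(2))
      show "(z k t)(k := s) \<in> topspace (Euclidean_space m)"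
        using zero k by (simp add: z_def topspace_Euclidean_space)
      fix i assume i: "i < m"
      then have "\<bar>\<gamma> t i - \<gamma> t0 i\<bar> < e" using that(1) by simp
      then show "\<bar>((z k t)(k := s)) i - \<gamma> t0 i\<bar> < e"
        using that(2) e(1) by (cases "i = k"; cases "i < k") (simp_all add: z_def)
    qed
    have "\<exists>\<xi>. \<bar>\<xi> - \<gamma> t0 k\<bar> \<le> \<bar>\<gamma> t k - \<gamma> t0 k\<bar> \<and>
        \<Delta> t = D k ((z k t)(k := \<xi>)) * (\<gamma> t k - \<gamma> t0 k)"
      if t: "\<forall>i\<in>{..<m}. \<bar>\<gamma> t i - \<gamma> t0 i\<bar> < e" for t
    proof -
      have "((\<lambda>s. f ((z k t)(k := s))) has_real_derivative D k ((z k t)(k := s))) (at s)"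
        if "\<bar>s - \<gamma> t0 k\<bar> \<le> \<bar>\<gamma> t k - \<gamma> t0 k\<bar>" for s
        using part[OF k inW[OF t that]] by simp
      from mean_value_between[of "\<gamma> t0 k" "\<gamma> t k", OF this]
      show ?thesis unfolding \<Delta>_def using zS by metis
    qed
    then obtain \<xi> where \<xi>: "\<And>t. \<forall>i\<in>{..<m}. \<bar>\<gamma> t i - \<gamma> t0 i\<bar> < e \<Longrightarrow>
        \<bar>\<xi> t - \<gamma> t0 k\<bar> \<le> \<bar>\<gamma> t k - \<gamma> t0 k\<bar> \<and> \<Delta> t = D k ((z k t)(k := \<xi> t)) * (\<gamma> t k - \<gamma> t0 k)"
      by metis
    have "((\<lambda>t. \<xi> t - \<gamma> t0 k) \<longlongrightarrow> 0) (at t0)"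
    proof (rule Lim_null_comparison)
      show "eventually (\<lambda>t. norm (\<xi> t - \<gamma> t0 k) \<le> \<bar>\<gamma> t k - \<gamma> t0 k\<bar>) (at t0)"
        using near by eventually_elim (use \<xi> in auto)
      show "((\<lambda>t. \<bar>\<gamma> t k - \<gamma> t0 k\<bar>) \<longlongrightarrow> 0) (at t0)"
        using lim[of k] by (simp add: tendsto_rabs_zero_iff LIM_zero_iff)
    qed
    then have lim\<xi>: "(\<xi> \<longlongrightarrow> \<gamma> t0 k) (at t0)" by (simp add: LIM_zero_iff)
    \<comment> \<open>Convergence in the function space is checked coordinate by coordinate, through
      the product topology.\<close>
    have lim_z: "((\<lambda>t. (z k t)(k := \<xi> t)) \<longlongrightarrow> \<gamma> t0) (at t0)"
    unfolding limitin_canonical_iff[symmetric] euclidean_product_topology[symmetric]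
        limitin_componentwise
    proof (intro conjI ballI)
      fix i show "limitin euclidean (\<lambda>t. ((z k t)(k := \<xi> t)) i) (\<gamma> t0 i) (at t0)"
        unfolding limitin_canonical_iff
        using lim lim\<xi> by (cases "i = k"; cases "i < k") (auto simp: z_def)
    qed auto
    have "((\<lambda>t. D k ((z k t)(k := \<xi> t))) \<longlongrightarrow> D k (\<gamma> t0)) (at t0)"
    proof (rule continuous_on_tendsto_compose[OF cont[OF k] lim_z \<gamma>(2)])
      show "eventually (\<lambda>t. (z k t)(k := \<xi> t) \<in> W) (at t0)"
        using near by eventually_elim (use inW \<xi> in blast)
    qed
    moreover have "((\<lambda>t. (\<gamma> t k - \<gamma> t0 k) / (t - t0)) \<longlongrightarrow> \<gamma>' k) (at t0)"
      using d\<gamma>[OF k] by (simp add: has_field_derivative_iff)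
    ultimately have "((\<lambda>t. D k ((z k t)(k := \<xi> t)) * ((\<gamma> t k - \<gamma> t0 k) / (t - t0)))
        \<longlongrightarrow> D k (\<gamma> t0) * \<gamma>' k) (at t0)" by (rule tendsto_mult)
    moreover have "eventually (\<lambda>t. D k ((z k t)(k := \<xi> t)) * ((\<gamma> t k - \<gamma> t0 k) / (t - t0))
        = (\<Delta> t - \<Delta> t0) / (t - t0)) (at t0)"
    proof -
      have "\<Delta> t0 = 0" by (simp add: \<Delta>_def z_def if_distrib cong: if_cong)
      with near show ?thesis by (elim eventually_mono) (use \<xi> in auto)
    qed
    ultimately have "((\<lambda>t. (\<Delta> t - \<Delta> t0) / (t - t0)) \<longlongrightarrow> D k (\<gamma> t0) * \<gamma>' k) (at t0)"
      by (rule Lim_transform_eventually)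
    then have "(\<Delta> has_real_derivative D k (\<gamma> t0) * \<gamma>' k) (at t0)"
      by (simp add: has_field_derivative_iff)
    from DERIV_add[OF this Suc.IH] k
    have "((\<lambda>t. \<Delta> t + f (z k t)) has_real_derivative D k (\<gamma> t0) * \<gamma>' k + (\<Sum>i<k. D i (\<gamma> t0) * \<gamma>' i)) (at t0)"
      by simp
    then show ?case by (simp add: \<Delta>_def add.commute)
  qed
  from this[of m] have "((\<lambda>t. f (z m t)) has_real_derivative (\<Sum>i<m. D i (\<gamma> t0) * \<gamma>' i)) (at t0)" by simp
  moreover have "z m = \<gamma>" using zero by (auto simp: z_def fun_eq_iff)
  ultimately show ?thesis by simp
qed

text \<open>A choice of derivative inside the class \<open>F\<close>, folded along
  \<open>js\<close>, is the family that \<open>smooth_open\<close> asks for. No formula for higher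
  derivatives has to be written down.\<close>

lemma smooth_open_coinduct:
  assumes W: "openin (Euclidean_space n) W" and "F f"
    and step: "\<And>g. F g \<Longrightarrow> continuous_on W g \<and>
      (\<forall>i<n. \<exists>g'. F g' \<and> (\<forall>x\<in>W. ((\<lambda>t. g (x(i := t))) has_real_derivative g' x) (at (x i))))"
  shows "smooth_open n W f"
proof -
  obtain d where d: "\<And>g i. F g \<Longrightarrow> i < n \<Longrightarrow> F (d g i) \<and>
      (\<forall>x\<in>W. ((\<lambda>t. g (x(i := t))) has_real_derivative d g i x) (at (x i)))"
    using step by metis
  define D where "D js = foldr (\<lambda>i g. d g i) js f" for js
  have "set js \<subseteq> {..<n} \<Longrightarrow> F (D js)" for js
    by (induction js) (auto simp: D_def assms(2) d)
  moreover have "W \<subseteq> topspace (Euclidean_space n)" using W openin_subset by blast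
  ultimately show ?thesis
    unfolding smooth_open_def using W step d
    by (intro conjI exI[of _ D]) (auto simp: D_def continuous_map_Euclidean_subset_iff)
qed

text \<open>The witness of \<open>smooth_open\<close> freed from its quantifier, so that one family
  can serve a smaller open set or another function with the same values on \<open>W\<close>.\<close>

definition jet :: "nat \<Rightarrow> (nat \<Rightarrow> real) set \<Rightarrow> ((nat \<Rightarrow> real) \<Rightarrow> real) \<Rightarrow> (nat list \<Rightarrow> (nat \<Rightarrow> real) \<Rightarrow> real) \<Rightarrow> bool" where
  "jet n W f D \<longleftrightarrow> (\<forall>x\<in>W. D [] x = f x) \<and> (\<forall>js. set js \<subseteq> {..<n} \<longrightarrow> continuous_on W (D js)) \<and>
     (\<forall>js i x. set js \<subseteq> {..<n} \<longrightarrow> i < n \<longrightarrow> x \<in> W \<longrightarrow>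
       ((\<lambda>t. D js (x(i := t))) has_real_derivative D (i # js) x) (at (x i)))"

lemma jetD:
  assumes "jet n W f D"
  shows "\<And>x. x \<in> W \<Longrightarrow> D [] x = f x"
    "\<And>js. set js \<subseteq> {..<n} \<Longrightarrow> continuous_on W (D js)"
    "\<And>js i x. set js \<subseteq> {..<n} \<Longrightarrow> i < n \<Longrightarrow> x \<in> W \<Longrightarrow>
       ((\<lambda>t. D js (x(i := t))) has_real_derivative D (i # js) x) (at (x i))"
  using assms unfolding jet_def by blast+

lemma smooth_open_iff_jet:
  "smooth_open n W f \<longleftrightarrow> openin (Euclidean_space n) W \<and> (\<exists>D. jet n W f D)"
proof (cases "openin (Euclidean_space n) W")
  case True
  have *: "W \<subseteq> topspace (Euclidean_space n)" using True openin_subset by blast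
  show ?thesis unfolding smooth_open_def jet_def continuous_map_Euclidean_subset_iff[OF *] by blast
qed (simp add: smooth_open_def)

section \<open>Restriction, coordinates and composition on open sets\<close>

lemma smooth_open_subset:
  assumes "smooth_open n W f" "openin (Euclidean_space n) V" "V \<subseteq> W"
  shows "smooth_open n V f"
proof -
  obtain D where "jet n W f D" using assms(1) smooth_open_iff_jet by blast
  then have "jet n V f D" using assms(3) continuous_on_subset[OF _ assms(3)] unfolding jet_def by blast
  then show ?thesis using assms(2) smooth_open_iff_jet by blast
qed

lemma smooth_open_continuous:
  assumes "smooth_open n W f" shows "continuous_on W f"
proof -
  obtain D where "jet n W f D" using assms smooth_open_iff_jet by blast
  then show ?thesis using jetD(1,2)[of n W f D] continuous_on_cong[of W W "D []" f]
    by (metis empty_subsetI list.set(1))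
qed

text \<open>The coinduction class is the coordinate together with all constants: differentiating the
  coordinate gives the constant 0 or 1.\<close>

lemma smooth_open_coordinate: "smooth_open n (topspace (Euclidean_space n)) (\<lambda>x. x i)"
proof (rule smooth_open_coinduct[where F = "\<lambda>g. g = (\<lambda>x. x i) \<or> (\<exists>c. g = (\<lambda>_. c))"])
  fix g :: "(nat \<Rightarrow> real) \<Rightarrow> real"
  assume g: "g = (\<lambda>x. x i) \<or> (\<exists>c. g = (\<lambda>_. c))"
  have "continuous_on (topspace (Euclidean_space n)) g"
    using g continuous_on_subset[OF continuous_on_product_coordinates[of i]] by auto
  moreover have "\<exists>c. \<forall>x. ((\<lambda>t. g (x(j := t))) has_real_derivative c) (at (x j))" for j
  proof (cases "i = j \<and> g = (\<lambda>x. x i)")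
    case True then show ?thesis by (auto intro!: exI[of _ 1] derivative_eq_intros)
  next
    case False then show ?thesis using g by (cases "i = j") (auto intro!: exI[of _ 0])
  qed
  then have "\<forall>j<n. \<exists>g'. (g' = (\<lambda>x. x i) \<or> (\<exists>c. g' = (\<lambda>_. c))) \<and>
      (\<forall>x\<in>topspace (Euclidean_space n). ((\<lambda>t. g (x(j := t))) has_real_derivative g' x) (at (x j)))"
    by metis
  ultimately show "continuous_on (topspace (Euclidean_space n)) g \<and> (\<forall>j<n. \<exists>g'. (g' = (\<lambda>x. x i) \<or> (\<exists>c. g' = (\<lambda>_. c))) \<and>
      (\<forall>x\<in>topspace (Euclidean_space n). ((\<lambda>t. g (x(j := t))) has_real_derivative g' x) (at (x j))))"
    by blast
qed auto

text \<open>
  The algebra generated by the pulled back derivatives of f and the derivatives of g; it is closed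
  under partial differentiation by the chain rule.
\<close>

inductive chain_algebra for n m :: nat and Df :: "nat list \<Rightarrow> (nat \<Rightarrow> real) \<Rightarrow> real"
    and Dg :: "nat \<Rightarrow> nat list \<Rightarrow> (nat \<Rightarrow> real) \<Rightarrow> real" and g where
  outer: "set js \<subseteq> {..<m} \<Longrightarrow> chain_algebra n m Df Dg g (\<lambda>x. Df js (g x))"
| inner: "k < m \<Longrightarrow> set js \<subseteq> {..<n} \<Longrightarrow> chain_algebra n m Df Dg g (Dg k js)"
| zero: "chain_algebra n m Df Dg g (\<lambda>_. 0)"
| add: "chain_algebra n m Df Dg g p \<Longrightarrow> chain_algebra n m Df Dg g q \<Longrightarrow>
    chain_algebra n m Df Dg g (\<lambda>x. p x + q x)"
| mult: "chain_algebra n m Df Dg g p \<Longrightarrow> chain_algebra n m Df Dg g q \<Longrightarrow>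
    chain_algebra n m Df Dg g (\<lambda>x. p x * q x)"

lemma chain_algebra_sum:
  assumes "\<And>k. k < l \<Longrightarrow> chain_algebra n m Df Dg g (p k)"
  shows "chain_algebra n m Df Dg g (\<lambda>x. \<Sum>k<(l::nat). p k x)"
  using assms
proof (induction l)
  case 0
  show ?case using chain_algebra.zero[of n m Df Dg g] by simp
next
  case (Suc l)
  have "chain_algebra n m Df Dg g (\<lambda>x. (\<Sum>k<l. p k x) + p l x)"
    by (rule chain_algebra.add) (use Suc in auto)
  then show ?case by simp
qed

text \<open>The coinduction class is \<open>chain_algebra\<close>, so the explicit shape of the
  higher derivatives of a composite never appears.\<close>

lemma smooth_open_compose:
  assumes f: "smooth_open m V f" and W: "openin (Euclidean_space n) W"
    and g: "\<And>k. k < m \<Longrightarrow> smooth_open n W (\<lambda>x. g x k)"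
    and g0: "\<And>x k. x \<in> W \<Longrightarrow> k \<ge> m \<Longrightarrow> g x k = 0" and gV: "g ` W \<subseteq> V"
  shows "smooth_open n W (\<lambda>x. f (g x))"
proof -
  have WE: "W \<subseteq> topspace (Euclidean_space n)" using W openin_subset by blast
  have V: "openin (Euclidean_space m) V" using f unfolding smooth_open_def by blast
  obtain Df where "jet m V f Df" using f smooth_open_iff_jet by blast
  note Df = jetD[OF this]
  have "\<forall>k. \<exists>D. k < m \<longrightarrow> jet n W (\<lambda>x. g x k) D" using g smooth_open_iff_jet by blast
  then obtain Dg where "\<And>k. k < m \<Longrightarrow> jet n W (\<lambda>x. g x k) (Dg k)" by metis
  note Dg = jetD[OF this]
  \<comment> \<open>\<open>h\<close> equals \<open>g\<close> on \<open>W\<close> but is built from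
    the jets, whose derivatives are the ones available, and it takes values in
    \<open>Euclidean_space m\<close> everywhere, as \<open>has_derivative_along_curve\<close>
    demands of a curve at all times.\<close>
  define h where "h x = (\<lambda>k. if k < m then Dg k [] x else 0)" for x
  have hg: "h x = g x" if "x \<in> W" for x
    using that Dg(1) g0 by (auto simp: h_def fun_eq_iff)
  have hE: "h x \<in> topspace (Euclidean_space m)" for x by (auto simp: h_def topspace_Euclidean_space)
  have hV: "h x \<in> V" if "x \<in> W" for x using that gV hg by auto
  have hcont: "continuous_on W h"
  proof (rule continuous_on_coordinatewise_then_product)
    fix k show "continuous_on W (\<lambda>x. h x k)" using Dg(2)[of k "[]"] by (cases "k < m") (auto simp: h_def)
  qed
  let ?C = "chain_algebra n m Df Dg h"
  have step: "continuous_on W p \<and>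
      (\<forall>i<n. \<exists>p'. ?C p' \<and> (\<forall>x\<in>W. ((\<lambda>t. p (x(i := t))) has_real_derivative p' x) (at (x i))))"
    if "?C p" for p
    using that
  proof induction
    case (outer js)
    have "continuous_on W (\<lambda>x. Df js (h x))"
      by (rule continuous_on_compose2[OF Df(2)[OF outer] hcont]) (use hV in auto)
    moreover have "\<exists>p'. ?C p' \<and> (\<forall>x\<in>W. ((\<lambda>t. Df js (h (x(i := t)))) has_real_derivative p' x) (at (x i)))"
      if i: "i < n" for i
    proof (intro exI conjI ballI)
      show "?C (\<lambda>x. \<Sum>k<m. Df (k # js) (h x) * Dg k [i] x)"
      proof (rule chain_algebra_sum)
        fix k assume k: "k < m"
        have "?C (\<lambda>x. Df (k # js) (h x))" by (rule chain_algebra.outer) (use outer k in auto)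
        moreover have "?C (Dg k [i])" by (rule chain_algebra.inner) (use k i in auto)
        ultimately show "?C (\<lambda>x. Df (k # js) (h x) * Dg k [i] x)" by (rule chain_algebra.mult)
      qed
      fix x assume x: "x \<in> W"
      have "((\<lambda>t. Df js (h (x(i := t)))) has_real_derivative
          (\<Sum>k<m. Df (k # js) (h (x(i := x i))) * Dg k [i] x)) (at (x i))"
      proof (rule has_derivative_along_curve[OF V])
        fix k assume k: "k < m"
        show "continuous_on V (Df (k # js))" using Df(2) outer k by auto
        show "((\<lambda>t. h (x(i := t)) k) has_real_derivative Dg k [i] x) (at (x i))"
          using Dg(3)[OF k, of "[]" i x] i x k by (simp add: h_def)
        fix y assume "y \<in> V"
        then show "((\<lambda>t. Df js (y(k := t))) has_real_derivative Df (k # js) y) (at (y k))"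
          using Df(3) outer k by auto
      qed (use hE hV[OF x] in auto)
      then show "((\<lambda>t. Df js (h (x(i := t)))) has_real_derivative
          (\<Sum>k<m. Df (k # js) (h x) * Dg k [i] x)) (at (x i))" by simp
    qed
    ultimately show ?case by blast
  next
    case (inner k js)
    have "?C (Dg k (i # js)) \<and>
        (\<forall>x\<in>W. ((\<lambda>t. Dg k js (x(i := t))) has_real_derivative Dg k (i # js) x) (at (x i)))"
      if "i < n" for i
    proof
      show "?C (Dg k (i # js))" by (rule chain_algebra.inner) (use inner that in auto)
    qed (use Dg(3) inner that in blast)
    then show ?case using Dg(2) inner by blast
  next
    case zero
    show ?case
    proof (intro conjI allI impI)
      fix i
      show "\<exists>p'. ?C p' \<and> (\<forall>x\<in>W. ((\<lambda>t. 0) has_real_derivative p' x) (at (x i)))"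
        by (rule exI[of _ "\<lambda>_. 0"]) (simp add: chain_algebra.zero)
    qed simp
  next
    case (add p q)
    have "\<exists>r. ?C r \<and> (\<forall>x\<in>W. ((\<lambda>t. p (x(i := t)) + q (x(i := t))) has_real_derivative r x) (at (x i)))"
      if "i < n" for i
    proof -
      from add that obtain p' q' where "?C p'" "?C q'"
        "\<forall>x\<in>W. ((\<lambda>t. p (x(i := t))) has_real_derivative p' x) (at (x i))"
        "\<forall>x\<in>W. ((\<lambda>t. q (x(i := t))) has_real_derivative q' x) (at (x i))" by metis
      then show ?thesis
        using chain_algebra.add[of n m Df Dg h p' q'] DERIV_add by blast
    qed
    then show ?case using add.IH continuous_on_add[of W p q] by blast
  next
    case (mult p q)
    have "\<exists>r. ?C r \<and> (\<forall>x\<in>W. ((\<lambda>t. p (x(i := t)) * q (x(i := t))) has_real_derivative r x) (at (x i)))"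
      if "i < n" for i
    proof -
      from mult that obtain p' q' where pq: "?C p'" "?C q'"
        "\<forall>x\<in>W. ((\<lambda>t. p (x(i := t))) has_real_derivative p' x) (at (x i))"
        "\<forall>x\<in>W. ((\<lambda>t. q (x(i := t))) has_real_derivative q' x) (at (x i))" by metis
      show ?thesis
      proof (intro exI[of _ "\<lambda>x. p' x * q x + q' x * p x"] conjI ballI)
        show "?C (\<lambda>x. p' x * q x + q' x * p x)"
          using mult.hyps pq(1,2) by (intro chain_algebra.add chain_algebra.mult)
        fix x assume "x \<in> W"
        then show "((\<lambda>t. p (x(i := t)) * q (x(i := t))) has_real_derivative p' x * q x + q' x * p x) (at (x i))"
          using DERIV_mult[of "\<lambda>t. p (x(i := t))" "p' x" "x i" UNIV "\<lambda>t. q (x(i := t))" "q' x"] pq by simp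
      qed
    qed
    then show ?case using mult.IH continuous_on_mult[of W p q] by blast
  qed
  have "smooth_open n W (\<lambda>x. Df [] (h x))"
    proof (rule smooth_open_coinduct[OF W, where F = ?C])
    show "?C (\<lambda>x. Df [] (h x))" by (rule chain_algebra.outer) simp
  qed (rule step)
  \<comment> \<open>A jet ties its entry at \<open>[]\<close> to the function only on
    \<open>W\<close>, where \<open>Df [] (h x)\<close> is \<open>f (g x)\<close>; hence the same
    family works.\<close>
  then obtain D where "jet n W (\<lambda>x. Df [] (h x)) D" unfolding smooth_open_iff_jet by blast
  then have "jet n W (\<lambda>x. f (g x)) D" using Df(1) hV hg unfolding jet_def by simp
  then show ?thesis using W smooth_open_iff_jet by blast
qed

subsection \<open>Smooth maps between arbitrary subsets\<close>

lemma smooth_coord_subset: "smooth_coord n T f \<Longrightarrow> S \<subseteq> T \<Longrightarrow> smooth_coord n S f"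
  unfolding smooth_coord_def
proof (rule ballI)
  fix x assume *: "\<forall>x\<in>T. \<exists>W h. x \<in> W \<and> smooth_open n W h \<and> (\<forall>y\<in>T \<inter> W. h y = f y)" "S \<subseteq> T" "x \<in> S"
  then obtain W h where "x \<in> W \<and> smooth_open n W h \<and> (\<forall>y\<in>T \<inter> W. h y = f y)" by blast
  then show "\<exists>W h. x \<in> W \<and> smooth_open n W h \<and> (\<forall>y\<in>S \<inter> W. h y = f y)"
    using *(2) by (intro exI[of _ W] exI[of _ h]) auto
qed

lemma smooth_vec_subset: "smooth_vec n T f \<Longrightarrow> S \<subseteq> T \<Longrightarrow> smooth_vec n S f"
  unfolding smooth_vec_def using smooth_coord_subset by blast

lemma smooth_coord_cong: "(\<And>x. x \<in> S \<Longrightarrow> f x = g x) \<Longrightarrow> smooth_coord n S f \<longleftrightarrow> smooth_coord n S g"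
  unfolding smooth_coord_def by (metis IntE)

lemma smooth_vec_cong: "(\<And>x. x \<in> S \<Longrightarrow> f x = g x) \<Longrightarrow> smooth_vec n S f \<longleftrightarrow> smooth_vec n S g"
  unfolding smooth_vec_def by (intro iff_allI smooth_coord_cong) simp

lemma smooth_coord_local:
  assumes "\<And>x. x \<in> S \<Longrightarrow> \<exists>W. x \<in> W \<and> openin (Euclidean_space n) W \<and> smooth_coord n (S \<inter> W) f"
  shows "smooth_coord n S f"
  unfolding smooth_coord_def
proof
  fix x assume x: "x \<in> S"
  from assms[OF x] obtain W where W: "x \<in> W" "openin (Euclidean_space n) W" "smooth_coord n (S \<inter> W) f" by blast
  then obtain V h where V: "x \<in> V" "smooth_open n V h" "\<forall>y\<in>S \<inter> W \<inter> V. h y = f y"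
    unfolding smooth_coord_def using x by blast
  have "openin (Euclidean_space n) (W \<inter> V)" using W V unfolding smooth_open_def by blast
  then show "\<exists>W h. x \<in> W \<and> smooth_open n W h \<and> (\<forall>y\<in>S \<inter> W. h y = f y)"
    using W V smooth_open_subset[OF V(2)] by (intro exI[of _ "W \<inter> V"] exI[of _ h]) auto
qed

lemma smooth_vec_local:
  assumes "\<And>x. x \<in> S \<Longrightarrow> \<exists>W. x \<in> W \<and> openin (Euclidean_space n) W \<and> smooth_vec n (S \<inter> W) f"
  shows "smooth_vec n S f"
  using assms smooth_coord_local[of S n] unfolding smooth_vec_def by meson

lemma smooth_coord_coordinate:
  assumes "S \<subseteq> topspace (Euclidean_space n)" shows "smooth_coord n S (\<lambda>x. x i)"
  unfolding smooth_coord_def using assms smooth_open_coordinate by blast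

lemma smooth_coord_zero:
  assumes "S \<subseteq> topspace (Euclidean_space n)" shows "smooth_coord n S (\<lambda>x. 0)"
  using smooth_coord_coordinate[OF assms, of n] assms
  by (subst smooth_coord_cong[where g = "\<lambda>x. x n"]) (auto simp: topspace_Euclidean_space subset_iff)

text \<open>Near \<open>x\<close> the function \<open>f\<close> and the first \<open>m\<close>
  coordinates of \<open>g\<close> have smooth extensions to open sets, and the composite of these
  extensions extends the composite.\<close>

lemma smooth_coord_compose:
  assumes f: "smooth_coord m T f" and g: "smooth_vec n S g"
    and gT: "g ` S \<subseteq> T" "g ` S \<subseteq> topspace (Euclidean_space m)"
  shows "smooth_coord n S (\<lambda>x. f (g x))"
  unfolding smooth_coord_def
proof
  fix x assume x: "x \<in> S"
  then obtain V h where V: "g x \<in> V" "smooth_open m V h" "\<forall>y\<in>T \<inter> V. h y = f y"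
    using f gT unfolding smooth_coord_def by (metis image_subset_iff)
  have Vo: "openin (Euclidean_space m) V" using V unfolding smooth_open_def by blast
  have "\<forall>k. \<exists>W h. x \<in> W \<and> smooth_open n W h \<and> (\<forall>y\<in>S \<inter> W. h y = g y k)"
    using g x unfolding smooth_vec_def smooth_coord_def by blast
  then obtain W p where W: "\<And>k. x \<in> W k" "\<And>k. smooth_open n (W k) (p k)" "\<And>k y. y \<in> S \<inter> W k \<Longrightarrow> p k y = g y k"
    by metis
  \<comment> \<open>The bound is \<open>k \<le> m\<close> instead of \<open>k < m\<close> so that
    the intersection is over a nonempty index set even for \<open>m = 0\<close>.\<close>
  define W0 where "W0 = (\<Inter>k\<le>m. W k)"
  have W0: "openin (Euclidean_space n) W0" unfolding W0_def
    using W(2) unfolding smooth_open_def by (intro openin_INT2) auto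
  have W0E: "W0 \<subseteq> topspace (Euclidean_space n)" using W0 openin_subset by blast
  \<comment> \<open>Zero coordinates from \<open>m\<close> on put \<open>q y\<close> into
    \<open>Euclidean_space m\<close> for every \<open>y\<close>; for \<open>g y\<close> this is
    known only on \<open>S\<close>.\<close>
  define q where "q y = (\<lambda>k. if k < m then p k y else 0)" for y
  have pk: "smooth_open n W0 (p k)" if "k \<le> m" for k
    by (rule smooth_open_subset[OF W(2)[of k] W0]) (use that in \<open>auto simp: W0_def\<close>)
  have qg: "q y = g y" if "y \<in> S" "y \<in> W0" for y
  proof
    fix k show "q y k = g y k"
    proof (cases "k < m")
      case True
      then show ?thesis using that W(3)[of y k] unfolding q_def W0_def by auto
    next
      case False
      then show ?thesis using that gT(2) by (auto simp: q_def topspace_Euclidean_space image_subset_iff)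
    qed
  qed
  have qm: "continuous_map (subtopology (Euclidean_space n) W0) (Euclidean_space m) q"
    unfolding q_def continuous_map_componentwise_Euclidean_space
  proof (intro allI impI)
    fix k assume "k < m"
    then have "continuous_on W0 (p k)" using smooth_open_continuous[OF pk[of k]] by simp
    then show "continuous_map (subtopology (Euclidean_space n) W0) euclideanreal (p k)"
      by (simp add: continuous_map_Euclidean_subset_iff[OF W0E])
  qed
  define U where "U = {y \<in> W0. q y \<in> V}"
  have "openin (subtopology (Euclidean_space n) W0) U"
    using openin_continuous_map_preimage[OF qm Vo] W0E by (simp add: U_def Int_absorb1)
  then have U: "openin (Euclidean_space n) U" using W0 openin_trans_full by blast
  have "smooth_open n U (\<lambda>y. h (q y))"
  proof (rule smooth_open_compose[OF V(2) U])
    fix k assume "k < m"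
    then show "smooth_open n U (\<lambda>y. q y k)"
      using smooth_open_subset[OF pk[of k] U] by (auto simp: U_def q_def)
  qed (auto simp: U_def q_def)
  moreover have "x \<in> W0" using W by (auto simp: W0_def)
  then have "x \<in> U" using V(1) x qg by (auto simp: U_def)
  moreover have "\<forall>y\<in>S \<inter> U. h (q y) = f (g y)"
    using qg V(3) gT by (auto simp: U_def image_subset_iff)
  ultimately show "\<exists>W h. x \<in> W \<and> smooth_open n W h \<and> (\<forall>y\<in>S \<inter> W. h y = f (g y))" by blast
qed

lemma smooth_vec_compose:
  assumes "smooth_vec m T f" "smooth_vec n S g" "g ` S \<subseteq> T" "g ` S \<subseteq> topspace (Euclidean_space m)"
  shows "smooth_vec n S (f \<circ> g)"
proof -
  have "smooth_coord n S (\<lambda>x. f (g x) i)" for i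
    using smooth_coord_compose[of m T "\<lambda>y. f y i" n S g] assms unfolding smooth_vec_def by blast
  then show ?thesis unfolding smooth_vec_def by simp
qed

section \<open>Smooth maps and diffeomorphisms\<close>

text \<open>
  The part of the manifold axioms that the calculus of smooth maps needs; unlike
  \<^const>\<open>smooth_manifold\<close> it holds for \<^const>\<open>times_line\<close> and \<^const>\<open>euclidean_mfd\<close>.
\<close>

definition charted :: "('a, 'z) smfd_scheme \<Rightarrow> bool" where
  "charted M \<longleftrightarrow> (\<Union>(U, c)\<in>matlas M. U) = mspace M \<and>
     (\<forall>(U, c)\<in>matlas M. openin (mtop M) U \<and> c ` U \<subseteq> topspace (Euclidean_space (mdim M)) \<and>
        homeomorphic_map (subtopology (mtop M) U) (subtopology (Euclidean_space (mdim M)) (c ` U)) c) \<and>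
     (\<forall>(U, c)\<in>matlas M. \<forall>(V, d)\<in>matlas M.
        smooth_vec (mdim M) (c ` (U \<inter> V)) (d \<circ> inv_into U c))"

text \<open>An open subset of the half-space consists of points of the half-space, so the
  intermediate restriction is absorbed. This lets \<open>charted\<close> speak of Euclidean space
  alone.\<close>

lemma subtopology_half_space:
  assumes "openin (half_space n) S"
  shows "subtopology (half_space n) S = subtopology (Euclidean_space n) S"
    "S \<subseteq> topspace (Euclidean_space n)"
proof -
  have "S \<subseteq> {x. 0 \<le> x 0} \<inter> topspace (Euclidean_space n)"
    using openin_subset[OF assms] by (auto simp: half_space_def)
  then show "subtopology (half_space n) S = subtopology (Euclidean_space n) S"
    "S \<subseteq> topspace (Euclidean_space n)"
    unfolding half_space_def subtopology_subtopology by (auto simp: Int_absorb1)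
qed

lemma smooth_manifold_charted: "smooth_manifold M \<Longrightarrow> charted M"
  unfolding smooth_manifold_def charted_def
  using subtopology_half_space[of "mdim M"] by fastforce

lemma chartedD:
  assumes "charted M" "(U, c) \<in> matlas M"
  shows "openin (mtop M) U" "U \<subseteq> mspace M" "c ` U \<subseteq> topspace (Euclidean_space (mdim M))" "inj_on c U"
    "homeomorphic_map (subtopology (mtop M) U) (subtopology (Euclidean_space (mdim M)) (c ` U)) c"
    "(V, d) \<in> matlas M \<Longrightarrow> smooth_vec (mdim M) (c ` (U \<inter> V)) (d \<circ> inv_into U c)"
proof -
  have *: "openin (mtop M) U \<and> c ` U \<subseteq> topspace (Euclidean_space (mdim M)) \<and>
      homeomorphic_map (subtopology (mtop M) U) (subtopology (Euclidean_space (mdim M)) (c ` U)) c"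
    using assms unfolding charted_def by blast
  then show U: "openin (mtop M) U" and h: "homeomorphic_map (subtopology (mtop M) U) (subtopology (Euclidean_space (mdim M)) (c ` U)) c"
    "c ` U \<subseteq> topspace (Euclidean_space (mdim M))" by blast+
  show US: "U \<subseteq> mspace M" using U openin_subset by blast
  show "inj_on c U" using homeomorphic_imp_injective_map[OF h(1)] US by (simp add: Int_absorb1)
  show "(V, d) \<in> matlas M \<Longrightarrow> smooth_vec (mdim M) (c ` (U \<inter> V)) (d \<circ> inv_into U c)"
    using assms unfolding charted_def by blast
qed

lemma charted_chart_at:
  assumes "charted M" "x \<in> mspace M"
  obtains U c where "(U, c) \<in> matlas M" "x \<in> U"
proof -
  have "x \<in> (\<Union>(U, c)\<in>matlas M. U)" using assms unfolding charted_def by blast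
  then show thesis using that by auto
qed

text \<open>At boundary points the image of a chart is not open in Euclidean space, so an open set
  of \<open>M\<close> is described as the trace of an open \<open>W\<close> on that image. This is
  the form in which locality of smoothness is used.\<close>

lemma chart_image_open:
  assumes "charted M" "(U, c) \<in> matlas M" "openin (mtop M) T"
  obtains W where "openin (Euclidean_space (mdim M)) W" "c ` (T \<inter> U) = W \<inter> c ` U"
proof -
  note c = chartedD[OF assms(1,2)]
  have "openin (subtopology (mtop M) U) (T \<inter> U)" using assms(3) openin_subtopology by blast
  then have "openin (subtopology (Euclidean_space (mdim M)) (c ` U)) (c ` (T \<inter> U))"
    using homeomorphic_imp_open_map[OF c(5)] unfolding open_map_def by blast
  then show thesis using that unfolding openin_subtopology by blast
qed

section \<open>Smooth maps on subsets: restriction, composition, locality\<close>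

lemma smooth_map_domain: "smooth_map M A N f \<Longrightarrow> A \<subseteq> mspace M"
  unfolding smooth_map_def by blast

lemma smooth_map_continuous: "smooth_map M A N f \<Longrightarrow> continuous_map (subtopology (mtop M) A) (mtop N) f"
  unfolding smooth_map_def by blast

lemma smooth_map_image: "smooth_map M A N f \<Longrightarrow> f ` A \<subseteq> mspace N"
  using continuous_map_image_subset_topspace[OF smooth_map_continuous] smooth_map_domain
  by (fastforce simp: Int_absorb1)

lemma smooth_map_charts:
  "smooth_map M A N f \<Longrightarrow> (U, c) \<in> matlas M \<Longrightarrow> (V, d) \<in> matlas N \<Longrightarrow>
    smooth_vec (mdim M) (c ` {x \<in> A \<inter> U. f x \<in> V}) (d \<circ> f \<circ> inv_into U c)"
  unfolding smooth_map_def by fast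

lemma smooth_mapI:
  assumes "A \<subseteq> mspace M" "continuous_map (subtopology (mtop M) A) (mtop N) f"
    "\<And>U c V d. (U, c) \<in> matlas M \<Longrightarrow> (V, d) \<in> matlas N \<Longrightarrow>
       smooth_vec (mdim M) (c ` {x \<in> A \<inter> U. f x \<in> V}) (d \<circ> f \<circ> inv_into U c)"
  shows "smooth_map M A N f"
  using assms unfolding smooth_map_def by blast

lemma smooth_map_cong:
  assumes "smooth_map M A N f" "charted M" "\<And>x. x \<in> A \<Longrightarrow> f x = g x"
  shows "smooth_map M A N g"
proof (rule smooth_mapI)
  show "A \<subseteq> mspace M" using assms(1) smooth_map_domain by blast
  show "continuous_map (subtopology (mtop M) A) (mtop N) g"
    by (rule continuous_map_eq[OF smooth_map_continuous[OF assms(1)]]) (use assms(3) in auto)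
  fix U c V d assume *: "(U, c) \<in> matlas M" "(V, d) \<in> matlas N"
  have "{x \<in> A \<inter> U. f x \<in> V} = {x \<in> A \<inter> U. g x \<in> V}" using assms(3) by auto
  then have "smooth_vec (mdim M) (c ` {x \<in> A \<inter> U. g x \<in> V}) (d \<circ> f \<circ> inv_into U c)"
    using smooth_map_charts[OF assms(1) *] by simp
  then show "smooth_vec (mdim M) (c ` {x \<in> A \<inter> U. g x \<in> V}) (d \<circ> g \<circ> inv_into U c)"
    by (rule iffD1[OF smooth_vec_cong, rotated]) (use chartedD(4)[OF assms(2) *(1)] assms(3) in auto)
qed

lemma smooth_map_subset:
  assumes "smooth_map M A N f" "B \<subseteq> A" shows "smooth_map M B N f"
proof (rule smooth_mapI)
  show "B \<subseteq> mspace M" using assms smooth_map_domain by blast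
  show "continuous_map (subtopology (mtop M) B) (mtop N) f"
    using continuous_map_from_subtopology_mono[OF smooth_map_continuous[OF assms(1)] assms(2)] .
  fix U c V d assume *: "(U, c) \<in> matlas M" "(V, d) \<in> matlas N"
  show "smooth_vec (mdim M) (c ` {x \<in> B \<inter> U. f x \<in> V}) (d \<circ> f \<circ> inv_into U c)"
    by (rule smooth_vec_subset[OF smooth_map_charts[OF assms(1) *]]) (use assms in auto)
qed

lemma smooth_map_id:
  assumes "charted M" "A \<subseteq> mspace M" shows "smooth_map M A M (\<lambda>x. x)"
proof (rule smooth_mapI)
  fix U c V d assume *: "(U, c) \<in> matlas M" "(V, d) \<in> matlas M"
  show "smooth_vec (mdim M) (c ` {x \<in> A \<inter> U. x \<in> V}) (d \<circ> (\<lambda>x. x) \<circ> inv_into U c)"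
  proof -
    have "d \<circ> (\<lambda>x. x) \<circ> inv_into U c = d \<circ> inv_into U c" by auto
    moreover have "c ` {x \<in> A \<inter> U. x \<in> V} \<subseteq> c ` (U \<inter> V)" by blast
    ultimately show ?thesis using smooth_vec_subset[OF chartedD(6)[OF assms(1) *]] by simp
  qed
qed (use assms continuous_map_id in \<open>auto simp: id_def intro: continuous_map_from_subtopology\<close>)

text \<open>Around each point a chart of the middle manifold at \<open>f x\<close> is inserted. By
  continuity the points sent into its domain form a relatively open set, and there the coordinate
  expression factors.\<close>

lemma smooth_map_compose:
  assumes M: "charted M" and N: "charted N" and f: "smooth_map M A N f" and g: "smooth_map N B P g"
    and fA: "f ` A \<subseteq> B"
  shows "smooth_map M A P (\<lambda>x. g (f x))"
proof (rule smooth_mapI)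
  show "A \<subseteq> mspace M" using f smooth_map_domain by blast
  have "continuous_map (subtopology (mtop M) A) (subtopology (mtop N) B) f"
    using smooth_map_continuous[OF f] fA smooth_map_domain[OF f] by (auto simp: continuous_map_in_subtopology)
  from continuous_map_compose[OF this smooth_map_continuous[OF g]]
  show "continuous_map (subtopology (mtop M) A) (mtop P) (\<lambda>x. g (f x))" by (simp add: o_def)
  fix U c W e assume U: "(U, c) \<in> matlas M" and W: "(W, e) \<in> matlas P"
  note c = chartedD[OF M U]
  let ?S = "c ` {x \<in> A \<inter> U. g (f x) \<in> W}"
  show "smooth_vec (mdim M) ?S (e \<circ> (\<lambda>x. g (f x)) \<circ> inv_into U c)"
  proof (rule smooth_vec_local)
    fix z assume "z \<in> ?S"
    then obtain x where x: "x \<in> A" "x \<in> U" "g (f x) \<in> W" "z = c x" by blast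
    then obtain V d where V: "(V, d) \<in> matlas N" "f x \<in> V"
      using charted_chart_at[OF N] smooth_map_image[OF f] by blast
    note d = chartedD[OF N V(1)]
    have "openin (subtopology (mtop M) A) {y \<in> A. f y \<in> V}"
      using openin_continuous_map_preimage[OF smooth_map_continuous[OF f] d(1)] smooth_map_domain[OF f]
      by (simp add: Int_absorb1)
    then obtain T where T: "openin (mtop M) T" "{y \<in> A. f y \<in> V} = T \<inter> A" unfolding openin_subtopology by blast
    obtain Q where Q: "openin (Euclidean_space (mdim M)) Q" "c ` (T \<inter> U) = Q \<inter> c ` U"
      using chart_image_open[OF M U T(1)] .
    have "x \<in> T" using T(2) x V by blast
    then have zQ: "z \<in> Q" using Q(2) x by blast
    let ?g1 = "d \<circ> f \<circ> inv_into U c" and ?g2 = "e \<circ> g \<circ> inv_into V d"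
    \<comment> \<open>A point of the coordinate set inside \<open>Q\<close> comes from
      \<open>T\<close>, hence \<open>f\<close> sends it into the domain of the middle chart.\<close>
    have elem: "\<exists>y. y \<in> A \<and> y \<in> U \<and> g (f y) \<in> W \<and> f y \<in> V \<and> w = c y" if w: "w \<in> ?S \<inter> Q" for w
    proof -
      obtain y where y: "y \<in> A" "y \<in> U" "g (f y) \<in> W" "w = c y" using w by blast
      then have "c y \<in> c ` (T \<inter> U)" using Q(2) w by blast
      then have "y \<in> T" using c(4) y(2) by (auto dest: inj_onD)
      then show ?thesis using y T(2) by blast
    qed
    have "smooth_vec (mdim M) (?S \<inter> Q) (?g2 \<circ> ?g1)"
    proof (rule smooth_vec_compose)
      show "smooth_vec (mdim N) (d ` {y \<in> B \<inter> V. g y \<in> W}) ?g2" by (rule smooth_map_charts[OF g V(1) W])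
      show "smooth_vec (mdim M) (?S \<inter> Q) ?g1"
        by (rule smooth_vec_subset[OF smooth_map_charts[OF f U V(1)]]) (use elem in blast)
      show "?g1 ` (?S \<inter> Q) \<subseteq> d ` {y \<in> B \<inter> V. g y \<in> W}"
      proof (rule image_subsetI)
        fix w assume "w \<in> ?S \<inter> Q"
        then obtain y where "y \<in> A" "y \<in> U" "g (f y) \<in> W" "f y \<in> V" "w = c y" using elem by blast
        then show "?g1 w \<in> d ` {y \<in> B \<inter> V. g y \<in> W}" using c(4) fA by auto
      qed
      then show "?g1 ` (?S \<inter> Q) \<subseteq> topspace (Euclidean_space (mdim N))" using d(3) by blast
    qed
    then have "smooth_vec (mdim M) (?S \<inter> Q) (e \<circ> (\<lambda>x. g (f x)) \<circ> inv_into U c)"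
    proof (rule iffD1[OF smooth_vec_cong, rotated])
      fix w assume "w \<in> ?S \<inter> Q"
      then obtain y where "y \<in> A" "y \<in> U" "g (f y) \<in> W" "f y \<in> V" "w = c y" using elem by blast
      then show "(?g2 \<circ> ?g1) w = (e \<circ> (\<lambda>x. g (f x)) \<circ> inv_into U c) w" using c(4) d(4) by simp
    qed
    with zQ Q(1) show "\<exists>W'. z \<in> W' \<and> openin (Euclidean_space (mdim M)) W' \<and>
        smooth_vec (mdim M) (?S \<inter> W') (e \<circ> (\<lambda>x. g (f x)) \<circ> inv_into U c)" by blast
  qed
qed

lemma smooth_map_local:
  assumes M: "charted M" and A: "A \<subseteq> mspace M"
    and loc: "\<And>x. x \<in> A \<Longrightarrow> \<exists>T. openin (mtop M) T \<and> x \<in> T \<and> smooth_map M (A \<inter> T) N f"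
  shows "smooth_map M A N f"
proof (rule smooth_mapI[OF A])
  show "continuous_map (subtopology (mtop M) A) (mtop N) f"
    unfolding continuous_map_def
  proof (intro conjI allI impI)
    show "f \<in> topspace (subtopology (mtop M) A) \<rightarrow> mspace N"
    proof
      fix x assume "x \<in> topspace (subtopology (mtop M) A)"
      then have x: "x \<in> A" by simp
      obtain T where "openin (mtop M) T" "x \<in> T" "smooth_map M (A \<inter> T) N f" using loc[OF x] by blast
      then show "f x \<in> mspace N" using smooth_map_image x by blast
    qed
    fix V assume V: "openin (mtop N) V"
    show "openin (subtopology (mtop M) A) {x \<in> topspace (subtopology (mtop M) A). f x \<in> V}"
    proof (subst openin_subopen, intro ballI)
      fix x assume x: "x \<in> {x \<in> topspace (subtopology (mtop M) A). f x \<in> V}"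
      then have "x \<in> A" by simp
      then obtain T where T: "openin (mtop M) T" "x \<in> T" "smooth_map M (A \<inter> T) N f" using loc by blast
      have "openin (subtopology (mtop M) (A \<inter> T)) {y \<in> A \<inter> T. f y \<in> V}"
      proof -
        have "topspace (subtopology (mtop M) (A \<inter> T)) = A \<inter> T" using A by auto
        then show ?thesis using openin_continuous_map_preimage[OF smooth_map_continuous[OF T(3)] V] by simp
      qed
      then obtain R where R: "openin (mtop M) R" "{y \<in> A \<inter> T. f y \<in> V} = R \<inter> (A \<inter> T)"
        unfolding openin_subtopology by blast
      have "openin (subtopology (mtop M) A) ((R \<inter> T) \<inter> A)" using R T openin_subtopology by blast
      moreover have "(R \<inter> T) \<inter> A = R \<inter> (A \<inter> T)" by blast
      ultimately have "openin (subtopology (mtop M) A) {y \<in> A \<inter> T. f y \<in> V}" unfolding R(2) by simp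
      then show "\<exists>T. openin (subtopology (mtop M) A) T \<and> x \<in> T \<and> T \<subseteq> {x \<in> topspace (subtopology (mtop M) A). f x \<in> V}"
        using x T A by (intro exI[of _ "{y \<in> A \<inter> T. f y \<in> V}"]) auto
    qed
  qed
next
  fix U c V d assume U: "(U, c) \<in> matlas M" and V: "(V, d) \<in> matlas N"
  note c = chartedD[OF M U]
  let ?S = "c ` {x \<in> A \<inter> U. f x \<in> V}"
  show "smooth_vec (mdim M) ?S (d \<circ> f \<circ> inv_into U c)"
  proof (rule smooth_vec_local)
    fix z assume "z \<in> ?S"
    then obtain x where x: "x \<in> A" "x \<in> U" "f x \<in> V" "z = c x" by blast
    then obtain T where T: "openin (mtop M) T" "x \<in> T" "smooth_map M (A \<inter> T) N f" using loc by blast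
    obtain Q where Q: "openin (Euclidean_space (mdim M)) Q" "c ` (T \<inter> U) = Q \<inter> c ` U"
      using chart_image_open[OF M U T(1)] .
    have "?S \<inter> Q \<subseteq> c ` {x \<in> (A \<inter> T) \<inter> U. f x \<in> V}"
    proof
      fix w assume w: "w \<in> ?S \<inter> Q"
      then obtain y where y: "y \<in> A" "y \<in> U" "f y \<in> V" "w = c y" by blast
      then have "c y \<in> c ` (T \<inter> U)" using Q(2) w by blast
      then have "y \<in> T" using c(4) y(2) by (auto dest: inj_onD)
      then show "w \<in> c ` {x \<in> (A \<inter> T) \<inter> U. f x \<in> V}" using y by blast
    qed
    then have "smooth_vec (mdim M) (?S \<inter> Q) (d \<circ> f \<circ> inv_into U c)"
      using smooth_vec_subset[OF smooth_map_charts[OF T(3) U V]] by blast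
    moreover have "z \<in> Q" using Q x T by blast
    ultimately show "\<exists>W. z \<in> W \<and> openin (Euclidean_space (mdim M)) W \<and>
        smooth_vec (mdim M) (?S \<inter> W) (d \<circ> f \<circ> inv_into U c)" using Q(1) by blast
  qed
qed

section \<open>Diffeomorphisms between subsets\<close>

lemma diffeoI:
  assumes "charted N" "smooth_map M A N f" "smooth_map N B M g"
    and "\<And>x. x \<in> A \<Longrightarrow> f x \<in> B" "\<And>y. y \<in> B \<Longrightarrow> g y \<in> A"
    and "\<And>x. x \<in> A \<Longrightarrow> g (f x) = x" "\<And>y. y \<in> B \<Longrightarrow> f (g y) = y"
  shows "diffeo M A N B f"
proof -
  have b: "bij_betw f A B" using assms(4-7) by (intro bij_betw_byWitness[where f' = g]) auto
  have "smooth_map N B M (inv_into A f)"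
  proof (rule smooth_map_cong[OF assms(3,1)])
    fix y assume "y \<in> B" then show "g y = inv_into A f y"
      using b assms(5,7) by (metis bij_betw_def inv_into_f_f)
  qed
  then show ?thesis using b assms(2) unfolding diffeo_def by blast
qed

lemma diffeoD:
  assumes "diffeo M A N B f"
  shows "bij_betw f A B" "inj_on f A" "f ` A = B" "smooth_map M A N f" "smooth_map N B M (inv_into A f)"
    "A \<subseteq> mspace M" "B \<subseteq> mspace N" "\<And>x. x \<in> A \<Longrightarrow> inv_into A f (f x) = x"
    "\<And>y. y \<in> B \<Longrightarrow> f (inv_into A f y) = y" "\<And>y. y \<in> B \<Longrightarrow> inv_into A f y \<in> A"
proof -
  show b: "bij_betw f A B" "smooth_map M A N f" "smooth_map N B M (inv_into A f)"
    using assms unfolding diffeo_def by auto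
  show "A \<subseteq> mspace M" "B \<subseteq> mspace N" using b(2,3) smooth_map_domain by blast+
qed (use assms in \<open>auto simp: diffeo_def bij_betw_def f_inv_into_f inv_into_into\<close>)

lemma diffeo_id: "charted M \<Longrightarrow> A \<subseteq> mspace M \<Longrightarrow> diffeo M A M A (\<lambda>x. x)"
  by (rule diffeoI[where g = "\<lambda>x. x"]) (auto intro: smooth_map_id)

lemma diffeo_inv: "charted M \<Longrightarrow> diffeo M A N B f \<Longrightarrow> diffeo N B M A (inv_into A f)"
  by (rule diffeoI[where g = f]) (use diffeoD[of M A N B f] in auto)

lemma diffeo_compose:
  assumes "charted M" "charted N" "charted P" "diffeo M A N B f" "diffeo N B P C g"
  shows "diffeo M A P C (\<lambda>x. g (f x))"
proof (rule diffeoI[where g = "\<lambda>y. inv_into A f (inv_into B g y)"])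
  note f = diffeoD[OF assms(4)] and g = diffeoD[OF assms(5)]
  show "smooth_map M A P (\<lambda>x. g (f x))"
    using smooth_map_compose[OF assms(1,2) f(4) g(4)] f(3) by auto
  show "smooth_map P C M (\<lambda>y. inv_into A f (inv_into B g y))"
    using smooth_map_compose[OF assms(3,2) g(5) f(5)] g(10) by auto
  show "\<And>x. x \<in> A \<Longrightarrow> g (f x) \<in> C" using f(3) g(3) by auto
  show "\<And>x. x \<in> A \<Longrightarrow> inv_into A f (inv_into B g (g (f x))) = x" using f(3,8) g(8) by auto
qed (use assms(3) diffeoD[OF assms(4)] diffeoD[OF assms(5)] in auto)

lemma diffeo_subset:
  assumes "charted N" "diffeo M A N B f" "A' \<subseteq> A"
  shows "diffeo M A' N (f ` A') f"
proof (rule diffeoI[where g = "inv_into A f"])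
  note f = diffeoD[OF assms(2)]
  show "smooth_map M A' N f" using smooth_map_subset[OF f(4) assms(3)] .
  show "smooth_map N (f ` A') M (inv_into A f)" by (rule smooth_map_subset[OF f(5)]) (use f(3) assms(3) in auto)
qed (use assms diffeoD[OF assms(2)] in auto)

lemma diffeo_cong:
  assumes "charted M" "charted N" "diffeo M A N B f" "\<And>x. x \<in> A \<Longrightarrow> f x = g x"
  shows "diffeo M A N B g"
proof (rule diffeoI[where g = "inv_into A f"])
  note f = diffeoD[OF assms(3)]
  show "smooth_map M A N g" using smooth_map_cong[OF f(4) assms(1)] assms(4) by auto
  show "\<And>y. y \<in> B \<Longrightarrow> g (inv_into A f y) = y" using f(9,10) assms(4) by metis
  show "\<And>x. x \<in> A \<Longrightarrow> g x \<in> B" using f(3) assms(4) by auto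
  show "\<And>x. x \<in> A \<Longrightarrow> inv_into A f (g x) = x" using f(8) assms(4) by auto
qed (use assms diffeoD[OF assms(3)] in auto)

lemma diffeo_homeomorphic:
  assumes "diffeo M A N B f"
  shows "homeomorphic_map (subtopology (mtop M) A) (subtopology (mtop N) B) f"
proof -
  note f = diffeoD[OF assms]
  have "homeomorphic_maps (subtopology (mtop M) A) (subtopology (mtop N) B) f (inv_into A f)"
    using smooth_map_continuous[OF f(4)] smooth_map_continuous[OF f(5)] f
    unfolding homeomorphic_maps_def by (auto simp: continuous_map_in_subtopology)
  then show ?thesis using homeomorphic_map_maps by blast
qed

lemma diffeo_open_image:
  assumes "diffeo M A N B f" "openin (mtop N) B" "openin (mtop M) T" "T \<subseteq> A"
  shows "openin (mtop N) (f ` T)"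
proof -
  have "openin (subtopology (mtop M) A) T" using assms(3,4) openin_subset_topspace_eq openin_subtopology by blast
  then have "openin (subtopology (mtop N) B) (f ` T)"
    using homeomorphic_imp_open_map[OF diffeo_homeomorphic[OF assms(1)]] unfolding open_map_def by blast
  then show ?thesis using assms(2) openin_trans_full by blast
qed

text \<open>Bijectivity is global, but smoothness of the map and of its inverse can be tested near
  each point. The set \<open>R\<close> is needed for the inverse: \<open>f\<close> has to carry
  \<open>A \<inter> T\<close> onto a relatively open part of \<open>B\<close>.\<close>

lemma diffeo_glue:
  assumes M: "charted M" and N: "charted N" and f: "bij_betw f A B"
    and A: "A \<subseteq> mspace M" and B: "B \<subseteq> mspace N"
    and loc: "\<And>x. x \<in> A \<Longrightarrow> \<exists>T R. openin (mtop M) T \<and> openin (mtop N) R \<and> x \<in> T \<and> f x \<in> R \<and>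
      diffeo M (A \<inter> T) N (B \<inter> R) f"
  shows "diffeo M A N B f"
proof (rule diffeoI[where g = "inv_into A f"])
  have inj: "inj_on f A" and im: "f ` A = B" using f by (auto simp: bij_betw_def)
  show "smooth_map M A N f"
  proof (rule smooth_map_local[OF M A])
    fix x assume "x \<in> A"
    then obtain T R where "openin (mtop M) T" "x \<in> T" "diffeo M (A \<inter> T) N (B \<inter> R) f" using loc by blast
    then show "\<exists>T. openin (mtop M) T \<and> x \<in> T \<and> smooth_map M (A \<inter> T) N f" using diffeoD(4) by blast
  qed
  show "smooth_map N B M (inv_into A f)"
  proof (rule smooth_map_local[OF N B])
    fix y assume "y \<in> B"
    then obtain x where x: "x \<in> A" "y = f x" using im by blast
    then obtain T R where T: "openin (mtop M) T" "openin (mtop N) R" "x \<in> T" "f x \<in> R"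
      "diffeo M (A \<inter> T) N (B \<inter> R) f" using loc by blast
    note d = diffeoD[OF T(5)]
    have "smooth_map N (B \<inter> R) M (inv_into A f)"
    proof (rule smooth_map_cong[OF d(5) N])
      fix z assume "z \<in> B \<inter> R"
      then show "inv_into (A \<inter> T) f z = inv_into A f z"
        using d(9,10) inj by (metis IntD1 inv_into_f_f)
    qed
    then show "\<exists>T. openin (mtop N) T \<and> y \<in> T \<and> smooth_map N (B \<inter> T) M (inv_into A f)"
      using T x by blast
  qed
qed (use N f in \<open>auto simp: bij_betw_def inv_into_into f_inv_into_f\<close>)

lemma charted_euclidean_mfd: "charted (euclidean_mfd n)"
proof -
  let ?E = "topspace (Euclidean_space n)"
  have "smooth_vec n ?E ((\<lambda>x. x) \<circ> inv_into ?E (\<lambda>x. x))"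
  proof (rule iffD1[OF smooth_vec_cong])
    show "smooth_vec n ?E (\<lambda>x. x)" using smooth_coord_coordinate unfolding smooth_vec_def by blast
  qed (simp add: inv_into_f_f[of "\<lambda>x. x", simplified])
  moreover have "homeomorphic_map (subtopology (Euclidean_space n) ?E) (subtopology (Euclidean_space n) ?E) (\<lambda>x. x)"
    using homeomorphic_map_id[of "Euclidean_space n"] by (simp add: id_def)
  ultimately show ?thesis unfolding charted_def euclidean_mfd_def by simp
qed

subsection \<open>Products with the line\<close>

lemma continuous_map_Euclidean_coordinate:
  assumes "continuous_map X (Euclidean_space n) f" shows "continuous_map X euclideanreal (\<lambda>x. f x i)"
  using assms unfolding Euclidean_space_def continuous_map_in_subtopology continuous_map_componentwise_UNIV
  by blast

lemma continuous_map_into_Euclidean: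
  assumes "\<And>i. i < n \<Longrightarrow> continuous_map X euclideanreal (\<lambda>x. f x i)"
    and "\<And>x i. x \<in> topspace X \<Longrightarrow> i \<ge> n \<Longrightarrow> f x i = 0"
  shows "continuous_map X (Euclidean_space n) f"
proof (rule continuous_map_eq)
  show "continuous_map X (Euclidean_space n) (\<lambda>x i. if i < n then f x i else 0)"
    unfolding continuous_map_componentwise_Euclidean_space using assms(1) by blast
qed (use assms(2) in \<open>auto simp: fun_eq_iff\<close>)

lemma times_line_simps [simp]:
  "mtop (times_line M) = prod_topology (mtop M) euclideanreal"
  "mdim (times_line M) = Suc (mdim M)"
  by (simp_all add: times_line_def)

lemma times_line_atlasE:
  assumes "(U', c') \<in> matlas (times_line M)"
  obtains U c where "(U, c) \<in> matlas M" "U' = U \<times> UNIV" "c' = (\<lambda>(x, t). (c x)(mdim M := t))"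
  using assms by (auto simp: times_line_def)

text \<open>Chart values of \<open>M\<close> vanish at index \<open>mdim M\<close>. That slot is
  therefore free for the coordinate of the line, and resetting it to zero recovers
  \<open>c x\<close>.\<close>

lemma times_line_chart:
  assumes "charted M" "(U, c) \<in> matlas M"
  defines "h \<equiv> (\<lambda>(x, t). (c x)(mdim M := t))"
  shows "h ` (U \<times> UNIV) \<subseteq> topspace (Euclidean_space (Suc (mdim M)))"
    "\<And>x t. x \<in> U \<Longrightarrow> (h (x, t))(mdim M := 0) = c x"
    "inj_on h (U \<times> UNIV)"
    "\<And>x t. x \<in> U \<Longrightarrow> inv_into (U \<times> UNIV) h (h (x, t)) = (x, t)"
proof -
  note c = chartedD[OF assms(1,2)]
  show "h ` (U \<times> UNIV) \<subseteq> topspace (Euclidean_space (Suc (mdim M)))"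
    using c(3) by (auto simp: h_def topspace_Euclidean_space)
  show 1: "(h (x, t))(mdim M := 0) = c x" if "x \<in> U" for x t
    using c(3) that by (fastforce simp: h_def topspace_Euclidean_space fun_eq_iff)
  show inj: "inj_on h (U \<times> UNIV)"
  proof (rule inj_onI)
    fix p q assume *: "p \<in> U \<times> (UNIV :: real set)" "q \<in> U \<times> (UNIV :: real set)" "h p = h q"
    then have "c (fst p) = c (fst q)" using 1[of "fst p" "snd p"] 1[of "fst q" "snd q"] by auto
    then have "fst p = fst q" using * c(4) by (auto dest: inj_onD)
    moreover have "h p (mdim M) = snd p" "h q (mdim M) = snd q" by (auto simp: h_def split: prod.splits)
    ultimately show "p = q" using *(3) by (simp add: prod_eq_iff)
  qed
  show "inv_into (U \<times> UNIV) h (h (x, t)) = (x, t)" if "x \<in> U" for x t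
    using inv_into_f_f[OF inj] that by simp
qed

text \<open>This is the coordinate form of a map times the identity of the line. The line sits at
  index \<open>n\<close> in the source and at index \<open>m\<close> in the target, since the
  dimensions may differ.\<close>

lemma smooth_vec_times_line:
  assumes F: "smooth_vec n T F" "F ` T \<subseteq> topspace (Euclidean_space m)" "T \<subseteq> topspace (Euclidean_space n)"
    and S: "S \<subseteq> topspace (Euclidean_space (Suc n))" "\<And>y. y \<in> S \<Longrightarrow> y(n := 0) \<in> T"
  shows "smooth_vec (Suc n) S (\<lambda>y. (F (y(n := 0)))(m := y n))"
proof -
  have pr: "smooth_vec (Suc n) S (\<lambda>y. y(n := 0))"
    unfolding smooth_vec_def
  proof
    fix i show "smooth_coord (Suc n) S (\<lambda>y. (y(n := 0)) i)"
      by (cases "i = n") (simp_all add: smooth_coord_zero[OF S(1)] smooth_coord_coordinate[OF S(1)])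
  qed
  have "smooth_vec (Suc n) S (F \<circ> (\<lambda>y. y(n := 0)))"
    by (rule smooth_vec_compose[OF F(1) pr]) (use S(2) F(3) in auto)
  then have "smooth_coord (Suc n) S (\<lambda>y. F (y(n := 0)) i)" for i by (simp add: smooth_vec_def o_def)
  then have "smooth_coord (Suc n) S (\<lambda>y. ((F (y(n := 0)))(m := y n)) i)" for i
    using smooth_coord_coordinate[OF S(1), of n] by (cases "i = m") simp_all
  then show ?thesis unfolding smooth_vec_def by blast
qed

lemma charted_times_line:
  assumes M: "charted M" shows "charted (times_line M)"
  unfolding charted_def
proof (intro conjI)
  have "(\<Union>(U, c)\<in>matlas (times_line M). U) = (\<Union>(U, c)\<in>matlas M. U) \<times> UNIV"
    by (auto simp: times_line_def)
  then show "(\<Union>(U, c)\<in>matlas (times_line M). U) = mspace (times_line M)"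
    using M by (simp add: charted_def)
  have *: "openin (mtop (times_line M)) U' \<and> c' ` U' \<subseteq> topspace (Euclidean_space (mdim (times_line M))) \<and>
      homeomorphic_map (subtopology (mtop (times_line M)) U')
        (subtopology (Euclidean_space (mdim (times_line M))) (c' ` U')) c'"
    if "(U', c') \<in> matlas (times_line M)" for U' c'
    using that
  proof (cases rule: times_line_atlasE)
    case (1 U c)
    let ?n = "mdim M"
    note c = chartedD[OF M 1(1)] and h = times_line_chart[OF M 1(1), folded 1(3)]
    let ?X = "subtopology (prod_topology (mtop M) euclideanreal) (U \<times> UNIV)"
    let ?Y = "subtopology (Euclidean_space (Suc ?n)) (c' ` (U \<times> UNIV))"
    \<comment> \<open>The inverse chart: drop the coordinate of the line, invert \<open>c\<close>,
      and return that coordinate as second component.\<close>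
    let ?g = "\<lambda>y. (inv_into U c (y(?n := 0)), y ?n)"
    have topX: "topspace ?X = U \<times> UNIV" using c(2) by auto
    have topY: "topspace ?Y = c' ` (U \<times> UNIV)" using h(1) by auto
    have cc: "continuous_map (subtopology (mtop M) U) (Euclidean_space ?n) c"
      using homeomorphic_imp_continuous_map[OF c(5)] continuous_map_in_subtopology by blast
    have fst: "continuous_map ?X (subtopology (mtop M) U) fst"
      using c(2) by (auto simp: continuous_map_in_subtopology intro: continuous_map_from_subtopology continuous_map_fst)
    have "continuous_map ?X (Euclidean_space ?n) (\<lambda>p. c (fst p))"
      using continuous_map_compose[OF fst cc] by (simp add: o_def)
    note cfst = continuous_map_Euclidean_coordinate[OF this]
    have snd: "continuous_map ?X euclideanreal snd"
      by (intro continuous_map_from_subtopology continuous_map_snd)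
    have f: "continuous_map ?X (Euclidean_space (Suc ?n)) c'"
    proof (rule continuous_map_into_Euclidean)
      fix i show "continuous_map ?X euclideanreal (\<lambda>x. c' x i)"
        using cfst[of i] snd by (cases "i = ?n") (auto simp: 1(3) case_prod_unfold)
    next
      fix p i assume "p \<in> topspace ?X" "Suc ?n \<le> i"
      then show "c' p i = 0" using h(1) topX by (auto simp: topspace_Euclidean_space)
    qed
    have proj: "continuous_map ?Y (subtopology (Euclidean_space ?n) (c ` U)) (\<lambda>y. y(?n := 0))"
      unfolding continuous_map_in_subtopology
    proof
      show "continuous_map ?Y (Euclidean_space ?n) (\<lambda>y. y(?n := 0))"
      proof (rule continuous_map_into_Euclidean)
        fix i assume "i < ?n"
        then show "continuous_map ?Y euclideanreal (\<lambda>y. (y(?n := 0)) i)"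
          using continuous_map_Euclidean_coordinate[OF continuous_map_from_subtopology[OF continuous_map_id[unfolded id_def]]]
          by simp
      qed (auto simp: topspace_Euclidean_space)
      show "(\<lambda>y. y(?n := 0)) \<in> topspace ?Y \<rightarrow> c ` U" using h(2) topY by auto
    qed
    have inv: "continuous_map (subtopology (Euclidean_space ?n) (c ` U)) (subtopology (mtop M) U) (inv_into U c)"
    proof -
      obtain k where k: "homeomorphic_maps (subtopology (mtop M) U) (subtopology (Euclidean_space ?n) (c ` U)) c k"
        using c(5) homeomorphic_map_maps by blast
      show ?thesis
      proof (rule continuous_map_eq)
        show "continuous_map (subtopology (Euclidean_space ?n) (c ` U)) (subtopology (mtop M) U) k"
          using k homeomorphic_maps_def by blast
        fix y assume "y \<in> topspace (subtopology (Euclidean_space ?n) (c ` U))"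
        then obtain x where "x \<in> U" "y = c x" by auto
        then show "k y = inv_into U c y" using k c(2,4) unfolding homeomorphic_maps_def by auto
      qed
    qed
    have g: "continuous_map ?Y ?X ?g"
      unfolding continuous_map_in_subtopology continuous_map_pairwise o_def
    proof (intro conjI)
      show "continuous_map ?Y (mtop M) (\<lambda>y. fst (?g y))"
        using continuous_map_compose[OF proj inv] by (simp add: o_def continuous_map_in_subtopology)
      show "continuous_map ?Y euclideanreal (\<lambda>y. snd (?g y))"
        using continuous_map_Euclidean_coordinate[OF continuous_map_from_subtopology[OF continuous_map_id[unfolded id_def]]]
        by simp
      show "?g \<in> topspace ?Y \<rightarrow> U \<times> UNIV" using h(2) topY c(4) by auto
    qed
    have "homeomorphic_maps ?X ?Y c' ?g"
      unfolding homeomorphic_maps_def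
    proof (intro conjI ballI)
      show "continuous_map ?X ?Y c'" using f topX by (auto simp: continuous_map_in_subtopology)
      have gc: "?g (c' p) = p" if "p \<in> U \<times> UNIV" for p
        using that h(2)[of "fst p" "snd p"] c(4) by (auto simp: 1(3))
      then show "\<And>x. x \<in> topspace ?X \<Longrightarrow> ?g (c' x) = x" using topX by simp
      show "\<And>y. y \<in> topspace ?Y \<Longrightarrow> c' (?g y) = y" using gc topY by fastforce
    qed (rule g)
    moreover have "openin (prod_topology (mtop M) euclideanreal) (U \<times> UNIV)"
      using c(1) by (simp add: openin_prod_Times_iff)
    ultimately show ?thesis using h(1) 1(2) homeomorphic_map_maps by fastforce
  qed
  then show "\<forall>(U, c)\<in>matlas (times_line M). openin (mtop (times_line M)) U \<and> c ` U \<subseteq> topspace (Euclidean_space (mdim (times_line M))) \<and>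
      homeomorphic_map (subtopology (mtop (times_line M)) U)
        (subtopology (Euclidean_space (mdim (times_line M))) (c ` U)) c" by blast
  have "smooth_vec (Suc (mdim M)) (c' ` (U' \<inter> V')) (d' \<circ> inv_into U' c')"
    if U': "(U', c') \<in> matlas (times_line M)" and V': "(V', d') \<in> matlas (times_line M)" for U' c' V' d'
    using U'
  proof (cases rule: times_line_atlasE)
    case U: (1 U c)
    note c = chartedD[OF M U(1)] and h = times_line_chart[OF M U(1), folded U(3)]
    show ?thesis using V'
    proof (cases rule: times_line_atlasE)
      case V: (1 V d)
      note d = chartedD[OF M V(1)]
      let ?n = "mdim M"
      have "smooth_vec (Suc ?n) (c' ` (U' \<inter> V')) (\<lambda>y. ((d \<circ> inv_into U c) (y(?n := 0)))(?n := y ?n))"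
      proof (rule smooth_vec_times_line[OF c(6)[OF V(1)]])
        show "(d \<circ> inv_into U c) ` c ` (U \<inter> V) \<subseteq> topspace (Euclidean_space ?n)" using c(4) d(3) by auto
        show "c' ` (U' \<inter> V') \<subseteq> topspace (Euclidean_space (Suc ?n))" using h(1) U(2) by auto
        show "\<And>y. y \<in> c' ` (U' \<inter> V') \<Longrightarrow> y(?n := 0) \<in> c ` (U \<inter> V)" using h(2) U(2) V(2) by auto
      qed (use c(3) in auto)
      then show ?thesis
      proof (rule iffD1[OF smooth_vec_cong, rotated])
        fix y assume "y \<in> c' ` (U' \<inter> V')"
        then obtain x t where xt: "x \<in> U" "x \<in> V" "y = c' (x, t)" using U(2) V(2) by auto
        have "y ?n = t" using xt by (simp add: U(3))
        then show "((d \<circ> inv_into U c) (y(?n := 0)))(?n := y ?n) = (d' \<circ> inv_into U' c') y"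
          using xt h(2,4) c(4) U(2) by (simp add: V(3))
      qed
    qed
  qed
  then show "\<forall>(U, c)\<in>matlas (times_line M). \<forall>(V, d)\<in>matlas (times_line M).
      smooth_vec (mdim (times_line M)) (c ` (U \<inter> V)) (d \<circ> inv_into U c)" by auto
qed

lemma smooth_map_times_line:
  assumes M: "charted M" and N: "charted N" and f: "smooth_map M A N f"
  shows "smooth_map (times_line M) (A \<times> UNIV) (times_line N) (\<lambda>(x, t). (f x, t))"
proof (rule smooth_mapI)
  show "A \<times> UNIV \<subseteq> mspace (times_line M)" using smooth_map_domain[OF f] by auto
  have "continuous_map (prod_topology (subtopology (mtop M) A) euclideanreal) (prod_topology (mtop N) euclideanreal)
      (\<lambda>(x, t). (f x, t))"
    using smooth_map_continuous[OF f] continuous_map_prod_top[of _ euclideanreal _ euclideanreal f "\<lambda>x. x"]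
    by (auto simp: id_def[symmetric])
  then show "continuous_map (subtopology (mtop (times_line M)) (A \<times> UNIV)) (mtop (times_line N)) (\<lambda>(x, t). (f x, t))"
    by (simp add: subtopology_Times[symmetric] prod_topology_subtopology)
  fix U' c' V' d' assume U': "(U', c') \<in> matlas (times_line M)" and V': "(V', d') \<in> matlas (times_line N)"
  let ?n = "mdim M" and ?m = "mdim N" and ?S = "c' ` {x \<in> (A \<times> UNIV) \<inter> U'. (\<lambda>(x, t). (f x, t)) x \<in> V'}"
  show "smooth_vec (mdim (times_line M)) ?S (d' \<circ> (\<lambda>(x, t). (f x, t)) \<circ> inv_into U' c')"
    using U'
  proof (cases rule: times_line_atlasE)
    case U: (1 U c)
    note c = chartedD[OF M U(1)] and h = times_line_chart[OF M U(1), folded U(3)]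
    show ?thesis using V'
    proof (cases rule: times_line_atlasE)
      case V: (1 V d)
      note d = chartedD[OF N V(1)]
      have "smooth_vec (Suc ?n) ?S (\<lambda>y. ((d \<circ> f \<circ> inv_into U c) (y(?n := 0)))(?m := y ?n))"
      proof (rule smooth_vec_times_line[OF smooth_map_charts[OF f U(1) V(1)]])
        show "(d \<circ> f \<circ> inv_into U c) ` c ` {x \<in> A \<inter> U. f x \<in> V} \<subseteq> topspace (Euclidean_space ?m)" using c(4) d(3) by auto
        show "?S \<subseteq> topspace (Euclidean_space (Suc ?n))" using h(1) U(2) by auto
        show "\<And>y. y \<in> ?S \<Longrightarrow> y(?n := 0) \<in> c ` {x \<in> A \<inter> U. f x \<in> V}" using h(2) U(2) V(2) by auto
      qed (use c(3) in auto)
      then show ?thesis unfolding times_line_simps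
      proof (rule iffD1[OF smooth_vec_cong, rotated])
        fix y assume "y \<in> ?S"
        then obtain x t where xt: "x \<in> U" "f x \<in> V" "y = c' (x, t)" using U(2) V(2) by auto
        have "y ?n = t" using xt by (simp add: U(3))
        then show "((d \<circ> f \<circ> inv_into U c) (y(?n := 0)))(?m := y ?n) = (d' \<circ> (\<lambda>(x, t). (f x, t)) \<circ> inv_into U' c') y"
          using xt h(2,4) c(4) U(2) by (simp add: V(3))
      qed
    qed
  qed
qed

lemma diffeo_times_line:
  assumes M: "charted M" and N: "charted N" and f: "diffeo M A N B f"
  shows "diffeo (times_line M) (A \<times> UNIV) (times_line N) (B \<times> UNIV) (\<lambda>(x, t). (f x, t))"
  by (rule diffeoI[where g = "\<lambda>(y, t). (inv_into A f y, t)"])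
    (use diffeoD[OF f] in \<open>auto intro!: charted_times_line smooth_map_times_line M N\<close>)

section \<open>Manifolds decomposed into open pieces\<close>

text \<open>Each \<open>A p\<close> may be a proper part of \<open>M p\<close>, because a single
  manifold will contribute many fibres. Disjointness is required between different indices; within
  one piece injectivity comes from the diffeomorphism.\<close>

definition pieces ::
  "('b, 'z) smfd_scheme \<Rightarrow> 'p set \<Rightarrow> ('p \<Rightarrow> ('a, 'y) smfd_scheme) \<Rightarrow> ('p \<Rightarrow> 'a set) \<Rightarrow> ('p \<Rightarrow> 'a \<Rightarrow> 'b) \<Rightarrow> bool" where
  "pieces N P M A j \<longleftrightarrow>
     (\<forall>p\<in>P. charted (M p) \<and> openin (mtop (M p)) (A p) \<and> openin (mtop N) (j p ` A p) \<and>
        diffeo (M p) (A p) N (j p ` A p) (j p)) \<and>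
     (\<forall>p\<in>P. \<forall>q\<in>P. \<forall>x\<in>A p. \<forall>y\<in>A q. j p x = j q y \<longrightarrow> p = q) \<and>
     (\<Union>p\<in>P. j p ` A p) = mspace N"

lemma piecesD:
  assumes "pieces N P M A j"
  shows "\<And>p. p \<in> P \<Longrightarrow> charted (M p)" "\<And>p. p \<in> P \<Longrightarrow> openin (mtop (M p)) (A p)"
    "\<And>p. p \<in> P \<Longrightarrow> openin (mtop N) (j p ` A p)"
    "\<And>p. p \<in> P \<Longrightarrow> diffeo (M p) (A p) N (j p ` A p) (j p)"
    "\<And>p q x y. p \<in> P \<Longrightarrow> q \<in> P \<Longrightarrow> x \<in> A p \<Longrightarrow> y \<in> A q \<Longrightarrow> j p x = j q y \<Longrightarrow> p = q \<and> x = y"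
    "\<And>p x. p \<in> P \<Longrightarrow> x \<in> A p \<Longrightarrow> j p x \<in> mspace N" "\<And>p. p \<in> P \<Longrightarrow> A p \<subseteq> mspace (M p)"
    "\<And>p. p \<in> P \<Longrightarrow> inj_on (j p) (A p)"
proof -
  show d: "diffeo (M p) (A p) N (j p ` A p) (j p)" if "p \<in> P" for p using assms that unfolding pieces_def by blast
  show i: "inj_on (j p) (A p)" if "p \<in> P" for p using diffeoD(2)[OF d[OF that]] .
  show "p = q \<and> x = y" if "p \<in> P" "q \<in> P" "x \<in> A p" "y \<in> A q" "j p x = j q y" for p q x y
  proof -
    have "p = q" using assms that unfolding pieces_def by blast
    then show ?thesis using i[OF that(1)] that by (auto dest: inj_onD)
  qed
  show "A p \<subseteq> mspace (M p)" if "p \<in> P" for p using diffeoD(6)[OF d[OF that]] .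
  show "j p x \<in> mspace N" if "p \<in> P" "x \<in> A p" for p x using diffeoD(7)[OF d[OF that(1)]] that by blast
qed (use assms in \<open>auto simp: pieces_def\<close>)

lemma pieces_cases:
  assumes "pieces N P M A j" "y \<in> mspace N"
  obtains p x where "p \<in> P" "x \<in> A p" "y = j p x"
proof -
  have "y \<in> (\<Union>p\<in>P. j p ` A p)" using assms unfolding pieces_def by blast
  then show thesis using that by blast
qed

text \<open>A point of \<open>N\<close> determines both its index and its preimage, so any rule on
  the pieces defines a map. It is made extensional because group actions consist of extensional
  maps.\<close>

lemma pieces_fun_exists:
  assumes "pieces N P M A j"
  obtains F where "\<And>p x. p \<in> P \<Longrightarrow> x \<in> A p \<Longrightarrow> F (j p x) = h p x" "F \<in> extensional (mspace N)"
proof -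
  define F where "F = (\<lambda>y\<in>mspace N. let (p, x) = (SOME (p, x). p \<in> P \<and> x \<in> A p \<and> y = j p x) in h p x)"
  have "F (j p x) = h p x" if px: "p \<in> P" "x \<in> A p" for p x
  proof -
    have "(SOME (q, z). q \<in> P \<and> z \<in> A q \<and> j p x = j q z) = (p, x)"
    proof (rule some_equality)
      fix w assume w: "case w of (q, z) \<Rightarrow> q \<in> P \<and> z \<in> A q \<and> j p x = j q z"
      obtain q z where qz: "w = (q, z)" by (cases w)
      then have "p = q \<and> x = z" using w px piecesD(5)[OF assms, of p q x z] by simp
      then show "w = (p, x)" using qz by simp
    qed (use px in simp)
    then show ?thesis using piecesD(6)[OF assms px] by (simp add: F_def)
  qed
  moreover have "F \<in> extensional (mspace N)" by (simp add: F_def)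
  ultimately show thesis using that by blast
qed

text \<open>Pieces are open, so smoothness may be tested on each; there \<open>F\<close> is the
  inverse of \<open>j p\<close> followed by the given map.\<close>

lemma pieces_smooth_map:
  assumes N: "pieces N P M A j" "charted N" and B: "\<And>p. p \<in> P \<Longrightarrow> B p \<subseteq> A p"
    and F: "\<And>p. p \<in> P \<Longrightarrow> smooth_map (M p) (B p) L (\<lambda>x. F (j p x))"
  shows "smooth_map N (\<Union>p\<in>P. j p ` B p) L F"
proof (rule smooth_map_local[OF N(2)])
  show "(\<Union>p\<in>P. j p ` B p) \<subseteq> mspace N" using B piecesD(6)[OF N(1)] by blast
  fix y assume "y \<in> (\<Union>p\<in>P. j p ` B p)"
  then obtain p x where p: "p \<in> P" "x \<in> B p" "y = j p x" by blast
  note d = diffeoD[OF piecesD(4)[OF N(1) p(1)]]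
  have eq: "(\<Union>p\<in>P. j p ` B p) \<inter> j p ` A p = j p ` B p"
  proof
    show "(\<Union>p\<in>P. j p ` B p) \<inter> j p ` A p \<subseteq> j p ` B p"
    proof
      fix z assume "z \<in> (\<Union>p\<in>P. j p ` B p) \<inter> j p ` A p"
      then obtain q b a where "q \<in> P" "b \<in> B q" "z = j q b" "a \<in> A p" "z = j p a" by blast
      then show "z \<in> j p ` B p" using piecesD(5)[OF N(1), of q p b a] B p by blast
    qed
  qed (use B p in blast)
  have "smooth_map N (j p ` B p) L (\<lambda>y. F (j p (inv_into (A p) (j p) y)))"
  proof (rule smooth_map_compose[OF N(2) piecesD(1)[OF N(1) p(1)] _ F[OF p(1)]])
    show "smooth_map N (j p ` B p) (M p) (inv_into (A p) (j p))"
      by (rule smooth_map_subset[OF d(5)]) (use B p in blast)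
    show "inv_into (A p) (j p) ` j p ` B p \<subseteq> B p" using d(2) B p by auto
  qed
  then have "smooth_map N (j p ` B p) L F"
    by (rule smooth_map_cong[OF _ N(2)]) (use d(2) B p in \<open>auto simp: subset_iff\<close>)
  then show "\<exists>T. openin (mtop N) T \<and> y \<in> T \<and> smooth_map N ((\<Union>p\<in>P. j p ` B p) \<inter> T) L F"
    using eq piecesD(3)[OF N(1) p(1)] p B by (intro exI[of _ "j p ` A p"]) auto
qed

text \<open>With \<open>\<beta>\<close> merely injective and the \<open>B p\<close> arbitrary
  subsets, one statement covers isomorphisms of whole manifolds, embeddings onto some of the pieces,
  and lifts of hypersurfaces and of closed sides.\<close>

lemma pieces_diffeo:
  assumes N: "pieces N P M A j" "charted N" and N': "pieces N' P' M' A' j'" "charted N'"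
    and \<beta>: "inj_on \<beta> P" "\<beta> ` P \<subseteq> P'"
    and B: "\<And>p. p \<in> P \<Longrightarrow> B p \<subseteq> A p" and B': "\<And>p. p \<in> P \<Longrightarrow> B' p \<subseteq> A' (\<beta> p)"
    and k: "\<And>p. p \<in> P \<Longrightarrow> diffeo (M p) (B p) (M' (\<beta> p)) (B' p) (k p)"
    and F: "\<And>p x. p \<in> P \<Longrightarrow> x \<in> B p \<Longrightarrow> F (j p x) = j' (\<beta> p) (k p x)"
  shows "diffeo N (\<Union>p\<in>P. j p ` B p) N' (\<Union>p\<in>P. j' (\<beta> p) ` B' p) F"
proof -
  have \<beta>P: "\<And>p. p \<in> P \<Longrightarrow> \<beta> p \<in> P'" using \<beta> by blast
  obtain h where h: "\<And>p x. p \<in> P' \<Longrightarrow> x \<in> A' p \<Longrightarrow>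
      h (j' p x) = j (inv_into P \<beta> p) (inv_into (B (inv_into P \<beta> p)) (k (inv_into P \<beta> p)) x)"
    by (rule pieces_fun_exists[OF N'(1), of "\<lambda>p x. j (inv_into P \<beta> p) (inv_into (B (inv_into P \<beta> p)) (k (inv_into P \<beta> p)) x)"]) blast
  have h': "h (j' (\<beta> p) x) = j p (inv_into (B p) (k p) x)" if "p \<in> P" "x \<in> A' (\<beta> p)" for p x
    using h[OF \<beta>P that(2)] that \<beta>(1) by simp
  show ?thesis
  proof (rule diffeoI[where g = h])
    show "smooth_map N (\<Union>p\<in>P. j p ` B p) N' F"
    proof (rule pieces_smooth_map[OF N B])
      fix p assume p: "p \<in> P"
      note kd = diffeoD[OF k[OF p]] and jd = diffeoD[OF piecesD(4)[OF N'(1) \<beta>P[OF p]]]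
      have "smooth_map (M p) (B p) N' (\<lambda>x. j' (\<beta> p) (k p x))"
        by (rule smooth_map_compose[OF piecesD(1)[OF N(1) p] piecesD(1)[OF N'(1) \<beta>P[OF p]] kd(4) jd(4)])
          (use kd(3) B' p in blast)
      then show "smooth_map (M p) (B p) N' (\<lambda>x. F (j p x))"
        by (rule smooth_map_cong[OF _ piecesD(1)[OF N(1) p]]) (use F p in auto)
    qed
    \<comment> \<open>The inverse is glued over the pieces of \<open>N'\<close>; indices outside the
      image of \<open>\<beta>\<close> carry the empty set.\<close>
    have "smooth_map N' (\<Union>q\<in>P'. j' q ` (if q \<in> \<beta> ` P then B' (inv_into P \<beta> q) else {})) N h"
    proof (rule pieces_smooth_map[OF N'])
      fix q assume q: "q \<in> P'"
      show "(if q \<in> \<beta> ` P then B' (inv_into P \<beta> q) else {}) \<subseteq> A' q"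
      proof (cases "q \<in> \<beta> ` P")
        case True
        then obtain p where "p \<in> P" "q = \<beta> p" by blast
        then show ?thesis using B'[of p] \<beta>(1) by simp
      qed simp
      show "smooth_map (M' q) (if q \<in> \<beta> ` P then B' (inv_into P \<beta> q) else {}) N (\<lambda>x. h (j' q x))"
      proof (cases "q \<in> \<beta> ` P")
        case True
        then obtain p where p: "p \<in> P" "q = \<beta> p" by blast
        note kd = diffeoD[OF k[OF p(1)]] and jd = diffeoD[OF piecesD(4)[OF N(1) p(1)]]
        have "smooth_map (M' q) (B' p) N (\<lambda>x. j p (inv_into (B p) (k p) x))"
          unfolding p(2)
          by (rule smooth_map_compose[OF piecesD(1)[OF N'(1) \<beta>P[OF p(1)]] piecesD(1)[OF N(1) p(1)] kd(5) jd(4)])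
            (use kd(10) B p in blast)
        then have "smooth_map (M' q) (B' p) N (\<lambda>x. h (j' q x))"
          by (rule smooth_map_cong[OF _ piecesD(1)[OF N'(1) q]]) (use h'[OF p(1)] B'[OF p(1)] p(2) in \<open>auto simp: subset_iff\<close>)
        then show ?thesis using p \<beta>(1) by simp
      next
        case False
        have "smooth_map (M' q) {} N (\<lambda>x. h (j' q x))"
          by (rule smooth_mapI) (auto simp: smooth_vec_def smooth_coord_def continuous_map_def)
        then show ?thesis using False by simp
      qed
    qed
    moreover have "(\<Union>q\<in>P'. j' q ` (if q \<in> \<beta> ` P then B' (inv_into P \<beta> q) else {})) = (\<Union>p\<in>P. j' (\<beta> p) ` B' p)"
    proof -
      have "(\<Union>q\<in>P'. j' q ` (if q \<in> \<beta> ` P then B' (inv_into P \<beta> q) else {})) =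
          (\<Union>q\<in>\<beta> ` P. j' q ` B' (inv_into P \<beta> q))"
        using \<beta>(2) by (fastforce split: if_splits)
      also have "\<dots> = (\<Union>p\<in>P. j' (\<beta> p) ` B' p)" using \<beta>(1) by simp
      finally show ?thesis .
    qed
    ultimately show "smooth_map N' (\<Union>p\<in>P. j' (\<beta> p) ` B' p) N h" by simp
    show "F y \<in> (\<Union>p\<in>P. j' (\<beta> p) ` B' p)" "h (F y) = y" if y: "y \<in> (\<Union>p\<in>P. j p ` B p)" for y
    proof -
      obtain p x where p: "p \<in> P" "x \<in> B p" "y = j p x" using y by blast
      note kd = diffeoD[OF k[OF p(1)]]
      have kx: "k p x \<in> B' p" using kd(3) p by blast
      then show "F y \<in> (\<Union>p\<in>P. j' (\<beta> p) ` B' p)" using F p by auto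
      show "h (F y) = y" using F[OF p(1,2)] h'[OF p(1), of "k p x"] kx B'[OF p(1)] kd(8) p by auto
    qed
    show "h z \<in> (\<Union>p\<in>P. j p ` B p)" "F (h z) = z" if z: "z \<in> (\<Union>p\<in>P. j' (\<beta> p) ` B' p)" for z
    proof -
      obtain p x where p: "p \<in> P" "x \<in> B' p" "z = j' (\<beta> p) x" using z by blast
      note kd = diffeoD[OF k[OF p(1)]]
      have hz: "h z = j p (inv_into (B p) (k p) x)" using h'[OF p(1)] p B' by auto
      then show "h z \<in> (\<Union>p\<in>P. j p ` B p)" using kd(10) p by blast
      show "F (h z) = z" using hz F[OF p(1) kd(10)[OF p(2)]] kd(9)[OF p(2)] p by simp
    qed
  qed (rule N'(2))
qed

subsection \<open>Construction of finite disjoint unions\<close>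

text \<open>Finiteness of \<open>P\<close> and compactness of the parts make the sum compact.
  Injectivity of \<open>E\<close> is required for all points of the type, so that images of
  arbitrary subsets under different indices are disjoint.\<close>

locale manifold_sum =
  fixes P :: "'p set" and M :: "'p \<Rightarrow> ('a, 'z) smfd_scheme" and A :: "'p \<Rightarrow> 'a set" and E :: "'p \<Rightarrow> 'a \<Rightarrow> 'b"
    and n :: nat
  assumes finP: "finite P" and M: "\<And>p. p \<in> P \<Longrightarrow> smooth_manifold (M p)" "\<And>p. p \<in> P \<Longrightarrow> mdim (M p) = n"
    and A: "\<And>p. p \<in> P \<Longrightarrow> openin (mtop (M p)) (A p)" "\<And>p. p \<in> P \<Longrightarrow> compactin (mtop (M p)) (A p)"
    and E: "\<And>p q x y. p \<in> P \<Longrightarrow> q \<in> P \<Longrightarrow> E p x = E q y \<Longrightarrow> p = q \<and> x = y"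
begin

definition "sum_space = (\<Union>p\<in>P. E p ` A p)"

definition "sum_top = topology (\<lambda>W. W \<subseteq> sum_space \<and> (\<forall>p\<in>P. openin (mtop (M p)) {x \<in> A p. E p x \<in> W}))"

definition "sum_atlas =
  {(E p ` (U \<inter> A p), c \<circ> inv_into (A p) (E p)) | p U c. p \<in> P \<and> (U, c) \<in> matlas (M p)}"

lemma sum_pieceE:
  assumes "y \<in> (\<Union>p\<in>P. E p ` B p)"
  obtains p x where "p \<in> P" "x \<in> B p" "y = E p x"
proof -
  obtain p where p: "p \<in> P" "y \<in> E p ` B p" using assms by (rule UN_E)
  from p(2) show thesis by (rule imageE) (rule that[OF p(1)])
qed

lemma openin_sum_top:
  "openin sum_top W \<longleftrightarrow> W \<subseteq> sum_space \<and> (\<forall>p\<in>P. openin (mtop (M p)) {x \<in> A p. E p x \<in> W})"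
proof -
  have "istopology (\<lambda>W. W \<subseteq> sum_space \<and> (\<forall>p\<in>P. openin (mtop (M p)) {x \<in> A p. E p x \<in> W}))"
    unfolding istopology_def
  proof (intro conjI allI impI)
    fix S T
    assume S: "S \<subseteq> sum_space \<and> (\<forall>p\<in>P. openin (mtop (M p)) {x \<in> A p. E p x \<in> S})"
      and T: "T \<subseteq> sum_space \<and> (\<forall>p\<in>P. openin (mtop (M p)) {x \<in> A p. E p x \<in> T})"
    then show "S \<inter> T \<subseteq> sum_space" by blast
    have "{x \<in> A p. E p x \<in> S \<inter> T} = {x \<in> A p. E p x \<in> S} \<inter> {x \<in> A p. E p x \<in> T}" for p by blast
    then show "\<forall>p\<in>P. openin (mtop (M p)) {x \<in> A p. E p x \<in> S \<inter> T}" using S T by auto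
  next
    fix K assume K: "\<forall>S\<in>K. S \<subseteq> sum_space \<and> (\<forall>p\<in>P. openin (mtop (M p)) {x \<in> A p. E p x \<in> S})"
    then show "\<Union> K \<subseteq> sum_space" by blast
    have "{x \<in> A p. E p x \<in> \<Union> K} = (\<Union>S\<in>K. {x \<in> A p. E p x \<in> S})" for p by blast
    then show "\<forall>p\<in>P. openin (mtop (M p)) {x \<in> A p. E p x \<in> \<Union> K}" using K by auto
  qed
  then show ?thesis unfolding sum_top_def by (simp add: topology_inverse')
qed

lemma inj_E_UNIV: "p \<in> P \<Longrightarrow> inj (E p)"
proof (rule injI)
  fix x y assume "p \<in> P" "E p x = E p y"
  then show "x = y" using E[of p p x y] by simp
qed

lemma E_disjoint:
  assumes "p \<in> P" "q \<in> P" "p \<noteq> q" shows "E p ` S \<inter> E q ` T = {}"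
proof -
  have "z \<notin> E q ` T" if "z \<in> E p ` S" for z
  proof
    assume "z \<in> E q ` T"
    then obtain y where y: "z = E q y" by (rule imageE)
    from that obtain x where "z = E p x" by (rule imageE)
    then show False using y E[OF assms(1,2), of x y] assms(3) by simp
  qed
  then show ?thesis by (simp add: disjoint_iff)
qed

lemma inj_E: "p \<in> P \<Longrightarrow> inj_on (E p) (A p)"
  using inj_E_UNIV inj_on_subset by blast

lemma inv_E: "p \<in> P \<Longrightarrow> x \<in> A p \<Longrightarrow> inv_into (A p) (E p) (E p x) = x"
  using inj_E by simp

lemma A_subset: "p \<in> P \<Longrightarrow> A p \<subseteq> mspace (M p)"
  using A(1) openin_subset by blast

lemma openin_sum_image:
  assumes "p \<in> P" "openin (mtop (M p)) T" "T \<subseteq> A p"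
  shows "openin sum_top (E p ` T)"
  unfolding openin_sum_top
proof (intro conjI ballI)
  show "E p ` T \<subseteq> sum_space" using assms by (auto simp: sum_space_def)
  fix q assume q: "q \<in> P"
  have "{x \<in> A q. E q x \<in> E p ` T} = (if q = p then T else {})"
  proof (cases "q = p")
    case True
    have "E p x \<in> E p ` T \<longleftrightarrow> x \<in> T" for x using inj_image_mem_iff[OF inj_E_UNIV[OF assms(1)]] .
    then show ?thesis using True assms(3) by auto
  next
    case False
    have "E q x \<notin> E p ` T" for x using E_disjoint[OF q assms(1), of "{x}" T] False by simp
    then show ?thesis using False by simp
  qed
  then show "openin (mtop (M q)) {x \<in> A q. E q x \<in> E p ` T}" using assms by auto
qed

lemma topspace_sum_top: "topspace sum_top = sum_space"
proof
  show "topspace sum_top \<subseteq> sum_space" using openin_sum_top openin_topspace by blast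
  show "sum_space \<subseteq> topspace sum_top" unfolding sum_space_def
    using openin_subset[OF openin_sum_image] A by blast
qed

lemma continuous_E: "p \<in> P \<Longrightarrow> continuous_map (subtopology (mtop (M p)) (A p)) sum_top (E p)"
  unfolding continuous_map_def
proof (intro conjI allI impI)
  assume p: "p \<in> P"
  have tp: "topspace (subtopology (mtop (M p)) (A p)) = A p" using A_subset[OF p] by auto
  show "E p \<in> topspace (subtopology (mtop (M p)) (A p)) \<rightarrow> topspace sum_top"
    using p unfolding tp topspace_sum_top sum_space_def by blast
  fix W assume "openin sum_top W"
  then show "openin (subtopology (mtop (M p)) (A p)) {x \<in> topspace (subtopology (mtop (M p)) (A p)). E p x \<in> W}"
    using p A(1)[OF p] unfolding tp by (auto simp: openin_sum_top openin_open_subtopology)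
qed

lemma homeo_E:
  assumes p: "p \<in> P"
  shows "homeomorphic_map (subtopology (mtop (M p)) (A p)) (subtopology sum_top (E p ` A p)) (E p)"
proof (rule bijective_open_imp_homeomorphic_map)
  show "continuous_map (subtopology (mtop (M p)) (A p)) (subtopology sum_top (E p ` A p)) (E p)"
    using continuous_E[OF p] by (simp add: continuous_map_in_subtopology)
  show "open_map (subtopology (mtop (M p)) (A p)) (subtopology sum_top (E p ` A p)) (E p)"
    unfolding open_map_def
  proof (intro allI impI)
    fix T assume "openin (subtopology (mtop (M p)) (A p)) T"
    then have "openin sum_top (E p ` T)" "E p ` T \<subseteq> E p ` A p"
      using openin_sum_image[OF p] A(1)[OF p] by (auto simp: openin_open_subtopology)
    then show "openin (subtopology sum_top (E p ` A p)) (E p ` T)"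
      using openin_subset_topspace_eq by (metis Int_absorb2 openin_subtopology)
  qed
  have "topspace (subtopology (mtop (M p)) (A p)) = A p" using A_subset[OF p] by auto
  moreover have "topspace (subtopology sum_top (E p ` A p)) = E p ` A p"
    using p by (auto simp: topspace_sum_top sum_space_def)
  ultimately show "E p ` topspace (subtopology (mtop (M p)) (A p)) = topspace (subtopology sum_top (E p ` A p))"
    "inj_on (E p) (topspace (subtopology (mtop (M p)) (A p)))" using inj_E[OF p] by auto
qed

lemma sum_chartE:
  assumes "(U', c') \<in> sum_atlas"
  obtains p U c where "p \<in> P" "(U, c) \<in> matlas (M p)" "U' = E p ` (U \<inter> A p)" "c' = c \<circ> inv_into (A p) (E p)"
  using assms unfolding sum_atlas_def by blast

lemma Hausdorff_sum_top: "Hausdorff_space sum_top"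
  unfolding Hausdorff_space_def
proof (intro allI impI)
  fix x y assume xy: "x \<in> topspace sum_top \<and> y \<in> topspace sum_top \<and> x \<noteq> y"
  obtain p a where p: "p \<in> P" "a \<in> A p" "x = E p a"
    using xy sum_pieceE[of x A] unfolding topspace_sum_top sum_space_def by metis
  obtain q b where q: "q \<in> P" "b \<in> A q" "y = E q b"
    using xy sum_pieceE[of y A] unfolding topspace_sum_top sum_space_def by metis
  show "\<exists>U V. openin sum_top U \<and> openin sum_top V \<and> x \<in> U \<and> y \<in> V \<and> disjnt U V"
  proof (cases "p = q")
    case False
    then have "disjnt (E p ` A p) (E q ` A q)" using E_disjoint[OF p(1) q(1)] by (simp add: disjnt_def)
    moreover have "openin sum_top (E p ` A p)" "openin sum_top (E q ` A q)"
      using openin_sum_image A(1) p(1) q(1) by auto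
    moreover have "x \<in> E p ` A p" "y \<in> E q ` A q" using p q by auto
    ultimately show ?thesis by blast
  next
    case True
    have "Hausdorff_space (mtop (M p))" using M(1)[OF p(1)] by (simp add: smooth_manifold_def)
    moreover have "a \<noteq> b" using xy p(3) q(3) True by auto
    moreover have "a \<in> mspace (M p)" "b \<in> mspace (M p)" using A_subset p(1,2) q(2) True by auto
    ultimately obtain U V where UV: "openin (mtop (M p)) U" "openin (mtop (M p)) V" "a \<in> U" "b \<in> V" "disjnt U V"
      unfolding Hausdorff_space_def by metis
    have "openin sum_top (E p ` (U \<inter> A p))" "openin sum_top (E p ` (V \<inter> A p))"
      using openin_sum_image[OF p(1)] UV A(1)[OF p(1)] by auto
    moreover have "disjnt (E p ` (U \<inter> A p)) (E p ` (V \<inter> A p))"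
      using UV(5) image_Int[OF inj_E_UNIV[OF p(1)], of "U \<inter> A p" "V \<inter> A p"] by (auto simp: disjnt_def)
    moreover have "x \<in> E p ` (U \<inter> A p)" "y \<in> E p ` (V \<inter> A p)" using UV(3,4) p q True by auto
    ultimately show ?thesis by blast
  qed
qed

lemma second_countable_sum_top: "second_countable sum_top"
proof -
  have "\<forall>p\<in>P. \<exists>\<B>. countable \<B> \<and> (\<forall>V\<in>\<B>. openin (mtop (M p)) V) \<and>
      (\<forall>U x. openin (mtop (M p)) U \<and> x \<in> U \<longrightarrow> (\<exists>V\<in>\<B>. x \<in> V \<and> V \<subseteq> U))"
    using M(1) unfolding smooth_manifold_def second_countable_def by blast
  then obtain \<B> where \<B>: "\<And>p. p \<in> P \<Longrightarrow> countable (\<B> p)" "\<And>p V. p \<in> P \<Longrightarrow> V \<in> \<B> p \<Longrightarrow> openin (mtop (M p)) V"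
      "\<And>p U x. p \<in> P \<Longrightarrow> openin (mtop (M p)) U \<Longrightarrow> x \<in> U \<Longrightarrow> \<exists>V\<in>\<B> p. x \<in> V \<and> V \<subseteq> U"
    by metis
  let ?C = "\<Union>p\<in>P. (\<lambda>V. E p ` (V \<inter> A p)) ` \<B> p"
  show ?thesis unfolding second_countable_def
  proof (intro exI[of _ ?C] conjI ballI allI impI)
    show "countable ?C" using \<B>(1) finP by (auto intro: countable_UN countable_finite)
    fix V assume "V \<in> ?C"
    then obtain p T where "p \<in> P" "T \<in> \<B> p" "V = E p ` (T \<inter> A p)" by blast
    then show "openin sum_top V" using openin_sum_image[of p "T \<inter> A p"] \<B>(2) A(1) by auto
  next
    fix U x assume U: "openin sum_top U \<and> x \<in> U"
    then obtain p a where p: "p \<in> P" "a \<in> A p" "x = E p a"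
      using openin_subset topspace_sum_top unfolding sum_space_def by blast
    have "openin (mtop (M p)) {a \<in> A p. E p a \<in> U}" using U p openin_sum_top by blast
    then obtain V where "V \<in> \<B> p" "a \<in> V" "V \<subseteq> {a \<in> A p. E p a \<in> U}"
      using \<B>(3)[OF p(1)] U p by blast
    then show "\<exists>V\<in>?C. x \<in> V \<and> V \<subseteq> U" using p by (intro bexI[of _ "E p ` (V \<inter> A p)"]) auto
  qed
qed

lemma compact_sum_top: "compact_space sum_top"
proof -
  have "compactin sum_top (E p ` A p)" if p: "p \<in> P" for p
    using image_compactin[OF _ continuous_E[OF p], of "A p"] A(2)[OF p] by (simp add: compactin_subtopology)
  then have "compactin sum_top (\<Union>p\<in>P. E p ` A p)" using finP by (intro compactin_Union) auto
  then show ?thesis by (simp add: compact_space_def topspace_sum_top sum_space_def)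
qed

text \<open>A chart of the sum is a chart \<open>c\<close> of one summand read through
  \<open>E p\<close>. Openness of \<open>A p\<close> keeps the restricted image open in the
  half-space.\<close>

lemma sum_chart:
  assumes p: "p \<in> P" and U: "(U, c) \<in> matlas (M p)"
  defines "U' \<equiv> E p ` (U \<inter> A p)" and "c' \<equiv> c \<circ> inv_into (A p) (E p)"
  shows "c' ` U' = c ` (U \<inter> A p)" "\<And>x. x \<in> U \<Longrightarrow> x \<in> A p \<Longrightarrow> c' (E p x) = c x"
    "\<And>x. x \<in> U \<Longrightarrow> x \<in> A p \<Longrightarrow> inv_into U' c' (c x) = E p x"
    "openin sum_top U'" "openin (half_space n) (c' ` U')"
    "homeomorphic_map (subtopology sum_top U') (subtopology (half_space n) (c' ` U')) c'"
proof -
  note ch = chartedD[OF smooth_manifold_charted[OF M(1)[OF p]] U]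
  have hs: "openin (half_space n) (c ` U)" "homeomorphic_map (subtopology (mtop (M p)) U) (subtopology (half_space n) (c ` U)) c"
    using M[OF p] U unfolding smooth_manifold_def by auto
  show im: "c' ` U' = c ` (U \<inter> A p)" unfolding U'_def c'_def by (force simp: image_image inv_E[OF p])
  show 1: "c' (E p x) = c x" if "x \<in> U" "x \<in> A p" for x using that inv_E[OF p] by (simp add: c'_def)
  have inj: "inj_on c' U'"
    unfolding U'_def using 1 ch(4) by (auto intro!: inj_onI dest: inj_onD)
  show "inv_into U' c' (c x) = E p x" if "x \<in> U" "x \<in> A p" for x
    using inv_into_f_f[OF inj, of "E p x"] 1[OF that] that by (simp add: U'_def)
  show U': "openin sum_top U'" unfolding U'_def
    using openin_sum_image[OF p] ch(1) A(1)[OF p] by auto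
  have UA: "openin (subtopology (mtop (M p)) U) (U \<inter> A p)"
    using A(1)[OF p] ch(1) by (simp add: openin_open_subtopology openin_Int)
  then have "openin (subtopology (half_space n) (c ` U)) (c ` (U \<inter> A p))"
    using homeomorphic_imp_open_map[OF hs(2)] unfolding open_map_def by blast
  then show "openin (half_space n) (c' ` U')" unfolding im using hs(1) openin_trans_full by blast
  have "homeomorphic_map (subtopology (subtopology (mtop (M p)) U) (U \<inter> A p)) (subtopology (subtopology (half_space n) (c ` U)) (c ` (U \<inter> A p))) c"
    by (rule homeomorphic_map_subtopologies_alt[OF hs(2)])
      (use ch(2,4) A_subset[OF p] in \<open>auto dest: inj_onD\<close>)
  then have h1: "homeomorphic_map (subtopology (mtop (M p)) (U \<inter> A p)) (subtopology (half_space n) (c ` (U \<inter> A p))) c"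
    unfolding subtopology_subtopology by (simp add: Int_absorb1 image_mono)
  have "homeomorphic_map (subtopology (subtopology (mtop (M p)) (A p)) (U \<inter> A p)) (subtopology (subtopology sum_top (E p ` A p)) U') (E p)"
    unfolding U'_def by (rule homeomorphic_map_subtopologies_alt[OF homeo_E[OF p]])
      (use inj_E[OF p] A_subset[OF p] p in \<open>auto simp: topspace_sum_top sum_space_def dest: inj_onD\<close>)
  then have h2: "homeomorphic_map (subtopology (mtop (M p)) (U \<inter> A p)) (subtopology sum_top U') (E p)"
    unfolding subtopology_subtopology U'_def by (simp add: Int_absorb1 image_mono)
  then obtain g where g: "homeomorphic_maps (subtopology (mtop (M p)) (U \<inter> A p)) (subtopology sum_top U') (E p) g"
    using homeomorphic_map_maps by blast
  then have "homeomorphic_map (subtopology sum_top U') (subtopology (mtop (M p)) (U \<inter> A p)) g"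
    using homeomorphic_maps_sym homeomorphic_map_maps by blast
  from homeomorphic_map_compose[OF this h1]
  show "homeomorphic_map (subtopology sum_top U') (subtopology (half_space n) (c' ` U')) c'"
    unfolding im
  proof (rule homeomorphic_map_eq)
    fix y assume "y \<in> topspace (subtopology sum_top U')"
    then obtain x where x: "x \<in> U" "x \<in> A p" "y = E p x" unfolding U'_def by auto
    then have "g y = x" using g A_subset[OF p] unfolding homeomorphic_maps_def by auto
    then show "(c \<circ> g) y = c' y" using 1 x by simp
  qed
qed

text \<open>Charts from different pieces have disjoint domains; for charts from the same piece the
  map \<open>E p\<close> cancels and a transition of the summand remains.\<close>

lemma sum_chart_transition:
  assumes p: "p \<in> P" and U: "(U, c) \<in> matlas (M p)" and q: "q \<in> P" and V: "(V, d) \<in> matlas (M q)"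
  shows "smooth_vec n ((c \<circ> inv_into (A p) (E p)) ` (E p ` (U \<inter> A p) \<inter> E q ` (V \<inter> A q)))
    ((d \<circ> inv_into (A q) (E q)) \<circ> inv_into (E p ` (U \<inter> A p)) (c \<circ> inv_into (A p) (E p)))"
    (is "smooth_vec n ?S ?f")
proof (cases "p = q")
  case False
  then have "?S = {}" using E_disjoint[OF p q] by simp
  then show ?thesis by (simp add: smooth_vec_def smooth_coord_def)
next
  case True
  note u = sum_chart[OF p U]
  note ch = chartedD[OF smooth_manifold_charted[OF M(1)[OF p]] U]
  have elem: "\<exists>x. x \<in> U \<inter> V \<inter> A p \<and> z = c x" if "z \<in> ?S" for z
    using that E[OF p p] u(2) True by auto
  have "smooth_vec n ?S (d \<circ> inv_into U c)"
    by (rule smooth_vec_subset[OF ch(6)[unfolded M(2)[OF p], of V d]]) (use V True elem in auto)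
  then show ?thesis
  proof (rule iffD1[OF smooth_vec_cong, rotated])
    fix z assume "z \<in> ?S"
    then obtain x where "x \<in> U \<inter> V \<inter> A p" "z = c x" using elem by blast
    then show "(d \<circ> inv_into U c) z = ?f z" using u(3) ch(4) inv_E[OF p] True by simp
  qed
qed

text \<open>Stated for any record with these three fields: it is applied to a record with a dummy
  action, from which the true action is defined, and then to the final manifold.\<close>

context
  fixes N :: "('b, 'y) smfd_scheme"
  assumes N: "mtop N = sum_top" "matlas N = sum_atlas" "mdim N = n"
begin

lemma sum_atlasI: "p \<in> P \<Longrightarrow> (U, c) \<in> matlas (M p) \<Longrightarrow> (E p ` (U \<inter> A p), c \<circ> inv_into (A p) (E p)) \<in> sum_atlas"
  unfolding sum_atlas_def by blast

lemma smooth_manifold_sum: "smooth_manifold N"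
  unfolding smooth_manifold_def N
proof (intro conjI)
  show "(\<Union>(U, c)\<in>sum_atlas. U) = topspace sum_top"
  proof
    show "(\<Union>(U, c)\<in>sum_atlas. U) \<subseteq> topspace sum_top"
      by (auto simp: topspace_sum_top sum_space_def elim!: sum_chartE)
    show "topspace sum_top \<subseteq> (\<Union>(U, c)\<in>sum_atlas. U)"
    proof
      fix y assume "y \<in> topspace sum_top"
      then obtain p x where p: "p \<in> P" "x \<in> A p" "y = E p x" unfolding topspace_sum_top sum_space_def by blast
      then obtain U c where "(U, c) \<in> matlas (M p)" "x \<in> U"
        using charted_chart_at[OF smooth_manifold_charted[OF M(1)[OF p(1)]]] A_subset by blast
      then show "y \<in> (\<Union>(U, c)\<in>sum_atlas. U)" using sum_atlasI[OF p(1)] p by blast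
    qed
  qed
  show "\<forall>(U, c)\<in>sum_atlas. openin sum_top U \<and> openin (half_space n) (c ` U) \<and>
      homeomorphic_map (subtopology sum_top U) (subtopology (half_space n) (c ` U)) c"
    using sum_chart(4-6) by (auto elim!: sum_chartE)
  show "\<forall>(U, c)\<in>sum_atlas. \<forall>(V, d)\<in>sum_atlas. smooth_vec n (c ` (U \<inter> V)) (d \<circ> inv_into U c)"
    using sum_chart_transition by (auto elim!: sum_chartE)
qed (rule Hausdorff_sum_top second_countable_sum_top)+

lemma diffeo_sum_piece:
  assumes p: "p \<in> P"
  shows "diffeo (M p) (A p) N (E p ` A p) (E p)"
proof (rule diffeoI[where g = "inv_into (A p) (E p)"])
  note Mp = smooth_manifold_charted[OF M(1)[OF p]]
  show "smooth_map (M p) (A p) N (E p)"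
  proof (rule smooth_mapI)
    fix U c V' d' assume U: "(U, c) \<in> matlas (M p)" and V': "(V', d') \<in> matlas N"
    note ch = chartedD[OF Mp U]
    obtain q V d where V: "q \<in> P" "(V, d) \<in> matlas (M q)" "V' = E q ` (V \<inter> A q)" "d' = d \<circ> inv_into (A q) (E q)"
      using V' unfolding N by (rule sum_chartE)
    let ?S = "c ` {x \<in> A p \<inter> U. E p x \<in> V'}"
    show "smooth_vec (mdim (M p)) ?S (d' \<circ> E p \<circ> inv_into U c)"
    proof (cases "p = q")
      case False
      then have "?S = {}" using E_disjoint[OF p V(1), of "A p" "V \<inter> A q"] V(3) by auto
      then show ?thesis unfolding smooth_vec_def smooth_coord_def by blast
    next
      case True
      have elem: "\<exists>x. x \<in> U \<inter> V \<inter> A p \<and> z = c x" if "z \<in> ?S" for z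
        using that E[OF p p] V(3) True by auto
      have "smooth_vec (mdim (M p)) ?S (d \<circ> inv_into U c)"
        by (rule smooth_vec_subset[OF ch(6)[of V d]]) (use V True elem in auto)
      then show ?thesis
      proof (rule iffD1[OF smooth_vec_cong, rotated])
        fix z assume "z \<in> ?S"
        then obtain x where "x \<in> U \<inter> V \<inter> A p" "z = c x" using elem by blast
        then show "(d \<circ> inv_into U c) z = (d' \<circ> E p \<circ> inv_into U c) z"
          using V(4) True ch(4) inv_E[OF p] by simp
      qed
    qed
  qed (use continuous_E[OF p] A_subset[OF p] N in auto)
  show "smooth_map N (E p ` A p) (M p) (inv_into (A p) (E p))"
  proof (rule smooth_mapI)
    show "E p ` A p \<subseteq> mspace N" using p by (auto simp: N topspace_sum_top sum_space_def)
    obtain g where g: "homeomorphic_maps (subtopology (mtop (M p)) (A p)) (subtopology sum_top (E p ` A p)) (E p) g"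
      using homeo_E[OF p] homeomorphic_map_maps by blast
    then have "continuous_map (subtopology sum_top (E p ` A p)) (mtop (M p)) g"
      unfolding homeomorphic_maps_def continuous_map_in_subtopology by blast
    then have "continuous_map (subtopology sum_top (E p ` A p)) (mtop (M p)) (inv_into (A p) (E p))"
    proof (rule continuous_map_eq)
      fix y assume "y \<in> topspace (subtopology sum_top (E p ` A p))"
      then obtain x where "x \<in> A p" "y = E p x" by auto
      then show "g y = inv_into (A p) (E p) y"
        using g inv_E[OF p] A_subset[OF p] unfolding homeomorphic_maps_def by auto
    qed
    then show "continuous_map (subtopology (mtop N) (E p ` A p)) (mtop (M p)) (inv_into (A p) (E p))" by (simp add: N)
    fix U' c' V d assume U': "(U', c') \<in> matlas N" and V: "(V, d) \<in> matlas (M p)"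
    obtain q U c where U: "q \<in> P" "(U, c) \<in> matlas (M q)" "U' = E q ` (U \<inter> A q)" "c' = c \<circ> inv_into (A q) (E q)"
      using U' unfolding N by (rule sum_chartE)
    let ?S = "c' ` {y \<in> E p ` A p \<inter> U'. inv_into (A p) (E p) y \<in> V}"
    show "smooth_vec (mdim N) ?S (d \<circ> inv_into (A p) (E p) \<circ> inv_into U' c')"
    proof (cases "p = q")
      case False
      then have "?S = {}" using E_disjoint[OF p U(1), of "A p" "U \<inter> A q"] U(3) by auto
      then show ?thesis unfolding smooth_vec_def smooth_coord_def by blast
    next
      case True
      note Up = U(2)[folded True]
      note u = sum_chart[OF p Up] and ch = chartedD[OF Mp Up]
      have elem: "\<exists>x. x \<in> U \<inter> V \<inter> A p \<and> z = c x" if "z \<in> ?S" for z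
        using that E[OF p p] U(3,4) True inv_E[OF p] by auto
      have "smooth_vec n ?S (d \<circ> inv_into U c)"
        by (rule smooth_vec_subset[OF ch(6)[unfolded M(2)[OF p], OF V]]) (use elem in auto)
      then show ?thesis unfolding N(3)
      proof (rule iffD1[OF smooth_vec_cong, rotated])
        fix z assume "z \<in> ?S"
        then obtain x where x: "x \<in> U \<inter> V \<inter> A p" "z = c x" using elem by blast
        then have "inv_into U' c' z = E p x" using u(3) U(3,4) True by simp
        then show "(d \<circ> inv_into U c) z = (d \<circ> inv_into (A p) (E p) \<circ> inv_into U' c') z"
          using x ch(4) inv_E[OF p] by simp
      qed
    qed
  qed
qed (use smooth_manifold_charted[OF smooth_manifold_sum] inv_E[OF p] inj_E[OF p] in
    \<open>auto simp: inv_into_into f_inv_into_f\<close>)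

lemma pieces_sum: "pieces N P M A E"
  unfolding pieces_def
proof (intro conjI ballI impI)
  show "(\<Union>p\<in>P. E p ` A p) = mspace N" by (simp add: N topspace_sum_top sum_space_def)
  fix p assume p: "p \<in> P"
  show "openin (mtop N) (E p ` A p)" using openin_sum_image[OF p A(1)[OF p]] by (simp add: N)
  show "charted (M p)" using smooth_manifold_charted[OF M(1)[OF p]] .
qed (use A E diffeo_sum_piece in auto)

text \<open>Boundary points are detected by charts, and the charts of the sum are those of the
  summands restricted to the pieces. This later keeps transported hypersurfaces away from the
  boundary.\<close>

lemma mboundary_sum: "mboundary N = (\<Union>p\<in>P. E p ` (mboundary (M p) \<inter> A p))"
proof (intro equalityI subsetI)
  fix y assume y: "y \<in> mboundary N"
  obtain U' c' where y: "0 < n" "(U', c') \<in> sum_atlas" "y \<in> U'" "c' y 0 = 0"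
    using y unfolding mboundary_def N by blast
  obtain p U c where U: "p \<in> P" "(U, c) \<in> matlas (M p)" "U' = E p ` (U \<inter> A p)" "c' = c \<circ> inv_into (A p) (E p)"
    using sum_chartE[OF y(2)] by blast
  obtain x where x: "x \<in> U" "x \<in> A p" "y = E p x" using y(3) unfolding U(3) by (rule imageE) blast
  then have "c x 0 = 0" using y(4) U(4) inv_E[OF U(1)] by simp
  then have "x \<in> mboundary (M p)"
    unfolding mboundary_def using U(2) x(1) y(1) M(2)[OF U(1)] by auto
  then show "y \<in> (\<Union>p\<in>P. E p ` (mboundary (M p) \<inter> A p))"
    unfolding x(3) using x(2) by (intro UN_I[OF U(1)] imageI IntI)
next
  fix y assume "y \<in> (\<Union>p\<in>P. E p ` (mboundary (M p) \<inter> A p))"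
  then obtain p x where p: "p \<in> P" "x \<in> mboundary (M p)" "x \<in> A p" "y = E p x"
    by (rule sum_pieceE) blast
  obtain U c where U: "0 < n" "(U, c) \<in> matlas (M p)" "x \<in> U" "c x 0 = 0"
    using p(2) M(2)[OF p(1)] unfolding mboundary_def by auto
  have "y \<in> E p ` (U \<inter> A p) \<and> (c \<circ> inv_into (A p) (E p)) y 0 = 0"
    using p(3,4) U(3,4) inv_E[OF p(1,3)] by auto
  then have "\<exists>(U, c)\<in>sum_atlas. y \<in> U \<and> c y 0 = 0"
    by (intro bexI[OF _ sum_atlasI[OF p(1) U(2)]]) simp
  then show "y \<in> mboundary N" unfolding mboundary_def N using U(1) by simp
qed

end

end

section \<open>Labelled manifolds\<close>

lemma UN_imageE:
  assumes "y \<in> (\<Union>p\<in>P. E p ` B p)"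
  obtains p x where "p \<in> P" "x \<in> B p" "y = E p x"
proof -
  obtain p where p: "p \<in> P" "y \<in> E p ` B p" using assms by (rule UN_E)
  from p(2) show thesis by (rule imageE) (rule that[OF p(1)])
qed

text \<open>An action is a homomorphism to \<open>BijGroup\<close>, whose elements are extensional
  bijections; bijectivity is supplied by the action of the inverse element.\<close>

lemma group_actionI:
  assumes "group G" and "\<And>g. g \<in> carrier G \<Longrightarrow> act g \<in> extensional E"
    and cl: "\<And>g x. g \<in> carrier G \<Longrightarrow> x \<in> E \<Longrightarrow> act g x \<in> E"
    and one: "\<And>x. x \<in> E \<Longrightarrow> act \<one>\<^bsub>G\<^esub> x = x"
    and mult: "\<And>g h x. g \<in> carrier G \<Longrightarrow> h \<in> carrier G \<Longrightarrow> x \<in> E \<Longrightarrow> act (g \<otimes>\<^bsub>G\<^esub> h) x = act g (act h x)"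
  shows "group_action G E act"
proof -
  interpret group G by fact
  have bij: "act g \<in> Bij E" if g: "g \<in> carrier G" for g
  proof -
    have "bij_betw (act g) E E"
    proof (rule bij_betw_byWitness[where f' = "act (inv\<^bsub>G\<^esub> g)"])
      show "\<forall>x\<in>E. act (inv\<^bsub>G\<^esub> g) (act g x) = x" "\<forall>x\<in>E. act g (act (inv\<^bsub>G\<^esub> g) x) = x"
        using mult[of "inv\<^bsub>G\<^esub> g" g] mult[of g "inv\<^bsub>G\<^esub> g"] one g by auto
    qed (use cl g in auto)
    then show ?thesis using assms(2) g by (simp add: Bij_def)
  qed
  have "act \<in> hom G (BijGroup E)"
  proof (rule homI)
    show "\<And>g. g \<in> carrier G \<Longrightarrow> act g \<in> carrier (BijGroup E)" using bij by (simp add: BijGroup_def)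
    fix g h assume gh: "g \<in> carrier G" "h \<in> carrier G"
    have "act (g \<otimes>\<^bsub>G\<^esub> h) = compose E (act g) (act h)"
      by (rule extensionalityI[of _ E]) (use gh assms(2) mult in \<open>auto simp: compose_def\<close>)
    then show "act (g \<otimes>\<^bsub>G\<^esub> h) = act g \<otimes>\<^bsub>BijGroup E\<^esub> act h" using bij gh by (simp add: BijGroup_def)
  qed
  then show ?thesis
    by (simp add: group_action_def group_hom_def group_hom_axioms_def assms(1) group_BijGroup)
qed

lemma G_manifoldD:
  assumes "G_manifold n G M"
  shows "smooth_manifold M" "charted M" "compact_space (mtop M)" "mdim M = n" "group G"
    "\<And>g x. g \<in> carrier G \<Longrightarrow> x \<in> mspace M \<Longrightarrow> mact M g x \<in> mspace M"
    "\<And>x. x \<in> mspace M \<Longrightarrow> mact M \<one>\<^bsub>G\<^esub> x = x"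
    "\<And>g h x. g \<in> carrier G \<Longrightarrow> h \<in> carrier G \<Longrightarrow> x \<in> mspace M \<Longrightarrow> mact M (g \<otimes>\<^bsub>G\<^esub> h) x = mact M g (mact M h x)"
    "\<And>g x. g \<in> carrier G \<Longrightarrow> x \<in> mspace M \<Longrightarrow> mact M (inv\<^bsub>G\<^esub> g) (mact M g x) = x"
    "\<And>g x. g \<in> carrier G \<Longrightarrow> x \<in> mspace M \<Longrightarrow> mact M g (mact M (inv\<^bsub>G\<^esub> g) x) = x"
    "\<And>g. g \<in> carrier G \<Longrightarrow> smooth_map M (mspace M) M (mact M g)"
    "\<And>g. g \<in> carrier G \<Longrightarrow> mact M g \<in> extensional (mspace M)"
    "group_action G (mspace M) (mact M)"
proof -
  show ga: "group_action G (mspace M) (mact M)" and sm: "smooth_manifold M"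
    using assms unfolding G_manifold_def by auto
  interpret group_action G "mspace M" "mact M" by fact
  show gr: "group G" using group_hom group_hom.axioms(1) by blast
  interpret group G by fact
  show cl: "mact M g x \<in> mspace M" if "g \<in> carrier G" "x \<in> mspace M" for g x
    using element_image[OF that] by simp
  show one: "mact M \<one>\<^bsub>G\<^esub> x = x" if "x \<in> mspace M" for x
    using id_eq_one that by (metis restrict_apply')
  show mult: "mact M (g \<otimes>\<^bsub>G\<^esub> h) x = mact M g (mact M h x)"
    if "g \<in> carrier G" "h \<in> carrier G" "x \<in> mspace M" for g h x
    using composition_rule that by blast
  show "mact M (inv\<^bsub>G\<^esub> g) (mact M g x) = x" "mact M g (mact M (inv\<^bsub>G\<^esub> g) x) = x"
    if "g \<in> carrier G" "x \<in> mspace M" for g x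
    using mult[of "inv\<^bsub>G\<^esub> g" g x] mult[of g "inv\<^bsub>G\<^esub> g" x] one that by auto
  show "mact M g \<in> extensional (mspace M)" if "g \<in> carrier G" for g
    using bij_prop0[OF that] by (simp add: Bij_def)
qed (use assms smooth_manifold_charted in \<open>auto simp: G_manifold_def\<close>)

lemma diffeo_act:
  assumes M: "G_manifold n G M" and g: "g \<in> carrier G" and A: "A \<subseteq> mspace M"
  shows "diffeo M A M (mact M g ` A) (mact M g)"
proof (rule diffeoI[where g = "mact M (inv\<^bsub>G\<^esub> g)"])
  note m = G_manifoldD[OF M]
  interpret group G by (rule m(5))
  show "smooth_map M A M (mact M g)" by (rule smooth_map_subset[OF m(11)[OF g] A])
  show "smooth_map M (mact M g ` A) M (mact M (inv\<^bsub>G\<^esub> g))"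
    by (rule smooth_map_subset[OF m(11)]) (use g A m(6) in auto)
qed (use A g G_manifoldD[OF M] in auto)

text \<open>
  The SK groups over a finite G-set X are formed from manifolds equipped with an equivariant locally
  constant map to X. So that the objects remain plain manifolds, this map is the restriction of a
  fixed labelling of all real numbers by points.
\<close>

abbreviation fibre :: "('a \<Rightarrow> 'x) \<Rightarrow> ('a, 'z) smfd_scheme \<Rightarrow> 'x \<Rightarrow> 'a set" where
  "fibre \<pi> M y \<equiv> {x \<in> mspace M. \<pi> x = y}"

definition lab_mfd :: "nat \<Rightarrow> ('g, 'b) monoid_scheme \<Rightarrow> ('g, 'x) gset \<Rightarrow> ('a \<Rightarrow> 'x) \<Rightarrow> ('a, 'g) gmfd \<Rightarrow> bool" where
  "lab_mfd n G X \<pi> M \<longleftrightarrow> G_manifold n G M \<and>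
     (\<forall>x\<in>mspace M. \<pi> x \<in> pts X \<and> (\<forall>g\<in>carrier G. \<pi> (mact M g x) = gact X g (\<pi> x))) \<and>
     (\<forall>y\<in>pts X. openin (mtop M) (fibre \<pi> M y))"

text \<open>Points outside \<open>pts X\<close> have empty fibres, so all fibres are open. The
  complement of a fibre is the union of the others, hence open too, and a closed subset of a compact
  space is compact.\<close>

lemma lab_mfdD:
  assumes "lab_mfd n G X \<pi> M"
  shows "G_manifold n G M" "charted M" "\<And>x. x \<in> mspace M \<Longrightarrow> \<pi> x \<in> pts X"
    "\<And>x g. x \<in> mspace M \<Longrightarrow> g \<in> carrier G \<Longrightarrow> \<pi> (mact M g x) = gact X g (\<pi> x)"
    "\<And>y. openin (mtop M) (fibre \<pi> M y)" "\<And>y. compactin (mtop M) (fibre \<pi> M y)"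
proof -
  show 1: "G_manifold n G M" "\<And>x. x \<in> mspace M \<Longrightarrow> \<pi> x \<in> pts X"
    "\<And>x g. x \<in> mspace M \<Longrightarrow> g \<in> carrier G \<Longrightarrow> \<pi> (mact M g x) = gact X g (\<pi> x)"
    using assms unfolding lab_mfd_def by auto
  show "charted M" using G_manifoldD(2)[OF 1(1)] .
  show op: "openin (mtop M) (fibre \<pi> M y)" for y
  proof (cases "y \<in> pts X")
    case False
    then have "fibre \<pi> M y = {}" using 1(2) by blast
    then show ?thesis by (metis openin_empty)
  qed (use assms in \<open>auto simp: lab_mfd_def\<close>)
  have "mspace M - fibre \<pi> M y = (\<Union>z\<in>- {y}. fibre \<pi> M z)" for y by blast
  moreover have "openin (mtop M) (\<Union>z\<in>- {y}. fibre \<pi> M z)" for y using op by (intro openin_Union) auto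
  ultimately have "closedin (mtop M) (fibre \<pi> M y)" for y by (auto simp: closedin_def)
  then show "compactin (mtop M) (fibre \<pi> M y)" for y
    using closedin_compact_space[OF G_manifoldD(3)[OF 1(1)]] by blast
qed

definition lab_diffeo ::
  "('g, 'b) monoid_scheme \<Rightarrow> ('a \<Rightarrow> 'x) \<Rightarrow> ('a, 'g) gmfd \<Rightarrow> ('a, 'g) gmfd \<Rightarrow> 'a set \<Rightarrow> ('a \<Rightarrow> 'a) \<Rightarrow> bool" where
  "lab_diffeo G \<pi> M N U f \<longleftrightarrow> G_diffeo G M (mspace M) N U f \<and> (\<forall>x\<in>mspace M. \<pi> (f x) = \<pi> x)"

definition lab_iso :: "('g, 'b) monoid_scheme \<Rightarrow> ('a \<Rightarrow> 'x) \<Rightarrow> ('a, 'g) gmfd \<Rightarrow> ('a, 'g) gmfd \<Rightarrow> bool" where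
  "lab_iso G \<pi> M N \<longleftrightarrow> (\<exists>f. lab_diffeo G \<pi> M N (mspace N) f)"

lemma lab_diffeoI:
  assumes "G_manifold n G M" and d: "diffeo M (mspace M) N U f"
    and eq: "\<And>g x. g \<in> carrier G \<Longrightarrow> x \<in> mspace M \<Longrightarrow> f (mact M g x) = mact N g (f x)"
    and lab: "\<And>x. x \<in> mspace M \<Longrightarrow> \<pi> (f x) = \<pi> x"
  shows "lab_diffeo G \<pi> M N U f"
proof -
  have cl: "\<And>g x. g \<in> carrier G \<Longrightarrow> x \<in> mspace M \<Longrightarrow> mact M g x \<in> mspace M"
    using G_manifoldD(6)[OF assms(1)] .
  have "invariant_under G N U" unfolding invariant_under_def
  proof (intro ballI)
    fix g y assume g: "g \<in> carrier G" and "y \<in> U"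
    then obtain x where x: "x \<in> mspace M" "y = f x" using diffeoD(3)[OF d] by blast
    then have "mact N g y = f (mact M g x)" using eq g by simp
    then show "mact N g y \<in> U" using diffeoD(3)[OF d] cl[OF g x(1)] by blast
  qed
  then show ?thesis using d eq lab cl unfolding lab_diffeo_def G_diffeo_def invariant_under_def by blast
qed

lemma lab_diffeoD:
  assumes "lab_diffeo G \<pi> M N U f"
  shows "diffeo M (mspace M) N U f"
    "\<And>g x. g \<in> carrier G \<Longrightarrow> x \<in> mspace M \<Longrightarrow> f (mact M g x) = mact N g (f x)"
    "\<And>x. x \<in> mspace M \<Longrightarrow> \<pi> (f x) = \<pi> x"
  using assms unfolding lab_diffeo_def G_diffeo_def by auto

lemma lab_diffeo_fibre:
  assumes f: "lab_diffeo G \<pi> M N U f" and N: "charted N"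
  shows "diffeo M (fibre \<pi> M y) N {x \<in> U. \<pi> x = y} f"
proof -
  note d = diffeoD[OF lab_diffeoD(1)[OF f]]
  have "f ` fibre \<pi> M y = {x \<in> U. \<pi> x = y}"
  proof
    show "f ` fibre \<pi> M y \<subseteq> {x \<in> U. \<pi> x = y}" using d(3) lab_diffeoD(3)[OF f] by auto
    show "{x \<in> U. \<pi> x = y} \<subseteq> f ` fibre \<pi> M y"
    proof
      fix z assume z: "z \<in> {x \<in> U. \<pi> x = y}"
      then obtain x where "x \<in> mspace M" "z = f x" using d(3) by blast
      then show "z \<in> f ` fibre \<pi> M y" using z lab_diffeoD(3)[OF f] by simp
    qed
  qed
  then show ?thesis using diffeo_subset[OF N lab_diffeoD(1)[OF f], of "fibre \<pi> M y"] by auto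
qed

lemma lab_diffeo_compose:
  assumes "lab_mfd n G X \<pi> M" "lab_mfd n G X \<pi> N" "lab_mfd n G X \<pi> L"
    and f: "lab_diffeo G \<pi> M N (mspace N) f" and g: "lab_diffeo G \<pi> N L U g"
  shows "lab_diffeo G \<pi> M L U (\<lambda>x. g (f x))"
proof (rule lab_diffeoI[OF lab_mfdD(1)[OF assms(1)]])
  note fd = diffeoD[OF lab_diffeoD(1)[OF f]]
  show "diffeo M (mspace M) L U (\<lambda>x. g (f x))"
    by (rule diffeo_compose[OF _ _ _ lab_diffeoD(1)[OF f] lab_diffeoD(1)[OF g]]) (use assms lab_mfdD in blast)+
  fix x assume x: "x \<in> mspace M"
  then have fx: "f x \<in> mspace N" using fd(3) by blast
  then show "\<pi> (g (f x)) = \<pi> x" using lab_diffeoD(3)[OF f x] lab_diffeoD(3)[OF g fx] by simp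
  fix h assume "h \<in> carrier G"
  then show "g (f (mact M h x)) = mact L h (g (f x))"
    using lab_diffeoD(2)[OF f] lab_diffeoD(2)[OF g] x fx by simp
qed

lemma lab_diffeo_sub:
  assumes "lab_mfd n G X \<pi> M" "lab_mfd n G X \<pi> N" "lab_mfd n G X \<pi> L"
    and f: "lab_diffeo G \<pi> M N U f" and g: "lab_diffeo G \<pi> N L V g"
  shows "lab_diffeo G \<pi> M L (g ` U) (\<lambda>x. g (f x))"
proof (rule lab_diffeoI[OF lab_mfdD(1)[OF assms(1)]])
  note fd = diffeoD[OF lab_diffeoD(1)[OF f]]
  note ch = lab_mfdD(2)[OF assms(1)] lab_mfdD(2)[OF assms(2)] lab_mfdD(2)[OF assms(3)]
  show "diffeo M (mspace M) L (g ` U) (\<lambda>x. g (f x))"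
    by (rule diffeo_compose[OF ch lab_diffeoD(1)[OF f] diffeo_subset[OF ch(3) lab_diffeoD(1)[OF g] fd(7)]])
  fix x assume x: "x \<in> mspace M"
  then have fx: "f x \<in> mspace N" using fd(3,7) by blast
  then show "\<pi> (g (f x)) = \<pi> x" using lab_diffeoD(3)[OF f x] lab_diffeoD(3)[OF g fx] by simp
  fix h assume "h \<in> carrier G"
  then show "g (f (mact M h x)) = mact L h (g (f x))"
    using lab_diffeoD(2)[OF f] lab_diffeoD(2)[OF g] x fx by simp
qed

lemma lab_iso_refl: "lab_mfd n G X \<pi> M \<Longrightarrow> lab_iso G \<pi> M M"
  unfolding lab_iso_def
  by (intro exI[of _ "\<lambda>x. x"] lab_diffeoI diffeo_id lab_mfdD(1)) (auto dest: lab_mfdD(2))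

lemma lab_iso_sym:
  assumes "lab_mfd n G X \<pi> M" "lab_mfd n G X \<pi> N" "lab_iso G \<pi> M N"
  shows "lab_iso G \<pi> N M"
proof -
  obtain f where f: "lab_diffeo G \<pi> M N (mspace N) f" using assms(3) unfolding lab_iso_def by blast
  note d = diffeoD[OF lab_diffeoD(1)[OF f]]
  let ?g = "inv_into (mspace M) f"
  have "lab_diffeo G \<pi> N M (mspace M) ?g"
  proof (rule lab_diffeoI[OF lab_mfdD(1)[OF assms(2)] diffeo_inv[OF lab_mfdD(2)[OF assms(1)] lab_diffeoD(1)[OF f]]])
    fix y assume y: "y \<in> mspace N"
    show "\<pi> (?g y) = \<pi> y" using lab_diffeoD(3)[OF f d(10)[OF y]] d(9)[OF y] by simp
    fix g assume g: "g \<in> carrier G"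
    have "f (mact M g (?g y)) = mact N g y" using lab_diffeoD(2)[OF f g d(10)[OF y]] d(9)[OF y] by simp
    then show "?g (mact N g y) = mact M g (?g y)"
      using d(8) G_manifoldD(6)[OF lab_mfdD(1)[OF assms(1)] g d(10)[OF y]] by metis
  qed
  then show ?thesis unfolding lab_iso_def by blast
qed

lemma lab_iso_trans:
  assumes "lab_mfd n G X \<pi> M" "lab_mfd n G X \<pi> N" "lab_mfd n G X \<pi> L" "lab_iso G \<pi> M N" "lab_iso G \<pi> N L"
  shows "lab_iso G \<pi> M L"
  using lab_diffeo_compose[OF assms(1-3)] assms(4,5) unfolding lab_iso_def by blast

subsection \<open>Disjoint unions\<close>

definition lab_sum :: "('g, 'b) monoid_scheme \<Rightarrow> ('a \<Rightarrow> 'x) \<Rightarrow> ('a, 'g) gmfd \<Rightarrow> ('a, 'g) gmfd \<Rightarrow> ('a, 'g) gmfd \<Rightarrow> bool" where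
  "lab_sum G \<pi> M1 M2 N \<longleftrightarrow>
     (\<exists>U1 U2 f1 f2. openin (mtop N) U1 \<and> openin (mtop N) U2 \<and> U1 \<union> U2 = mspace N \<and> U1 \<inter> U2 = {} \<and>
        lab_diffeo G \<pi> M1 N U1 f1 \<and> lab_diffeo G \<pi> M2 N U2 f2)"

lemma lab_sum_pieces:
  assumes "lab_mfd n G X \<pi> M1" "lab_mfd n G X \<pi> M2"
    "openin (mtop N) U1" "openin (mtop N) U2" "U1 \<union> U2 = mspace N" "U1 \<inter> U2 = {}"
    "lab_diffeo G \<pi> M1 N U1 f1" "lab_diffeo G \<pi> M2 N U2 f2"
  shows "pieces N UNIV (\<lambda>b. if b then M1 else M2) (\<lambda>b. mspace (if b then M1 else M2)) (\<lambda>b. if b then f1 else f2)"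
proof -
  note d1 = diffeoD(3)[OF lab_diffeoD(1)[OF assms(7)]] and d2 = diffeoD(3)[OF lab_diffeoD(1)[OF assms(8)]]
  have "f1 x \<noteq> f2 y" if "x \<in> mspace M1" "y \<in> mspace M2" for x y using d1 d2 assms(6) that by blast
  then have "\<forall>x\<in>mspace (if p then M1 else M2). \<forall>y\<in>mspace (if q then M1 else M2).
      (if p then f1 else f2) x = (if q then f1 else f2) y \<longrightarrow> p = q" for p q
    by (cases p; cases q) (simp_all, metis)
  then show ?thesis unfolding pieces_def
    using assms(3-5) d1 d2 lab_diffeoD(1)[OF assms(7)] lab_diffeoD(1)[OF assms(8)] lab_mfdD(2)[OF assms(1)] lab_mfdD(2)[OF assms(2)]
    by (auto simp: UNIV_bool)
qed

text \<open>The universal property of disjoint unions in embedded form: disjoint open images of the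
  two summands in \<open>N'\<close> extend to an embedding of the sum. Uniqueness and associativity
  of sums both follow from it.\<close>

lemma lab_sum_map:
  assumes M: "lab_mfd n G X \<pi> M1" "lab_mfd n G X \<pi> M2" and N: "lab_mfd n G X \<pi> N" and N': "lab_mfd n G X \<pi> N'"
    and sum: "lab_sum G \<pi> M1 M2 N"
    and f': "lab_diffeo G \<pi> M1 N' U1' f1'" "lab_diffeo G \<pi> M2 N' U2' f2'"
    and U': "openin (mtop N') U1'" "openin (mtop N') U2'" "U1' \<inter> U2' = {}"
  shows "\<exists>F. lab_diffeo G \<pi> N N' (U1' \<union> U2') F"
proof -
  obtain U1 U2 f1 f2 where U: "openin (mtop N) U1" "openin (mtop N) U2" "U1 \<union> U2 = mspace N" "U1 \<inter> U2 = {}"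
    "lab_diffeo G \<pi> M1 N U1 f1" "lab_diffeo G \<pi> M2 N U2 f2" using sum unfolding lab_sum_def by blast
  \<comment> \<open>Indexing the summands by \<open>bool\<close> makes the sum an instance of
    \<open>pieces\<close> and lets one argument serve both of them.\<close>
  let ?Mb = "\<lambda>b. if b then M1 else M2" and ?f = "\<lambda>b. if b then f1 else f2" and ?f' = "\<lambda>b. if b then f1' else f2'"
    and ?U' = "\<lambda>b. if b then U1' else U2'"
  note pc = lab_sum_pieces[OF M U]
  note ch = lab_mfdD(2)[OF N] lab_mfdD(2)[OF N'] lab_mfdD(2)[OF M(1)] lab_mfdD(2)[OF M(2)]
  obtain F where F: "\<And>b x. x \<in> mspace (?Mb b) \<Longrightarrow> F (?f b x) = ?f' b x"
    using pieces_fun_exists[OF pc, of ?f'] by (metis UNIV_I)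
  have fb: "lab_diffeo G \<pi> (?Mb b) N (if b then U1 else U2) (?f b)" for b using U(5,6) by simp
  have fb': "lab_diffeo G \<pi> (?Mb b) N' (?U' b) (?f' b)" for b using f' by simp
  have el: "\<exists>b x. x \<in> mspace (?Mb b) \<and> y = ?f b x" if "y \<in> mspace N" for y
    using pieces_cases[OF pc that] by metis
  have "diffeo N (mspace N) N' (U1' \<union> U2') F"
  proof (rule diffeo_glue[OF ch(1,2)])
    have im: "F ` (?f b ` mspace (?Mb b)) = ?U' b" for b
      using F diffeoD(3)[OF lab_diffeoD(1)[OF fb'[of b]]] by (simp add: image_image cong: image_cong)
    have sp: "mspace N = ?f True ` mspace (?Mb True) \<union> ?f False ` mspace (?Mb False)"
      using U(3) diffeoD(3)[OF lab_diffeoD(1)[OF U(5)]] diffeoD(3)[OF lab_diffeoD(1)[OF U(6)]] by simp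
    have "F ` mspace N = U1' \<union> U2'"
      unfolding sp image_Un im by simp
    moreover have "inj_on F (mspace N)"
    proof (rule inj_onI)
      fix y z assume yz: "y \<in> mspace N" "z \<in> mspace N" "F y = F z"
      obtain b x b' x' where x: "x \<in> mspace (?Mb b)" "y = ?f b x" "x' \<in> mspace (?Mb b')" "z = ?f b' x'"
        using el yz by metis
      then have eq: "?f' b x = ?f' b' x'" using F yz(3) by metis
      moreover have "?f' b x \<in> ?U' b" "?f' b' x' \<in> ?U' b'"
        using diffeoD(3)[OF lab_diffeoD(1)[OF fb']] x by blast+
      ultimately have "b = b'" using U'(3) by (cases b; cases b') auto
      then have "x = x'" using eq x diffeoD(2)[OF lab_diffeoD(1)[OF fb'[of b]]] by (auto dest: inj_onD)
      then show "y = z" using x \<open>b = b'\<close> by simp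
    qed
    ultimately show "bij_betw F (mspace N) (U1' \<union> U2')" by (simp add: bij_betw_def)
    show "U1' \<union> U2' \<subseteq> mspace N'" using U' openin_subset by blast
    fix y assume "y \<in> mspace N"
    then obtain b x where x: "x \<in> mspace (?Mb b)" "y = ?f b x" using el by blast
    let ?T = "if b then U1 else U2"
    have cb: "charted (?Mb b)" using ch by simp
    note fd = diffeoD[OF lab_diffeoD(1)[OF fb[of b]]]
    have "diffeo N ?T N' (?U' b) (\<lambda>y. ?f' b (inv_into (mspace (?Mb b)) (?f b) y))"
      by (rule diffeo_compose[OF ch(1) cb ch(2) diffeo_inv[OF cb lab_diffeoD(1)[OF fb[of b]]] lab_diffeoD(1)[OF fb'[of b]]])
    then have d: "diffeo N ?T N' (?U' b) F"
    proof (rule diffeo_cong[OF ch(1,2)])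
      fix z assume "z \<in> ?T"
      then show "?f' b (inv_into (mspace (?Mb b)) (?f b) z) = F z"
        using F[OF fd(10), of z] fd(9)[of z] by simp
    qed
    have "mspace N \<inter> ?T = ?T" using U(3) by auto
    moreover have "(U1' \<union> U2') \<inter> ?U' b = ?U' b" by auto
    moreover have "y \<in> ?T" "F y \<in> ?U' b"
      using fd(3) x diffeoD(3)[OF d] by blast+
    ultimately show "\<exists>T R. openin (mtop N) T \<and> openin (mtop N') R \<and> y \<in> T \<and> F y \<in> R \<and> diffeo N (mspace N \<inter> T) N' ((U1' \<union> U2') \<inter> R) F"
      using d U(1,2) U'(1,2) by (intro exI[of _ ?T] exI[of _ "?U' b"]) auto
  qed simp
  then have "lab_diffeo G \<pi> N N' (U1' \<union> U2') F"
  proof (rule lab_diffeoI[OF lab_mfdD(1)[OF N]])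
    fix y assume "y \<in> mspace N"
    then obtain b x where x: "x \<in> mspace (?Mb b)" "y = ?f b x" using el by blast
    show "\<pi> (F y) = \<pi> y"
      using F[OF x(1)] lab_diffeoD(3)[OF fb' x(1)] lab_diffeoD(3)[OF fb x(1)] x(2) by simp
    fix g assume g: "g \<in> carrier G"
    have "lab_mfd n G X \<pi> (?Mb b)" using M by simp
    then have gx: "mact (?Mb b) g x \<in> mspace (?Mb b)" by (rule G_manifoldD(6)[OF lab_mfdD(1) g x(1)])
    have "F (mact N g y) = F (?f b (mact (?Mb b) g x))" using lab_diffeoD(2)[OF fb g x(1)] x(2) by simp
    also have "\<dots> = mact N' g (?f' b x)" using F[OF gx] lab_diffeoD(2)[OF fb' g x(1)] by simp
    also have "\<dots> = mact N' g (F y)" using F[OF x(1)] x(2) by simp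
    finally show "F (mact N g y) = mact N' g (F y)" .
  qed
  then show ?thesis by blast
qed

lemma lab_sum_unique:
  assumes "lab_mfd n G X \<pi> M1" "lab_mfd n G X \<pi> M2" "lab_mfd n G X \<pi> N" "lab_mfd n G X \<pi> N'"
    "lab_sum G \<pi> M1 M2 N" "lab_sum G \<pi> M1 M2 N'"
  shows "lab_iso G \<pi> N N'"
proof -
  obtain U1 U2 f1 f2 where "openin (mtop N') U1" "openin (mtop N') U2" "U1 \<union> U2 = mspace N'" "U1 \<inter> U2 = {}"
    "lab_diffeo G \<pi> M1 N' U1 f1" "lab_diffeo G \<pi> M2 N' U2 f2" using assms(6) unfolding lab_sum_def by blast
  then show ?thesis using lab_sum_map[OF assms(1-5)] unfolding lab_iso_def by metis
qed

lemma lab_sum_sym: "lab_sum G \<pi> M1 M2 N \<Longrightarrow> lab_sum G \<pi> M2 M1 N"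
  unfolding lab_sum_def by (metis Int_commute Un_commute)

lemma lab_sum_iso_left:
  assumes "lab_mfd n G X \<pi> M1" "lab_mfd n G X \<pi> M1'" "lab_mfd n G X \<pi> N"
    "lab_sum G \<pi> M1 M2 N" "lab_iso G \<pi> M1 M1'"
  shows "lab_sum G \<pi> M1' M2 N"
proof -
  obtain k where "lab_diffeo G \<pi> M1' M1 (mspace M1) k"
    using lab_iso_sym[OF assms(1,2,5)] unfolding lab_iso_def by blast
  then show ?thesis
    using assms(4) lab_diffeo_compose[OF assms(2,1,3)] unfolding lab_sum_def by meson
qed

lemma lab_sum_iso_right:
  assumes "lab_mfd n G X \<pi> M1" "lab_mfd n G X \<pi> M2" "lab_mfd n G X \<pi> N" "lab_mfd n G X \<pi> N'"
    "lab_sum G \<pi> M1 M2 N" "lab_iso G \<pi> N N'"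
  shows "lab_sum G \<pi> M1 M2 N'"
proof -
  obtain k where k: "lab_diffeo G \<pi> N N' (mspace N') k" using assms(6) unfolding lab_iso_def by blast
  note kd = diffeoD[OF lab_diffeoD(1)[OF k]]
  obtain U1 U2 f1 f2 where U: "openin (mtop N) U1" "openin (mtop N) U2" "U1 \<union> U2 = mspace N" "U1 \<inter> U2 = {}"
    "lab_diffeo G \<pi> M1 N U1 f1" "lab_diffeo G \<pi> M2 N U2 f2" using assms(5) unfolding lab_sum_def by blast
  have sub: "U1 \<subseteq> mspace N" "U2 \<subseteq> mspace N" using U(3) by auto
  have "openin (mtop N') (k ` U1)" "openin (mtop N') (k ` U2)"
    using diffeo_open_image[OF lab_diffeoD(1)[OF k] openin_topspace] U(1,2) sub by auto
  moreover have "k ` U1 \<union> k ` U2 = mspace N'" using kd(3) U(3) by (simp add: image_Un[symmetric])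
  moreover have "k ` U1 \<inter> k ` U2 = {}"
    using inj_on_image_Int[OF kd(2) sub] U(4) by simp
  ultimately show ?thesis unfolding lab_sum_def
    using lab_diffeo_sub[OF assms(1,3,4) U(5) k] lab_diffeo_sub[OF assms(2,3,4) U(6) k] by blast
qed

text \<open>The images of \<open>M2\<close> and \<open>M3\<close> in \<open>L\<close> are disjoint
  and open, so \<open>lab_sum_map\<close> embeds \<open>N'\<close> onto their union, which is the
  complement of the image of \<open>M1\<close>.\<close>

lemma lab_sum_assoc:
  assumes M: "lab_mfd n G X \<pi> M1" "lab_mfd n G X \<pi> M2" "lab_mfd n G X \<pi> M3"
    and N: "lab_mfd n G X \<pi> N" "lab_mfd n G X \<pi> N'" "lab_mfd n G X \<pi> L"
    and sum: "lab_sum G \<pi> M1 M2 N" "lab_sum G \<pi> N M3 L" "lab_sum G \<pi> M2 M3 N'"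
  shows "lab_sum G \<pi> M1 N' L"
proof -
  obtain U1 U2 f1 f2 where U: "openin (mtop N) U1" "openin (mtop N) U2" "U1 \<union> U2 = mspace N" "U1 \<inter> U2 = {}"
    "lab_diffeo G \<pi> M1 N U1 f1" "lab_diffeo G \<pi> M2 N U2 f2" using sum(1) unfolding lab_sum_def by blast
  obtain V W g h where V: "openin (mtop L) V" "openin (mtop L) W" "V \<union> W = mspace L" "V \<inter> W = {}"
    "lab_diffeo G \<pi> N L V g" "lab_diffeo G \<pi> M3 L W h" using sum(2) unfolding lab_sum_def by blast
  note gd = diffeoD[OF lab_diffeoD(1)[OF V(5)]]
  have sub: "U1 \<subseteq> mspace N" "U2 \<subseteq> mspace N" using U(3) by auto
  have o: "openin (mtop L) (g ` U1)" "openin (mtop L) (g ` U2)"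
    using diffeo_open_image[OF lab_diffeoD(1)[OF V(5)] V(1)] U(1,2) sub by auto
  have un: "g ` U1 \<union> g ` U2 = V" using gd(3) U(3) by (simp add: image_Un[symmetric])
  have dj: "g ` U1 \<inter> g ` U2 = {}" using inj_on_image_Int[OF gd(2) sub] U(4) by simp
  have "g ` U2 \<inter> W = {}" using un V(4) by blast
  from lab_sum_map[OF M(2,3) N(2,3) sum(3) lab_diffeo_sub[OF M(2) N(1,3) U(6) V(5)] V(6) o(2) V(2) this]
  obtain F where "lab_diffeo G \<pi> N' L (g ` U2 \<union> W) F" by blast
  moreover have "lab_diffeo G \<pi> M1 L (g ` U1) (\<lambda>x. g (f1 x))" by (rule lab_diffeo_sub[OF M(1) N(1,3) U(5) V(5)])
  moreover have "openin (mtop L) (g ` U2 \<union> W)" using o V(2) by blast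
  moreover have "g ` U1 \<union> (g ` U2 \<union> W) = mspace L" using un V(3) by blast
  moreover have "g ` U1 \<inter> (g ` U2 \<union> W) = {}" using un dj V(4) by blast
  ultimately show ?thesis unfolding lab_sum_def using o(1) by blast
qed

text \<open>The constant \<open>undefined\<close> is the only extensional map on the empty set, so
  it is the action.\<close>

definition empty_mfd :: "nat \<Rightarrow> ('a, 'g) gmfd" where
  "empty_mfd n = \<lparr>mtop = discrete_topology {}, matlas = {}, mdim = n, mact = (\<lambda>_ _. undefined)\<rparr>"

lemma lab_mfd_empty: "group G \<Longrightarrow> lab_mfd n G X \<pi> (empty_mfd n)"
  unfolding lab_mfd_def G_manifold_def smooth_manifold_def empty_mfd_def
  by (auto simp: second_countable_def Hausdorff_space_def compact_space_def smooth_map_def continuous_map_def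
      intro!: group_actionI exI[of _ "{}"] simp del: Hausdorff_space_discrete_topology)

lemma diffeo_empty: "charted N \<Longrightarrow> diffeo M {} N {} f"
  by (rule diffeoI) (auto intro!: smooth_mapI simp: continuous_map_def smooth_vec_def smooth_coord_def)

lemma lab_sum_empty:
  assumes "lab_mfd n G X \<pi> M" "lab_mfd n G X \<pi> E" "mspace E = {}" shows "lab_sum G \<pi> E M M"
proof -
  have "lab_diffeo G \<pi> E M {} (\<lambda>x. x)"
    by (rule lab_diffeoI[OF lab_mfdD(1)[OF assms(2)]]) (use assms(3) diffeo_empty[OF lab_mfdD(2)[OF assms(1)]] in auto)
  moreover have "lab_diffeo G \<pi> M M (mspace M) (\<lambda>x. x)"
    by (rule lab_diffeoI[OF lab_mfdD(1)[OF assms(1)]]) (use diffeo_id[OF lab_mfdD(2)[OF assms(1)]] in auto)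
  ultimately show ?thesis unfolding lab_sum_def
    by (intro exI[of _ "{}"] exI[of _ "mspace M"] exI[of _ "\<lambda>x. x"]) simp
qed

lemma lab_iso_empty:
  assumes "lab_mfd n G X \<pi> M" "lab_mfd n G X \<pi> E" "mspace E = {}"
  shows "lab_iso G \<pi> E M \<longleftrightarrow> mspace M = {}"
proof
  assume "lab_iso G \<pi> E M"
  then obtain f where "diffeo E (mspace E) M (mspace M) f" unfolding lab_iso_def lab_diffeo_def G_diffeo_def by blast
  then show "mspace M = {}" using diffeoD(3) assms(3) by fastforce
next
  assume M: "mspace M = {}"
  have "lab_diffeo G \<pi> E M (mspace M) (\<lambda>x. x)"
    by (rule lab_diffeoI[OF lab_mfdD(1)[OF assms(2)]]) (use M assms(3) diffeo_empty[OF lab_mfdD(2)[OF assms(1)]] in auto)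
  then show "lab_iso G \<pi> E M" unfolding lab_iso_def by blast
qed

section \<open>Transport along correspondences\<close>

text \<open>
  A correspondence from G-manifolds over X to H-manifolds over Y is a finite H-set P with maps
  f and q to X and Y, where f is equivariant along the cocycle c. It sends M to the disjoint union
  of the fibres of M over f p, for p in P. Restriction, induction, conjugation, passage to a fibre
  over an orbit and the action of a span are all of this form.
\<close>

definition corresp ::
  "('g, 'b) monoid_scheme \<Rightarrow> ('g, 'x) gset \<Rightarrow> ('h, 'c) monoid_scheme \<Rightarrow> ('h, 'y) gset \<Rightarrow> 'p set \<Rightarrow>
   ('h \<Rightarrow> 'p \<Rightarrow> 'p) \<Rightarrow> ('h \<Rightarrow> 'p \<Rightarrow> 'g) \<Rightarrow> ('p \<Rightarrow> 'x) \<Rightarrow> ('p \<Rightarrow> 'y) \<Rightarrow> bool" where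
  "corresp G X H Y P a c f q \<longleftrightarrow> group H \<and> finite P \<and> (\<forall>p\<in>P. q p \<in> pts Y \<and> a \<one>\<^bsub>H\<^esub> p = p \<and> c \<one>\<^bsub>H\<^esub> p = \<one>\<^bsub>G\<^esub>) \<and>
     (\<forall>h\<in>carrier H. \<forall>p\<in>P. a h p \<in> P \<and> c h p \<in> carrier G \<and> f (a h p) = gact X (c h p) (f p) \<and>
        q (a h p) = gact Y h (q p)) \<and>
     (\<forall>h\<in>carrier H. \<forall>h'\<in>carrier H. \<forall>p\<in>P. a (h \<otimes>\<^bsub>H\<^esub> h') p = a h (a h' p) \<and>
        c (h \<otimes>\<^bsub>H\<^esub> h') p = c h (a h' p) \<otimes>\<^bsub>G\<^esub> c h' p)"

lemma correspD:
  assumes "corresp G X H Y P a c f q"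
  shows "group H" "finite P" "\<And>p. p \<in> P \<Longrightarrow> q p \<in> pts Y" "\<And>p. p \<in> P \<Longrightarrow> a \<one>\<^bsub>H\<^esub> p = p"
    "\<And>p. p \<in> P \<Longrightarrow> c \<one>\<^bsub>H\<^esub> p = \<one>\<^bsub>G\<^esub>"
    "\<And>h p. h \<in> carrier H \<Longrightarrow> p \<in> P \<Longrightarrow> a h p \<in> P"
    "\<And>h p. h \<in> carrier H \<Longrightarrow> p \<in> P \<Longrightarrow> c h p \<in> carrier G"
    "\<And>h p. h \<in> carrier H \<Longrightarrow> p \<in> P \<Longrightarrow> f (a h p) = gact X (c h p) (f p)"
    "\<And>h p. h \<in> carrier H \<Longrightarrow> p \<in> P \<Longrightarrow> q (a h p) = gact Y h (q p)"
    "\<And>h h' p. h \<in> carrier H \<Longrightarrow> h' \<in> carrier H \<Longrightarrow> p \<in> P \<Longrightarrow> a (h \<otimes>\<^bsub>H\<^esub> h') p = a h (a h' p)"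
    "\<And>h h' p. h \<in> carrier H \<Longrightarrow> h' \<in> carrier H \<Longrightarrow> p \<in> P \<Longrightarrow> c (h \<otimes>\<^bsub>H\<^esub> h') p = c h (a h' p) \<otimes>\<^bsub>G\<^esub> c h' p"
  using assms unfolding corresp_def by auto

text \<open>A relation instead of a function, since disjoint unions are determined only up to
  diffeomorphism. The maps \<open>j\<close> record how the fibres sit in \<open>N\<close>, which is
  what makes transports comparable and composable.\<close>

definition transported ::
  "('h, 'c) monoid_scheme \<Rightarrow> 'p set \<Rightarrow> ('h \<Rightarrow> 'p \<Rightarrow> 'p) \<Rightarrow> ('h \<Rightarrow> 'p \<Rightarrow> 'g) \<Rightarrow> ('p \<Rightarrow> 'x) \<Rightarrow> ('p \<Rightarrow> 'y) \<Rightarrow>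
   ('a \<Rightarrow> 'x) \<Rightarrow> ('b \<Rightarrow> 'y) \<Rightarrow> ('a, 'g) gmfd \<Rightarrow> ('b, 'h) gmfd \<Rightarrow> ('p \<Rightarrow> 'a \<Rightarrow> 'b) \<Rightarrow> bool" where
  "transported H P a c f q \<pi> \<rho> M N j \<longleftrightarrow> pieces N P (\<lambda>_. M) (\<lambda>p. fibre \<pi> M (f p)) j \<and>
     (\<forall>p\<in>P. \<forall>x\<in>fibre \<pi> M (f p). \<rho> (j p x) = q p \<and>
        (\<forall>h\<in>carrier H. mact N h (j p x) = j (a h p) (mact M (c h p) x)))"

lemma transportedD:
  assumes "transported H P a c f q \<pi> \<rho> M N j"
  shows "pieces N P (\<lambda>_. M) (\<lambda>p. fibre \<pi> M (f p)) j"
    "\<And>p x. p \<in> P \<Longrightarrow> x \<in> mspace M \<Longrightarrow> \<pi> x = f p \<Longrightarrow> \<rho> (j p x) = q p"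
    "\<And>h p x. h \<in> carrier H \<Longrightarrow> p \<in> P \<Longrightarrow> x \<in> mspace M \<Longrightarrow> \<pi> x = f p \<Longrightarrow>
       mact N h (j p x) = j (a h p) (mact M (c h p) x)"
    "\<And>p x. p \<in> P \<Longrightarrow> x \<in> mspace M \<Longrightarrow> \<pi> x = f p \<Longrightarrow> j p x \<in> mspace N"
proof -
  show 1: "pieces N P (\<lambda>_. M) (\<lambda>p. fibre \<pi> M (f p)) j"
    "\<And>p x. p \<in> P \<Longrightarrow> x \<in> mspace M \<Longrightarrow> \<pi> x = f p \<Longrightarrow> \<rho> (j p x) = q p"
    "\<And>h p x. h \<in> carrier H \<Longrightarrow> p \<in> P \<Longrightarrow> x \<in> mspace M \<Longrightarrow> \<pi> x = f p \<Longrightarrow>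
       mact N h (j p x) = j (a h p) (mact M (c h p) x)"
    using assms unfolding transported_def by auto
  show "j p x \<in> mspace N" if "p \<in> P" "x \<in> mspace M" "\<pi> x = f p" for p x
    using piecesD(6)[OF 1(1), of p x] that by simp
qed

lemma transported_cases:
  assumes "transported H P a c f q \<pi> \<rho> M N j" "y \<in> mspace N"
  obtains p x where "p \<in> P" "x \<in> mspace M" "\<pi> x = f p" "y = j p x"
proof (rule pieces_cases[OF transportedD(1)[OF assms(1)] assms(2)])
  fix p x assume "p \<in> P" "x \<in> fibre \<pi> M (f p)" "y = j p x"
  then show thesis using that[of p x] by simp
qed

lemma corresp_fibre:
  assumes "corresp G X H Y P a c f q" "lab_mfd n G X \<pi> M" "h \<in> carrier H" "p \<in> P" "x \<in> mspace M" "\<pi> x = f p"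
  shows "mact M (c h p) x \<in> mspace M" "\<pi> (mact M (c h p) x) = f (a h p)"
  using correspD(7,8)[OF assms(1,3,4)] lab_mfdD(4)[OF assms(2,5)] assms(6)
    G_manifoldD(6)[OF lab_mfdD(1)[OF assms(2)] _ assms(5)] by auto

text \<open>Room for disjoint unions inside the reals: the real number is a point of a summand, the
  natural number is the number of the summand, and every label must have such a copy at its
  disposal.\<close>

definition ample :: "('h, 'y) gset \<Rightarrow> (real \<Rightarrow> 'y) \<Rightarrow> bool" where
  "ample Y \<rho> \<longleftrightarrow> (\<forall>y\<in>pts Y. \<exists>\<iota> :: real \<times> nat \<Rightarrow> real. inj \<iota> \<and> (\<forall>z. \<rho> (\<iota> z) = y))"

lemma transported_id:
  assumes M: "lab_mfd n G X \<pi> M"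
  shows "transported G (pts X) (gact X) (\<lambda>g _. g) (\<lambda>x. x) (\<lambda>x. x) \<pi> \<pi> M M (\<lambda>_ x. x)"
proof -
  have "(\<Union>p\<in>pts X. (\<lambda>x. x) ` fibre \<pi> M p) = mspace M" using lab_mfdD(3)[OF M] by auto
  then show ?thesis unfolding transported_def pieces_def
    using lab_mfdD(2,5)[OF M] diffeo_id[OF lab_mfdD(2)[OF M]] by auto
qed

text \<open>The common source of transports and of binary sums: the action \<open>a\<close> on
  indices is covered by maps \<open>\<alpha>\<close> between the parts, and these assemble to an
  action on the sum.\<close>

lemma family_sum_exists:
  fixes M :: "'p \<Rightarrow> (real, 'g) gmfd" and Y :: "('h, 'y) gset"
  assumes H: "group H" and finP: "finite P"
    and M: "\<And>p. p \<in> P \<Longrightarrow> smooth_manifold (M p)" "\<And>p. p \<in> P \<Longrightarrow> mdim (M p) = n"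
    and A: "\<And>p. p \<in> P \<Longrightarrow> openin (mtop (M p)) (A p)" "\<And>p. p \<in> P \<Longrightarrow> compactin (mtop (M p)) (A p)"
    and a: "\<And>h p. h \<in> carrier H \<Longrightarrow> p \<in> P \<Longrightarrow> a h p \<in> P" "\<And>p. p \<in> P \<Longrightarrow> a \<one>\<^bsub>H\<^esub> p = p"
      "\<And>h h' p. h \<in> carrier H \<Longrightarrow> h' \<in> carrier H \<Longrightarrow> p \<in> P \<Longrightarrow> a (h \<otimes>\<^bsub>H\<^esub> h') p = a h (a h' p)"
    and \<alpha>: "\<And>h p. h \<in> carrier H \<Longrightarrow> p \<in> P \<Longrightarrow> smooth_map (M p) (A p) (M (a h p)) (\<alpha> h p)"
      "\<And>h p x. h \<in> carrier H \<Longrightarrow> p \<in> P \<Longrightarrow> x \<in> A p \<Longrightarrow> \<alpha> h p x \<in> A (a h p)"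
      "\<And>p x. p \<in> P \<Longrightarrow> x \<in> A p \<Longrightarrow> \<alpha> \<one>\<^bsub>H\<^esub> p x = x"
      "\<And>h h' p x. h \<in> carrier H \<Longrightarrow> h' \<in> carrier H \<Longrightarrow> p \<in> P \<Longrightarrow> x \<in> A p \<Longrightarrow>
         \<alpha> (h \<otimes>\<^bsub>H\<^esub> h') p x = \<alpha> h (a h' p) (\<alpha> h' p x)"
    and q: "\<And>p. p \<in> P \<Longrightarrow> q p \<in> pts Y" "\<And>h p. h \<in> carrier H \<Longrightarrow> p \<in> P \<Longrightarrow> q (a h p) = gact Y h (q p)"
    and \<rho>: "ample Y \<rho>"
  shows "\<exists>N j. lab_mfd n H Y \<rho> N \<and> pieces N P M A j \<and>
    (\<forall>p\<in>P. \<forall>x\<in>A p. \<rho> (j p x) = q p \<and> (\<forall>h\<in>carrier H. mact N h (j p x) = j (a h p) (\<alpha> h p x))) \<and>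
    mboundary N = (\<Union>p\<in>P. j p ` (mboundary (M p) \<inter> A p))"
proof -
  obtain \<iota> :: "'y \<Rightarrow> real \<times> nat \<Rightarrow> real" where \<iota>: "\<And>y. y \<in> pts Y \<Longrightarrow> inj (\<iota> y)" "\<And>y z. y \<in> pts Y \<Longrightarrow> \<rho> (\<iota> y z) = y"
    using \<rho> unfolding ample_def by metis
  \<comment> \<open>The piece is placed in the copy reserved for its label \<open>q p\<close>; the
    number of \<open>p\<close> separates pieces that share a label.\<close>
  define E where "E p x = \<iota> (q p) (x, to_nat_on P p)" for p x
  have E_lab: "\<rho> (E p x) = q p" if "p \<in> P" for p x unfolding E_def using \<iota>(2) q(1) that by blast
  have E_inj: "p = p' \<and> x = x'" if "p \<in> P" "p' \<in> P" "E p x = E p' x'" for p p' x x'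
  proof -
    have qq: "q p = q p'" using E_lab that by metis
    then have "\<iota> (q p) (x, to_nat_on P p) = \<iota> (q p) (x', to_nat_on P p')" using that(3) by (simp add: E_def)
    then have "(x, to_nat_on P p) = (x', to_nat_on P p')" using \<iota>(1)[OF q(1)[OF that(1)]] by (simp add: inj_eq)
    then show ?thesis
      using inj_on_to_nat_on[OF countable_finite[OF finP]] that by (auto dest: inj_onD)
  qed
  interpret S: manifold_sum P M A E n
    by (rule manifold_sum.intro[OF finP M A E_inj])
  have Mc: "charted (M p)" if "p \<in> P" for p using smooth_manifold_charted[OF M(1)[OF that]] .
  \<comment> \<open>The action is to be defined piece by piece, which needs \<open>pieces\<close>
    for a record whose action is still a dummy.\<close>
  define N0 :: "(real, 'h) gmfd" where
    "N0 = \<lparr>mtop = S.sum_top, matlas = S.sum_atlas, mdim = n, mact = (\<lambda>_ _. undefined)\<rparr>"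
  have pc0: "pieces N0 P M A E" by (rule S.pieces_sum) (simp_all add: N0_def)
  have "\<exists>F. (\<forall>p\<in>P. \<forall>x\<in>A p. F (E p x) = E (a h p) (\<alpha> h p x)) \<and> F \<in> extensional (mspace N0)" for h
    by (rule pieces_fun_exists[OF pc0, of "\<lambda>p x. E (a h p) (\<alpha> h p x)"]) blast
  then obtain F where F: "\<And>h p x. p \<in> P \<Longrightarrow> x \<in> A p \<Longrightarrow> F h (E p x) = E (a h p) (\<alpha> h p x)"
    "\<And>h. F h \<in> extensional (mspace N0)" by metis
  define N where "N = \<lparr>mtop = S.sum_top, matlas = S.sum_atlas, mdim = n, mact = F\<rparr>"
  have N: "mtop N = S.sum_top" "matlas N = S.sum_atlas" "mdim N = n" "mact N = F" by (simp_all add: N_def)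
  have pc: "pieces N P M A E" by (rule S.pieces_sum[OF N(1-3)])
  have sm: "smooth_manifold N" by (rule S.smooth_manifold_sum[OF N(1-3)])
  note jN = piecesD(6)[OF pc]
  have "group_action H (mspace N) F"
  proof (rule group_actionI[OF H])
    show "\<And>h. F h \<in> extensional (mspace N)" using F(2) by (simp add: N0_def N_def)
    show "F h y \<in> mspace N" if h: "h \<in> carrier H" and y: "y \<in> mspace N" for h y
      using y
    proof (rule pieces_cases[OF pc])
      fix p x assume p: "p \<in> P" "x \<in> A p" "y = E p x"
      then show ?thesis using jN[OF a(1)[OF h p(1)] \<alpha>(2)[OF h p(1,2)]] F(1)[OF p(1,2)] by simp
    qed
    show "F \<one>\<^bsub>H\<^esub> y = y" if y: "y \<in> mspace N" for y
      using y
    proof (rule pieces_cases[OF pc])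
      fix p x assume p: "p \<in> P" "x \<in> A p" "y = E p x"
      then show ?thesis using F(1)[OF p(1,2)] a(2)[OF p(1)] \<alpha>(3)[OF p(1,2)] by simp
    qed
    show "F (h \<otimes>\<^bsub>H\<^esub> h') y = F h (F h' y)" if h: "h \<in> carrier H" "h' \<in> carrier H" and y: "y \<in> mspace N" for h h' y
      using y
    proof (rule pieces_cases[OF pc])
      fix p x assume p: "p \<in> P" "x \<in> A p" "y = E p x"
      have "F h (F h' y) = F h (E (a h' p) (\<alpha> h' p x))" using F(1)[OF p(1,2)] p(3) by simp
      also have "\<dots> = E (a h (a h' p)) (\<alpha> h (a h' p) (\<alpha> h' p x))"
        using F(1)[OF a(1)[OF h(2) p(1)] \<alpha>(2)[OF h(2) p(1,2)]] .
      also have "\<dots> = F (h \<otimes>\<^bsub>H\<^esub> h') y" using F(1)[OF p(1,2)] p(3) a(3)[OF h p(1)] \<alpha>(4)[OF h p(1,2)] by simp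
      finally show ?thesis by simp
    qed
  qed
  moreover have "smooth_map N (mspace N) N (F h)" if h: "h \<in> carrier H" for h
  proof -
    have "smooth_map N (\<Union>p\<in>P. E p ` A p) N (F h)"
    proof (rule pieces_smooth_map[OF pc smooth_manifold_charted[OF sm] subset_refl])
      fix p assume p: "p \<in> P"
      have "smooth_map (M p) (A p) N (\<lambda>x. E (a h p) (\<alpha> h p x))"
        by (rule smooth_map_compose[OF Mc[OF p] Mc[OF a(1)[OF h p]] \<alpha>(1)[OF h p]
              diffeoD(4)[OF piecesD(4)[OF pc a(1)[OF h p]]]]) (use \<alpha>(2)[OF h p] in blast)
      then show "smooth_map (M p) (A p) N (\<lambda>x. F h (E p x))"
        by (rule smooth_map_cong[OF _ Mc[OF p]]) (use F(1)[OF p] in auto)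
    qed
    then show ?thesis using pc unfolding pieces_def by simp
  qed
  ultimately have GN: "G_manifold n H N"
    unfolding G_manifold_def using sm S.compact_sum_top by (simp add: N)
  have lab: "lab_mfd n H Y \<rho> N" unfolding lab_mfd_def
  proof (intro conjI ballI)
    fix y assume y: "y \<in> mspace N"
    then show "\<rho> y \<in> pts Y"
      by (rule pieces_cases[OF pc]) (use E_lab q(1) in auto)
    fix h assume h: "h \<in> carrier H"
    show "\<rho> (mact N h y) = gact Y h (\<rho> y)" using y
    proof (rule pieces_cases[OF pc])
      fix p x assume p: "p \<in> P" "x \<in> A p" "y = E p x"
      then show ?thesis using F(1)[OF p(1,2)] E_lab[OF p(1)] E_lab[OF a(1)[OF h p(1)]] q(2)[OF h p(1)] by (simp add: N(4))
    qed
  next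
    fix z assume "z \<in> pts Y"
    have "fibre \<rho> N z = (\<Union>p\<in>{p \<in> P. q p = z}. E p ` A p)" (is "_ = ?R")
    proof
      show "fibre \<rho> N z \<subseteq> ?R"
      proof
        fix y assume y: "y \<in> fibre \<rho> N z"
        then have "y \<in> mspace N" by simp
        then show "y \<in> ?R"
        proof (rule pieces_cases[OF pc])
          fix p x assume p: "p \<in> P" "x \<in> A p" "y = E p x"
          then have "q p = z" using E_lab[OF p(1)] y by simp
          then show ?thesis unfolding p(3) using p(1,2) by (intro UN_I[of p] imageI) auto
        qed
      qed
      show "?R \<subseteq> fibre \<rho> N z" using E_lab jN by auto
    qed
    moreover have "openin (mtop N) ?R" using piecesD(3)[OF pc] by (intro openin_Union) auto
    ultimately show "openin (mtop N) (fibre \<rho> N z)" by simp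
  qed (rule GN)
  have "\<forall>p\<in>P. \<forall>x\<in>A p. \<rho> (E p x) = q p \<and> (\<forall>h\<in>carrier H. mact N h (E p x) = E (a h p) (\<alpha> h p x))"
    using E_lab F(1) by (simp add: N(4))
  then show ?thesis using lab pc S.mboundary_sum[OF N(1-3)] by blast
qed

text \<open>The constant family \<open>M\<close>, cut down to the fibre over \<open>f p\<close> at
  index \<open>p\<close>. The cocycle identity for \<open>c\<close> is precisely the
  multiplicativity required of the maps between the parts.\<close>

lemma transported_exists:
  fixes M :: "(real, 'g) gmfd" and Y :: "('h, 'y) gset"
  assumes C: "corresp G X H Y P a c f q" and M: "lab_mfd n G X \<pi> M" and \<rho>: "ample Y \<rho>"
  shows "\<exists>N j. lab_mfd n H Y \<rho> N \<and> transported H P a c f q \<pi> \<rho> M N j \<and>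
    mboundary N = (\<Union>p\<in>P. j p ` (mboundary M \<inter> fibre \<pi> M (f p)))"
  unfolding transported_def conj_assoc
proof (rule family_sum_exists[where a = a and \<alpha> = "\<lambda>h p. mact M (c h p)"])
  note C' = correspD[OF C] and M' = lab_mfdD[OF M] and G' = G_manifoldD[OF lab_mfdD(1)[OF M]]
  fix h p assume h: "h \<in> carrier H" and p: "p \<in> P"
  show "smooth_map M (fibre \<pi> M (f p)) M (mact M (c h p))"
    by (rule smooth_map_subset[OF G'(11)[OF C'(7)[OF h p]]]) blast
  show "\<And>x. x \<in> fibre \<pi> M (f p) \<Longrightarrow> mact M (c h p) x \<in> fibre \<pi> M (f (a h p))"
    using corresp_fibre[OF C M h p] by simp
  fix h' x assume h': "h' \<in> carrier H" and x: "x \<in> fibre \<pi> M (f p)"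
  show "mact M (c (h \<otimes>\<^bsub>H\<^esub> h') p) x = mact M (c h (a h' p)) (mact M (c h' p) x)"
    using C'(11)[OF h h' p] G'(8)[OF C'(7)[OF h C'(6)[OF h' p]] C'(7)[OF h' p]] x by simp
next
  note C' = correspD[OF C] and M' = lab_mfdD[OF M] and G' = G_manifoldD[OF lab_mfdD(1)[OF M]]
  show "smooth_manifold M" "mdim M = n" by (fact G'(1,4))+
  show "openin (mtop M) (fibre \<pi> M (f p))" "compactin (mtop M) (fibre \<pi> M (f p))" for p by (fact M'(5,6))+
  show "\<And>p x. p \<in> P \<Longrightarrow> x \<in> fibre \<pi> M (f p) \<Longrightarrow> mact M (c \<one>\<^bsub>H\<^esub> p) x = x" using C'(5) G'(7) by simp
qed (use correspD[OF C] \<rho> in auto)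

lemma finite_gsetD:
  assumes "finite_gset G X"
  shows "finite (pts X)" "group G" "\<And>g y. g \<in> carrier G \<Longrightarrow> y \<in> pts X \<Longrightarrow> gact X g y \<in> pts X"
    "\<And>y. y \<in> pts X \<Longrightarrow> gact X \<one>\<^bsub>G\<^esub> y = y"
    "\<And>g h y. g \<in> carrier G \<Longrightarrow> h \<in> carrier G \<Longrightarrow> y \<in> pts X \<Longrightarrow> gact X (g \<otimes>\<^bsub>G\<^esub> h) y = gact X g (gact X h y)"
    "\<And>g. g \<in> carrier G \<Longrightarrow> gact X g \<in> extensional (pts X)"
proof -
  show "finite (pts X)" using assms by (simp add: finite_gset_def)
  interpret group_action G "pts X" "gact X" using assms by (simp add: finite_gset_def)
  show "group G" using group_hom group_hom.axioms(1) by blast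
  show "gact X g y \<in> pts X" if "g \<in> carrier G" "y \<in> pts X" for g y using element_image[OF that] by simp
  show "gact X \<one>\<^bsub>G\<^esub> y = y" if "y \<in> pts X" for y using id_eq_one that by (metis restrict_apply')
  show "gact X (g \<otimes>\<^bsub>G\<^esub> h) y = gact X g (gact X h y)"
    if "g \<in> carrier G" "h \<in> carrier G" "y \<in> pts X" for g h y using composition_rule that by blast
  show "gact X g \<in> extensional (pts X)" if "g \<in> carrier G" for g using bij_prop0[OF that] by (simp add: Bij_def)
qed

text \<open>The index set is \<open>bool\<close> times \<open>pts X\<close>, because each part in
  \<open>family_sum_exists\<close> carries a single label; a summand reappears as the union of its
  fibres.\<close>

lemma lab_sum_exists:
  fixes M1 M2 :: "(real, 'g) gmfd"
  assumes X: "finite_gset G X" and \<pi>: "ample X \<pi>" and M: "lab_mfd n G X \<pi> M1" "lab_mfd n G X \<pi> M2"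
  shows "\<exists>N. lab_mfd n G X \<pi> N \<and> lab_sum G \<pi> M1 M2 N"
proof -
  define Mb where "Mb b = (if b then M1 else M2)" for b
  have Mb: "lab_mfd n G X \<pi> (Mb b)" for b using M by (simp add: Mb_def)
  note M' = lab_mfdD[OF Mb] and G' = G_manifoldD[OF lab_mfdD(1)[OF Mb]]
  note X' = finite_gsetD[OF X]
  let ?P = "(UNIV :: bool set) \<times> pts X" and ?a = "\<lambda>g (b, y). (b, gact X g y)"
  have "\<exists>N j. lab_mfd n G X \<pi> N \<and> pieces N ?P (\<lambda>p. Mb (fst p)) (\<lambda>p. fibre \<pi> (Mb (fst p)) (snd p)) j \<and>
    (\<forall>p\<in>?P. \<forall>x\<in>fibre \<pi> (Mb (fst p)) (snd p). \<pi> (j p x) = snd p \<and>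
      (\<forall>g\<in>carrier G. mact N g (j p x) = j (?a g p) (mact (Mb (fst p)) g x))) \<and>
    mboundary N = (\<Union>p\<in>?P. j p ` (mboundary (Mb (fst p)) \<inter> fibre \<pi> (Mb (fst p)) (snd p)))"
  proof (rule family_sum_exists[where \<alpha> = "\<lambda>g p. mact (Mb (fst p)) g"])
    show "group G" by (fact G'(5))
    show "finite ?P" using X'(1) by simp
    show "ample X \<pi>" by fact
    fix p assume p: "p \<in> ?P"
    obtain b y where pe: "p = (b, y)" by (cases p)
    show "smooth_manifold (Mb (fst p))" "mdim (Mb (fst p)) = n" by (fact G'(1,4))+
    show "openin (mtop (Mb (fst p))) (fibre \<pi> (Mb (fst p)) (snd p))"
      "compactin (mtop (Mb (fst p))) (fibre \<pi> (Mb (fst p)) (snd p))" by (fact M'(5,6))+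
    show "?a \<one>\<^bsub>G\<^esub> p = p" using p X'(4) by (auto simp: pe)
    show "snd p \<in> pts X" using p by auto
    show "\<And>x. x \<in> fibre \<pi> (Mb (fst p)) (snd p) \<Longrightarrow> mact (Mb (fst p)) \<one>\<^bsub>G\<^esub> x = x" using G'(7) by simp
    fix g assume g: "g \<in> carrier G"
    show "?a g p \<in> ?P" using p X'(3)[OF g] by (auto simp: pe)
    show "snd (?a g p) = gact X g (snd p)" by (simp add: pe)
    show "smooth_map (Mb (fst p)) (fibre \<pi> (Mb (fst p)) (snd p)) (Mb (fst (?a g p))) (mact (Mb (fst p)) g)"
      by (simp add: pe) (rule smooth_map_subset[OF G'(11)[OF g]], blast)
    show "\<And>x. x \<in> fibre \<pi> (Mb (fst p)) (snd p) \<Longrightarrow>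
        mact (Mb (fst p)) g x \<in> fibre \<pi> (Mb (fst (?a g p))) (snd (?a g p))"
      using M'(4)[OF _ g] G'(6)[OF g] by (simp add: pe)
    fix g' assume g': "g' \<in> carrier G"
    show "?a (g \<otimes>\<^bsub>G\<^esub> g') p = ?a g (?a g' p)" using p X'(5)[OF g g'] by (auto simp: pe)
    show "\<And>x. x \<in> fibre \<pi> (Mb (fst p)) (snd p) \<Longrightarrow>
        mact (Mb (fst p)) (g \<otimes>\<^bsub>G\<^esub> g') x = mact (Mb (fst (?a g' p))) g (mact (Mb (fst p)) g' x)"
      using G'(8)[OF g g'] by (simp add: pe)
  qed
  then obtain N j where N: "lab_mfd n G X \<pi> N"
    and pc: "pieces N ?P (\<lambda>p. Mb (fst p)) (\<lambda>p. fibre \<pi> (Mb (fst p)) (snd p)) j"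
    and j: "\<And>p x. p \<in> ?P \<Longrightarrow> x \<in> fibre \<pi> (Mb (fst p)) (snd p) \<Longrightarrow> \<pi> (j p x) = snd p"
      "\<And>p x g. p \<in> ?P \<Longrightarrow> x \<in> fibre \<pi> (Mb (fst p)) (snd p) \<Longrightarrow> g \<in> carrier G \<Longrightarrow>
        mact N g (j p x) = j (?a g p) (mact (Mb (fst p)) g x)" by blast
  let ?U = "\<lambda>b. \<Union>y\<in>pts X. j (b, y) ` fibre \<pi> (Mb b) y"
  have f: "lab_diffeo G \<pi> (Mb b) N (?U b) (\<lambda>x. j (b, \<pi> x) x)" for b
  proof (rule lab_diffeoI[OF lab_mfdD(1)[OF Mb]])
    have tr: "pieces (Mb b) (pts X) (\<lambda>_. Mb b) (\<lambda>y. fibre \<pi> (Mb b) y) (\<lambda>_ x. x)"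
      using transportedD(1)[OF transported_id[OF Mb[of b]]] .
    have "diffeo (Mb b) (\<Union>y\<in>pts X. (\<lambda>x. x) ` fibre \<pi> (Mb b) y) N (?U b) (\<lambda>x. j (b, \<pi> x) x)"
    proof (rule pieces_diffeo[OF tr M'(2) pc lab_mfdD(2)[OF N], where \<beta> = "\<lambda>y. (b, y)" and k = "\<lambda>_ x. x"])
      show "diffeo (Mb b) (fibre \<pi> (Mb b) y) (Mb (fst (b, y))) (fibre \<pi> (Mb b) y) (\<lambda>x. x)" for y
        using diffeo_id[OF M'(2)[of b], of "fibre \<pi> (Mb b) y"] by simp
    qed (auto simp: inj_on_def)
    moreover have "(\<Union>y\<in>pts X. (\<lambda>x. x) ` fibre \<pi> (Mb b) y) = mspace (Mb b)" using M'(3) by auto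
    ultimately show "diffeo (Mb b) (mspace (Mb b)) N (?U b) (\<lambda>x. j (b, \<pi> x) x)" by simp
    fix x assume x: "x \<in> mspace (Mb b)"
    then show "\<pi> (j (b, \<pi> x) x) = \<pi> x" using j(1)[of "(b, \<pi> x)" x] M'(3) by simp
    fix g assume g: "g \<in> carrier G"
    show "j (b, \<pi> (mact (Mb b) g x)) (mact (Mb b) g x) = mact N g (j (b, \<pi> x) x)"
      using j(2)[of "(b, \<pi> x)" x g] x g M'(3,4) by simp
  qed
  have "openin (mtop N) (?U b)" for b
    using piecesD(3)[OF pc, of "(b, _)"] by (intro openin_Union) auto
  moreover have "?U True \<union> ?U False = mspace N"
  proof -
    have P: "?P = (\<lambda>y. (True, y)) ` pts X \<union> (\<lambda>y. (False, y)) ` pts X" by (auto simp: UNIV_bool)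
    have "(\<Union>p\<in>?P. j p ` fibre \<pi> (Mb (fst p)) (snd p)) = ?U True \<union> ?U False"
      unfolding P by (simp only: UN_Un UN_simps(10) fst_conv snd_conv)
    then show ?thesis using pc unfolding pieces_def by (simp only:)
  qed
  moreover have "?U True \<inter> ?U False = {}"
  proof (rule ccontr)
    assume "?U True \<inter> ?U False \<noteq> {}"
    then obtain z where z: "z \<in> ?U True" "z \<in> ?U False" by blast
    obtain y x where 1: "y \<in> pts X" "x \<in> fibre \<pi> (Mb True) y" "z = j (True, y) x" using z(1) by (rule UN_imageE)
    obtain y' x' where 2: "y' \<in> pts X" "x' \<in> fibre \<pi> (Mb False) y'" "z = j (False, y') x'" using z(2) by (rule UN_imageE)
    show False using piecesD(5)[OF pc, of "(True, y)" "(False, y')" x x'] 1 2 by simp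
  qed
  ultimately have "lab_sum G \<pi> (Mb True) (Mb False) N"
    unfolding lab_sum_def using f[of True] f[of False] by meson
  then show ?thesis using N by (auto simp: Mb_def)
qed

text \<open>
  Two transports agree as soon as their pieces can be matched; this covers change of the source
  manifold, of the index set, and twisting of the pieces by group elements.
\<close>

lemma transported_iso:
  assumes C: "corresp G X H Y P a c f q"
    and M: "lab_mfd n G X \<pi> M" and N: "lab_mfd n H Y \<rho> N" and N': "lab_mfd n H Y \<rho> N'"
    and tr: "transported H P a c f q \<pi> \<rho> M N j"
    and tr': "transported H P' a' c' f' q' \<pi>' \<rho> M' N' j'"
    and \<beta>: "bij_betw \<beta> P P'" "\<And>h p. h \<in> carrier H \<Longrightarrow> p \<in> P \<Longrightarrow> \<beta> (a h p) = a' h (\<beta> p)" "\<And>p. p \<in> P \<Longrightarrow> q' (\<beta> p) = q p"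
    and k: "\<And>p. p \<in> P \<Longrightarrow> diffeo M (fibre \<pi> M (f p)) M' (fibre \<pi>' M' (f' (\<beta> p))) (k p)"
    and keq: "\<And>h p x. h \<in> carrier H \<Longrightarrow> p \<in> P \<Longrightarrow> x \<in> mspace M \<Longrightarrow> \<pi> x = f p \<Longrightarrow>
      k (a h p) (mact M (c h p) x) = mact M' (c' h (\<beta> p)) (k p x)"
  shows "lab_iso H \<rho> N N'"
proof -
  note t = transportedD[OF tr] and t' = transportedD[OF tr']
  have \<beta>P: "\<beta> p \<in> P'" if "p \<in> P" for p using \<beta>(1) that by (auto simp: bij_betw_def)
  obtain F where F: "\<And>p x. p \<in> P \<Longrightarrow> x \<in> fibre \<pi> M (f p) \<Longrightarrow> F (j p x) = j' (\<beta> p) (k p x)"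
    by (rule pieces_fun_exists[OF t(1), of "\<lambda>p x. j' (\<beta> p) (k p x)"]) blast
  have kx: "k p x \<in> mspace M'" "\<pi>' (k p x) = f' (\<beta> p)" if "p \<in> P" "x \<in> mspace M" "\<pi> x = f p" for p x
    using diffeoD(3)[OF k[OF that(1)]] that by blast+
  have "diffeo N (\<Union>p\<in>P. j p ` fibre \<pi> M (f p)) N' (\<Union>p\<in>P. j' (\<beta> p) ` fibre \<pi>' M' (f' (\<beta> p))) F"
    by (rule pieces_diffeo[OF t(1) lab_mfdD(2)[OF N] t'(1) lab_mfdD(2)[OF N'] _ _ subset_refl subset_refl k F])
      (use \<beta>(1) in \<open>auto simp: bij_betw_def\<close>)
  moreover have "(\<Union>p\<in>P. j' (\<beta> p) ` fibre \<pi>' M' (f' (\<beta> p))) = (\<Union>p\<in>P'. j' p ` fibre \<pi>' M' (f' p))"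
  proof -
    have "P' = \<beta> ` P" using \<beta>(1) by (simp add: bij_betw_def)
    then show ?thesis by (simp only: UN_simps(10))
  qed
  ultimately have d: "diffeo N (mspace N) N' (mspace N') F"
    using t(1) t'(1) unfolding pieces_def by simp
  have "lab_diffeo H \<rho> N N' (mspace N') F"
  proof (rule lab_diffeoI[OF lab_mfdD(1)[OF N] d])
    fix y assume y: "y \<in> mspace N"
    show "\<rho> (F y) = \<rho> y" using y
    proof (rule transported_cases[OF tr])
      fix p x assume p: "p \<in> P" "x \<in> mspace M" "\<pi> x = f p" "y = j p x"
      then show ?thesis using F[of p x] t(2)[OF p(1-3)] t'(2)[OF \<beta>P[OF p(1)] kx[OF p(1-3)]] \<beta>(3) by simp
    qed
    fix h assume h: "h \<in> carrier H"
    show "F (mact N h y) = mact N' h (F y)" using y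
    proof (rule transported_cases[OF tr])
      fix p x assume p: "p \<in> P" "x \<in> mspace M" "\<pi> x = f p" "y = j p x"
      have "F (mact N h y) = F (j (a h p) (mact M (c h p) x))" using t(3)[OF h p(1-3)] p(4) by simp
      also have "\<dots> = j' (\<beta> (a h p)) (k (a h p) (mact M (c h p) x))"
        using F[OF correspD(6)[OF C h p(1)]] corresp_fibre[OF C M h p(1-3)] by simp
      also have "\<dots> = j' (a' h (\<beta> p)) (mact M' (c' h (\<beta> p)) (k p x))"
        using \<beta>(2)[OF h p(1)] keq[OF h p(1-3)] by simp
      also have "\<dots> = mact N' h (j' (\<beta> p) (k p x))" using t'(3)[OF h \<beta>P[OF p(1)] kx[OF p(1-3)]] by simp
      also have "\<dots> = mact N' h (F y)" using F[of p x] p by simp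
      finally show ?thesis .
    qed
  qed
  then show ?thesis unfolding lab_iso_def by blast
qed

section \<open>Transport of isomorphisms, embeddings, sums and composites\<close>

lemma transported_cong:
  assumes C: "corresp G X H Y P a c f q"
    and M: "lab_mfd n G X \<pi> M" "lab_mfd n G X \<pi> M'" "lab_iso G \<pi> M M'"
    and N: "lab_mfd n H Y \<rho> N" "lab_mfd n H Y \<rho> N'"
    and tr: "transported H P a c f q \<pi> \<rho> M N j" "transported H P a c f q \<pi> \<rho> M' N' j'"
  shows "lab_iso H \<rho> N N'"
proof -
  obtain k where k: "lab_diffeo G \<pi> M M' (mspace M') k" using M(3) unfolding lab_iso_def by blast
  show ?thesis
  proof (rule transported_iso[OF C M(1) N tr, where \<beta> = "\<lambda>p. p" and k = "\<lambda>_. k"])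
    show "diffeo M (fibre \<pi> M (f p)) M' (fibre \<pi> M' (f p)) k" for p
      using lab_diffeo_fibre[OF k lab_mfdD(2)[OF M(2)], of "f p"] by simp
  qed (use lab_diffeoD(2)[OF k] correspD(7)[OF C] in \<open>auto simp: bij_betw_def\<close>)
qed

text \<open>An open embedding is applied fibre by fibre. Used for both summands of a disjoint union,
  this shows that transport preserves sums.\<close>

lemma transported_sub:
  assumes C: "corresp G X H Y P a c f q"
    and M: "lab_mfd n G X \<pi> M" "lab_mfd n G X \<pi> M'"
    and k: "lab_diffeo G \<pi> M M' U k" "openin (mtop M') U"
    and N: "lab_mfd n H Y \<rho> N" "lab_mfd n H Y \<rho> N'"
    and tr: "transported H P a c f q \<pi> \<rho> M N j" and tr': "transported H P a c f q \<pi> \<rho> M' N' j'"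
  shows "\<exists>F. lab_diffeo H \<rho> N N' (\<Union>p\<in>P. j' p ` {x \<in> U. \<pi> x = f p}) F"
    "openin (mtop N') (\<Union>p\<in>P. j' p ` {x \<in> U. \<pi> x = f p})"
proof -
  note t = transportedD[OF tr] and t' = transportedD[OF tr']
  have U: "U \<subseteq> mspace M'" using k(2) openin_subset by blast
  obtain F where F: "\<And>p x. p \<in> P \<Longrightarrow> x \<in> fibre \<pi> M (f p) \<Longrightarrow> F (j p x) = j' p (k x)"
    using pieces_fun_exists[OF t(1), of "\<lambda>p x. j' p (k x)"] by metis
  have kx: "k x \<in> mspace M'" "\<pi> (k x) = \<pi> x" if "x \<in> mspace M" for x
    using diffeoD(3)[OF lab_diffeoD(1)[OF k(1)]] lab_diffeoD(3)[OF k(1)] that U by blast+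
  have "diffeo N (\<Union>p\<in>P. j p ` fibre \<pi> M (f p)) N' (\<Union>p\<in>P. j' p ` {x \<in> U. \<pi> x = f p}) F"
    by (rule pieces_diffeo[OF t(1) lab_mfdD(2)[OF N(1)] t'(1) lab_mfdD(2)[OF N(2)], where \<beta> = "\<lambda>p. p" and k = "\<lambda>_. k"])
      (use lab_diffeo_fibre[OF k(1) lab_mfdD(2)[OF M(2)]] F U in auto)
  then have d: "diffeo N (mspace N) N' (\<Union>p\<in>P. j' p ` {x \<in> U. \<pi> x = f p}) F"
    using t(1) unfolding pieces_def by simp
  have "lab_diffeo H \<rho> N N' (\<Union>p\<in>P. j' p ` {x \<in> U. \<pi> x = f p}) F"
  proof (rule lab_diffeoI[OF lab_mfdD(1)[OF N(1)] d])
    fix y assume y: "y \<in> mspace N"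
    show "\<rho> (F y) = \<rho> y" using y
    proof (rule transported_cases[OF tr])
      fix p x assume p: "p \<in> P" "x \<in> mspace M" "\<pi> x = f p" "y = j p x"
      then show ?thesis using F[of p x] t(2)[OF p(1-3)] t'(2)[OF p(1) kx(1)[OF p(2)]] kx(2)[OF p(2)] by simp
    qed
    fix h assume h: "h \<in> carrier H"
    show "F (mact N h y) = mact N' h (F y)" using y
    proof (rule transported_cases[OF tr])
      fix p x assume p: "p \<in> P" "x \<in> mspace M" "\<pi> x = f p" "y = j p x"
      have "F (mact N h y) = F (j (a h p) (mact M (c h p) x))" using t(3)[OF h p(1-3)] p(4) by simp
      also have "\<dots> = j' (a h p) (k (mact M (c h p) x))"
        using F[OF correspD(6)[OF C h p(1)]] corresp_fibre[OF C M(1) h p(1-3)] by simp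
      also have "\<dots> = j' (a h p) (mact M' (c h p) (k x))"
        using lab_diffeoD(2)[OF k(1) correspD(7)[OF C h p(1)] p(2)] by simp
      also have "\<dots> = mact N' h (j' p (k x))" using t'(3)[OF h p(1) kx(1)[OF p(2)]] kx(2)[OF p(2)] p(3) by simp
      also have "\<dots> = mact N' h (F y)" using F[of p x] p by simp
      finally show ?thesis .
    qed
  qed
  then show "\<exists>F. lab_diffeo H \<rho> N N' (\<Union>p\<in>P. j' p ` {x \<in> U. \<pi> x = f p}) F" by blast
  have "openin (mtop N') (j' p ` {x \<in> U. \<pi> x = f p})" if p: "p \<in> P" for p
  proof (rule diffeo_open_image[OF piecesD(4,3)[OF t'(1) p]])
    have "{x \<in> U. \<pi> x = f p} = U \<inter> fibre \<pi> M' (f p)" using U by blast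
    then show "openin (mtop M') {x \<in> U. \<pi> x = f p}" using k(2) lab_mfdD(5)[OF M(2)] by auto
  qed (use U in auto)
  then show "openin (mtop N') (\<Union>p\<in>P. j' p ` {x \<in> U. \<pi> x = f p})" by blast
qed

lemma transported_lab_sum:
  assumes C: "corresp G X H Y P a c f q"
    and M: "lab_mfd n G X \<pi> M1" "lab_mfd n G X \<pi> M2" "lab_mfd n G X \<pi> M" "lab_sum G \<pi> M1 M2 M"
    and N: "lab_mfd n H Y \<rho> N1" "lab_mfd n H Y \<rho> N2" "lab_mfd n H Y \<rho> N"
    and tr: "transported H P a c f q \<pi> \<rho> M1 N1 j1" "transported H P a c f q \<pi> \<rho> M2 N2 j2"
      "transported H P a c f q \<pi> \<rho> M N j"
  shows "lab_sum H \<rho> N1 N2 N"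
proof -
  obtain U1 U2 k1 k2 where U: "openin (mtop M) U1" "openin (mtop M) U2" "U1 \<union> U2 = mspace M" "U1 \<inter> U2 = {}"
    "lab_diffeo G \<pi> M1 M U1 k1" "lab_diffeo G \<pi> M2 M U2 k2" using M(4) unfolding lab_sum_def by blast
  let ?V = "\<lambda>U. \<Union>p\<in>P. j p ` {x \<in> U. \<pi> x = f p}"
  note pc = transportedD(1)[OF tr(3)]
  note s1 = transported_sub[OF C M(1,3) U(5,1) N(1,3) tr(1,3)]
    and s2 = transported_sub[OF C M(2,3) U(6,2) N(2,3) tr(2,3)]
  have un: "?V U1 \<union> ?V U2 = mspace N"
  proof -
    have "{x \<in> U1. \<pi> x = y} \<union> {x \<in> U2. \<pi> x = y} = fibre \<pi> M y" for y using U(3) by blast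
    then have "?V U1 \<union> ?V U2 = (\<Union>p\<in>P. j p ` fibre \<pi> M (f p))"
      by (simp add: UN_Un_distrib[symmetric] image_Un[symmetric])
    then show ?thesis using pc unfolding pieces_def by simp
  qed
  have dj: "?V U1 \<inter> ?V U2 = {}"
  proof (rule ccontr)
    assume "?V U1 \<inter> ?V U2 \<noteq> {}"
    then obtain p x p' x' where "p \<in> P" "x \<in> U1" "\<pi> x = f p" "p' \<in> P" "x' \<in> U2" "\<pi> x' = f p'" "j p x = j p' x'"
      by auto
    moreover from this have "p = p' \<and> x = x'" using piecesD(5)[OF pc, of p p' x x'] U(3) by auto
    ultimately show False using U(4) by blast
  qed
  show ?thesis unfolding lab_sum_def using s1 s2 un dj by blast
qed

text \<open>Splitting the index set splits the union of fibres, as the labels and the cocycle of the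
  parts are those of the whole. The sets \<open>P1\<close> and \<open>P2\<close> share a type so
  that the inner fact \<open>V\<close> applies to both.\<close>

lemma transported_additive:
  fixes P1 P2 :: "'z set"
  assumes C1: "corresp G X H Y P1 a1 c1 f1 q1" and C2: "corresp G X H Y P2 a2 c2 f2 q2"
    and M: "lab_mfd n G X \<pi> M" and N: "lab_mfd n H Y \<rho> N1" "lab_mfd n H Y \<rho> N2" "lab_mfd n H Y \<rho> N"
    and tr1: "transported H P1 a1 c1 f1 q1 \<pi> \<rho> M N1 j1" and tr2: "transported H P2 a2 c2 f2 q2 \<pi> \<rho> M N2 j2"
    and tr: "transported H P a c f q \<pi> \<rho> M N j"
    and b1: "inj_on b1 P1" "\<And>p. p \<in> P1 \<Longrightarrow> f (b1 p) = f1 p \<and> q (b1 p) = q1 p"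
      "\<And>h p. h \<in> carrier H \<Longrightarrow> p \<in> P1 \<Longrightarrow> b1 (a1 h p) = a h (b1 p) \<and> c h (b1 p) = c1 h p"
    and b2: "inj_on b2 P2" "\<And>p. p \<in> P2 \<Longrightarrow> f (b2 p) = f2 p \<and> q (b2 p) = q2 p"
      "\<And>h p. h \<in> carrier H \<Longrightarrow> p \<in> P2 \<Longrightarrow> b2 (a2 h p) = a h (b2 p) \<and> c h (b2 p) = c2 h p"
    and b: "b1 ` P1 \<union> b2 ` P2 = P" "b1 ` P1 \<inter> b2 ` P2 = {}"
  shows "lab_sum H \<rho> N1 N2 N"
proof -
  note t = transportedD[OF tr]
  let ?V = "\<lambda>Q. \<Union>p\<in>Q. j p ` fibre \<pi> M (f p)"
  have V: "\<exists>F. lab_diffeo H \<rho> N' N (?V (b' ` P')) F"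
    if C': "corresp G X H Y P' a' c' f' q'" and N': "lab_mfd n H Y \<rho> N'" and tr': "transported H P' a' c' f' q' \<pi> \<rho> M N' j'"
      and b': "inj_on b' P'" "\<And>p. p \<in> P' \<Longrightarrow> f (b' p) = f' p \<and> q (b' p) = q' p"
        "\<And>h p. h \<in> carrier H \<Longrightarrow> p \<in> P' \<Longrightarrow> b' (a' h p) = a h (b' p) \<and> c h (b' p) = c' h p" "b' ` P' \<subseteq> P"
    for P' :: "'z set" and a' c' f' q' N' j' b'
  proof -
    note t' = transportedD[OF tr']
    have b'P: "b' p \<in> P" if "p \<in> P'" for p using b'(4) that by blast
    obtain F where F: "\<And>p x. p \<in> P' \<Longrightarrow> x \<in> fibre \<pi> M (f' p) \<Longrightarrow> F (j' p x) = j (b' p) x"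
      using pieces_fun_exists[OF t'(1), of "\<lambda>p x. j (b' p) x"] by metis
    have "diffeo N' (\<Union>p\<in>P'. j' p ` fibre \<pi> M (f' p)) N (\<Union>p\<in>P'. j (b' p) ` fibre \<pi> M (f' p)) F"
    proof (rule pieces_diffeo[OF t'(1) lab_mfdD(2)[OF N'] t(1) lab_mfdD(2)[OF N(3)] b'(1,4) subset_refl, where k = "\<lambda>_ x. x"])
      show "diffeo M (fibre \<pi> M (f' p)) M (fibre \<pi> M (f' p)) (\<lambda>x. x)" for p
        by (rule diffeo_id[OF lab_mfdD(2)[OF M]]) blast
    qed (use b'(2) F in auto)
    moreover have "(\<Union>p\<in>P'. j (b' p) ` fibre \<pi> M (f' p)) = ?V (b' ` P')" using b'(2) by simp
    ultimately have d: "diffeo N' (mspace N') N (?V (b' ` P')) F" using t'(1) unfolding pieces_def by simp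
    have "lab_diffeo H \<rho> N' N (?V (b' ` P')) F"
    proof (rule lab_diffeoI[OF lab_mfdD(1)[OF N'] d])
      fix y assume y: "y \<in> mspace N'"
      show "\<rho> (F y) = \<rho> y" using y
      proof (rule transported_cases[OF tr'])
        fix p x assume p: "p \<in> P'" "x \<in> mspace M" "\<pi> x = f' p" "y = j' p x"
        then show ?thesis using F[of p x] t'(2)[OF p(1-3)] t(2)[OF b'P[OF p(1)] p(2)] b'(2)[OF p(1)] by simp
      qed
      fix h assume h: "h \<in> carrier H"
      show "F (mact N' h y) = mact N h (F y)" using y
      proof (rule transported_cases[OF tr'])
        fix p x assume p: "p \<in> P'" "x \<in> mspace M" "\<pi> x = f' p" "y = j' p x"
        have "F (mact N' h y) = F (j' (a' h p) (mact M (c' h p) x))" using t'(3)[OF h p(1-3)] p(4) by simp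
        also have "\<dots> = j (b' (a' h p)) (mact M (c' h p) x)"
          using F[OF correspD(6)[OF C' h p(1)]] corresp_fibre[OF C' M h p(1-3)] by simp
        also have "\<dots> = mact N h (j (b' p) x)" using t(3)[OF h b'P[OF p(1)] p(2)] b'(2,3) h p(1,3) by simp
        also have "\<dots> = mact N h (F y)" using F[of p x] p by simp
        finally show ?thesis .
      qed
    qed
    then show ?thesis by blast
  qed
  obtain F1 where F1: "lab_diffeo H \<rho> N1 N (?V (b1 ` P1)) F1" using V[OF C1 N(1) tr1 b1] b(1) by blast
  obtain F2 where F2: "lab_diffeo H \<rho> N2 N (?V (b2 ` P2)) F2" using V[OF C2 N(2) tr2 b2] b(1) by blast
  have "openin (mtop N) (?V Q)" if "Q \<subseteq> P" for Q
    using piecesD(3)[OF t(1)] that by (intro openin_Union) blast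
  then have o: "openin (mtop N) (?V (b1 ` P1))" "openin (mtop N) (?V (b2 ` P2))" using b(1) by blast+
  have un: "?V (b1 ` P1) \<union> ?V (b2 ` P2) = mspace N"
    using t(1) b(1) unfolding pieces_def by (metis (no_types, lifting) UN_Un)
  have dj: "?V (b1 ` P1) \<inter> ?V (b2 ` P2) = {}"
  proof (rule ccontr)
    assume "?V (b1 ` P1) \<inter> ?V (b2 ` P2) \<noteq> {}"
    then obtain z where z: "z \<in> ?V (b1 ` P1)" "z \<in> ?V (b2 ` P2)" by blast
    obtain p x where 1: "p \<in> b1 ` P1" "x \<in> fibre \<pi> M (f p)" "z = j p x" using z(1) by (rule UN_imageE)
    obtain p' x' where 2: "p' \<in> b2 ` P2" "x' \<in> fibre \<pi> M (f p')" "z = j p' x'" using z(2) by (rule UN_imageE)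
    have *: "p \<in> b1 ` P1" "x \<in> fibre \<pi> M (f p)" "p' \<in> b2 ` P2" "x' \<in> fibre \<pi> M (f p')" "j p x = j p' x'"
      using 1 2 by simp_all
    then have "p \<in> P" "p' \<in> P" using b(1) by blast+
    then have "p = p'" using piecesD(5)[OF t(1) _ _ *(2,4,5)] by blast
    then show False using * b(2) by blast
  qed
  show ?thesis unfolding lab_sum_def using F1 F2 o un dj by blast
qed

text \<open>A point of \<open>L\<close> has an index \<open>v\<close> and comes from a point of
  \<open>N\<close> over \<open>f' v\<close>, which has an index \<open>u\<close> with
  \<open>q u = f' v\<close>. So the indices of the composite are the pullback of \<open>P\<close>
  and \<open>Q\<close>. An element of \<open>K\<close> acts on \<open>Q\<close> directly, and on
  \<open>P\<close> through the cocycle \<open>c'\<close>.\<close>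

lemma transported_compose:
  assumes C: "corresp G X H Y P a c f q" and D: "corresp H Y K Z Q a' c' f' q'"
    and M: "lab_mfd n G X \<pi> M" and N: "lab_mfd n H Y \<rho> N" and L: "lab_mfd n K Z \<sigma> L"
    and trN: "transported H P a c f q \<pi> \<rho> M N j" and trL: "transported K Q a' c' f' q' \<rho> \<sigma> N L i"
    and r: "bij_betw (\<lambda>r. (r1 r, r2 r)) R {(u, v). u \<in> P \<and> v \<in> Q \<and> q u = f' v}"
    and aR: "\<And>k r. k \<in> carrier K \<Longrightarrow> r \<in> R \<Longrightarrow>
      aR k r \<in> R \<and> r2 (aR k r) = a' k (r2 r) \<and> r1 (aR k r) = a (c' k (r2 r)) (r1 r)"
    and e: "\<And>r. r \<in> R \<Longrightarrow> fR r = f (r1 r) \<and> qR r = q' (r2 r)"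
      "\<And>k r. k \<in> carrier K \<Longrightarrow> r \<in> R \<Longrightarrow> cR k r = c (c' k (r2 r)) (r1 r)"
  shows "transported K R aR cR fR qR \<pi> \<sigma> M L (\<lambda>r x. i (r2 r) (j (r1 r) x))"
proof -
  note tN = transportedD[OF trN] and tL = transportedD[OF trL]
  have r': "r1 r \<in> P" "r2 r \<in> Q" "q (r1 r) = f' (r2 r)" if "r \<in> R" for r
  proof -
    have "(r1 r, r2 r) \<in> {(u, v). u \<in> P \<and> v \<in> Q \<and> q u = f' v}" using r that by (blast dest: bij_betwE)
    then show "r1 r \<in> P" "r2 r \<in> Q" "q (r1 r) = f' (r2 r)" by auto
  qed
  have jf: "j (r1 r) ` fibre \<pi> M (fR r) \<subseteq> fibre \<rho> N (f' (r2 r))" if "r \<in> R" for r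
    using tN(2,4)[OF r'(1)[OF that]] r'(3)[OF that] e(1)[OF that] by auto
  have ch: "charted M" "charted N" "charted L" using lab_mfdD(2) M N L by blast+
  have "pieces L R (\<lambda>_. M) (\<lambda>r. fibre \<pi> M (fR r)) (\<lambda>r x. i (r2 r) (j (r1 r) x))"
    unfolding pieces_def
  proof (intro conjI ballI impI)
    fix r assume rR: "r \<in> R"
    note r1 = r'[OF rR]
    have oj: "openin (mtop N) (j (r1 r) ` fibre \<pi> M (fR r))" using piecesD(3)[OF tN(1) r1(1)] e(1)[OF rR] by simp
    have im: "(\<lambda>x. i (r2 r) (j (r1 r) x)) ` fibre \<pi> M (fR r) = i (r2 r) ` j (r1 r) ` fibre \<pi> M (fR r)"
      by (simp only: image_image)
    show "openin (mtop L) ((\<lambda>x. i (r2 r) (j (r1 r) x)) ` fibre \<pi> M (fR r))" unfolding im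
      by (rule diffeo_open_image[OF piecesD(4,3)[OF tL(1) r1(2)] oj jf[OF rR]])
    show "diffeo M (fibre \<pi> M (fR r)) L ((\<lambda>x. i (r2 r) (j (r1 r) x)) ` fibre \<pi> M (fR r)) (\<lambda>x. i (r2 r) (j (r1 r) x))"
      unfolding im
      by (rule diffeo_compose[OF ch _ diffeo_subset[OF ch(3) piecesD(4)[OF tL(1) r1(2)] jf[OF rR]]])
        (use piecesD(4)[OF tN(1) r1(1)] e(1)[OF rR] in simp)
    fix s x y assume sR: "s \<in> R" and x: "x \<in> fibre \<pi> M (fR r)" and y: "y \<in> fibre \<pi> M (fR s)"
      and eq: "i (r2 r) (j (r1 r) x) = i (r2 s) (j (r1 s) y)"
    have "r2 r = r2 s \<and> j (r1 r) x = j (r1 s) y"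
      by (rule piecesD(5)[OF tL(1) r1(2) r'(2)[OF sR] _ _ eq]) (use jf rR sR x y in blast)+
    moreover from this have "r1 r = r1 s"
      using piecesD(5)[OF tN(1) r1(1) r'(1)[OF sR], of x y] x y e(1) rR sR by auto
    ultimately show "r = s" using r rR sR by (auto simp: bij_betw_def dest: inj_onD)
  next
    show "(\<Union>r\<in>R. (\<lambda>x. i (r2 r) (j (r1 r) x)) ` fibre \<pi> M (fR r)) = mspace L"
    proof
      show "(\<Union>r\<in>R. (\<lambda>x. i (r2 r) (j (r1 r) x)) ` fibre \<pi> M (fR r)) \<subseteq> mspace L"
      proof (intro UN_least image_subsetI)
        fix r x assume "r \<in> R" "x \<in> fibre \<pi> M (fR r)"
        then have "r \<in> R" "j (r1 r) x \<in> fibre \<rho> N (f' (r2 r))" using jf by blast+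
        then show "i (r2 r) (j (r1 r) x) \<in> mspace L" using tL(4)[OF r'(2)] by simp
      qed
      show "mspace L \<subseteq> (\<Union>r\<in>R. (\<lambda>x. i (r2 r) (j (r1 r) x)) ` fibre \<pi> M (fR r))"
      proof
        fix z assume z: "z \<in> mspace L"
        obtain v y where v: "v \<in> Q" "y \<in> mspace N" "\<rho> y = f' v" "z = i v y" using transported_cases[OF trL z] by metis
        obtain u x where u: "u \<in> P" "x \<in> mspace M" "\<pi> x = f u" "y = j u x" using transported_cases[OF trN v(2)] by metis
        have "q u = f' v" using tN(2)[OF u(1-3)] u(4) v(3) by simp
        then have "(u, v) \<in> (\<lambda>r. (r1 r, r2 r)) ` R" using r u(1) v(1) by (simp add: bij_betw_def)
        then obtain r where rr: "r \<in> R" "r1 r = u" "r2 r = v" by auto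
        then have "x \<in> fibre \<pi> M (fR r)" using u e(1) by simp
        moreover have "z = (\<lambda>x. i (r2 r) (j (r1 r) x)) x" using rr u v by simp
        ultimately show "z \<in> (\<Union>r\<in>R. (\<lambda>x. i (r2 r) (j (r1 r) x)) ` fibre \<pi> M (fR r))" using rr(1) by blast
      qed
    qed
  qed (use ch lab_mfdD(5)[OF M] in auto)
  moreover have "\<sigma> (i (r2 r) (j (r1 r) x)) = qR r \<and>
      (\<forall>k\<in>carrier K. mact L k (i (r2 r) (j (r1 r) x)) = i (r2 (aR k r)) (j (r1 (aR k r)) (mact M (cR k r) x)))"
    if rR: "r \<in> R" and x: "x \<in> fibre \<pi> M (fR r)" for r x
  proof -
    note r1 = r'[OF rR]
    have x': "x \<in> mspace M" "\<pi> x = f (r1 r)" using x e(1)[OF rR] by auto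
    have jx: "j (r1 r) x \<in> mspace N" "\<rho> (j (r1 r) x) = f' (r2 r)" using jf[OF rR] x by blast+
    have "mact L k (i (r2 r) (j (r1 r) x)) = i (r2 (aR k r)) (j (r1 (aR k r)) (mact M (cR k r) x))"
      if k: "k \<in> carrier K" for k
      using tL(3)[OF k r1(2) jx] tN(3)[OF correspD(7)[OF D k r1(2)] r1(1) x'] aR[OF k rR] e(2)[OF k rR] by simp
    then show ?thesis using tL(2)[OF r1(2) jx] e(1)[OF rR] by simp
  qed
  ultimately show ?thesis unfolding transported_def by blast
qed

section \<open>Transport of cutting and pasting\<close>

text \<open>Labels are controlled through \<open>k1\<close> and \<open>k2\<close>. For
  \<open>\<phi>\<close> the same property follows, because \<open>k1 x = k2 (\<phi> x)\<close> on
  \<open>S\<close>.\<close>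

definition lab_SK_op ::
  "nat \<Rightarrow> ('g, 'b) monoid_scheme \<Rightarrow> ('g, 'x) gset \<Rightarrow> ('a \<Rightarrow> 'x) \<Rightarrow> ('a, 'g) gmfd \<Rightarrow> ('a, 'g) gmfd \<Rightarrow> bool" where
  "lab_SK_op n G X \<pi> M N \<longleftrightarrow> lab_mfd n G X \<pi> M \<and> lab_mfd n G X \<pi> N \<and>
     (\<exists>S M1 M2 \<phi>. cut_along G M S M1 M2 \<and> G_diffeo G M S M S \<phi> \<and>
        (\<exists>k1 k2. G_diffeo G M M1 N (k1 ` M1) k1 \<and> G_diffeo G M M2 N (k2 ` M2) k2 \<and>
           k1 ` M1 \<union> k2 ` M2 = mspace N \<and>
           (\<forall>x\<in>M1. \<forall>y\<in>M2. k1 x = k2 y \<longleftrightarrow> x \<in> S \<and> y = \<phi> x) \<and>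
           (\<forall>x\<in>M1. \<pi> (k1 x) = \<pi> x) \<and> (\<forall>x\<in>M2. \<pi> (k2 x) = \<pi> x)))"

definition lift :: "'p set \<Rightarrow> ('p \<Rightarrow> 'x) \<Rightarrow> ('a \<Rightarrow> 'x) \<Rightarrow> ('p \<Rightarrow> 'a \<Rightarrow> 'b) \<Rightarrow> 'a set \<Rightarrow> 'b set" where
  "lift P f \<pi> j B = (\<Union>p\<in>P. j p ` {x \<in> B. \<pi> x = f p})"

section \<open>Subsets of a transported manifold lying over a subset of the source\<close>

lemma liftE:
  assumes "y \<in> lift P f \<pi> j B"
  obtains p x where "p \<in> P" "x \<in> B" "\<pi> x = f p" "y = j p x"
proof -
  obtain p x where "p \<in> P" "x \<in> {x \<in> B. \<pi> x = f p}" "y = j p x"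
    using assms unfolding lift_def by (rule UN_imageE)
  then show thesis using that[of p x] by simp
qed

lemma liftI: "p \<in> P \<Longrightarrow> x \<in> B \<Longrightarrow> \<pi> x = f p \<Longrightarrow> j p x \<in> lift P f \<pi> j B"
  unfolding lift_def by (intro UN_I[of p] imageI) simp_all

lemma lift_iff:
  assumes "transported H P a c f q \<pi> \<rho> M N j" "B \<subseteq> mspace M" "p \<in> P" "x \<in> mspace M" "\<pi> x = f p"
  shows "j p x \<in> lift P f \<pi> j B \<longleftrightarrow> x \<in> B"
proof
  assume "j p x \<in> lift P f \<pi> j B"
  then obtain p' x' where *: "p' \<in> P" "x' \<in> B" "\<pi> x' = f p'" "j p x = j p' x'" by (rule liftE)
  then have "p = p' \<and> x = x'"
    using piecesD(5)[OF transportedD(1)[OF assms(1)] assms(3) *(1), of x x'] assms(2,4,5) by auto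
  then show "x \<in> B" using * by simp
next
  assume "x \<in> B"
  then show "j p x \<in> lift P f \<pi> j B" using liftI[of p P x B \<pi> f j] assms(3,5) by simp
qed

lemma lift_subset:
  assumes "transported H P a c f q \<pi> \<rho> M N j" "B \<subseteq> mspace M"
  shows "lift P f \<pi> j B \<subseteq> mspace N"
proof
  fix y assume "y \<in> lift P f \<pi> j B"
  then obtain p x where "p \<in> P" "x \<in> B" "\<pi> x = f p" "y = j p x" by (rule liftE)
  then show "y \<in> mspace N" using transportedD(4)[OF assms(1)] assms(2) by auto
qed

lemma lift_mono: "B \<subseteq> B' \<Longrightarrow> lift P f \<pi> j B \<subseteq> lift P f \<pi> j B'"
  by (rule subsetI, erule liftE) (auto intro: liftI)

lemma lift_Un: "lift P f \<pi> j (B \<union> B') = lift P f \<pi> j B \<union> lift P f \<pi> j B'"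
  unfolding lift_def by auto

lemma lift_mspace:
  assumes "transported H P a c f q \<pi> \<rho> M N j" shows "lift P f \<pi> j (mspace M) = mspace N"
  using transportedD(1)[OF assms] unfolding lift_def pieces_def by simp

lemma lift_Int:
  assumes tr: "transported H P a c f q \<pi> \<rho> M N j" and B: "B \<subseteq> mspace M" "B' \<subseteq> mspace M"
  shows "lift P f \<pi> j (B \<inter> B') = lift P f \<pi> j B \<inter> lift P f \<pi> j B'"
proof
  show "lift P f \<pi> j (B \<inter> B') \<subseteq> lift P f \<pi> j B \<inter> lift P f \<pi> j B'"
    by (simp add: lift_mono)
  show "lift P f \<pi> j B \<inter> lift P f \<pi> j B' \<subseteq> lift P f \<pi> j (B \<inter> B')"
  proof
    fix y assume y: "y \<in> lift P f \<pi> j B \<inter> lift P f \<pi> j B'"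
    then obtain p x where p: "p \<in> P" "x \<in> B" "\<pi> x = f p" "y = j p x" by (elim IntE liftE)
    then have "x \<in> B'" using lift_iff[OF tr B(2) p(1) _ p(3)] y B(1) by auto
    then show "y \<in> lift P f \<pi> j (B \<inter> B')" unfolding p(4) using p by (intro liftI) auto
  qed
qed

lemma openin_lift:
  assumes tr: "transported H P a c f q \<pi> \<rho> M N j" and M: "lab_mfd n G X \<pi> M" and B: "openin (mtop M) B"
  shows "openin (mtop N) (lift P f \<pi> j B)"
proof -
  note t = transportedD[OF tr]
  have "openin (mtop N) (j p ` {x \<in> B. \<pi> x = f p})" if p: "p \<in> P" for p
  proof (rule diffeo_open_image[OF piecesD(4,3)[OF t(1) p]])
    have "{x \<in> B. \<pi> x = f p} = B \<inter> fibre \<pi> M (f p)" using openin_subset[OF B] by blast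
    then show "openin (mtop M) {x \<in> B. \<pi> x = f p}" using B lab_mfdD(5)[OF M] by auto
  qed (use openin_subset[OF B] in auto)
  then show ?thesis unfolding lift_def by (intro openin_Union) auto
qed

text \<open>Since the pieces are disjoint and cover \<open>N\<close>, the complement of a lift is
  the lift of the complement.\<close>

lemma closedin_lift:
  assumes tr: "transported H P a c f q \<pi> \<rho> M N j" and M: "lab_mfd n G X \<pi> M" and B: "closedin (mtop M) B"
  shows "closedin (mtop N) (lift P f \<pi> j B)"
proof -
  have BM: "B \<subseteq> mspace M" using closedin_subset[OF B] .
  have "lift P f \<pi> j B \<union> lift P f \<pi> j (mspace M - B) = mspace N"
    using lift_mspace[OF tr] BM by (simp add: lift_Un[symmetric] Un_absorb1)
  moreover have "lift P f \<pi> j B \<inter> lift P f \<pi> j (mspace M - B) = {}"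
    using lift_Int[OF tr BM, of "mspace M - B"] by (simp add: lift_def)
  ultimately have "mspace N - lift P f \<pi> j B = lift P f \<pi> j (mspace M - B)" by blast
  then show ?thesis unfolding closedin_def
    using openin_lift[OF tr M, of "mspace M - B"] B lift_subset[OF tr BM] by (simp add: closedin_def)
qed

lemma invariant_lift:
  assumes C: "corresp G X H Y P a c f q" and M: "lab_mfd n G X \<pi> M"
    and tr: "transported H P a c f q \<pi> \<rho> M N j" and B: "invariant_under G M B" "B \<subseteq> mspace M"
  shows "invariant_under H N (lift P f \<pi> j B)"
  unfolding invariant_under_def
proof (intro ballI)
  fix h y assume h: "h \<in> carrier H" and "y \<in> lift P f \<pi> j B"
  then obtain p x where p: "p \<in> P" "x \<in> B" "\<pi> x = f p" "y = j p x" by (elim liftE)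
  then have x: "x \<in> mspace M" using B(2) by blast
  have "mact M (c h p) x \<in> B" using B(1) correspD(7)[OF C h p(1)] p(2) unfolding invariant_under_def by blast
  then show "mact N h y \<in> lift P f \<pi> j B"
    using transportedD(3)[OF tr h p(1) x p(3)] p(4) corresp_fibre(2)[OF C M h p(1) x p(3)] correspD(6)[OF C h p(1)]
    by (simp add: liftI)
qed

text \<open>A label-preserving \<open>k\<close> matches the parts of \<open>B\<close> and
  \<open>B'\<close> over each \<open>f p\<close>, so it can be applied on every piece at once. It is
  used for the gluing diffeomorphism and for both embeddings of the sides.\<close>

lemma lift_G_diffeo:
  assumes C: "corresp G X H Y P a c f q"
    and M: "lab_mfd n G X \<pi> M" "lab_mfd n G X \<pi> M'" and N: "lab_mfd n H Y \<rho> N" "lab_mfd n H Y \<rho> N'"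
    and tr: "transported H P a c f q \<pi> \<rho> M N j" and tr': "transported H P a c f q \<pi> \<rho> M' N' j'"
    and k: "G_diffeo G M B M' B' k" and lab: "\<And>x. x \<in> B \<Longrightarrow> \<pi> (k x) = \<pi> x"
  obtains F where "G_diffeo H N (lift P f \<pi> j B) N' (lift P f \<pi> j' B') F"
    "\<And>p x. p \<in> P \<Longrightarrow> x \<in> mspace M \<Longrightarrow> \<pi> x = f p \<Longrightarrow> F (j p x) = j' p (k x)"
proof -
  note t = transportedD[OF tr] and t' = transportedD[OF tr']
  have kd: "diffeo M B M' B' k" and inv: "invariant_under G M B" "invariant_under G M' B'"
    and keq: "\<And>g x. g \<in> carrier G \<Longrightarrow> x \<in> B \<Longrightarrow> k (mact M g x) = mact M' g (k x)"
    using k unfolding G_diffeo_def by auto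
  note d = diffeoD[OF kd]
  obtain F where F: "\<And>p x. p \<in> P \<Longrightarrow> x \<in> fibre \<pi> M (f p) \<Longrightarrow> F (j p x) = j' p (k x)"
    by (rule pieces_fun_exists[OF t(1), of "\<lambda>p x. j' p (k x)"]) blast
  have im: "k ` {x \<in> B. \<pi> x = y} = {x \<in> B'. \<pi> x = y}" for y
  proof
    show "k ` {x \<in> B. \<pi> x = y} \<subseteq> {x \<in> B'. \<pi> x = y}" using d(3) lab by auto
    show "{x \<in> B'. \<pi> x = y} \<subseteq> k ` {x \<in> B. \<pi> x = y}"
    proof
      fix z assume z: "z \<in> {x \<in> B'. \<pi> x = y}"
      then obtain x where "x \<in> B" "z = k x" using d(3) by blast
      then show "z \<in> k ` {x \<in> B. \<pi> x = y}" using z lab by simp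
    qed
  qed
  have "diffeo N (lift P f \<pi> j B) N' (lift P f \<pi> j' B') F"
    unfolding lift_def
  proof (rule pieces_diffeo[OF t(1) lab_mfdD(2)[OF N(1)] t'(1) lab_mfdD(2)[OF N(2)], where \<beta> = "\<lambda>p. p" and k = "\<lambda>_. k"])
    show "diffeo M {x \<in> B. \<pi> x = f p} M' {x \<in> B'. \<pi> x = f p} k" for p
      using diffeo_subset[OF lab_mfdD(2)[OF M(2)] kd, of "{x \<in> B. \<pi> x = f p}"] im by simp
  qed (use d(6,7) F in auto)
  moreover have "F (mact N h y) = mact N' h (F y)" if h: "h \<in> carrier H" and y: "y \<in> lift P f \<pi> j B" for h y
    using y
  proof (rule liftE)
    fix p x assume p: "p \<in> P" "x \<in> B" "\<pi> x = f p" "y = j p x"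
    have x: "x \<in> mspace M" using p(2) d(6) by blast
    have kx: "k x \<in> mspace M'" "\<pi> (k x) = f p" using p(2,3) d(3,7) lab by auto
    have "F (mact N h y) = F (j (a h p) (mact M (c h p) x))" using t(3)[OF h p(1) x p(3)] p(4) by simp
    also have "\<dots> = j' (a h p) (k (mact M (c h p) x))"
      using F[OF correspD(6)[OF C h p(1)]] corresp_fibre[OF C M(1) h p(1) x p(3)] by simp
    also have "\<dots> = j' (a h p) (mact M' (c h p) (k x))" using keq[OF correspD(7)[OF C h p(1)] p(2)] by simp
    also have "\<dots> = mact N' h (j' p (k x))" using t'(3)[OF h p(1) kx] by simp
    also have "\<dots> = mact N' h (F y)" using F[of p x] p x by simp
    finally show ?thesis .
  qed
  ultimately have "G_diffeo H N (lift P f \<pi> j B) N' (lift P f \<pi> j' B') F"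
    unfolding G_diffeo_def
    using invariant_lift[OF C M(1) tr inv(1) d(6)] invariant_lift[OF C M(2) tr' inv(2) d(7)] by blast
  then show thesis using that F by simp
qed

text \<open>Slice charts are cut down to one fibre and carried over by \<open>j p\<close>.
  Disjointness from the boundary comes from \<open>bd\<close>, as lifts of disjoint sets are
  disjoint.\<close>

lemma hypersurface_lift:
  assumes M: "lab_mfd n G X \<pi> M" and N: "charted N" "mdim N = n"
    and tr: "transported H P a c f q \<pi> \<rho> M N j"
    and bd: "mboundary N \<subseteq> lift P f \<pi> j (mboundary M \<inter> mspace M)" and S: "hypersurface M S"
  shows "hypersurface N (lift P f \<pi> j S)"
proof -
  note t = transportedD[OF tr] and Mc = lab_mfdD(2)[OF M]
  have SM: "S \<subseteq> mspace M" using S closedin_subset unfolding hypersurface_def by blast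
  have n: "mdim M = n" using G_manifoldD(4)[OF lab_mfdD(1)[OF M]] .
  have "\<exists>U' c' V'. y \<in> U' \<and> openin (mtop N) U' \<and> openin (Euclidean_space n) V' \<and>
      diffeo N U' (euclidean_mfd n) V' c' \<and> c' ` (U' \<inter> lift P f \<pi> j S) = {x \<in> V'. x 0 = 0} \<and> 0 < n"
    if "y \<in> lift P f \<pi> j S" for y
    using that
  proof (rule liftE)
    fix p x assume p: "p \<in> P" "x \<in> S" "\<pi> x = f p" "y = j p x"
    obtain U c V where U: "0 < n" "x \<in> U" "openin (mtop M) U" "openin (Euclidean_space n) V"
      "diffeo M U (euclidean_mfd n) V c" "c ` (U \<inter> S) = {x \<in> V. x 0 = 0}"
    proof -
      have "0 < n \<and> (\<exists>U c V. x \<in> U \<and> openin (mtop M) U \<and> openin (Euclidean_space n) V \<and>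
          diffeo M U (euclidean_mfd n) V c \<and> c ` (U \<inter> S) = {x \<in> V. x 0 = 0})"
        using S p(2) unfolding hypersurface_def n by blast
      then show thesis using that by blast
    qed
    let ?W = "U \<inter> fibre \<pi> M (f p)"
    have Wo: "openin (mtop M) ?W" using U(3) lab_mfdD(5)[OF M] by blast
    have dj: "diffeo M ?W N (j p ` ?W) (j p)" by (rule diffeo_subset[OF N(1) piecesD(4)[OF t(1) p(1)]]) blast
    have dc: "diffeo M ?W (euclidean_mfd n) (c ` ?W) c" by (rule diffeo_subset[OF charted_euclidean_mfd U(5)]) blast
    note jd = diffeoD[OF dj]
    let ?c = "\<lambda>z. c (inv_into ?W (j p) z)"
    have "diffeo N (j p ` ?W) (euclidean_mfd n) (c ` ?W) ?c"
      by (rule diffeo_compose[OF N(1) Mc charted_euclidean_mfd diffeo_inv[OF Mc dj] dc])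
    moreover have "openin (mtop N) (j p ` ?W)"
      by (rule diffeo_open_image[OF piecesD(4,3)[OF t(1) p(1)] Wo]) blast
    moreover have "openin (Euclidean_space n) (c ` ?W)"
      using diffeo_open_image[OF U(5) _ Wo] U(4) by (simp add: euclidean_mfd_def)
    moreover have "y \<in> j p ` ?W" unfolding p(4) using U(2) p(2,3) SM by (intro imageI) auto
    moreover have "?c ` (j p ` ?W \<inter> lift P f \<pi> j S) = {x \<in> c ` ?W. x 0 = 0}"
    proof -
      have "j p ` ?W \<inter> lift P f \<pi> j S = j p ` (?W \<inter> S)"
      proof
        show "j p ` ?W \<inter> lift P f \<pi> j S \<subseteq> j p ` (?W \<inter> S)"
        proof
          fix z assume z: "z \<in> j p ` ?W \<inter> lift P f \<pi> j S"
          then have "z \<in> j p ` ?W" by blast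
          then obtain w where w: "z = j p w" "w \<in> ?W" by (rule imageE)
          then have "w \<in> S" using lift_iff[OF tr SM p(1), of w] z by auto
          then show "z \<in> j p ` (?W \<inter> S)" using w by blast
        qed
        show "j p ` (?W \<inter> S) \<subseteq> j p ` ?W \<inter> lift P f \<pi> j S"
        proof (rule image_subsetI)
          fix w assume "w \<in> ?W \<inter> S"
          then show "j p w \<in> j p ` ?W \<inter> lift P f \<pi> j S" using liftI[OF p(1), of w S \<pi> f j] by simp
        qed
      qed
      moreover have "?c ` j p ` (?W \<inter> S) = c ` (?W \<inter> S)"
        unfolding image_image by (rule image_cong[OF refl]) (use jd(8) in auto)
      \<comment> \<open>Shrinking a slice chart keeps the slice condition because \<open>c\<close>
        is injective on \<open>U\<close>: a point of \<open>?W\<close> with vanishing first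
        coordinate has the same image as a point of \<open>S\<close>, hence is that point.\<close>
      moreover have "c ` (?W \<inter> S) = {x \<in> c ` ?W. x 0 = 0}"
      proof
        show "c ` (?W \<inter> S) \<subseteq> {x \<in> c ` ?W. x 0 = 0}" using U(6) by blast
        show "{x \<in> c ` ?W. x 0 = 0} \<subseteq> c ` (?W \<inter> S)"
        proof
          fix z assume "z \<in> {x \<in> c ` ?W. x 0 = 0}"
          then obtain u where u: "u \<in> ?W" "z = c u" "z 0 = 0" by blast
          then have "z \<in> c ` (U \<inter> S)" using U(6) diffeoD(3)[OF U(5)] by blast
          then obtain s where "s \<in> U" "s \<in> S" "z = c s" by blast
          then have "u \<in> S" using u diffeoD(2)[OF U(5)] by (auto dest: inj_onD)
          then show "z \<in> c ` (?W \<inter> S)" using u by blast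
        qed
      qed
      ultimately show ?thesis by simp
    qed
    ultimately show ?thesis using U(1)
      by (intro exI[of _ "j p ` ?W"] exI[of _ ?c] exI[of _ "c ` ?W"] conjI)
  qed
  moreover have "lift P f \<pi> j S \<inter> mboundary N = {}"
  proof -
    have "lift P f \<pi> j S \<inter> lift P f \<pi> j (mboundary M \<inter> mspace M) = lift P f \<pi> j (S \<inter> (mboundary M \<inter> mspace M))"
      using lift_Int[OF tr SM] by simp
    also have "S \<inter> (mboundary M \<inter> mspace M) = {}" using S unfolding hypersurface_def by blast
    also have "lift P f \<pi> j {} = {}" by (simp add: lift_def)
    finally show ?thesis using bd by blast
  qed
  ultimately show ?thesis
    using closedin_lift[OF tr M] S N(2) unfolding hypersurface_def by blast
qed

text \<open>This decomposition of the product with the line is what allows the tubular embedding to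
  be glued from the pieces.\<close>

lemma pieces_times_line:
  assumes tr: "transported H P a c f q \<pi> \<rho> M N j" and ch: "charted M" "charted N"
  shows "pieces (times_line N) P (\<lambda>_. times_line M) (\<lambda>p. fibre \<pi> M (f p) \<times> UNIV) (\<lambda>p (x, t). (j p x, t))"
proof -
  note pc = transportedD(1)[OF tr]
  have im: "(\<lambda>(x, t). (j p x, t)) ` (A \<times> UNIV) = j p ` A \<times> (UNIV :: real set)" for p A
    by (auto simp: image_iff)
  show ?thesis unfolding pieces_def
  proof (intro conjI ballI impI)
    fix p assume p: "p \<in> P"
    show "charted (times_line M)" by (rule charted_times_line[OF ch(1)])
    show "openin (mtop (times_line M)) (fibre \<pi> M (f p) \<times> UNIV)"
      using piecesD(2)[OF pc p] by (simp add: openin_prod_Times_iff)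
    show "openin (mtop (times_line N)) ((\<lambda>(x, t). (j p x, t)) ` (fibre \<pi> M (f p) \<times> UNIV))"
      using piecesD(3)[OF pc p] unfolding im by (simp add: openin_prod_Times_iff)
    show "diffeo (times_line M) (fibre \<pi> M (f p) \<times> UNIV) (times_line N)
        ((\<lambda>(x, t). (j p x, t)) ` (fibre \<pi> M (f p) \<times> UNIV)) (\<lambda>(x, t). (j p x, t))"
      unfolding im by (rule diffeo_times_line[OF ch piecesD(4)[OF pc p]])
    fix p' x x' assume p': "p' \<in> P" and x: "x \<in> fibre \<pi> M (f p) \<times> (UNIV :: real set)"
      and x': "x' \<in> fibre \<pi> M (f p') \<times> (UNIV :: real set)"
      and eq: "(case x of (x, t) \<Rightarrow> (j p x, t)) = (case x' of (x, t) \<Rightarrow> (j p' x, t))"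
    have "j p (fst x) = j p' (fst x')" using eq by (simp add: case_prod_unfold)
    then show "p = p'" using piecesD(5)[OF pc p p', of "fst x" "fst x'"] x x' by auto
  next
    have "(\<Union>p\<in>P. (\<lambda>(x, t). (j p x, t)) ` (fibre \<pi> M (f p) \<times> UNIV)) = (\<Union>p\<in>P. j p ` fibre \<pi> M (f p)) \<times> (UNIV :: real set)"
      unfolding im by auto
    then show "(\<Union>p\<in>P. (\<lambda>(x, t). (j p x, t)) ` (fibre \<pi> M (f p) \<times> UNIV)) = mspace (times_line N)"
      using pc unfolding pieces_def by simp
  qed
qed

text \<open>The lines of a tubular neighbourhood are connected, so the label is constant along them.\<close>

lemma tubular_label:
  assumes M: "lab_mfd n G X \<pi> M" and e: "smooth_map (times_line M) (S \<times> UNIV) M e"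
    and e0: "\<And>s. s \<in> S \<Longrightarrow> e (s, 0) = s" and s: "s \<in> S"
  shows "\<pi> (e (s, t)) = \<pi> s"
proof -
  have sM: "s \<in> mspace M" using smooth_map_domain[OF e] s by auto
  have "continuous_map euclideanreal (subtopology (mtop (times_line M)) (S \<times> UNIV)) (\<lambda>t. (s, t))"
    using s sM by (auto simp: continuous_map_in_subtopology continuous_map_pairwise o_def continuous_map_id[unfolded id_def])
  from continuous_map_compose[OF this smooth_map_continuous[OF e]]
  have c: "continuous_map euclideanreal (mtop M) (\<lambda>t. e (s, t))" by (simp add: o_def)
  have eM: "e (s, t) \<in> mspace M" for t using smooth_map_image[OF e] s by blast
  have op: "open {t. e (s, t) \<in> T}" if "openin (mtop M) T" for T
    using openin_continuous_map_preimage[OF c that] by simp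
  let ?A = "{t. e (s, t) \<in> fibre \<pi> M (\<pi> s)}"
  have compl: "- ?A = {t. e (s, t) \<in> (\<Union>y\<in>- {\<pi> s}. fibre \<pi> M y)}" using eM by auto
  have "openin (mtop M) (\<Union>y\<in>- {\<pi> s}. fibre \<pi> M y)" using lab_mfdD(5)[OF M] by (intro openin_Union) auto
  then have "open (- ?A)" unfolding compl by (rule op)
  moreover have "open ?A" using op[OF lab_mfdD(5)[OF M]] .
  ultimately have "?A = {} \<or> ?A = UNIV" using clopen[of ?A] by (simp add: closed_def)
  moreover have "0 \<in> ?A" using e0[OF s] sM by simp
  ultimately have "t \<in> ?A" by blast
  then show ?thesis by simp
qed

text \<open>The tubular embedding is applied on every piece. By \<open>tubular_label\<close> a line
  that starts in a fibre stays in it, so \<open>e (x, t)\<close> can be fed to the same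
  \<open>j p\<close> as \<open>x\<close>.\<close>

lemma cut_along_lift:
  fixes M :: "('a, 'g) gmfd"
  assumes C: "corresp G X H Y P a c f q" and M: "lab_mfd n G X \<pi> M" and N: "lab_mfd n H Y \<rho> N"
    and tr: "transported H P a c f q \<pi> \<rho> M N j"
    and bd: "mboundary N \<subseteq> lift P f \<pi> j (mboundary M \<inter> mspace M)" and cut: "cut_along G M S M1 M2"
  shows "cut_along H N (lift P f \<pi> j S) (lift P f \<pi> j M1) (lift P f \<pi> j M2)"
proof -
  let ?L = "lift P f \<pi> j"
  note t = transportedD[OF tr] and pc = transportedD(1)[OF tr] and Mc = lab_mfdD(2)[OF M] and Nc = lab_mfdD(2)[OF N]
  have cut': "hypersurface M S" "invariant_under G M S" "closedin (mtop M) M1" "invariant_under G M M1"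
     "closedin (mtop M) M2" "invariant_under G M M2" "M1 \<union> M2 = mspace M" "M1 \<inter> M2 = S"
    using cut unfolding cut_along_def by auto
  have sub: "M1 \<subseteq> mspace M" "M2 \<subseteq> mspace M" "S \<subseteq> mspace M" using cut'(7,8) by auto
  obtain e :: "'a \<times> real \<Rightarrow> 'a" where e: "openin (mtop M) (e ` (S \<times> UNIV))"
    "diffeo (times_line M) (S \<times> UNIV) M (e ` (S \<times> UNIV)) e"
    "\<And>s. s \<in> S \<Longrightarrow> e (s, 0) = s"
    "\<And>g s t. g \<in> carrier G \<Longrightarrow> s \<in> S \<Longrightarrow> e (mact M g s, t) = mact M g (e (s, t))"
    "\<And>s t. s \<in> S \<Longrightarrow> (t \<le> 0 \<longrightarrow> e (s, t) \<in> M1) \<and> (t \<ge> 0 \<longrightarrow> e (s, t) \<in> M2)"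
    using cut unfolding cut_along_def by blast
  have lab: "\<pi> (e (s, t)) = \<pi> s" if "s \<in> S" for s t
    by (rule tubular_label[OF M diffeoD(4)[OF e(2)] e(3) that])
  have eM: "e (s, t) \<in> mspace M" if "s \<in> S" for s t using diffeoD(7)[OF e(2)] that by blast
  \<comment> \<open>One function on \<open>N\<close> for each height \<open>t\<close>; together they
    form \<open>e'\<close>.\<close>
  have "\<forall>t. \<exists>F. \<forall>p\<in>P. \<forall>x\<in>fibre \<pi> M (f p). F (j p x) = j p (e (x, t))"
  proof
    fix t show "\<exists>F. \<forall>p\<in>P. \<forall>x\<in>fibre \<pi> M (f p). F (j p x) = j p (e (x, t))"
      by (rule pieces_fun_exists[OF pc, of "\<lambda>p x. j p (e (x, t))"]) blast
  qed
  then obtain F where F: "\<And>t p x. p \<in> P \<Longrightarrow> x \<in> fibre \<pi> M (f p) \<Longrightarrow> F t (j p x) = j p (e (x, t))" by metis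
  define e' where "e' = (\<lambda>(y, t). F t y)"
  have e': "e' (j p x, t) = j p (e (x, t))" if "p \<in> P" "x \<in> mspace M" "\<pi> x = f p" for p x t
    using F[of p x t] that by (simp add: e'_def)
  let ?B = "\<lambda>p. {x \<in> S. \<pi> x = f p} \<times> (UNIV :: real set)"
  have d: "diffeo (times_line N) (\<Union>p\<in>P. (\<lambda>(x, t). (j p x, t)) ` ?B p) N (\<Union>p\<in>P. j p ` e ` ?B p) e'"
  proof (rule pieces_diffeo[OF pieces_times_line[OF tr Mc Nc] charted_times_line[OF Nc] pc Nc, where \<beta> = "\<lambda>p. p" and k = "\<lambda>_. e"])
    fix p assume "p \<in> P"
    show "diffeo (times_line M) (?B p) M (e ` ?B p) e" by (rule diffeo_subset[OF Mc e(2)]) blast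
    show "e ` ?B p \<subseteq> fibre \<pi> M (f p)" using lab eM by auto
  qed (use sub(3) e' in auto)
  have dom: "(\<Union>p\<in>P. (\<lambda>(x, t). (j p x, t)) ` ?B p) = ?L S \<times> UNIV"
  proof
    show "(\<Union>p\<in>P. (\<lambda>(x, t). (j p x, t)) ` ?B p) \<subseteq> ?L S \<times> UNIV" by (auto intro: liftI)
    show "?L S \<times> UNIV \<subseteq> (\<Union>p\<in>P. (\<lambda>(x, t). (j p x, t)) ` ?B p)"
    proof
      fix z assume z: "z \<in> ?L S \<times> (UNIV :: real set)"
      obtain y t where yt: "z = (y, t)" by (cases z)
      then have "y \<in> ?L S" using z by simp
      then obtain p x where p: "p \<in> P" "x \<in> S" "\<pi> x = f p" "y = j p x" by (rule liftE)
      then have "(x, t) \<in> ?B p" "z = (\<lambda>(x, t). (j p x, t)) (x, t)" using yt by auto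
      then show "z \<in> (\<Union>p\<in>P. (\<lambda>(x, t). (j p x, t)) ` ?B p)" using p(1) by (intro UN_I[of p] image_eqI)
    qed
  qed
  have e'im: "e' ` (?L S \<times> UNIV) = (\<Union>p\<in>P. j p ` e ` ?B p)" using diffeoD(3)[OF d] dom by simp
  have "e ` ?B p = {x \<in> e ` (S \<times> UNIV). \<pi> x = f p}" for p using lab by auto
  then have "(\<Union>p\<in>P. j p ` e ` ?B p) = ?L (e ` (S \<times> UNIV))" by (simp only: lift_def)
  then have e'lift: "e' ` (?L S \<times> UNIV) = ?L (e ` (S \<times> UNIV))" using e'im by (rule trans[rotated])
  have ex: "openin (mtop N) (e' ` (?L S \<times> UNIV)) \<and> diffeo (times_line N) (?L S \<times> UNIV) N (e' ` (?L S \<times> UNIV)) e' \<and>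
      (\<forall>s\<in>?L S. e' (s, 0) = s) \<and>
      (\<forall>h\<in>carrier H. \<forall>s\<in>?L S. \<forall>t. e' (mact N h s, t) = mact N h (e' (s, t))) \<and>
      (\<forall>s\<in>?L S. \<forall>t. (t \<le> 0 \<longrightarrow> e' (s, t) \<in> ?L M1) \<and> (t \<ge> 0 \<longrightarrow> e' (s, t) \<in> ?L M2))"
  proof (intro conjI ballI allI)
    show "openin (mtop N) (e' ` (?L S \<times> UNIV))" unfolding e'lift by (rule openin_lift[OF tr M e(1)])
    show "diffeo (times_line N) (?L S \<times> UNIV) N (e' ` (?L S \<times> UNIV)) e'" using d unfolding dom e'im .
    fix s assume "s \<in> ?L S"
    then obtain p x where p: "p \<in> P" "x \<in> S" "\<pi> x = f p" "s = j p x" by (rule liftE)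
    have x: "x \<in> mspace M" using p(2) sub by blast
    show "e' (s, 0) = s" using e'[OF p(1) x p(3)] e(3)[OF p(2)] p(4) by simp
    fix t
    have es: "e' (s, t) = j p (e (x, t))" using e'[OF p(1) x p(3)] p(4) by simp
    show "t \<le> 0 \<longrightarrow> e' (s, t) \<in> ?L M1" "0 \<le> t \<longrightarrow> e' (s, t) \<in> ?L M2"
      using e(5)[OF p(2)] lab[OF p(2), of t] p(1,3) unfolding es by (auto intro: liftI)
    fix h assume h: "h \<in> carrier H"
    note cg = correspD(7)[OF C h p(1)] and cf = corresp_fibre[OF C M h p(1)]
    have "e' (mact N h s, t) = e' (j (a h p) (mact M (c h p) x), t)" using t(3)[OF h p(1) x p(3)] p(4) by simp
    also have "\<dots> = j (a h p) (e (mact M (c h p) x, t))" using e'[OF correspD(6)[OF C h p(1)] cf[OF x p(3)]] .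
    also have "\<dots> = j (a h p) (mact M (c h p) (e (x, t)))" using e(4)[OF cg p(2)] by simp
    also have "\<dots> = mact N h (j p (e (x, t)))" using t(3)[OF h p(1) eM[OF p(2)]] lab[OF p(2)] p(3) by simp
    finally show "e' (mact N h s, t) = mact N h (e' (s, t))" using es by simp
  qed
  show ?thesis unfolding cut_along_def
  proof (intro conjI)
    show "hypersurface N (?L S)"
      by (rule hypersurface_lift[OF M Nc G_manifoldD(4)[OF lab_mfdD(1)[OF N]] tr bd cut'(1)])
    show "?L M1 \<union> ?L M2 = mspace N" using lift_mspace[OF tr] cut'(7) by (simp add: lift_Un[symmetric])
    show "?L M1 \<inter> ?L M2 = ?L S" using lift_Int[OF tr sub(1,2)] cut'(8) by simp
    show "\<exists>e. openin (mtop N) (e ` (?L S \<times> UNIV)) \<and> diffeo (times_line N) (?L S \<times> UNIV) N (e ` (?L S \<times> UNIV)) e \<and>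
      (\<forall>s\<in>?L S. e (s, 0) = s) \<and>
      (\<forall>h\<in>carrier H. \<forall>s\<in>?L S. \<forall>t. e (mact N h s, t) = mact N h (e (s, t))) \<and>
      (\<forall>s\<in>?L S. \<forall>t. (t \<le> 0 \<longrightarrow> e (s, t) \<in> ?L M1) \<and> (t \<ge> 0 \<longrightarrow> e (s, t) \<in> ?L M2))"
      using ex by (rule exI[of _ e'])
  qed (use invariant_lift[OF C M tr] closedin_lift[OF tr M] cut' sub in auto)
qed

text \<open>All data of the operation lift. The pasting condition survives because an equality
  between points of pieces, in \<open>N\<close> as in \<open>N'\<close>, means equal indices
  together with equality of the underlying points.\<close>

lemma lab_SK_op_transported:
  assumes C: "corresp G X H Y P a c f q" and op: "lab_SK_op n G X \<pi> M M'"
    and N: "lab_mfd n H Y \<rho> N" "lab_mfd n H Y \<rho> N'"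
    and tr: "transported H P a c f q \<pi> \<rho> M N j" and tr': "transported H P a c f q \<pi> \<rho> M' N' j'"
    and bd: "mboundary N \<subseteq> lift P f \<pi> j (mboundary M \<inter> mspace M)"
  shows "lab_SK_op n H Y \<rho> N N'"
proof -
  have M: "lab_mfd n G X \<pi> M" "lab_mfd n G X \<pi> M'" using op unfolding lab_SK_op_def by auto
  obtain S M1 M2 \<phi> k1 k2 where "cut_along G M S M1 M2 \<and> G_diffeo G M S M S \<phi> \<and>
    G_diffeo G M M1 M' (k1 ` M1) k1 \<and> G_diffeo G M M2 M' (k2 ` M2) k2 \<and> k1 ` M1 \<union> k2 ` M2 = mspace M' \<and>
    (\<forall>x\<in>M1. \<forall>y\<in>M2. k1 x = k2 y \<longleftrightarrow> x \<in> S \<and> y = \<phi> x) \<and>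
    (\<forall>x\<in>M1. \<pi> (k1 x) = \<pi> x) \<and> (\<forall>x\<in>M2. \<pi> (k2 x) = \<pi> x)"
    using op unfolding lab_SK_op_def by (elim conjE exE) (rule that, intro conjI)
  then have op': "cut_along G M S M1 M2" "G_diffeo G M S M S \<phi>"
    "G_diffeo G M M1 M' (k1 ` M1) k1" "G_diffeo G M M2 M' (k2 ` M2) k2" "k1 ` M1 \<union> k2 ` M2 = mspace M'"
    "\<And>x y. x \<in> M1 \<Longrightarrow> y \<in> M2 \<Longrightarrow> k1 x = k2 y \<longleftrightarrow> x \<in> S \<and> y = \<phi> x"
    "\<And>x. x \<in> M1 \<Longrightarrow> \<pi> (k1 x) = \<pi> x" "\<And>x. x \<in> M2 \<Longrightarrow> \<pi> (k2 x) = \<pi> x"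
    by simp_all
  let ?L = "lift P f \<pi> j"
  note t = transportedD[OF tr] and t' = transportedD[OF tr']
  have SM: "M1 \<union> M2 = mspace M" "M1 \<inter> M2 = S" using op'(1) unfolding cut_along_def by auto
  have \<phi>S: "\<phi> x \<in> S" if "x \<in> S" for x
    using op'(2) diffeoD(3) that unfolding G_diffeo_def by blast
  \<comment> \<open>The pasting condition gives \<open>k1 x = k2 (\<phi> x)\<close>, and both
    embeddings keep labels; only therefore can \<open>\<phi>\<close> be lifted.\<close>
  have \<phi>lab: "\<pi> (\<phi> x) = \<pi> x" if "x \<in> S" for x
  proof -
    have "x \<in> M1" "\<phi> x \<in> M2" using that \<phi>S SM(2) by auto
    then show ?thesis using op'(6)[of x "\<phi> x"] op'(7)[of x] op'(8)[of "\<phi> x"] that by simp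
  qed
  obtain \<Phi> where \<Phi>: "G_diffeo H N (?L S) N (?L S) \<Phi>"
    "\<And>p x. p \<in> P \<Longrightarrow> x \<in> mspace M \<Longrightarrow> \<pi> x = f p \<Longrightarrow> \<Phi> (j p x) = j p (\<phi> x)"
    using lift_G_diffeo[OF C M(1,1) N(1,1) tr tr op'(2) \<phi>lab] by metis
  obtain F1 where F1: "G_diffeo H N (?L M1) N' (lift P f \<pi> j' (k1 ` M1)) F1"
    "\<And>p x. p \<in> P \<Longrightarrow> x \<in> mspace M \<Longrightarrow> \<pi> x = f p \<Longrightarrow> F1 (j p x) = j' p (k1 x)"
    using lift_G_diffeo[OF C M N tr tr' op'(3,7)] by metis
  obtain F2 where F2: "G_diffeo H N (?L M2) N' (lift P f \<pi> j' (k2 ` M2)) F2"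
    "\<And>p x. p \<in> P \<Longrightarrow> x \<in> mspace M \<Longrightarrow> \<pi> x = f p \<Longrightarrow> F2 (j p x) = j' p (k2 x)"
    using lift_G_diffeo[OF C M N tr tr' op'(4,8)] by metis
  have im: "F1 ` ?L M1 = lift P f \<pi> j' (k1 ` M1)" "F2 ` ?L M2 = lift P f \<pi> j' (k2 ` M2)"
    using F1(1) F2(1) diffeoD(3) unfolding G_diffeo_def by blast+
  have kM: "k1 x \<in> mspace M'" if "x \<in> M1" for x using op'(5) that by blast
  have kM': "k2 x \<in> mspace M'" if "x \<in> M2" for x using op'(5) that by blast
  have glue: "F1 x = F2 y \<longleftrightarrow> x \<in> ?L S \<and> y = \<Phi> x" if x: "x \<in> ?L M1" and y: "y \<in> ?L M2" for x y
  proof -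
    obtain p u where p: "p \<in> P" "u \<in> M1" "\<pi> u = f p" "x = j p u" using x by (rule liftE)
    obtain r v where r: "r \<in> P" "v \<in> M2" "\<pi> v = f r" "y = j r v" using y by (rule liftE)
    have uv: "u \<in> mspace M" "v \<in> mspace M" using p(2) r(2) SM by auto
    have "F1 x = F2 y \<longleftrightarrow> j' p (k1 u) = j' r (k2 v)"
      using F1(2)[OF p(1) uv(1) p(3)] F2(2)[OF r(1) uv(2) r(3)] p(4) r(4) by simp
    also have "\<dots> \<longleftrightarrow> p = r \<and> k1 u = k2 v"
      using piecesD(5)[OF t'(1) p(1) r(1), of "k1 u" "k2 v"] kM[OF p(2)] kM'[OF r(2)] op'(7)[OF p(2)] op'(8)[OF r(2)] p(3) r(3)
      by auto
    also have "\<dots> \<longleftrightarrow> u \<in> S \<and> p = r \<and> v = \<phi> u" using op'(6)[OF p(2) r(2)] by auto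
    also have "\<dots> \<longleftrightarrow> u \<in> S \<and> j r v = j p (\<phi> u)"
    proof (cases "u \<in> S")
      case True
      have "\<phi> u \<in> fibre \<pi> M (f p)" using \<phi>S[OF True] \<phi>lab[OF True] SM p(3) by auto
      then show ?thesis using piecesD(5)[OF t(1) r(1) p(1), of v "\<phi> u"] uv(2) r(3) by auto
    qed simp
    also have "\<dots> \<longleftrightarrow> x \<in> ?L S \<and> y = \<Phi> x"
      using lift_iff[OF tr _ p(1) uv(1) p(3), of S] \<Phi>(2)[OF p(1) uv(1) p(3)] SM p(4) r(4) by auto
    finally show ?thesis .
  qed
  have lab: "\<rho> (F1 x) = \<rho> x" if x: "x \<in> ?L M1" for x
  proof -
    obtain p u where p: "p \<in> P" "u \<in> M1" "\<pi> u = f p" "x = j p u" using x by (rule liftE)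
    have u: "u \<in> mspace M" using p(2) SM by auto
    then show ?thesis using F1(2)[OF p(1) u p(3)] t(2)[OF p(1) u p(3)] t'(2)[OF p(1) kM[OF p(2)]] op'(7)[OF p(2)] p by simp
  qed
  have lab': "\<rho> (F2 x) = \<rho> x" if x: "x \<in> ?L M2" for x
  proof -
    obtain p u where p: "p \<in> P" "u \<in> M2" "\<pi> u = f p" "x = j p u" using x by (rule liftE)
    have u: "u \<in> mspace M" using p(2) SM by auto
    then show ?thesis using F2(2)[OF p(1) u p(3)] t(2)[OF p(1) u p(3)] t'(2)[OF p(1) kM'[OF p(2)]] op'(8)[OF p(2)] p by simp
  qed
  have "F1 ` ?L M1 \<union> F2 ` ?L M2 = mspace N'"
    unfolding im using lift_mspace[OF tr'] op'(5) by (simp add: lift_Un[symmetric])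
  then have "\<exists>k1 k2. G_diffeo H N (?L M1) N' (k1 ` ?L M1) k1 \<and> G_diffeo H N (?L M2) N' (k2 ` ?L M2) k2 \<and>
      k1 ` ?L M1 \<union> k2 ` ?L M2 = mspace N' \<and> (\<forall>x\<in>?L M1. \<forall>y\<in>?L M2. k1 x = k2 y \<longleftrightarrow> x \<in> ?L S \<and> y = \<Phi> x) \<and>
      (\<forall>x\<in>?L M1. \<rho> (k1 x) = \<rho> x) \<and> (\<forall>x\<in>?L M2. \<rho> (k2 x) = \<rho> x)"
    using F1(1) F2(1) glue lab lab' by (intro exI[of _ F1] exI[of _ F2]) (simp add: im)
  then show ?thesis unfolding lab_SK_op_def
    using N \<Phi>(1) cut_along_lift[OF C M(1) N(1) tr bd op'(1)] by blast
qed

section \<open>Monoids of isomorphism classes\<close>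

text \<open>The common pattern of labelled manifolds and of spans. Sums exist only up to
  isomorphism, so they are a relation, and uniqueness and invariance become axioms.\<close>

locale object_sums =
  fixes obj :: "'o \<Rightarrow> bool" and iso :: "'o \<Rightarrow> 'o \<Rightarrow> bool" and sum :: "'o \<Rightarrow> 'o \<Rightarrow> 'o \<Rightarrow> bool" and emp :: "'o \<Rightarrow> bool"
  assumes iso_refl: "obj M \<Longrightarrow> iso M M"
    and iso_sym: "obj M \<Longrightarrow> obj N \<Longrightarrow> iso M N \<Longrightarrow> iso N M"
    and iso_trans: "obj M \<Longrightarrow> obj N \<Longrightarrow> obj L \<Longrightarrow> iso M N \<Longrightarrow> iso N L \<Longrightarrow> iso M L"
    and sum_exists: "obj M \<Longrightarrow> obj N \<Longrightarrow> \<exists>L. obj L \<and> sum M N L"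
    and sum_unique: "obj M \<Longrightarrow> obj N \<Longrightarrow> obj L \<Longrightarrow> obj L' \<Longrightarrow> sum M N L \<Longrightarrow> sum M N L' \<Longrightarrow> iso L L'"
    and sum_sym: "sum M N L \<Longrightarrow> sum N M L"
    and sum_iso_left: "obj M \<Longrightarrow> obj M' \<Longrightarrow> obj N \<Longrightarrow> obj L \<Longrightarrow> sum M N L \<Longrightarrow> iso M M' \<Longrightarrow> sum M' N L"
    and sum_iso_right: "obj M \<Longrightarrow> obj N \<Longrightarrow> obj L \<Longrightarrow> obj L' \<Longrightarrow> sum M N L \<Longrightarrow> iso L L' \<Longrightarrow> sum M N L'"
    and sum_assoc: "obj M1 \<Longrightarrow> obj M2 \<Longrightarrow> obj M3 \<Longrightarrow> obj N \<Longrightarrow> obj N' \<Longrightarrow> obj L \<Longrightarrow>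
      sum M1 M2 N \<Longrightarrow> sum N M3 L \<Longrightarrow> sum M2 M3 N' \<Longrightarrow> sum M1 N' L"
    and emp_exists: "\<exists>E. obj E \<and> emp E"
    and sum_emp: "obj M \<Longrightarrow> obj E \<Longrightarrow> emp E \<Longrightarrow> sum E M M"
    and iso_emp: "obj M \<Longrightarrow> obj E \<Longrightarrow> emp E \<Longrightarrow> iso E M \<longleftrightarrow> emp M"
begin

definition cls :: "'o \<Rightarrow> 'o set" where
  "cls M = {N. obj N \<and> iso M N}"

definition class_monoid :: "'o set monoid" where
  "class_monoid = \<lparr>carrier = {cls M | M. obj M},
     mult = (\<lambda>A B. {N. obj N \<and> (\<exists>M1\<in>A. \<exists>M2\<in>B. sum M1 M2 N)}), one = {N. obj N \<and> emp N}\<rparr>"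

lemma cls_eq_iff:
  assumes "obj M" "obj N" shows "cls M = cls N \<longleftrightarrow> iso M N"
proof
  assume "cls M = cls N"
  then show "iso M N" using iso_refl[OF assms(2)] assms(2) unfolding cls_def by blast
next
  assume MN: "iso M N"
  show "cls M = cls N" unfolding cls_def
  proof (rule Collect_cong)
    fix L show "(obj L \<and> iso M L) = (obj L \<and> iso N L)"
      using iso_trans[of N M L] iso_trans[of M N L] iso_sym[OF assms MN] MN assms by blast
  qed
qed

lemma cls_in_carrier: "obj M \<Longrightarrow> cls M \<in> carrier class_monoid"
  unfolding class_monoid_def by auto

lemma carrierE:
  assumes "A \<in> carrier class_monoid" obtains M where "obj M" "A = cls M"
  using assms unfolding class_monoid_def by auto

text \<open>Invariance in each variable moves a sum of other representatives back to
  \<open>M1\<close> and \<open>M2\<close>, where uniqueness applies; conversely every object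
  isomorphic to \<open>N\<close> is itself a sum of \<open>M1\<close> and \<open>M2\<close>.\<close>

lemma mult_cls:
  assumes o: "obj M1" "obj M2" "obj N" and s: "sum M1 M2 N"
  shows "cls M1 \<otimes>\<^bsub>class_monoid\<^esub> cls M2 = cls N"
proof -
  have "obj L \<and> (\<exists>M1'\<in>cls M1. \<exists>M2'\<in>cls M2. sum M1' M2' L) \<longleftrightarrow> obj L \<and> iso N L" for L
  proof (intro conj_cong refl iffI)
    assume L: "obj L" and "\<exists>M1'\<in>cls M1. \<exists>M2'\<in>cls M2. sum M1' M2' L"
    then obtain M1' M2' where M': "obj M1'" "iso M1 M1'" "obj M2'" "iso M2 M2'" "sum M1' M2' L"
      unfolding cls_def by blast
    have "sum M1' M2 N" by (rule sum_iso_left[OF o(1) M'(1) o(2,3) s M'(2)])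
    then have "sum M2' M1' N" by (rule sum_iso_left[OF o(2) M'(3) M'(1) o(3) sum_sym M'(4)])
    then have "sum M1' M2' N" by (rule sum_sym)
    then show "iso N L" by (rule sum_unique[OF M'(1,3) o(3) L _ M'(5)])
  next
    assume L: "obj L" and "iso N L"
    then have "sum M1 M2 L" using sum_iso_right[OF o L s] by blast
    then show "\<exists>M1'\<in>cls M1. \<exists>M2'\<in>cls M2. sum M1' M2' L"
      using iso_refl[OF o(1)] iso_refl[OF o(2)] o unfolding cls_def by blast
  qed
  then show ?thesis unfolding class_monoid_def cls_def[of N] by simp
qed

lemma one_cls: "obj E \<Longrightarrow> emp E \<Longrightarrow> \<one>\<^bsub>class_monoid\<^esub> = cls E"
  unfolding class_monoid_def cls_def using iso_emp[of _ E] by auto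

lemma comm_monoid_class: "comm_monoid class_monoid"
proof (rule comm_monoidI)
  obtain E where E: "obj E" "emp E" using emp_exists by blast
  show "\<one>\<^bsub>class_monoid\<^esub> \<in> carrier class_monoid" using one_cls[OF E] cls_in_carrier[OF E(1)] by simp
  fix A assume "A \<in> carrier class_monoid"
  then obtain M where M: "obj M" "A = cls M" by (rule carrierE)
  show "\<one>\<^bsub>class_monoid\<^esub> \<otimes>\<^bsub>class_monoid\<^esub> A = A"
    using one_cls[OF E] M mult_cls[OF E(1) M(1) M(1) sum_emp[OF M(1) E]] by simp
  fix B assume "B \<in> carrier class_monoid"
  then obtain N where N: "obj N" "B = cls N" by (rule carrierE)
  obtain L where L: "obj L" "sum M N L" using sum_exists M N by blast
  have AB: "A \<otimes>\<^bsub>class_monoid\<^esub> B = cls L" using mult_cls[OF M(1) N(1) L] M N by simp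
  show "A \<otimes>\<^bsub>class_monoid\<^esub> B \<in> carrier class_monoid" using AB cls_in_carrier[OF L(1)] by simp
  show "A \<otimes>\<^bsub>class_monoid\<^esub> B = B \<otimes>\<^bsub>class_monoid\<^esub> A"
    using AB mult_cls[OF N(1) M(1) L(1) sum_sym[OF L(2)]] M N by simp
  fix C assume "C \<in> carrier class_monoid"
  then obtain K where K: "obj K" "C = cls K" by (rule carrierE)
  obtain Q where Q: "obj Q" "sum L K Q" using sum_exists L K by blast
  obtain R where R: "obj R" "sum N K R" using sum_exists N K by blast
  show "A \<otimes>\<^bsub>class_monoid\<^esub> B \<otimes>\<^bsub>class_monoid\<^esub> C = A \<otimes>\<^bsub>class_monoid\<^esub> (B \<otimes>\<^bsub>class_monoid\<^esub> C)"
    using AB mult_cls[OF L(1) K(1) Q] mult_cls[OF N(1) K(1) R]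
      mult_cls[OF M(1) R(1) Q(1) sum_assoc[OF M(1) N(1) K(1) L(1) R(1) Q(1) L(2) Q(2) R(2)]] M N K by simp
qed

end

section \<open>Group completion and its quotients\<close>

text \<open>Evaluation at an arbitrary representing pair; additivity of \<open>\<phi>\<close> makes
  the choice immaterial.\<close>

definition completion_lift :: "('v, 'w) monoid_scheme \<Rightarrow> ('a \<Rightarrow> 'v) \<Rightarrow> ('a \<times> 'a) set \<Rightarrow> 'v" where
  "completion_lift B \<phi> P = (let (a, b) = (SOME p. p \<in> P) in \<phi> a \<otimes>\<^bsub>B\<^esub> inv\<^bsub>B\<^esub> \<phi> b)"

context comm_monoid
begin

lemma equiv_completion_rel: "equiv (carrier G \<times> carrier G) (completion_rel G)"
proof (rule equivI)
  show "completion_rel G \<subseteq> (carrier G \<times> carrier G) \<times> carrier G \<times> carrier G"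
    unfolding completion_rel_def by auto
  show "refl_on (carrier G \<times> carrier G) (completion_rel G)"
    unfolding refl_on_def completion_rel_def by auto
  show "sym (completion_rel G)"
    unfolding sym_def completion_rel_def by (auto dest: sym)
  show "trans (completion_rel G)"
  proof (rule transI)
    fix p q r assume "(p, q) \<in> completion_rel G" "(q, r) \<in> completion_rel G"
    then obtain a b c d e f k l where *: "p = (a, b)" "q = (c, d)" "r = (e, f)"
      and [simp]: "a \<in> carrier G" "b \<in> carrier G" "c \<in> carrier G" "d \<in> carrier G" "e \<in> carrier G" "f \<in> carrier G"
        "k \<in> carrier G" "l \<in> carrier G"
      and k: "a \<otimes> d \<otimes> k = c \<otimes> b \<otimes> k" and l: "c \<otimes> f \<otimes> l = e \<otimes> d \<otimes> l"
      unfolding completion_rel_def by auto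
    \<comment> \<open>Without cancellation the middle term \<open>d\<close> cannot be removed, so it
      becomes part of the witness.\<close>
    have "a \<otimes> f \<otimes> (d \<otimes> k \<otimes> l) = (a \<otimes> d \<otimes> k) \<otimes> (f \<otimes> l)" by (simp add: m_ac)
    also have "\<dots> = (c \<otimes> f \<otimes> l) \<otimes> (b \<otimes> k)" unfolding k by (simp add: m_ac)
    also have "\<dots> = e \<otimes> b \<otimes> (d \<otimes> k \<otimes> l)" unfolding l by (simp add: m_ac)
    finally have "\<exists>m\<in>carrier G. a \<otimes> f \<otimes> m = e \<otimes> b \<otimes> m" by (intro bexI[of _ "d \<otimes> k \<otimes> l"]) auto
    then show "(p, r) \<in> completion_rel G" unfolding completion_rel_def * by simp
  qed
qed

lemma formal_diff_eq_iff:
  assumes "a \<in> carrier G" "b \<in> carrier G" "c \<in> carrier G" "d \<in> carrier G"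
  shows "formal_diff G a b = formal_diff G c d \<longleftrightarrow> (\<exists>k\<in>carrier G. a \<otimes> d \<otimes> k = c \<otimes> b \<otimes> k)"
  using eq_equiv_class_iff[OF equiv_completion_rel, of "(a, b)" "(c, d)"] assms
  unfolding formal_diff_def by (auto simp: completion_rel_def)

lemma formal_diff_in_carrier:
  "a \<in> carrier G \<Longrightarrow> b \<in> carrier G \<Longrightarrow> formal_diff G a b \<in> carrier (group_completion G)"
  unfolding formal_diff_def group_completion_def by (simp add: quotientI)

lemma completion_cases:
  assumes "P \<in> carrier (group_completion G)"
  obtains a b where "a \<in> carrier G" "b \<in> carrier G" "P = formal_diff G a b"
  using assms unfolding group_completion_def formal_diff_def by (auto elim: quotientE)

lemma mem_formal_diff:
  assumes "(a', b') \<in> formal_diff G a b" "a \<in> carrier G" "b \<in> carrier G"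
  shows "a' \<in> carrier G" "b' \<in> carrier G" "formal_diff G a' b' = formal_diff G a b"
proof -
  have r: "((a, b), (a', b')) \<in> completion_rel G" using assms(1) unfolding formal_diff_def by simp
  then show "a' \<in> carrier G" "b' \<in> carrier G" unfolding completion_rel_def by auto
  show "formal_diff G a' b' = formal_diff G a b"
    using equiv_class_eq[OF equiv_completion_rel r] unfolding formal_diff_def by simp
qed

lemma self_mem_formal_diff: "a \<in> carrier G \<Longrightarrow> b \<in> carrier G \<Longrightarrow> (a, b) \<in> formal_diff G a b"
  unfolding formal_diff_def using equiv_class_self[OF equiv_completion_rel, of "(a, b)"] by simp

lemma mult_formal_diff:
  assumes [simp]: "a \<in> carrier G" "b \<in> carrier G" "c \<in> carrier G" "d \<in> carrier G"
  shows "formal_diff G a b \<otimes>\<^bsub>group_completion G\<^esub> formal_diff G c d = formal_diff G (a \<otimes> c) (b \<otimes> d)"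
proof -
  have "formal_diff G (a' \<otimes> c') (b' \<otimes> d') = formal_diff G (a \<otimes> c) (b \<otimes> d)"
    if "(a', b') \<in> formal_diff G a b" "(c', d') \<in> formal_diff G c d" for a' b' c' d'
  proof -
    note m = mem_formal_diff[OF that(1)] mem_formal_diff[OF that(2)]
    have [simp]: "a' \<in> carrier G" "b' \<in> carrier G" "c' \<in> carrier G" "d' \<in> carrier G" using m by auto
    obtain k l where [simp]: "k \<in> carrier G" "l \<in> carrier G"
      and k: "a' \<otimes> b \<otimes> k = a \<otimes> b' \<otimes> k" and l: "c' \<otimes> d \<otimes> l = c \<otimes> d' \<otimes> l"
      using m(3,6) formal_diff_eq_iff by auto
    have "a' \<otimes> c' \<otimes> (b \<otimes> d) \<otimes> (k \<otimes> l) = (a' \<otimes> b \<otimes> k) \<otimes> (c' \<otimes> d \<otimes> l)" by (simp add: m_ac)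
    also have "\<dots> = a \<otimes> c \<otimes> (b' \<otimes> d') \<otimes> (k \<otimes> l)" unfolding k l by (simp add: m_ac)
    finally show ?thesis using formal_diff_eq_iff[of "a' \<otimes> c'" "b' \<otimes> d'" "a \<otimes> c" "b \<otimes> d"]
      by (auto intro!: bexI[of _ "k \<otimes> l"])
  qed
  then have "(\<Union>(a', b')\<in>formal_diff G a b. \<Union>(c', d')\<in>formal_diff G c d. formal_diff G (a' \<otimes> c') (b' \<otimes> d'))
      = (\<Union>(a', b')\<in>formal_diff G a b. \<Union>(c', d')\<in>formal_diff G c d. formal_diff G (a \<otimes> c) (b \<otimes> d))"
    by (intro SUP_cong refl) (auto split: prod.splits)
  also have "\<dots> = formal_diff G (a \<otimes> c) (b \<otimes> d)"
    using self_mem_formal_diff[of a b] self_mem_formal_diff[of c d] by auto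
  finally show ?thesis unfolding group_completion_def by simp
qed

lemma one_completion: "\<one>\<^bsub>group_completion G\<^esub> = formal_diff G \<one> \<one>"
  unfolding group_completion_def by simp

lemma comm_group_completion: "comm_group (group_completion G)"
proof (rule comm_groupI)
  fix P assume "P \<in> carrier (group_completion G)"
  then obtain a b where P: "a \<in> carrier G" "b \<in> carrier G" "P = formal_diff G a b" by (rule completion_cases)
  show "\<one>\<^bsub>group_completion G\<^esub> \<otimes>\<^bsub>group_completion G\<^esub> P = P" using P by (simp add: one_completion mult_formal_diff)
  have "formal_diff G b a \<otimes>\<^bsub>group_completion G\<^esub> P = \<one>\<^bsub>group_completion G\<^esub>"
    using P by (auto simp: one_completion mult_formal_diff formal_diff_eq_iff m_ac intro!: bexI[of _ \<one>])
  then show "\<exists>Q\<in>carrier (group_completion G). Q \<otimes>\<^bsub>group_completion G\<^esub> P = \<one>\<^bsub>group_completion G\<^esub>"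
    using formal_diff_in_carrier P by blast
  fix Q assume "Q \<in> carrier (group_completion G)"
  then obtain c d where Q: "c \<in> carrier G" "d \<in> carrier G" "Q = formal_diff G c d" by (rule completion_cases)
  show "P \<otimes>\<^bsub>group_completion G\<^esub> Q \<in> carrier (group_completion G)"
    using P Q by (simp add: mult_formal_diff formal_diff_in_carrier)
  show "P \<otimes>\<^bsub>group_completion G\<^esub> Q = Q \<otimes>\<^bsub>group_completion G\<^esub> P"
    using P Q by (simp add: mult_formal_diff m_comm)
  fix R assume "R \<in> carrier (group_completion G)"
  then obtain e f where R: "e \<in> carrier G" "f \<in> carrier G" "R = formal_diff G e f" by (rule completion_cases)
  show "P \<otimes>\<^bsub>group_completion G\<^esub> Q \<otimes>\<^bsub>group_completion G\<^esub> R = P \<otimes>\<^bsub>group_completion G\<^esub> (Q \<otimes>\<^bsub>group_completion G\<^esub> R)"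
    using P Q R by (simp add: mult_formal_diff m_assoc)
qed (simp add: one_completion formal_diff_in_carrier)

lemma completion_of_in_carrier: "a \<in> carrier G \<Longrightarrow> completion_of G a \<in> carrier (group_completion G)"
  unfolding completion_of_def by (simp add: formal_diff_in_carrier)

lemma completion_of_mult:
  "a \<in> carrier G \<Longrightarrow> b \<in> carrier G \<Longrightarrow>
    completion_of G (a \<otimes> b) = completion_of G a \<otimes>\<^bsub>group_completion G\<^esub> completion_of G b"
  unfolding completion_of_def by (simp add: mult_formal_diff)

lemma formal_diff_conv:
  assumes [simp]: "a \<in> carrier G" "b \<in> carrier G"
  shows "formal_diff G a b = completion_of G a \<otimes>\<^bsub>group_completion G\<^esub> inv\<^bsub>group_completion G\<^esub> completion_of G b"
proof -
  interpret C: comm_group "group_completion G" by (rule comm_group_completion)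
  have "formal_diff G a b \<otimes>\<^bsub>group_completion G\<^esub> completion_of G b = completion_of G a"
    by (auto simp: completion_of_def mult_formal_diff formal_diff_eq_iff m_ac intro!: bexI[of _ \<one>])
  then show ?thesis
    using C.inv_solve_right formal_diff_in_carrier completion_of_in_carrier assms by metis
qed

lemma completion_lift:
  assumes B: "comm_group B" and \<phi>: "\<And>a. a \<in> carrier G \<Longrightarrow> \<phi> a \<in> carrier B"
    "\<And>a b. a \<in> carrier G \<Longrightarrow> b \<in> carrier G \<Longrightarrow> \<phi> (a \<otimes> b) = \<phi> a \<otimes>\<^bsub>B\<^esub> \<phi> b"
  shows "a \<in> carrier G \<Longrightarrow> b \<in> carrier G \<Longrightarrow> completion_lift B \<phi> (formal_diff G a b) = \<phi> a \<otimes>\<^bsub>B\<^esub> inv\<^bsub>B\<^esub> \<phi> b"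
    "completion_lift B \<phi> \<in> hom (group_completion G) B"
    "a \<in> carrier G \<Longrightarrow> completion_lift B \<phi> (completion_of G a) = \<phi> a"
proof -
  interpret B: comm_group B by fact
  \<comment> \<open>Multiplicativity makes \<open>\<phi> \<one>\<close> idempotent, hence trivial in
    a group.\<close>
  have one: "\<phi> \<one> = \<one>\<^bsub>B\<^esub>"
    using \<phi>(2)[of \<one> \<one>] \<phi>(1)[of \<one>] B.l_cancel_one[of "\<phi> \<one>" "\<phi> \<one>"] by simp
  show 1: "completion_lift B \<phi> (formal_diff G a b) = \<phi> a \<otimes>\<^bsub>B\<^esub> inv\<^bsub>B\<^esub> \<phi> b"
    if ab: "a \<in> carrier G" "b \<in> carrier G" for a b
  proof -
    obtain c d where cd: "(SOME p. p \<in> formal_diff G a b) = (c, d)" by (cases "SOME p. p \<in> formal_diff G a b")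
    have "(c, d) \<in> formal_diff G a b"
      unfolding cd[symmetric] using self_mem_formal_diff[OF ab] by (rule someI)
    note m = mem_formal_diff[OF this ab]
    obtain k where k: "k \<in> carrier G" "c \<otimes> b \<otimes> k = a \<otimes> d \<otimes> k" using m ab formal_diff_eq_iff by auto
    then have "\<phi> c \<otimes>\<^bsub>B\<^esub> \<phi> b \<otimes>\<^bsub>B\<^esub> \<phi> k = \<phi> a \<otimes>\<^bsub>B\<^esub> \<phi> d \<otimes>\<^bsub>B\<^esub> \<phi> k"
      using \<phi> m(1,2) ab by (metis m_closed)
    then have "\<phi> c \<otimes>\<^bsub>B\<^esub> \<phi> b = \<phi> a \<otimes>\<^bsub>B\<^esub> \<phi> d" using \<phi>(1) m(1,2) ab k(1) by simp
    then have "\<phi> c \<otimes>\<^bsub>B\<^esub> \<phi> b \<otimes>\<^bsub>B\<^esub> (inv\<^bsub>B\<^esub> \<phi> b \<otimes>\<^bsub>B\<^esub> inv\<^bsub>B\<^esub> \<phi> d) =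
        \<phi> a \<otimes>\<^bsub>B\<^esub> \<phi> d \<otimes>\<^bsub>B\<^esub> (inv\<^bsub>B\<^esub> \<phi> d \<otimes>\<^bsub>B\<^esub> inv\<^bsub>B\<^esub> \<phi> b)"
      using \<phi>(1) m(1,2) ab by (simp add: B.m_comm)
    moreover have "x \<otimes>\<^bsub>B\<^esub> y \<otimes>\<^bsub>B\<^esub> (inv\<^bsub>B\<^esub> y \<otimes>\<^bsub>B\<^esub> z) = x \<otimes>\<^bsub>B\<^esub> z"
      if "x \<in> carrier B" "y \<in> carrier B" "z \<in> carrier B" for x y z
      using that B.m_assoc[of y "inv\<^bsub>B\<^esub> y" z] B.m_assoc[of x y "inv\<^bsub>B\<^esub> y \<otimes>\<^bsub>B\<^esub> z"] by simp
    ultimately have "\<phi> c \<otimes>\<^bsub>B\<^esub> inv\<^bsub>B\<^esub> \<phi> d = \<phi> a \<otimes>\<^bsub>B\<^esub> inv\<^bsub>B\<^esub> \<phi> b"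
      using \<phi>(1) m(1,2) ab by simp
    then show ?thesis unfolding completion_lift_def cd by simp
  qed
  show "completion_lift B \<phi> \<in> hom (group_completion G) B"
  proof (rule homI)
    fix P assume "P \<in> carrier (group_completion G)"
    then obtain a b where P: "a \<in> carrier G" "b \<in> carrier G" "P = formal_diff G a b" by (rule completion_cases)
    then show "completion_lift B \<phi> P \<in> carrier B" using \<phi>(1) 1 by simp
    fix Q assume "Q \<in> carrier (group_completion G)"
    then obtain c d where Q: "c \<in> carrier G" "d \<in> carrier G" "Q = formal_diff G c d" by (rule completion_cases)
    show "completion_lift B \<phi> (P \<otimes>\<^bsub>group_completion G\<^esub> Q) = completion_lift B \<phi> P \<otimes>\<^bsub>B\<^esub> completion_lift B \<phi> Q"
      using P Q 1 \<phi> by (simp add: mult_formal_diff B.inv_mult B.m_ac)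
  qed
  show "completion_lift B \<phi> (completion_of G a) = \<phi> a" if "a \<in> carrier G"
    using 1[OF that one_closed] one \<phi>(1)[OF that] by (simp add: completion_of_def)
qed

end

text \<open>The construction of the SK group for an arbitrary monoid and an arbitrary set of
  relations; it isolates the universal property from the geometry.\<close>

definition rel_quot :: "('a, 'b) monoid_scheme \<Rightarrow> ('a \<times> 'a) set \<Rightarrow> ('a \<times> 'a) set set monoid" where
  "rel_quot A R = group_completion A Mod generate (group_completion A) {formal_diff A a b | a b. (a, b) \<in> R}"

definition quot_elem :: "('a, 'b) monoid_scheme \<Rightarrow> ('a \<times> 'a) set \<Rightarrow> 'a \<Rightarrow> ('a \<times> 'a) set set" where
  "quot_elem A R a =
     generate (group_completion A) {formal_diff A a b | a b. (a, b) \<in> R} #>\<^bsub>group_completion A\<^esub> completion_of A a"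

context
  fixes A :: "('a, 'b) monoid_scheme" and R :: "('a \<times> 'a) set"
  assumes A: "comm_monoid A" and R: "R \<subseteq> carrier A \<times> carrier A"
begin

interpretation A: comm_monoid A by (rule A)
interpretation C: comm_group "group_completion A" by (rule A.comm_group_completion)

private definition "Ker = generate (group_completion A) {formal_diff A a b | a b. (a, b) \<in> R}"

private lemma relators: "{formal_diff A a b | a b. (a, b) \<in> R} \<subseteq> carrier (group_completion A)"
  using R A.formal_diff_in_carrier by auto

private lemma normal_Ker: "Ker \<lhd> group_completion A"
  unfolding Ker_def using C.generate_is_subgroup[OF relators] by (simp add: C.subgroup_imp_normal)

private lemma quot_conv: "rel_quot A R = group_completion A Mod Ker" "quot_elem A R a = Ker #>\<^bsub>group_completion A\<^esub> completion_of A a"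
  unfolding rel_quot_def quot_elem_def Ker_def by simp_all

lemma comm_group_quot: "comm_group (rel_quot A R)"
  unfolding quot_conv by (rule C.abelian_FactGroup) (use normal_Ker normal_imp_subgroup in blast)

lemma quot_elem_in_carrier: "a \<in> carrier A \<Longrightarrow> quot_elem A R a \<in> carrier (rel_quot A R)"
  unfolding quot_conv carrier_FactGroup using A.completion_of_in_carrier by blast

lemma quot_elem_mult:
  "a \<in> carrier A \<Longrightarrow> b \<in> carrier A \<Longrightarrow> quot_elem A R (a \<otimes>\<^bsub>A\<^esub> b) = quot_elem A R a \<otimes>\<^bsub>rel_quot A R\<^esub> quot_elem A R b"
  unfolding quot_conv mult_FactGroup
  by (simp add: A.completion_of_mult A.completion_of_in_carrier normal.rcos_sum[OF normal_Ker])

private lemma coset_hom: "(\<lambda>x. Ker #>\<^bsub>group_completion A\<^esub> x) \<in> hom (group_completion A) (group_completion A Mod Ker)"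
  by (rule normal.r_coset_hom_Mod[OF normal_Ker])

lemma quot_cases:
  assumes "x \<in> carrier (rel_quot A R)"
  obtains a b where "a \<in> carrier A" "b \<in> carrier A"
    "x = quot_elem A R a \<otimes>\<^bsub>rel_quot A R\<^esub> inv\<^bsub>rel_quot A R\<^esub> quot_elem A R b"
proof -
  obtain y where y: "y \<in> carrier (group_completion A)" "x = Ker #>\<^bsub>group_completion A\<^esub> y"
    using assms unfolding quot_conv carrier_FactGroup by auto
  obtain a b where ab: "a \<in> carrier A" "b \<in> carrier A" "y = formal_diff A a b" using A.completion_cases[OF y(1)] .
  interpret Q: comm_group "group_completion A Mod Ker" using comm_group_quot unfolding quot_conv .
  interpret h: group_hom "group_completion A" "group_completion A Mod Ker" "\<lambda>x. Ker #>\<^bsub>group_completion A\<^esub> x"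
    by unfold_locales (rule coset_hom)
  have "x = (Ker #>\<^bsub>group_completion A\<^esub> completion_of A a) \<otimes>\<^bsub>group_completion A Mod Ker\<^esub>
      inv\<^bsub>group_completion A Mod Ker\<^esub> (Ker #>\<^bsub>group_completion A\<^esub> completion_of A b)"
    using y(2) ab A.completion_of_in_carrier by (simp add: A.formal_diff_conv)
  then show thesis using that ab unfolding quot_conv by blast
qed

lemma quot_elem_rel:
  assumes "(a, b) \<in> R" shows "quot_elem A R a = quot_elem A R b"
proof -
  have ab: "a \<in> carrier A" "b \<in> carrier A" using assms R by auto
  interpret N: normal Ker "group_completion A" by (rule normal_Ker)
  have "formal_diff A a b \<in> Ker" unfolding Ker_def using assms by (auto intro: generate.incl)
  then have "completion_of A a \<otimes>\<^bsub>group_completion A\<^esub> inv\<^bsub>group_completion A\<^esub> completion_of A b \<in> Ker"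
    using A.formal_diff_conv[OF ab] by simp
  then show ?thesis unfolding quot_conv
    using ab A.completion_of_in_carrier C.repr_independence[OF _ _ N.subgroup_axioms]
      N.rcos_module_rev C.is_group by (metis N.rcos_module C.group_axioms)
qed

lemma quot_lift:
  assumes B: "comm_group B" and \<phi>: "\<And>a. a \<in> carrier A \<Longrightarrow> \<phi> a \<in> carrier B"
    "\<And>a b. a \<in> carrier A \<Longrightarrow> b \<in> carrier A \<Longrightarrow> \<phi> (a \<otimes>\<^bsub>A\<^esub> b) = \<phi> a \<otimes>\<^bsub>B\<^esub> \<phi> b"
    and rel: "\<And>a b. (a, b) \<in> R \<Longrightarrow> \<phi> a = \<phi> b"
  shows "\<exists>h\<in>hom (rel_quot A R) B. \<forall>a\<in>carrier A. h (quot_elem A R a) = \<phi> a"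
proof -
  interpret B: comm_group B by (rule B)
  let ?\<Phi> = "completion_lift B \<phi>"
  note L = A.completion_lift[of B \<phi>, OF B \<phi>]
  interpret \<Phi>: group_hom "group_completion A" B ?\<Phi> by unfold_locales (rule L(2))
  interpret N: normal Ker "group_completion A" by (rule normal_Ker)
  have "Ker \<subseteq> kernel (group_completion A) B ?\<Phi>"
    unfolding Ker_def
  proof (rule C.generate_subgroup_incl[OF _ \<Phi>.subgroup_kernel])
    show "{formal_diff A a b | a b. (a, b) \<in> R} \<subseteq> kernel (group_completion A) B ?\<Phi>"
    proof
      fix z assume z: "z \<in> {formal_diff A a b | a b. (a, b) \<in> R}"
      then obtain a b where ab: "(a, b) \<in> R" "z = formal_diff A a b" by blast
      then have "a \<in> carrier A" "b \<in> carrier A" using R by auto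
      then have "?\<Phi> z = \<one>\<^bsub>B\<^esub>" using L(1) ab rel[OF ab(1)] \<phi>(1) by simp
      then show "z \<in> kernel (group_completion A) B ?\<Phi>" using z relators by (auto simp: kernel_def)
    qed
  qed
  then have ker: "?\<Phi> z = \<one>\<^bsub>B\<^esub>" if "z \<in> Ker" for z using that by (auto simp: kernel_def)
  have im: "?\<Phi> ` (Ker #>\<^bsub>group_completion A\<^esub> x) = {?\<Phi> x}" if x: "x \<in> carrier (group_completion A)" for x
  proof -
    have "?\<Phi> y = ?\<Phi> x" if "y \<in> Ker #>\<^bsub>group_completion A\<^esub> x" for y
    proof -
      obtain z where z: "z \<in> Ker" "y = z \<otimes>\<^bsub>group_completion A\<^esub> x" using \<open>y \<in> _\<close> unfolding r_coset_def by blast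
      then have "?\<Phi> y = ?\<Phi> z \<otimes>\<^bsub>B\<^esub> ?\<Phi> x" using x N.mem_carrier by simp
      then show ?thesis using ker[OF z(1)] \<Phi>.hom_closed[OF x] by simp
    qed
    then have "?\<Phi> ` (Ker #>\<^bsub>group_completion A\<^esub> x) \<subseteq> {?\<Phi> x}" by (intro image_subsetI) simp
    moreover have "Ker #>\<^bsub>group_completion A\<^esub> x \<noteq> {}" using C.rcos_self[OF x N.subgroup_axioms] by blast
    then have "?\<Phi> ` (Ker #>\<^bsub>group_completion A\<^esub> x) \<noteq> {}" by simp
    ultimately show ?thesis by (metis subset_singletonD)
  qed
  \<comment> \<open>By \<open>im\<close> the image of a coset is a singleton, so its only element is
    the value.\<close>
  define h where "h X = the_elem (?\<Phi> ` X)" for X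
  have h: "h (Ker #>\<^bsub>group_completion A\<^esub> x) = ?\<Phi> x" if "x \<in> carrier (group_completion A)" for x
    unfolding h_def im[OF that] by simp
  have "h \<in> hom (rel_quot A R) B"
  proof (rule homI)
    fix x assume "x \<in> carrier (rel_quot A R)"
    then obtain x' where x: "x' \<in> carrier (group_completion A)" "x = Ker #>\<^bsub>group_completion A\<^esub> x'"
      unfolding quot_conv carrier_FactGroup by auto
    then show "h x \<in> carrier B" using h by simp
    fix y assume "y \<in> carrier (rel_quot A R)"
    then obtain y' where y: "y' \<in> carrier (group_completion A)" "y = Ker #>\<^bsub>group_completion A\<^esub> y'"
      unfolding quot_conv carrier_FactGroup by auto
    show "h (x \<otimes>\<^bsub>rel_quot A R\<^esub> y) = h x \<otimes>\<^bsub>B\<^esub> h y"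
      unfolding quot_conv mult_FactGroup using x y h by (simp add: N.rcos_sum)
  qed
  moreover have "\<forall>a\<in>carrier A. h (quot_elem A R a) = \<phi> a"
    unfolding quot_conv using h A.completion_of_in_carrier L(3) by simp
  ultimately show ?thesis by blast
qed

text \<open>Every element of the quotient is a difference of two elements coming from the
  monoid.\<close>

lemma quot_hom_eq:
  assumes B: "group B" and h: "h \<in> hom (rel_quot A R) B" "h' \<in> hom (rel_quot A R) B"
    and eq: "\<And>a. a \<in> carrier A \<Longrightarrow> h (quot_elem A R a) = h' (quot_elem A R a)" and x: "x \<in> carrier (rel_quot A R)"
  shows "h x = h' x"
proof -
  interpret Q: comm_group "rel_quot A R" by (rule comm_group_quot)
  interpret B: group B by (rule B)
  interpret h: group_hom "rel_quot A R" B h by unfold_locales (rule h(1))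
  interpret h': group_hom "rel_quot A R" B h' by unfold_locales (rule h(2))
  obtain a b where ab: "a \<in> carrier A" "b \<in> carrier A"
    "x = quot_elem A R a \<otimes>\<^bsub>rel_quot A R\<^esub> inv\<^bsub>rel_quot A R\<^esub> quot_elem A R b" using quot_cases[OF x] .
  then show ?thesis using eq quot_elem_in_carrier by simp
qed

end

section \<open>SK groups of labelled manifolds\<close>

definition is_empty_mfd :: "('a, 'z) smfd_scheme \<Rightarrow> bool" where
  "is_empty_mfd E \<longleftrightarrow> mspace E = {}"

abbreviation lab_cls :: "nat \<Rightarrow> ('g, 'b) monoid_scheme \<Rightarrow> ('g, 'x) gset \<Rightarrow> (real \<Rightarrow> 'x) \<Rightarrow> 'g mfd \<Rightarrow> 'g mfd set" where
  "lab_cls n G X \<pi> \<equiv> object_sums.cls (lab_mfd n G X \<pi>) (lab_iso G \<pi>)"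

abbreviation lab_monoid :: "nat \<Rightarrow> ('g, 'b) monoid_scheme \<Rightarrow> ('g, 'x) gset \<Rightarrow> (real \<Rightarrow> 'x) \<Rightarrow> 'g mfd set monoid" where
  "lab_monoid n G X \<pi> \<equiv>
     object_sums.class_monoid (lab_mfd n G X \<pi>) (lab_iso G \<pi>) (lab_sum G \<pi>) is_empty_mfd"

text \<open>The disjunction of both directions copies \<open>SK_equivalent\<close>, so that over a
  point the relators agree literally.\<close>

definition lab_SK_rel ::
  "nat \<Rightarrow> ('g, 'b) monoid_scheme \<Rightarrow> ('g, 'x) gset \<Rightarrow> (real \<Rightarrow> 'x) \<Rightarrow> ('g mfd set \<times> 'g mfd set) set" where
  "lab_SK_rel n G X \<pi> = {(lab_cls n G X \<pi> M, lab_cls n G X \<pi> N) | M N.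
     lab_mfd n G X \<pi> M \<and> lab_mfd n G X \<pi> N \<and>
     ((lab_SK_op n G X \<pi>)\<^sup>*\<^sup>* M N \<or> (lab_SK_op n G X \<pi>)\<^sup>*\<^sup>* N M)}"

definition lab_SK :: "nat \<Rightarrow> ('g, 'b) monoid_scheme \<Rightarrow> ('g, 'x) gset \<Rightarrow> (real \<Rightarrow> 'x) \<Rightarrow> 'g sk monoid" where
  "lab_SK n G X \<pi> = rel_quot (lab_monoid n G X \<pi>) (lab_SK_rel n G X \<pi>)"

definition lab_elem :: "nat \<Rightarrow> ('g, 'b) monoid_scheme \<Rightarrow> ('g, 'x) gset \<Rightarrow> (real \<Rightarrow> 'x) \<Rightarrow> 'g mfd \<Rightarrow> ('g mfd set \<times> 'g mfd set) set set" where
  "lab_elem n G X \<pi> M = quot_elem (lab_monoid n G X \<pi>) (lab_SK_rel n G X \<pi>) (lab_cls n G X \<pi> M)"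

locale labelling =
  fixes n :: nat and G :: "('g, 'b) monoid_scheme" and X :: "('g, 'x) gset" and \<pi> :: "real \<Rightarrow> 'x"
  assumes gset: "finite_gset G X" and ample: "ample X \<pi>"
begin

sublocale S: object_sums "lab_mfd n G X \<pi>" "lab_iso G \<pi>" "lab_sum G \<pi>" is_empty_mfd
proof (unfold_locales, goal_cases)
  case 1 then show ?case by (rule lab_iso_refl)
next
  case 2 then show ?case by (rule lab_iso_sym)
next
  case 3 then show ?case by (rule lab_iso_trans)
next
  case 4 then show ?case by (rule lab_sum_exists[OF gset ample])
next
  case 5 then show ?case by (rule lab_sum_unique)
next
  case 6 then show ?case by (rule lab_sum_sym)
next
  case 7 then show ?case by - (rule lab_sum_iso_left)
next
  case 8 then show ?case by - (rule lab_sum_iso_right)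
next
  case 9 then show ?case by - (rule lab_sum_assoc)
next
  case 10 show ?case
    using lab_mfd_empty[OF finite_gsetD(2)[OF gset]] by (intro exI[of _ "empty_mfd n"]) (simp add: empty_mfd_def is_empty_mfd_def)
next
  case 11 then show ?case unfolding is_empty_mfd_def by (rule lab_sum_empty)
next
  case 12 then show ?case unfolding is_empty_mfd_def by (rule lab_iso_empty)
qed

lemma rel_subset: "lab_SK_rel n G X \<pi> \<subseteq> carrier (lab_monoid n G X \<pi>) \<times> carrier (lab_monoid n G X \<pi>)"
  unfolding lab_SK_rel_def using S.cls_in_carrier by auto

lemma comm_group_lab_SK: "comm_group (lab_SK n G X \<pi>)"
  unfolding lab_SK_def by (rule comm_group_quot[OF S.comm_monoid_class rel_subset])

lemma elem_in_carrier: "lab_mfd n G X \<pi> M \<Longrightarrow> lab_elem n G X \<pi> M \<in> carrier (lab_SK n G X \<pi>)"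
  unfolding lab_SK_def lab_elem_def
  by (rule quot_elem_in_carrier[OF S.comm_monoid_class rel_subset S.cls_in_carrier])

lemma elem_iso:
  "lab_mfd n G X \<pi> M \<Longrightarrow> lab_mfd n G X \<pi> N \<Longrightarrow> lab_iso G \<pi> M N \<Longrightarrow> lab_elem n G X \<pi> M = lab_elem n G X \<pi> N"
  unfolding lab_elem_def by (rule arg_cong[where f = "quot_elem _ _"]) (rule iffD2[OF S.cls_eq_iff])

lemma elem_sum:
  assumes "lab_mfd n G X \<pi> M1" "lab_mfd n G X \<pi> M2" "lab_mfd n G X \<pi> N" "lab_sum G \<pi> M1 M2 N"
  shows "lab_elem n G X \<pi> N = lab_elem n G X \<pi> M1 \<otimes>\<^bsub>lab_SK n G X \<pi>\<^esub> lab_elem n G X \<pi> M2"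
  unfolding lab_SK_def lab_elem_def S.mult_cls[OF assms, symmetric]
  by (rule quot_elem_mult[OF S.comm_monoid_class rel_subset]) (use assms S.cls_in_carrier in auto)

lemma elem_op:
  assumes "lab_SK_op n G X \<pi> M N" shows "lab_elem n G X \<pi> M = lab_elem n G X \<pi> N"
proof -
  have "lab_mfd n G X \<pi> M" "lab_mfd n G X \<pi> N" using assms unfolding lab_SK_op_def by auto
  then have "(lab_cls n G X \<pi> M, lab_cls n G X \<pi> N) \<in> lab_SK_rel n G X \<pi>"
    unfolding lab_SK_rel_def using assms by blast
  then show ?thesis unfolding lab_elem_def by (rule quot_elem_rel[OF S.comm_monoid_class rel_subset])
qed

text \<open>An additive invariant unchanged by one operation is unchanged by a finite sequence of
  them, hence kills the relators and descends by \<open>quot_lift\<close>.\<close>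

lemma hom_exists:
  assumes B: "comm_group B" and \<phi>: "\<And>M. lab_mfd n G X \<pi> M \<Longrightarrow> \<phi> M \<in> carrier B"
    and iso: "\<And>M N. lab_mfd n G X \<pi> M \<Longrightarrow> lab_mfd n G X \<pi> N \<Longrightarrow> lab_iso G \<pi> M N \<Longrightarrow> \<phi> M = \<phi> N"
    and sum: "\<And>M1 M2 N. lab_mfd n G X \<pi> M1 \<Longrightarrow> lab_mfd n G X \<pi> M2 \<Longrightarrow> lab_mfd n G X \<pi> N \<Longrightarrow>
      lab_sum G \<pi> M1 M2 N \<Longrightarrow> \<phi> N = \<phi> M1 \<otimes>\<^bsub>B\<^esub> \<phi> M2"
    and op: "\<And>M N. lab_SK_op n G X \<pi> M N \<Longrightarrow> \<phi> M = \<phi> N"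
  shows "\<exists>h\<in>hom (lab_SK n G X \<pi>) B. \<forall>M. lab_mfd n G X \<pi> M \<longrightarrow> h (lab_elem n G X \<pi> M) = \<phi> M"
proof -
  \<comment> \<open>\<open>\<psi>\<close> evaluates \<open>\<phi>\<close> on a chosen
    representative; the hypothesis \<open>iso\<close> removes the dependence on the choice.\<close>
  define \<psi> where "\<psi> A = \<phi> (SOME M. lab_mfd n G X \<pi> M \<and> A = lab_cls n G X \<pi> M)" for A
  have \<psi>: "\<psi> (lab_cls n G X \<pi> M) = \<phi> M" if M: "lab_mfd n G X \<pi> M" for M
  proof -
    let ?N = "SOME N. lab_mfd n G X \<pi> N \<and> lab_cls n G X \<pi> M = lab_cls n G X \<pi> N"
    have "lab_mfd n G X \<pi> ?N \<and> lab_cls n G X \<pi> M = lab_cls n G X \<pi> ?N"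
      by (rule someI[of _ M]) (use M in simp)
    then show ?thesis using iso[of M ?N] S.cls_eq_iff[of M ?N] M by (simp add: \<psi>_def)
  qed
  have "\<exists>h\<in>hom (rel_quot (lab_monoid n G X \<pi>) (lab_SK_rel n G X \<pi>)) B.
      \<forall>A\<in>carrier (lab_monoid n G X \<pi>). h (quot_elem (lab_monoid n G X \<pi>) (lab_SK_rel n G X \<pi>) A) = \<psi> A"
  proof (rule quot_lift[OF S.comm_monoid_class rel_subset B])
    fix A assume "A \<in> carrier (lab_monoid n G X \<pi>)"
    then obtain M where M: "lab_mfd n G X \<pi> M" "A = lab_cls n G X \<pi> M" by (rule S.carrierE)
    then show "\<psi> A \<in> carrier B" using \<psi> \<phi> by simp
    fix A' assume "A' \<in> carrier (lab_monoid n G X \<pi>)"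
    then obtain M' where M': "lab_mfd n G X \<pi> M'" "A' = lab_cls n G X \<pi> M'" by (rule S.carrierE)
    obtain N where N: "lab_mfd n G X \<pi> N" "lab_sum G \<pi> M M' N" using S.sum_exists M M' by blast
    show "\<psi> (A \<otimes>\<^bsub>lab_monoid n G X \<pi>\<^esub> A') = \<psi> A \<otimes>\<^bsub>B\<^esub> \<psi> A'"
      using S.mult_cls[OF M(1) M'(1) N] sum[OF M(1) M'(1) N] \<psi> M M' N by simp
  next
    fix A A' assume "(A, A') \<in> lab_SK_rel n G X \<pi>"
    then obtain M N where MN: "lab_mfd n G X \<pi> M" "lab_mfd n G X \<pi> N" "A = lab_cls n G X \<pi> M" "A' = lab_cls n G X \<pi> N"
      "(lab_SK_op n G X \<pi>)\<^sup>*\<^sup>* M N \<or> (lab_SK_op n G X \<pi>)\<^sup>*\<^sup>* N M" unfolding lab_SK_rel_def by blast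
    have "\<phi> K = \<phi> L" if "(lab_SK_op n G X \<pi>)\<^sup>*\<^sup>* K L" for K L
      using that by induction (use op in auto)
    then show "\<psi> A = \<psi> A'" using MN \<psi> by metis
  qed
  then show ?thesis unfolding lab_SK_def lab_elem_def using \<psi> S.cls_in_carrier by metis
qed

lemma hom_eq:
  assumes B: "group B" and h: "h \<in> hom (lab_SK n G X \<pi>) B" "h' \<in> hom (lab_SK n G X \<pi>) B"
    and eq: "\<And>M. lab_mfd n G X \<pi> M \<Longrightarrow> h (lab_elem n G X \<pi> M) = h' (lab_elem n G X \<pi> M)"
    and x: "x \<in> carrier (lab_SK n G X \<pi>)"
  shows "h x = h' x"
proof (rule quot_hom_eq[OF S.comm_monoid_class rel_subset B, folded lab_SK_def, OF h _ x])
  fix A assume "A \<in> carrier (lab_monoid n G X \<pi>)"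
  then obtain M where "lab_mfd n G X \<pi> M" "A = lab_cls n G X \<pi> M" by (rule S.carrierE)
  then show "h (quot_elem (lab_monoid n G X \<pi>) (lab_SK_rel n G X \<pi>) A) = h' (quot_elem (lab_monoid n G X \<pi>) (lab_SK_rel n G X \<pi>) A)"
    using eq unfolding lab_elem_def by simp
qed

end

subsection \<open>Homomorphisms induced by correspondences\<close>

text \<open>The condition quantifies over all transports, so no particular model of the disjoint
  union is singled out.\<close>

definition push ::
  "nat \<Rightarrow> ('g, 'b) monoid_scheme \<Rightarrow> ('g, 'x) gset \<Rightarrow> (real \<Rightarrow> 'x) \<Rightarrow> ('h, 'c) monoid_scheme \<Rightarrow> ('h, 'y) gset \<Rightarrow> (real \<Rightarrow> 'y) \<Rightarrow>
   'p set \<Rightarrow> ('h \<Rightarrow> 'p \<Rightarrow> 'p) \<Rightarrow> ('h \<Rightarrow> 'p \<Rightarrow> 'g) \<Rightarrow> ('p \<Rightarrow> 'x) \<Rightarrow> ('p \<Rightarrow> 'y) \<Rightarrow> 'g sk \<Rightarrow> 'h sk" where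
  "push n G X \<pi> H Y \<rho> P a c f q = (SOME h. h \<in> hom (lab_SK n G X \<pi>) (lab_SK n H Y \<rho>) \<and>
     (\<forall>M N j. lab_mfd n G X \<pi> M \<longrightarrow> lab_mfd n H Y \<rho> N \<longrightarrow> transported H P a c f q \<pi> \<rho> M N j \<longrightarrow>
        h (lab_elem n G X \<pi> M) = lab_elem n H Y \<rho> N))"

text \<open>The conditions of \<open>hom_exists\<close> are the facts that transport respects
  isomorphisms, sums and single operations. The boundary formula of
  \<open>transported_exists\<close> is what the last of these requires.\<close>

lemma push:
  assumes G: "labelling G X \<pi>" and H: "labelling H Y \<rho>" and C: "corresp G X H Y P a c f q"
  shows "push n G X \<pi> H Y \<rho> P a c f q \<in> hom (lab_SK n G X \<pi>) (lab_SK n H Y \<rho>)"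
    "lab_mfd n G X \<pi> M \<Longrightarrow> lab_mfd n H Y \<rho> N \<Longrightarrow> transported H P a c f q \<pi> \<rho> M N j \<Longrightarrow>
       push n G X \<pi> H Y \<rho> P a c f q (lab_elem n G X \<pi> M) = lab_elem n H Y \<rho> N"
proof -
  interpret G: labelling n G X \<pi> by (rule G)
  interpret H: labelling n H Y \<rho> by (rule H)
  define \<phi> where "\<phi> M = lab_elem n H Y \<rho> (SOME N. lab_mfd n H Y \<rho> N \<and> (\<exists>j. transported H P a c f q \<pi> \<rho> M N j))" for M
  have ex: "\<exists>N j. lab_mfd n H Y \<rho> N \<and> transported H P a c f q \<pi> \<rho> M N j \<and>
    mboundary N = (\<Union>p\<in>P. j p ` (mboundary M \<inter> fibre \<pi> M (f p)))" if "lab_mfd n G X \<pi> M" for M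
    by (rule transported_exists[OF C that H.ample])
  have \<phi>: "\<phi> M = lab_elem n H Y \<rho> N'"
    if M: "lab_mfd n G X \<pi> M" and M': "lab_mfd n G X \<pi> M'" "lab_iso G \<pi> M M'"
      and N': "lab_mfd n H Y \<rho> N'" "transported H P a c f q \<pi> \<rho> M' N' j'" for M M' N' j'
  proof -
    let ?N = "SOME N. lab_mfd n H Y \<rho> N \<and> (\<exists>j. transported H P a c f q \<pi> \<rho> M N j)"
    have "\<exists>N. lab_mfd n H Y \<rho> N \<and> (\<exists>j. transported H P a c f q \<pi> \<rho> M N j)" using ex[OF M] by blast
    from someI_ex[OF this] obtain j where "lab_mfd n H Y \<rho> ?N" "transported H P a c f q \<pi> \<rho> M ?N j" by blast
    then show ?thesis unfolding \<phi>_def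
      using H.elem_iso transported_cong[OF C M M' _ N'(1) _ N'(2)] N'(1) by blast
  qed
  have \<phi>': "\<phi> M = lab_elem n H Y \<rho> N" if "lab_mfd n G X \<pi> M" "lab_mfd n H Y \<rho> N" "transported H P a c f q \<pi> \<rho> M N j" for M N j
    using \<phi>[OF that(1,1) lab_iso_refl[OF that(1)] that(2,3)] .
  have "\<exists>h\<in>hom (lab_SK n G X \<pi>) (lab_SK n H Y \<rho>). \<forall>M. lab_mfd n G X \<pi> M \<longrightarrow> h (lab_elem n G X \<pi> M) = \<phi> M"
  proof (rule G.hom_exists[OF H.comm_group_lab_SK])
    fix M assume M: "lab_mfd n G X \<pi> M"
    obtain N j where "lab_mfd n H Y \<rho> N" "transported H P a c f q \<pi> \<rho> M N j" using ex[OF M] by blast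
    then show "\<phi> M \<in> carrier (lab_SK n H Y \<rho>)" using \<phi>'[OF M] H.elem_in_carrier by simp
    fix M' assume M': "lab_mfd n G X \<pi> M'" "lab_iso G \<pi> M M'"
    obtain N' j' where "lab_mfd n H Y \<rho> N'" "transported H P a c f q \<pi> \<rho> M' N' j'" using ex[OF M'(1)] by blast
    then show "\<phi> M = \<phi> M'" using \<phi>[OF M M'] \<phi>'[OF M'(1)] by simp
  next
    fix M1 M2 M assume M: "lab_mfd n G X \<pi> M1" "lab_mfd n G X \<pi> M2" "lab_mfd n G X \<pi> M" "lab_sum G \<pi> M1 M2 M"
    obtain N1 j1 where N1: "lab_mfd n H Y \<rho> N1" "transported H P a c f q \<pi> \<rho> M1 N1 j1" using ex[OF M(1)] by blast
    obtain N2 j2 where N2: "lab_mfd n H Y \<rho> N2" "transported H P a c f q \<pi> \<rho> M2 N2 j2" using ex[OF M(2)] by blast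
    obtain N j where N: "lab_mfd n H Y \<rho> N" "transported H P a c f q \<pi> \<rho> M N j" using ex[OF M(3)] by blast
    show "\<phi> M = \<phi> M1 \<otimes>\<^bsub>lab_SK n H Y \<rho>\<^esub> \<phi> M2"
      using H.elem_sum[OF N1(1) N2(1) N(1) transported_lab_sum[OF C M N1(1) N2(1) N(1) N1(2) N2(2) N(2)]]
        \<phi>'[OF M(1) N1] \<phi>'[OF M(2) N2] \<phi>'[OF M(3) N] by simp
  next
    fix M M' assume op: "lab_SK_op n G X \<pi> M M'"
    then have M: "lab_mfd n G X \<pi> M" "lab_mfd n G X \<pi> M'" unfolding lab_SK_op_def by auto
    obtain N j where N: "lab_mfd n H Y \<rho> N" "transported H P a c f q \<pi> \<rho> M N j"
      "mboundary N = (\<Union>p\<in>P. j p ` (mboundary M \<inter> fibre \<pi> M (f p)))" using ex[OF M(1)] by blast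
    obtain N' j' where N': "lab_mfd n H Y \<rho> N'" "transported H P a c f q \<pi> \<rho> M' N' j'" using ex[OF M(2)] by blast
    have "mboundary M \<inter> fibre \<pi> M (f p) = {x \<in> mboundary M \<inter> mspace M. \<pi> x = f p}" for p by blast
    then have "mboundary N \<subseteq> lift P f \<pi> j (mboundary M \<inter> mspace M)" unfolding N(3) lift_def by simp
    from lab_SK_op_transported[OF C op N(1) N'(1) N(2) N'(2) this]
    show "\<phi> M = \<phi> M'" using H.elem_op \<phi>'[OF M(1) N(1,2)] \<phi>'[OF M(2) N'] by simp
  qed
  then have "\<exists>h. h \<in> hom (lab_SK n G X \<pi>) (lab_SK n H Y \<rho>) \<and>
     (\<forall>M N j. lab_mfd n G X \<pi> M \<longrightarrow> lab_mfd n H Y \<rho> N \<longrightarrow> transported H P a c f q \<pi> \<rho> M N j \<longrightarrow>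
        h (lab_elem n G X \<pi> M) = lab_elem n H Y \<rho> N)" using \<phi>' by metis
  from someI_ex[OF this] show "push n G X \<pi> H Y \<rho> P a c f q \<in> hom (lab_SK n G X \<pi>) (lab_SK n H Y \<rho>)"
    "lab_mfd n G X \<pi> M \<Longrightarrow> lab_mfd n H Y \<rho> N \<Longrightarrow> transported H P a c f q \<pi> \<rho> M N j \<Longrightarrow>
       push n G X \<pi> H Y \<rho> P a c f q (lab_elem n G X \<pi> M) = lab_elem n H Y \<rho> N"
    unfolding push_def[symmetric] by blast+
qed

subsection \<open>Labellings\<close>

text \<open>An infinite set has the cardinality of its square.\<close>

lemma real_pairing_exists: "\<exists>d :: real \<times> real \<Rightarrow> real. bij d"
proof -
  have "\<exists>d. bij_betw d ((UNIV :: real set) \<times> (UNIV :: real set)) (UNIV :: real set)"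
    using card_of_ordIso card_of_Times_same_infinite infinite_UNIV_char_0 by blast
  then show ?thesis by simp
qed

lemma ample_exists:
  assumes "finite (pts X)" shows "\<exists>\<pi>. ample X \<pi>"
proof -
  obtain d :: "real \<times> real \<Rightarrow> real" where d: "bij d" using real_pairing_exists by blast
  let ?e = "to_nat_on (pts X)"
  \<comment> \<open>The labelling reads the second component of a coded pair as the number of a
    point of \<open>X\<close>.\<close>
  define \<pi> where "\<pi> r = inv_into (pts X) ?e (nat \<lfloor>snd (inv_into UNIV d r)\<rfloor>)" for r
  have "ample X \<pi>" unfolding ample_def
  proof
    fix y assume y: "y \<in> pts X"
    \<comment> \<open>The inner pair stores the given data; the outer one adds the number of
      \<open>y\<close>, which \<open>\<pi>\<close> reads back.\<close>
    define \<iota> where "\<iota> z = d (d (fst z, real (snd z)), real (?e y))" for z :: "real \<times> nat"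
    have "inj \<iota>" unfolding \<iota>_def by (rule injI) (simp add: inj_eq[OF bij_is_inj[OF d]] prod_eq_iff)
    moreover have "\<pi> (\<iota> z) = y" for z
      unfolding \<pi>_def \<iota>_def using bij_is_inj[OF d] y inj_on_to_nat_on[OF countable_finite[OF assms]] by simp
    ultimately show "\<exists>\<iota> :: real \<times> nat \<Rightarrow> real. inj \<iota> \<and> (\<forall>z. \<pi> (\<iota> z) = y)" by blast
  qed
  then show ?thesis by blast
qed

text \<open>One labelling is fixed for each \<open>X\<close>, so that the SK group over
  \<open>X\<close> depends on \<open>X\<close> alone, as the object part of a functor must.\<close>

definition label :: "('g, 'x) gset \<Rightarrow> real \<Rightarrow> 'x" where
  "label X = (SOME \<pi>. ample X \<pi>)"

lemma labelling_label: "finite_gset G X \<Longrightarrow> labelling G X (label X)"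
  unfolding labelling_def label_def using someI_ex[OF ample_exists] finite_gsetD(1) by blast

text \<open>Over a single point a label carries no information, which makes plain manifolds a
  special case.\<close>

definition point :: "('g, unit) gset" where
  "point = \<lparr>pts = UNIV, gact = (\<lambda>_ x. x)\<rparr>"

lemma labelling_point:
  assumes "group G" shows "labelling G (point :: ('g, unit) gset) (\<lambda>_. ())"
proof -
  have "finite_gset G (point :: ('g, unit) gset)"
    unfolding finite_gset_def point_def by (auto intro!: group_actionI[OF assms] simp: extensional_def)
  moreover obtain d :: "real \<times> real \<Rightarrow> real" where d: "bij d" using real_pairing_exists by blast
  have "inj (\<lambda>z :: real \<times> nat. d (fst z, real (snd z)))"
    by (intro injI) (simp add: inj_eq[OF bij_is_inj[OF d]] prod_eq_iff)
  then have "ample (point :: ('g, unit) gset) (\<lambda>_. ())" unfolding ample_def by auto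
  ultimately show ?thesis by (simp add: labelling_def)
qed

lemma lab_mfd_point: "lab_mfd n G (point :: ('g, unit) gset) (\<lambda>_. ()) M \<longleftrightarrow> G_manifold n G M"
  unfolding lab_mfd_def by (auto simp: point_def)

lemma lab_iso_point: "lab_iso G (\<lambda>_. ()) M N \<longleftrightarrow> (\<exists>f. G_diffeo G M (mspace M) N (mspace N) f)"
  unfolding lab_iso_def lab_diffeo_def by simp

lemma lab_SK_op_point: "lab_SK_op n G (point :: ('g, unit) gset) (\<lambda>_. ()) = SK_operation n G"
  unfolding fun_eq_iff lab_SK_op_def SK_operation_def pasted_along_def by (simp add: lab_mfd_point)

text \<open>An equality, not merely an isomorphism: over a point every labelled notion unfolds to
  the unlabelled one.\<close>

lemma lab_SK_point:
  assumes G: "group G"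
  shows "lab_SK n G (point :: ('g, unit) gset) (\<lambda>_. ()) = SK n G"
    "lab_elem n G (point :: ('g, unit) gset) (\<lambda>_. ()) M = SK_elem n G (mfd_class n G M)"
proof -
  interpret labelling n G "point :: ('g, unit) gset" "\<lambda>_. ()" by (rule labelling_point[OF G])
  have cls: "lab_cls n G point (\<lambda>_. ()) M = mfd_class n G M" for M
    unfolding S.cls_def mfd_class_def by (simp add: lab_mfd_point lab_iso_point)
  have mon: "lab_monoid n G point (\<lambda>_. ()) = mfd_monoid n G"
    unfolding S.class_monoid_def mfd_monoid_def cls
    by (simp add: lab_mfd_point lab_sum_def disjoint_union_of_def lab_diffeo_def is_empty_mfd_def)
  have rel: "{formal_diff (mfd_monoid n G) a b | a b. (a, b) \<in> lab_SK_rel n G point (\<lambda>_. ())} = SK_relators n G"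
    unfolding lab_SK_rel_def SK_relators_def SK_equivalent_def cls lab_SK_op_point lab_mfd_point by blast
  show "lab_SK n G point (\<lambda>_. ()) = SK n G"
    unfolding lab_SK_def rel_quot_def SK_def SK_kernel_def mon rel ..
  show "lab_elem n G point (\<lambda>_. ()) M = SK_elem n G (mfd_class n G M)"
    unfolding lab_elem_def quot_elem_def SK_elem_def SK_kernel_def mon rel cls ..
qed

section \<open>Spans of finite G-sets\<close>

abbreviation apts :: "('g, 'x) span \<Rightarrow> 'x set" where
  "apts u \<equiv> pts (apex u)"

definition span_map :: "('g, 'b) monoid_scheme \<Rightarrow> ('g, 'x) span \<Rightarrow> ('g, 'x) span \<Rightarrow> ('x \<Rightarrow> 'x) \<Rightarrow> bool" where
  "span_map G u v f \<longleftrightarrow> gset_map G (apex u) (apex v) f \<and>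
     (\<forall>p\<in>apts u. lleg v (f p) = lleg u p \<and> rleg v (f p) = rleg u p)"

lemma span_mapD:
  assumes "span_map G u v f"
  shows "\<And>p. p \<in> apts u \<Longrightarrow> f p \<in> apts v"
    "\<And>g p. g \<in> carrier G \<Longrightarrow> p \<in> apts u \<Longrightarrow> f (gact (apex u) g p) = gact (apex v) g (f p)"
    "\<And>p. p \<in> apts u \<Longrightarrow> lleg v (f p) = lleg u p" "\<And>p. p \<in> apts u \<Longrightarrow> rleg v (f p) = rleg u p"
  using assms unfolding span_map_def gset_map_def by auto

lemma span_mapI:
  assumes "\<And>p. p \<in> apts u \<Longrightarrow> f p \<in> apts v"
    "\<And>g p. g \<in> carrier G \<Longrightarrow> p \<in> apts u \<Longrightarrow> f (gact (apex u) g p) = gact (apex v) g (f p)"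
    "\<And>p. p \<in> apts u \<Longrightarrow> lleg v (f p) = lleg u p" "\<And>p. p \<in> apts u \<Longrightarrow> rleg v (f p) = rleg u p"
  shows "span_map G u v f"
  using assms unfolding span_map_def gset_map_def by auto

lemma span_map_compose: "span_map G u v f \<Longrightarrow> span_map G v w f' \<Longrightarrow> span_map G u w (\<lambda>p. f' (f p))"
  by (rule span_mapI) (simp_all add: span_mapD)

definition span_iso :: "('g, 'b) monoid_scheme \<Rightarrow> ('g, 'x) span \<Rightarrow> ('g, 'x) span \<Rightarrow> bool" where
  "span_iso G u v \<longleftrightarrow> (\<exists>f. span_map G u v f \<and> bij_betw f (apts u) (apts v))"

lemma is_spanD:
  assumes "is_span G X Y u"
  shows "finite_gset G (apex u)" "group G" "finite (apts u)"
    "\<And>p. p \<in> apts u \<Longrightarrow> lleg u p \<in> pts X" "\<And>p. p \<in> apts u \<Longrightarrow> rleg u p \<in> pts Y"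
    "\<And>g p. g \<in> carrier G \<Longrightarrow> p \<in> apts u \<Longrightarrow> lleg u (gact (apex u) g p) = gact X g (lleg u p)"
    "\<And>g p. g \<in> carrier G \<Longrightarrow> p \<in> apts u \<Longrightarrow> rleg u (gact (apex u) g p) = gact Y g (rleg u p)"
    "\<And>g p. g \<in> carrier G \<Longrightarrow> p \<in> apts u \<Longrightarrow> gact (apex u) g p \<in> apts u"
proof -
  show 1: "finite_gset G (apex u)" using assms unfolding is_span_def by blast
  show "group G" "finite (apts u)" using finite_gsetD[OF 1] by auto
  show "\<And>g p. g \<in> carrier G \<Longrightarrow> p \<in> apts u \<Longrightarrow> gact (apex u) g p \<in> apts u" using finite_gsetD(3)[OF 1] .
qed (use assms in \<open>auto simp: is_span_def gset_map_def\<close>)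

text \<open>Sums and pullbacks of spans are naturally built on sum and product types. This recodes a
  finite action on any type as a span whose points have the fixed type
  \<open>'g gpt\<close>.\<close>

lemma span_exists:
  fixes Q :: "'q set" and X Y :: "('g, 'g gpt) gset"
  assumes "group G" "finite Q" and a: "\<And>g z. g \<in> carrier G \<Longrightarrow> z \<in> Q \<Longrightarrow> a g z \<in> Q" "\<And>z. z \<in> Q \<Longrightarrow> a \<one>\<^bsub>G\<^esub> z = z"
      "\<And>g h z. g \<in> carrier G \<Longrightarrow> h \<in> carrier G \<Longrightarrow> z \<in> Q \<Longrightarrow> a (g \<otimes>\<^bsub>G\<^esub> h) z = a g (a h z)"
    and l: "\<And>z. z \<in> Q \<Longrightarrow> l z \<in> pts X" "\<And>g z. g \<in> carrier G \<Longrightarrow> z \<in> Q \<Longrightarrow> l (a g z) = gact X g (l z)"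
    and r: "\<And>z. z \<in> Q \<Longrightarrow> r z \<in> pts Y" "\<And>g z. g \<in> carrier G \<Longrightarrow> z \<in> Q \<Longrightarrow> r (a g z) = gact Y g (r z)"
  shows "\<exists>w e. is_span G X Y w \<and> bij_betw e Q (apts w) \<and>
    (\<forall>z\<in>Q. lleg w (e z) = l z \<and> rleg w (e z) = r z \<and> (\<forall>g\<in>carrier G. gact (apex w) g (e z) = e (a g z)))"
proof -
  \<comment> \<open>The second component of a point is an arbitrary natural number, so it can hold a
    numbering of \<open>Q\<close>.\<close>
  define e :: "'q \<Rightarrow> 'g gpt" where "e z = ({}, to_nat_on Q z)" for z
  define d where "d = inv_into Q e"
  have inj: "inj_on e Q"
    using inj_on_to_nat_on[OF countable_finite[OF assms(2)]] by (auto simp: inj_on_def e_def)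
  have de: "d (e z) = z" if "z \<in> Q" for z using inj that by (simp add: d_def)
  define w where "w = \<lparr>apex = \<lparr>pts = e ` Q, gact = (\<lambda>g. \<lambda>p\<in>e ` Q. e (a g (d p)))\<rparr>, lleg = l \<circ> d, rleg = r \<circ> d\<rparr>"
  have pw: "apts w = e ` Q" by (simp add: w_def)
  have gw: "gact (apex w) g (e z) = e (a g z)" if "z \<in> Q" for g z using de that by (simp add: w_def)
  have "finite_gset G (apex w)"
    unfolding finite_gset_def
  proof
    show "group_action G (apts w) (gact (apex w))"
    proof (rule group_actionI[OF assms(1)])
      show "gact (apex w) g \<in> extensional (apts w)" for g by (simp add: w_def)
      fix p assume "p \<in> apts w"
      then obtain z where z: "z \<in> Q" "p = e z" unfolding pw by (elim imageE)
      show "gact (apex w) \<one>\<^bsub>G\<^esub> p = p" using gw[OF z(1)] a(2)[OF z(1)] z(2) by simp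
      fix g assume g: "g \<in> carrier G"
      show "gact (apex w) g p \<in> apts w" unfolding z(2) gw[OF z(1)] pw using a(1)[OF g z(1)] by (rule imageI)
      fix h assume h: "h \<in> carrier G"
      show "gact (apex w) (g \<otimes>\<^bsub>G\<^esub> h) p = gact (apex w) g (gact (apex w) h p)"
        unfolding z(2) gw[OF z(1)] gw[OF a(1)[OF h z(1)]] a(3)[OF g h z(1)] ..
    qed
  qed (simp add: w_def assms(2))
  moreover have "lleg w (e z) = l z" "rleg w (e z) = r z" if "z \<in> Q" for z using de that by (simp_all add: w_def)
  ultimately have "is_span G X Y w" unfolding is_span_def gset_map_def pw using a(1) gw l r by auto
  moreover have "bij_betw e Q (apts w)" using inj by (simp add: w_def bij_betw_def)
  moreover have "\<forall>z\<in>Q. lleg w (e z) = l z \<and> rleg w (e z) = r z \<and> (\<forall>g\<in>carrier G. gact (apex w) g (e z) = e (a g z))"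
    using de by (simp add: w_def)
  ultimately show ?thesis by blast
qed

lemma span_iso_refl: "span_iso G u u"
  unfolding span_iso_def by (intro exI[of _ "\<lambda>x. x"]) (simp add: span_map_def gset_map_def bij_betw_def)

lemma span_iso_sym:
  assumes "is_span G X Y u" "span_iso G u v" shows "span_iso G v u"
proof -
  obtain f where f: "span_map G u v f" "bij_betw f (apts u) (apts v)" using assms(2) unfolding span_iso_def by blast
  note F = span_mapD[OF f(1)]
  let ?d = "inv_into (apts u) f"
  have d: "?d p \<in> apts u" "f (?d p) = p" if "p \<in> apts v" for p
    using f(2) that by (auto simp: bij_betw_def inv_into_into f_inv_into_f)
  have df: "?d (f p) = p" if "p \<in> apts u" for p using f(2) that by (simp add: bij_betw_def)
  have "span_map G v u ?d"
  proof (rule span_mapI)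
    fix p assume p: "p \<in> apts v"
    show "?d p \<in> apts u" using d p by blast
    show "lleg u (?d p) = lleg v p" "rleg u (?d p) = rleg v p" using F(3,4)[OF d(1)[OF p]] d(2)[OF p] by simp_all
    fix g assume g: "g \<in> carrier G"
    have "?d (gact (apex v) g p) = ?d (f (gact (apex u) g (?d p)))" using F(2)[OF g d(1)[OF p]] d(2)[OF p] by simp
    also have "\<dots> = gact (apex u) g (?d p)" by (rule df) (rule is_spanD(8)[OF assms(1) g d(1)[OF p]])
    finally show "?d (gact (apex v) g p) = gact (apex u) g (?d p)" .
  qed
  then show ?thesis unfolding span_iso_def using bij_betw_inv_into[OF f(2)] by blast
qed

lemma span_iso_trans: "span_iso G u v \<Longrightarrow> span_iso G v w \<Longrightarrow> span_iso G u w"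
  unfolding span_iso_def using span_map_compose bij_betw_trans[unfolded o_def] by meson

lemma span_sum_iff:
  "span_sum G u v w \<longleftrightarrow> (\<exists>i j. span_map G u w i \<and> inj_on i (apts u) \<and> span_map G v w j \<and> inj_on j (apts v) \<and>
     i ` apts u \<union> j ` apts v = apts w \<and> i ` apts u \<inter> j ` apts v = {})"
  unfolding span_sum_def span_map_def by meson

lemma span_sum_exists:
  fixes X Y :: "('g, 'g gpt) gset"
  assumes u: "is_span G X Y u" and v: "is_span G X Y v"
  shows "\<exists>w. is_span G X Y w \<and> span_sum G u v w"
proof -
  let ?Q = "apts u <+> apts v"
  note U = is_spanD[OF u] and V = is_spanD[OF v] and FU = finite_gsetD[OF is_spanD(1)[OF u]] and FV = finite_gsetD[OF is_spanD(1)[OF v]]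
  have "\<exists>w e. is_span G X Y w \<and> bij_betw e ?Q (apts w) \<and>
    (\<forall>z\<in>?Q. lleg w (e z) = case_sum (lleg u) (lleg v) z \<and> rleg w (e z) = case_sum (rleg u) (rleg v) z \<and>
      (\<forall>g\<in>carrier G. gact (apex w) g (e z) = e (map_sum (gact (apex u) g) (gact (apex v) g) z)))"
    by (rule span_exists[OF U(2)]) (use U V FU(4,5) FV(4,5) in auto)
  then obtain w e where w: "is_span G X Y w" and e: "bij_betw e ?Q (apts w)"
    and ew: "\<And>z. z \<in> ?Q \<Longrightarrow> lleg w (e z) = case_sum (lleg u) (lleg v) z \<and> rleg w (e z) = case_sum (rleg u) (rleg v) z \<and>
      (\<forall>g\<in>carrier G. gact (apex w) g (e z) = e (map_sum (gact (apex u) g) (gact (apex v) g) z))" by blast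
  have eP: "e z \<in> apts w" if "z \<in> ?Q" for z using e that by (auto simp: bij_betw_def)
  have "span_map G u w (\<lambda>p. e (Inl p))"
    by (rule span_mapI) (use ew[OF InlI] eP[OF InlI] in auto)
  moreover have "span_map G v w (\<lambda>p. e (Inr p))"
    by (rule span_mapI) (use ew[OF InrI] eP[OF InrI] in auto)
  moreover have inj: "inj_on e ?Q" using e by (simp add: bij_betw_def)
  have "inj_on (\<lambda>p. e (Inl p)) (apts u)" "inj_on (\<lambda>p. e (Inr p)) (apts v)"
    using inj by (auto simp: inj_on_def)
  moreover have "(\<lambda>p. e (Inl p)) ` apts u \<inter> (\<lambda>p. e (Inr p)) ` apts v = {}"
    using inj by (fastforce simp: inj_on_def)
  moreover have "(\<lambda>p. e (Inl p)) ` apts u \<union> (\<lambda>p. e (Inr p)) ` apts v = apts w"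
    using e by (auto simp: bij_betw_def Plus_def image_Un image_image)
  ultimately show ?thesis unfolding span_sum_iff using w by blast
qed

text \<open>The counterpart for spans of \<open>lab_sum_map\<close>; it again yields uniqueness and
  associativity of sums.\<close>

lemma span_sum_map:
  assumes u: "is_span G X Y u" and v: "is_span G X Y v" and s: "span_sum G u v w"
    and f1: "span_map G u l f1" "inj_on f1 (apts u)" and f2: "span_map G v l f2" "inj_on f2 (apts v)"
    and dj: "f1 ` apts u \<inter> f2 ` apts v = {}"
  shows "\<exists>F. span_map G w l F \<and> inj_on F (apts w) \<and> F ` apts w = f1 ` apts u \<union> f2 ` apts v"
proof -
  obtain i j where i: "span_map G u w i" "inj_on i (apts u)" and j: "span_map G v w j" "inj_on j (apts v)"
    and un: "i ` apts u \<union> j ` apts v = apts w" and dj': "i ` apts u \<inter> j ` apts v = {}"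
    using s unfolding span_sum_iff by blast
  define F where "F z = (if z \<in> i ` apts u then f1 (inv_into (apts u) i z) else f2 (inv_into (apts v) j z))" for z
  have Fi: "F (i p) = f1 p" if "p \<in> apts u" for p using that i(2) by (simp add: F_def)
  have Fj: "F (j p) = f2 p" if "p \<in> apts v" for p
  proof -
    have "j p \<notin> i ` apts u" using dj' that by blast
    then show ?thesis using that j(2) by (simp add: F_def)
  qed
  have cases: "(\<exists>p\<in>apts u. z = i p) \<or> (\<exists>p\<in>apts v. z = j p)" if "z \<in> apts w" for z
    using un that by blast
  note I = span_mapD[OF i(1)] and J = span_mapD[OF j(1)] and F1 = span_mapD[OF f1(1)] and F2 = span_mapD[OF f2(1)]
  have "span_map G w l F"
  proof (rule span_mapI)
    fix z assume z: "z \<in> apts w"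
    show "F z \<in> apts l" using cases[OF z] Fi Fj F1(1) F2(1) by auto
    show "lleg l (F z) = lleg w z" using cases[OF z] Fi Fj F1(3) F2(3) I(3) J(3) by auto
    show "rleg l (F z) = rleg w z" using cases[OF z] Fi Fj F1(4) F2(4) I(4) J(4) by auto
    fix g assume g: "g \<in> carrier G"
    from cases[OF z] show "F (gact (apex w) g z) = gact (apex l) g (F z)"
    proof (elim disjE bexE)
      fix p assume p: "p \<in> apts u" "z = i p"
      then show ?thesis using Fi[OF is_spanD(8)[OF u g p(1)]] Fi[OF p(1)] I(2)[OF g p(1)] F1(2)[OF g p(1)] by metis
    next
      fix p assume p: "p \<in> apts v" "z = j p"
      then show ?thesis using Fj[OF is_spanD(8)[OF v g p(1)]] Fj[OF p(1)] J(2)[OF g p(1)] F2(2)[OF g p(1)] by metis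
    qed
  qed
  moreover have "inj_on F (apts w)"
  proof (rule inj_onI)
    fix z z' assume z: "z \<in> apts w" "z' \<in> apts w" "F z = F z'"
    have "f1 p \<noteq> f2 p'" if "p \<in> apts u" "p' \<in> apts v" for p p' using dj that by blast
    then show "z = z'"
      using cases[OF z(1)] cases[OF z(2)] z(3) Fi Fj f1(2) f2(2) by (metis inj_onD)
  qed
  moreover have "F ` apts w = f1 ` apts u \<union> f2 ` apts v"
    unfolding un[symmetric] image_Un image_image using Fi Fj by simp
  ultimately show ?thesis by blast
qed

lemma object_sums_span:
  fixes X Y :: "('g, 'g gpt) gset"
  assumes "group G"
  shows "object_sums (is_span G X Y) (span_iso G) (span_sum G) (\<lambda>u. apts u = {})"
proof (unfold_locales, goal_cases)
  case 1 show ?case by (rule span_iso_refl)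
next
  case 2 then show ?case by - (rule span_iso_sym)
next
  case 3 then show ?case by - (rule span_iso_trans)
next
  case 4 then show ?case by (rule span_sum_exists)
next
  case (5 u v w w')
  obtain i j where i: "span_map G u w' i" "inj_on i (apts u)" "span_map G v w' j" "inj_on j (apts v)"
    "i ` apts u \<union> j ` apts v = apts w'" "i ` apts u \<inter> j ` apts v = {}"
    using 5(6) unfolding span_sum_iff by blast
  from span_sum_map[OF 5(1,2,5) i(1-4,6)] show ?case unfolding span_iso_def bij_betw_def using i(5) by auto
next
  case 6 then show ?case unfolding span_sum_iff by (metis Int_commute Un_commute)
next
  case (7 u u' v w)
  obtain k where k: "span_map G u' u k" "bij_betw k (apts u') (apts u)"
    using span_iso_sym[OF 7(1,6)] unfolding span_iso_def by blast
  obtain i j where i: "span_map G u w i" "inj_on i (apts u)" "span_map G v w j" "inj_on j (apts v)"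
    "i ` apts u \<union> j ` apts v = apts w" "i ` apts u \<inter> j ` apts v = {}"
    using 7(5) unfolding span_sum_iff by blast
  have im: "(\<lambda>p. i (k p)) ` apts u' = i ` apts u" using k(2) by (simp add: bij_betw_def image_image[symmetric])
  have "inj_on (\<lambda>p. i (k p)) (apts u')" using comp_inj_on[of k "apts u'" i] k(2) i(2) by (simp add: bij_betw_def o_def)
  then show ?case unfolding span_sum_iff using span_map_compose[OF k(1) i(1)] i(3-6) im
    by (intro exI[of _ "\<lambda>p. i (k p)"] exI[of _ j]) simp
next
  case (8 u v w w')
  obtain k where k: "span_map G w w' k" "bij_betw k (apts w) (apts w')"
    using 8(6) unfolding span_iso_def by blast
  obtain i j where i: "span_map G u w i" "inj_on i (apts u)" "span_map G v w j" "inj_on j (apts v)"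
    "i ` apts u \<union> j ` apts v = apts w" "i ` apts u \<inter> j ` apts v = {}"
    using 8(5) unfolding span_sum_iff by blast
  have ki: "inj_on k (i ` apts u \<union> j ` apts v)" using k(2) i(5) by (simp add: bij_betw_def)
  have "inj_on (\<lambda>p. k (i p)) (apts u)" "inj_on (\<lambda>p. k (j p)) (apts v)"
    using comp_inj_on[OF i(2) inj_on_subset[OF ki]] comp_inj_on[OF i(4) inj_on_subset[OF ki]] by (simp_all add: o_def)
  moreover have "(\<lambda>p. k (i p)) ` apts u \<union> (\<lambda>p. k (j p)) ` apts v = apts w'"
    using k(2) i(5) unfolding bij_betw_def by (metis image_Un image_image)
  moreover have "(\<lambda>p. k (i p)) ` apts u \<inter> (\<lambda>p. k (j p)) ` apts v = {}"
    using inj_on_image_Int[OF ki, of "i ` apts u" "j ` apts v"] i(6) by (simp add: image_image)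
  ultimately show ?case unfolding span_sum_iff
    using span_map_compose[OF i(1) k(1)] span_map_compose[OF i(3) k(1)] by blast
next
  case (9 u1 u2 u3 w w' l)
  obtain i j where i: "span_map G u1 w i" "inj_on i (apts u1)" "span_map G u2 w j" "inj_on j (apts u2)"
    "i ` apts u1 \<union> j ` apts u2 = apts w" "i ` apts u1 \<inter> j ` apts u2 = {}"
    using 9(7) unfolding span_sum_iff by blast
  obtain k m where k: "span_map G w l k" "inj_on k (apts w)" "span_map G u3 l m" "inj_on m (apts u3)"
    "k ` apts w \<union> m ` apts u3 = apts l" "k ` apts w \<inter> m ` apts u3 = {}"
    using 9(8) unfolding span_sum_iff by blast
  have ki: "inj_on k (i ` apts u1 \<union> j ` apts u2)" using k(2) i(5) by simp
  have inj: "inj_on (\<lambda>p. k (i p)) (apts u1)" "inj_on (\<lambda>p. k (j p)) (apts u2)"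
    using comp_inj_on[OF i(2) inj_on_subset[OF ki]] comp_inj_on[OF i(4) inj_on_subset[OF ki]] by (simp_all add: o_def)
  have un: "(\<lambda>p. k (i p)) ` apts u1 \<union> (\<lambda>p. k (j p)) ` apts u2 = k ` apts w"
    using i(5) by (metis image_Un image_image)
  have dj: "(\<lambda>p. k (i p)) ` apts u1 \<inter> (\<lambda>p. k (j p)) ` apts u2 = {}"
    using inj_on_image_Int[OF ki, of "i ` apts u1" "j ` apts u2"] i(6) by (simp add: image_image)
  have "(\<lambda>p. k (j p)) ` apts u2 \<inter> m ` apts u3 = {}" using un k(6) by blast
  from span_sum_map[OF 9(2,3,9) span_map_compose[OF i(3) k(1)] inj(2) k(3,4) this]
  obtain F where F: "span_map G w' l F" "inj_on F (apts w')"
    "F ` apts w' = (\<lambda>p. k (j p)) ` apts u2 \<union> m ` apts u3" by blast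
  have "(\<lambda>p. k (i p)) ` apts u1 \<union> F ` apts w' = apts l"
    unfolding F(3) Un_assoc[symmetric] un by (rule k(5))
  moreover have "(\<lambda>p. k (i p)) ` apts u1 \<subseteq> k ` apts w" unfolding un[symmetric] by (rule Un_upper1)
  then have "(\<lambda>p. k (i p)) ` apts u1 \<inter> F ` apts w' = {}"
    unfolding F(3) Int_Un_distrib dj using k(6) by (simp add: disjoint_iff subset_iff)
  ultimately have "(\<lambda>p. k (i p)) ` apts u1 \<union> F ` apts w' = apts l"
    "(\<lambda>p. k (i p)) ` apts u1 \<inter> F ` apts w' = {}" by auto
  then show ?case unfolding span_sum_iff using span_map_compose[OF i(1) k(1)] inj(1) F(1,2) by blast
next
  case 10
  have "\<exists>w (e :: 'g gpt \<Rightarrow> 'g gpt). is_span G X Y w \<and> bij_betw e {} (apts w) \<and>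
    (\<forall>z\<in>{}. lleg w (e z) = undefined \<and> rleg w (e z) = undefined \<and> (\<forall>g\<in>carrier G. gact (apex w) g (e z) = e z))"
    by (rule span_exists[OF assms]) auto
  then show ?case unfolding bij_betw_def by blast
next
  case (11 u e)
  have "span_map G e u (\<lambda>x. x)" "span_map G u u (\<lambda>x. x)" using 11(3) by (auto intro!: span_mapI)
  then show ?case unfolding span_sum_iff using 11(3) by (intro exI[of _ "\<lambda>x. x"]) auto
next
  case (12 u e)
  have "span_map G e u (\<lambda>x. x)" using 12(3) by (auto intro!: span_mapI)
  then show ?case unfolding span_iso_def using 12(3) by (auto simp: bij_betw_def)
qed

lemma span_class_conv: "span_class G X Y u = {v. is_span G X Y v \<and> span_iso G u v}"
  unfolding span_class_def span_iso_def span_map_def by blast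

section \<open>Composition of spans and its bilinear extension\<close>

locale span_category =
  fixes G :: "('g, 'b) monoid_scheme"
  assumes group: "group G"
begin

interpretation S: object_sums "is_span G X Y" "span_iso G" "span_sum G" "\<lambda>u. apts u = {}"
  for X Y :: "('g, 'g gpt) gset" by (rule object_sums_span[OF group])

lemma cls_conv: "S.cls X Y u = span_class G X Y u"
  unfolding S.cls_def span_class_conv ..

lemma span_monoid_conv: "span_monoid G X Y = S.class_monoid X Y"
  unfolding S.class_monoid_def span_monoid_def cls_conv ..

lemma comm_monoid_span: "comm_monoid (span_monoid G X (Y :: ('g, 'g gpt) gset))"
  unfolding span_monoid_conv by (rule S.comm_monoid_class)

lemma span_class_in_carrier: "is_span G X (Y :: ('g, 'g gpt) gset) u \<Longrightarrow> span_class G X Y u \<in> carrier (span_monoid G X Y)"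
  unfolding span_monoid_conv cls_conv[symmetric] by (rule S.cls_in_carrier)

lemma span_carrierE:
  assumes "A \<in> carrier (span_monoid G X (Y :: ('g, 'g gpt) gset))"
  obtains u where "is_span G X Y u" "A = span_class G X Y u"
  using assms unfolding span_monoid_conv cls_conv[symmetric] by (rule S.carrierE)

lemma span_class_sum:
  "is_span G X (Y :: ('g, 'g gpt) gset) u \<Longrightarrow> is_span G X Y v \<Longrightarrow> is_span G X Y w \<Longrightarrow> span_sum G u v w \<Longrightarrow>
    span_class G X Y u \<otimes>\<^bsub>span_monoid G X Y\<^esub> span_class G X Y v = span_class G X Y w"
  unfolding span_monoid_conv cls_conv[symmetric] by (rule S.mult_cls)

text \<open>The projections are named so that maps between pullbacks can be specified by their two
  components.\<close>

definition pullback_maps ::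
  "('g, 'x) span \<Rightarrow> ('g, 'x) span \<Rightarrow> ('g, 'x) span \<Rightarrow> ('x \<Rightarrow> 'x) \<Rightarrow> ('x \<Rightarrow> 'x) \<Rightarrow> bool" where
  "pullback_maps u v w p q \<longleftrightarrow> gset_map G (apex w) (apex u) p \<and> gset_map G (apex w) (apex v) q \<and>
     bij_betw (\<lambda>z. (p z, q z)) (apts w) {(a, b). a \<in> apts u \<and> b \<in> apts v \<and> rleg u a = lleg v b} \<and>
     (\<forall>z\<in>apts w. lleg w z = lleg u (p z) \<and> rleg w z = rleg v (q z))"

lemma span_pullback_iff: "span_pullback G u v w \<longleftrightarrow> (\<exists>p q. pullback_maps u v w p q)"
  unfolding span_pullback_def pullback_maps_def ..

lemma pullback_mapsD:
  assumes "pullback_maps u v w p q"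
  shows "\<And>z. z \<in> apts w \<Longrightarrow> p z \<in> apts u" "\<And>z. z \<in> apts w \<Longrightarrow> q z \<in> apts v"
    "\<And>g z. g \<in> carrier G \<Longrightarrow> z \<in> apts w \<Longrightarrow> p (gact (apex w) g z) = gact (apex u) g (p z)"
    "\<And>g z. g \<in> carrier G \<Longrightarrow> z \<in> apts w \<Longrightarrow> q (gact (apex w) g z) = gact (apex v) g (q z)"
    "\<And>z. z \<in> apts w \<Longrightarrow> rleg u (p z) = lleg v (q z)"
    "\<And>a b. a \<in> apts u \<Longrightarrow> b \<in> apts v \<Longrightarrow> rleg u a = lleg v b \<Longrightarrow> \<exists>z\<in>apts w. p z = a \<and> q z = b"
    "\<And>z z'. z \<in> apts w \<Longrightarrow> z' \<in> apts w \<Longrightarrow> p z = p z' \<Longrightarrow> q z = q z' \<Longrightarrow> z = z'"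
    "\<And>z. z \<in> apts w \<Longrightarrow> lleg w z = lleg u (p z)" "\<And>z. z \<in> apts w \<Longrightarrow> rleg w z = rleg v (q z)"
    "bij_betw (\<lambda>z. (p z, q z)) (apts w) {(a, b). a \<in> apts u \<and> b \<in> apts v \<and> rleg u a = lleg v b}"
proof -
  show b: "bij_betw (\<lambda>z. (p z, q z)) (apts w) {(a, b). a \<in> apts u \<and> b \<in> apts v \<and> rleg u a = lleg v b}"
    using assms unfolding pullback_maps_def by blast
  then have im: "(\<lambda>z. (p z, q z)) ` apts w = {(a, b). a \<in> apts u \<and> b \<in> apts v \<and> rleg u a = lleg v b}"
    by (simp add: bij_betw_def)
  show "rleg u (p z) = lleg v (q z)" if "z \<in> apts w" for z using im that by blast
  show "\<exists>z\<in>apts w. p z = a \<and> q z = b'" if "a \<in> apts u" "b' \<in> apts v" "rleg u a = lleg v b'" for a b'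
  proof -
    have "(a, b') \<in> (\<lambda>z. (p z, q z)) ` apts w" unfolding im using that by simp
    then show ?thesis by auto
  qed
  show "z = z'" if "z \<in> apts w" "z' \<in> apts w" "p z = p z'" "q z = q z'" for z z'
    using b that unfolding bij_betw_def inj_on_def by simp
qed (use assms in \<open>auto simp: pullback_maps_def gset_map_def\<close>)

lemma span_pullbackI:
  assumes "\<And>z. z \<in> apts w \<Longrightarrow> p z \<in> apts u" "\<And>z. z \<in> apts w \<Longrightarrow> q z \<in> apts v"
    "\<And>g z. g \<in> carrier G \<Longrightarrow> z \<in> apts w \<Longrightarrow> p (gact (apex w) g z) = gact (apex u) g (p z)"
    "\<And>g z. g \<in> carrier G \<Longrightarrow> z \<in> apts w \<Longrightarrow> q (gact (apex w) g z) = gact (apex v) g (q z)"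
    "\<And>z. z \<in> apts w \<Longrightarrow> rleg u (p z) = lleg v (q z)"
    "\<And>a b. a \<in> apts u \<Longrightarrow> b \<in> apts v \<Longrightarrow> rleg u a = lleg v b \<Longrightarrow> \<exists>z\<in>apts w. p z = a \<and> q z = b"
    "\<And>z z'. z \<in> apts w \<Longrightarrow> z' \<in> apts w \<Longrightarrow> p z = p z' \<Longrightarrow> q z = q z' \<Longrightarrow> z = z'"
    "\<And>z. z \<in> apts w \<Longrightarrow> lleg w z = lleg u (p z)" "\<And>z. z \<in> apts w \<Longrightarrow> rleg w z = rleg v (q z)"
  shows "span_pullback G u v w"
proof -
  have "bij_betw (\<lambda>z. (p z, q z)) (apts w) {(a, b). a \<in> apts u \<and> b \<in> apts v \<and> rleg u a = lleg v b}"
    unfolding bij_betw_def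
  proof
    show "inj_on (\<lambda>z. (p z, q z)) (apts w)" by (rule inj_onI) (use assms(7) in simp)
    show "(\<lambda>z. (p z, q z)) ` apts w = {(a, b). a \<in> apts u \<and> b \<in> apts v \<and> rleg u a = lleg v b}"
    proof
      show "(\<lambda>z. (p z, q z)) ` apts w \<subseteq> {(a, b). a \<in> apts u \<and> b \<in> apts v \<and> rleg u a = lleg v b}"
        using assms(1,2,5) by blast
      show "{(a, b). a \<in> apts u \<and> b \<in> apts v \<and> rleg u a = lleg v b} \<subseteq> (\<lambda>z. (p z, q z)) ` apts w"
      proof
        fix y assume "y \<in> {(a, b). a \<in> apts u \<and> b \<in> apts v \<and> rleg u a = lleg v b}"
        then obtain a b where y: "y = (a, b)" "a \<in> apts u" "b \<in> apts v" "rleg u a = lleg v b" by blast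
        then obtain z where "z \<in> apts w" "p z = a" "q z = b" using assms(6) by blast
        then show "y \<in> (\<lambda>z. (p z, q z)) ` apts w" using y(1) by blast
      qed
    qed
  qed
  then show ?thesis unfolding span_pullback_def gset_map_def using assms(1-4,8,9)
    by (intro exI[of _ p] exI[of _ q]) auto
qed

text \<open>The fibre product with the diagonal action, recoded by
  \<open>span_exists\<close>.\<close>

lemma pullback_exists:
  fixes X Y Z :: "('g, 'g gpt) gset"
  assumes u: "is_span G X Y u" and v: "is_span G Y Z v"
  shows "\<exists>w. is_span G X Z w \<and> span_pullback G u v w"
proof -
  define Q where "Q = {z. fst z \<in> apts u \<and> snd z \<in> apts v \<and> rleg u (fst z) = lleg v (snd z)}"
  let ?a = "\<lambda>g. map_prod (gact (apex u) g) (gact (apex v) g)"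
  note U = is_spanD[OF u] and V = is_spanD[OF v] and FU = finite_gsetD[OF is_spanD(1)[OF u]] and FV = finite_gsetD[OF is_spanD(1)[OF v]]
  have Q: "fst z \<in> apts u" "snd z \<in> apts v" "rleg u (fst z) = lleg v (snd z)" if "z \<in> Q" for z
    using that by (simp_all add: Q_def)
  have "Q \<subseteq> apts u \<times> apts v" by (rule subsetI) (simp add: Q mem_Times_iff)
  then have fin: "finite Q" using U(3) V(3) finite_subset by blast
  have aQ: "?a g z \<in> Q" if "g \<in> carrier G" "z \<in> Q" for g z
    using U(8)[OF that(1) Q(1)[OF that(2)]] V(8)[OF that(1) Q(2)[OF that(2)]]
      U(7)[OF that(1) Q(1)[OF that(2)]] V(6)[OF that(1) Q(2)[OF that(2)]] Q(3)[OF that(2)] by (simp add: Q_def)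
  have "\<exists>w e. is_span G X Z w \<and> bij_betw e Q (apts w) \<and>
    (\<forall>z\<in>Q. lleg w (e z) = lleg u (fst z) \<and> rleg w (e z) = rleg v (snd z) \<and>
      (\<forall>g\<in>carrier G. gact (apex w) g (e z) = e (?a g z)))"
  proof (rule span_exists[OF U(2) fin])
    fix z assume z: "z \<in> Q"
    show "?a \<one>\<^bsub>G\<^esub> z = z" using FU(4)[OF Q(1)[OF z]] FV(4)[OF Q(2)[OF z]] by (simp add: prod_eq_iff)
    show "lleg u (fst z) \<in> pts X" "rleg v (snd z) \<in> pts Z" using U(4)[OF Q(1)[OF z]] V(5)[OF Q(2)[OF z]] .
    fix g assume g: "g \<in> carrier G"
    show "?a g z \<in> Q" by (rule aQ[OF g z])
    show "lleg u (fst (?a g z)) = gact X g (lleg u (fst z))" "rleg v (snd (?a g z)) = gact Z g (rleg v (snd z))"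
      using U(6)[OF g Q(1)[OF z]] V(7)[OF g Q(2)[OF z]] by simp_all
    fix h assume h: "h \<in> carrier G"
    show "?a (g \<otimes>\<^bsub>G\<^esub> h) z = ?a g (?a h z)"
      using FU(5)[OF g h Q(1)[OF z]] FV(5)[OF g h Q(2)[OF z]] by (simp add: prod_eq_iff)
  qed
  then obtain w e where w: "is_span G X Z w" and e: "bij_betw e Q (apts w)"
    and ew: "\<And>z. z \<in> Q \<Longrightarrow> lleg w (e z) = lleg u (fst z)" "\<And>z. z \<in> Q \<Longrightarrow> rleg w (e z) = rleg v (snd z)"
      "\<And>z g. z \<in> Q \<Longrightarrow> g \<in> carrier G \<Longrightarrow> gact (apex w) g (e z) = e (?a g z)" by blast
  define d where "d = inv_into Q e"
  have de: "d (e z) = z" if "z \<in> Q" for z using e that unfolding d_def bij_betw_def by simp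
  have el: "\<exists>z\<in>Q. y = e z" if "y \<in> apts w" for y using e that unfolding bij_betw_def by auto
  have "span_pullback G u v w"
  proof (rule span_pullbackI[where p = "\<lambda>y. fst (d y)" and q = "\<lambda>y. snd (d y)"])
    fix y assume y: "y \<in> apts w"
    obtain z where z: "z \<in> Q" "y = e z" using el[OF y] by blast
    note zy = Q[OF z(1)] de[OF z(1), folded z(2)] ew(1,2)[OF z(1), folded z(2)]
    show "fst (d y) \<in> apts u" "snd (d y) \<in> apts v" "rleg u (fst (d y)) = lleg v (snd (d y))"
      "lleg w y = lleg u (fst (d y))" "rleg w y = rleg v (snd (d y))" using zy by simp_all
    show "fst (d (gact (apex w) g y)) = gact (apex u) g (fst (d y))" "snd (d (gact (apex w) g y)) = gact (apex v) g (snd (d y))"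
      if g: "g \<in> carrier G" for g
      using ew(3)[OF z(1) g, folded z(2)] de[OF aQ[OF g z(1)]] zy(4) by simp_all
    fix y' assume y': "y' \<in> apts w" "fst (d y) = fst (d y')" "snd (d y) = snd (d y')"
    obtain z' where z': "z' \<in> Q" "y' = e z'" using el[OF y'(1)] by blast
    have "z = z'" using y'(2,3) zy(4) de[OF z'(1), folded z'(2)] by (simp add: prod_eq_iff)
    then show "y = y'" using z z' by simp
  next
    fix a b assume "a \<in> apts u" "b \<in> apts v" "rleg u a = lleg v b"
    then have ab: "(a, b) \<in> Q" by (simp add: Q_def)
    then have "e (a, b) \<in> apts w" using e unfolding bij_betw_def by blast
    then show "\<exists>y\<in>apts w. fst (d y) = a \<and> snd (d y) = b" using de[OF ab] by (intro bexI[of _ "e (a, b)"]) simp_all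
  qed
  then show ?thesis using w by blast
qed

text \<open>The isomorphism is \<open>f\<close> on the first component and \<open>k\<close> on the
  second; the point of \<open>w'\<close> with these components exists and is unique. Uniqueness also
  gives equivariance.\<close>

lemma pullback_iso:
  assumes u: "span_iso G u u'" and v: "span_iso G v v'" and w: "is_span G X Z w" "is_span G X Z w'"
    and pb: "span_pullback G u v w" "span_pullback G u' v' w'"
  shows "span_iso G w w'"
proof -
  obtain f where f: "span_map G u u' f" "bij_betw f (apts u) (apts u')" using u unfolding span_iso_def by blast
  obtain k where k: "span_map G v v' k" "bij_betw k (apts v) (apts v')" using v unfolding span_iso_def by blast
  note F = span_mapD[OF f(1)] and K = span_mapD[OF k(1)]
  obtain p q where "pullback_maps u v w p q" using pb(1) unfolding span_pullback_iff by blast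
    note 1 = pullback_mapsD[OF this]
  obtain p' q' where "pullback_maps u' v' w' p' q'" using pb(2) unfolding span_pullback_iff by blast
    note 2 = pullback_mapsD[OF this]
  have "\<forall>z\<in>apts w. \<exists>y\<in>apts w'. p' y = f (p z) \<and> q' y = k (q z)"
    using 1(1,2,5) 2(6) F(1,4) K(1,3) by metis
  then obtain h where h: "\<And>z. z \<in> apts w \<Longrightarrow> h z \<in> apts w' \<and> p' (h z) = f (p z) \<and> q' (h z) = k (q z)"
    by metis
  have "span_map G w w' h"
  proof (rule span_mapI)
    fix z assume z: "z \<in> apts w"
    show "h z \<in> apts w'" using h[OF z] by blast
    show "lleg w' (h z) = lleg w z" using h[OF z] 1(1,8)[OF z] 2(8) F(3) by metis
    show "rleg w' (h z) = rleg w z" using h[OF z] 1(2,9)[OF z] 2(9) K(4) by metis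
    fix g assume g: "g \<in> carrier G"
    have gz: "gact (apex w) g z \<in> apts w" and gh: "gact (apex w') g (h z) \<in> apts w'"
      using is_spanD(8)[OF w(1) g z] is_spanD(8)[OF w(2) g] h[OF z] by auto
    show "h (gact (apex w) g z) = gact (apex w') g (h z)"
    proof (rule 2(7)[OF _ gh])
      show "p' (h (gact (apex w) g z)) = p' (gact (apex w') g (h z))"
        using h[OF gz] h[OF z] 1(3)[OF g z] 2(3)[OF g, of "h z"] F(2)[OF g 1(1)[OF z]] by simp
      show "q' (h (gact (apex w) g z)) = q' (gact (apex w') g (h z))"
        using h[OF gz] h[OF z] 1(4)[OF g z] 2(4)[OF g, of "h z"] K(2)[OF g 1(2)[OF z]] by simp
    qed (use h[OF gz] in blast)
  qed
  moreover have "bij_betw h (apts w) (apts w')"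
    unfolding bij_betw_def
  proof
    show "inj_on h (apts w)"
    proof (rule inj_onI)
      fix z z' assume z: "z \<in> apts w" "z' \<in> apts w" "h z = h z'"
      then have "f (p z) = f (p z')" "k (q z) = k (q z')" using h by metis+
      then have "p z = p z'" "q z = q z'"
        using f(2) k(2) 1(1,2) z(1,2) unfolding bij_betw_def by (meson inj_onD)+
      then show "z = z'" using 1(7) z by blast
    qed
    show "h ` apts w = apts w'"
    proof
      show "h ` apts w \<subseteq> apts w'" using h by blast
      show "apts w' \<subseteq> h ` apts w"
      proof
        fix y assume y: "y \<in> apts w'"
        have "p' y \<in> f ` apts u" "q' y \<in> k ` apts v" using 2(1,2)[OF y] f(2) k(2) by (simp_all add: bij_betw_def)
        then obtain a b where ab: "a \<in> apts u" "p' y = f a" "b \<in> apts v" "q' y = k b" by blast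
        have "rleg u a = lleg v b" using 2(5)[OF y] ab F(4)[OF ab(1)] K(3)[OF ab(3)] by simp
        then obtain z where z: "z \<in> apts w" "p z = a" "q z = b" using 1(6) ab by blast
        have "h z = y" by (rule 2(7)) (use h[OF z(1)] z ab y in auto)
        then show "y \<in> h ` apts w" using z(1) by blast
      qed
    qed
  qed
  ultimately show ?thesis unfolding span_iso_def by blast
qed

text \<open>Pullback distributes over disjoint unions in either variable; both cases are instances of this.\<close>

lemma pullback_sum:
  assumes w: "is_span G X Z w1" "is_span G X Z w2" "is_span G X Z w"
    and pb: "span_pullback G u1 v1 w1" "span_pullback G u2 v2 w2" "span_pullback G u v w"
    and f: "span_map G u1 u f1" "inj_on f1 (apts u1)" "span_map G u2 u f2" "inj_on f2 (apts u2)"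
    and k: "span_map G v1 v k1" "inj_on k1 (apts v1)" "span_map G v2 v k2" "inj_on k2 (apts v2)"
    and split: "\<And>a b. a \<in> apts u \<Longrightarrow> b \<in> apts v \<Longrightarrow>
      (a \<in> f1 ` apts u1 \<and> b \<in> k1 ` apts v1) \<noteq> (a \<in> f2 ` apts u2 \<and> b \<in> k2 ` apts v2)"
  shows "span_sum G w1 w2 w"
proof -
  obtain p q where "pullback_maps u v w p q" using pb(3) unfolding span_pullback_iff by blast
    note 0 = pullback_mapsD[OF this]
  \<comment> \<open>Embeddings of \<open>u'\<close> and \<open>v'\<close> identify their pullback
    with the part of \<open>w\<close> lying over both images. The two instances are disjoint and
    cover by \<open>split\<close>.\<close>
  have part: "\<exists>h. span_map G w' w h \<and> inj_on h (apts w') \<and>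
      h ` apts w' = {z \<in> apts w. p z \<in> f ` apts u' \<and> q z \<in> k ` apts v'}"
    if w': "is_span G X Z w'" and pb': "span_pullback G u' v' w'"
      and f: "span_map G u' u f" "inj_on f (apts u')" and k: "span_map G v' v k" "inj_on k (apts v')"
    for u' v' w' f k
  proof -
    note F = span_mapD[OF f(1)] and K = span_mapD[OF k(1)]
    obtain p' q' where "pullback_maps u' v' w' p' q'" using pb' unfolding span_pullback_iff by blast
    note 2 = pullback_mapsD[OF this]
    have "\<forall>z\<in>apts w'. \<exists>y\<in>apts w. p y = f (p' z) \<and> q y = k (q' z)"
      using 2(1,2,5) 0(6) F(1,4) K(1,3) by metis
    then obtain h where h: "\<And>z. z \<in> apts w' \<Longrightarrow> h z \<in> apts w \<and> p (h z) = f (p' z) \<and> q (h z) = k (q' z)"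
      by metis
    have "span_map G w' w h"
    proof (rule span_mapI)
      fix z assume z: "z \<in> apts w'"
      show "h z \<in> apts w" using h[OF z] by blast
      show "lleg w (h z) = lleg w' z" using h[OF z] 2(1,8)[OF z] 0(8) F(3) by metis
      show "rleg w (h z) = rleg w' z" using h[OF z] 2(2,9)[OF z] 0(9) K(4) by metis
      fix g assume g: "g \<in> carrier G"
      have gz: "gact (apex w') g z \<in> apts w'" and gh: "gact (apex w) g (h z) \<in> apts w"
        using is_spanD(8)[OF w' g z] is_spanD(8)[OF w(3) g] h[OF z] by auto
      show "h (gact (apex w') g z) = gact (apex w) g (h z)"
      proof (rule 0(7)[OF _ gh])
        show "p (h (gact (apex w') g z)) = p (gact (apex w) g (h z))"
          using h[OF gz] h[OF z] 2(3)[OF g z] 0(3)[OF g, of "h z"] F(2)[OF g 2(1)[OF z]] by simp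
        show "q (h (gact (apex w') g z)) = q (gact (apex w) g (h z))"
          using h[OF gz] h[OF z] 2(4)[OF g z] 0(4)[OF g, of "h z"] K(2)[OF g 2(2)[OF z]] by simp
      qed (use h[OF gz] in blast)
    qed
    moreover have "inj_on h (apts w')"
    proof (rule inj_onI)
      fix z z' assume z: "z \<in> apts w'" "z' \<in> apts w'" "h z = h z'"
      then have "f (p' z) = f (p' z')" "k (q' z) = k (q' z')" using h by metis+
      then have "p' z = p' z'" "q' z = q' z'"
        using f(2) k(2) 2(1,2) z(1,2) by (meson inj_onD)+
      then show "z = z'" using 2(7) z by blast
    qed
    moreover have "h ` apts w' = {z \<in> apts w. p z \<in> f ` apts u' \<and> q z \<in> k ` apts v'}"
    proof
      show "h ` apts w' \<subseteq> {z \<in> apts w. p z \<in> f ` apts u' \<and> q z \<in> k ` apts v'}"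
        using h 2(1,2) by auto
      show "{z \<in> apts w. p z \<in> f ` apts u' \<and> q z \<in> k ` apts v'} \<subseteq> h ` apts w'"
      proof
        fix y assume "y \<in> {z \<in> apts w. p z \<in> f ` apts u' \<and> q z \<in> k ` apts v'}"
        then obtain a b where y: "y \<in> apts w" and ab: "a \<in> apts u'" "p y = f a" "b \<in> apts v'" "q y = k b" by blast
        have "rleg u' a = lleg v' b" using 0(5)[OF y] ab F(4)[OF ab(1)] K(3)[OF ab(3)] by simp
        then obtain z where z: "z \<in> apts w'" "p' z = a" "q' z = b" using 2(6) ab by blast
        have "h z = y" by (rule 0(7)) (use h[OF z(1)] z ab y in auto)
        then show "y \<in> h ` apts w'" using z(1) by blast
      qed
    qed
    ultimately show ?thesis by blast
  qed
  obtain h1 where h1: "span_map G w1 w h1" "inj_on h1 (apts w1)"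
    "h1 ` apts w1 = {z \<in> apts w. p z \<in> f1 ` apts u1 \<and> q z \<in> k1 ` apts v1}"
    using part[OF w(1) pb(1) f(1,2) k(1,2)] by blast
  obtain h2 where h2: "span_map G w2 w h2" "inj_on h2 (apts w2)"
    "h2 ` apts w2 = {z \<in> apts w. p z \<in> f2 ` apts u2 \<and> q z \<in> k2 ` apts v2}"
    using part[OF w(2) pb(2) f(3,4) k(3,4)] by blast
  have "h1 ` apts w1 \<union> h2 ` apts w2 = apts w" "h1 ` apts w1 \<inter> h2 ` apts w2 = {}"
    unfolding h1(3) h2(3) using split 0(1,2) by blast+
  then show ?thesis unfolding span_sum_iff using h1(1,2) h2(1,2) by blast
qed

text \<open>All pullbacks of isomorphic spans are isomorphic by \<open>pullback_iso\<close>.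
  Conversely, composing the projections with an isomorphism turns every \<open>w'\<close> isomorphic
  to \<open>w\<close> into a pullback of the same \<open>u\<close> and \<open>v\<close>.\<close>

lemma span_comp_class:
  fixes X Y Z :: "('g, 'g gpt) gset"
  assumes u: "is_span G X Y u" and v: "is_span G Y Z v" and w: "is_span G X Z w" "span_pullback G u v w"
  shows "span_comp G X Z (span_class G Y Z v) (span_class G X Y u) = span_class G X Z w"
proof
  show "span_comp G X Z (span_class G Y Z v) (span_class G X Y u) \<subseteq> span_class G X Z w"
  proof
    fix w' assume "w' \<in> span_comp G X Z (span_class G Y Z v) (span_class G X Y u)"
    then obtain u' v' where "is_span G X Z w'" "span_iso G u u'" "span_iso G v v'" "span_pullback G u' v' w'"
      unfolding span_comp_def span_class_conv by blast
    then show "w' \<in> span_class G X Z w" unfolding span_class_conv using pullback_iso w by blast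
  qed
  show "span_class G X Z w \<subseteq> span_comp G X Z (span_class G Y Z v) (span_class G X Y u)"
  proof
    fix w' assume "w' \<in> span_class G X Z w"
    then have w': "is_span G X Z w'" "span_iso G w w'" unfolding span_class_conv by auto
    obtain h where h: "span_map G w' w h" "bij_betw h (apts w') (apts w)"
      using span_iso_sym[OF w(1) w'(2)] unfolding span_iso_def by blast
    note H = span_mapD[OF h(1)]
    obtain p q where "pullback_maps u v w p q" using w(2) unfolding span_pullback_iff by blast
    note 1 = pullback_mapsD[OF this]
    have "span_pullback G u v w'"
    proof (rule span_pullbackI[where p = "\<lambda>z. p (h z)" and q = "\<lambda>z. q (h z)"])
      fix a b assume "a \<in> apts u" "b \<in> apts v" "rleg u a = lleg v b"
      then obtain y where y: "y \<in> apts w" "p y = a" "q y = b" using 1(6) by blast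
      then have "y \<in> h ` apts w'" using h(2) by (simp add: bij_betw_def)
      then show "\<exists>z\<in>apts w'. p (h z) = a \<and> q (h z) = b" using y by blast
    next
      fix z z' assume z: "z \<in> apts w'" "z' \<in> apts w'" "p (h z) = p (h z')" "q (h z) = q (h z')"
      then have "h z = h z'" using 1(7) H(1) by blast
      then show "z = z'" using h(2) z(1,2) unfolding bij_betw_def by (meson inj_onD)
    qed (use H 1 in simp_all, (metis H(3) 1(8), metis H(4) 1(9))?)
    then show "w' \<in> span_comp G X Z (span_class G Y Z v) (span_class G X Y u)"
      unfolding span_comp_def span_class_conv using w'(1) u v span_iso_refl by blast
  qed
qed

lemma span_comp_in_carrier:
  fixes X Y Z :: "('g, 'g gpt) gset"
  assumes "A \<in> carrier (span_monoid G X Y)" "B \<in> carrier (span_monoid G Y Z)"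
  shows "span_comp G X Z B A \<in> carrier (span_monoid G X Z)"
proof -
  obtain u where u: "is_span G X Y u" "A = span_class G X Y u" using assms(1) by (rule span_carrierE)
  obtain v where v: "is_span G Y Z v" "B = span_class G Y Z v" using assms(2) by (rule span_carrierE)
  obtain w where "is_span G X Z w" "span_pullback G u v w" using pullback_exists[OF u(1) v(1)] by blast
  then show ?thesis using span_comp_class[OF u(1) v(1)] u v span_class_in_carrier by simp
qed

lemma span_comp_add_right:
  fixes X Y Z :: "('g, 'g gpt) gset"
  assumes "A \<in> carrier (span_monoid G X Y)" "A' \<in> carrier (span_monoid G X Y)" "B \<in> carrier (span_monoid G Y Z)"
  shows "span_comp G X Z B (A \<otimes>\<^bsub>span_monoid G X Y\<^esub> A') =
    span_comp G X Z B A \<otimes>\<^bsub>span_monoid G X Z\<^esub> span_comp G X Z B A'"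
proof -
  obtain u1 where u1: "is_span G X Y u1" "A = span_class G X Y u1" using assms(1) by (rule span_carrierE)
  obtain u2 where u2: "is_span G X Y u2" "A' = span_class G X Y u2" using assms(2) by (rule span_carrierE)
  obtain v where v: "is_span G Y Z v" "B = span_class G Y Z v" using assms(3) by (rule span_carrierE)
  obtain u where u: "is_span G X Y u" "span_sum G u1 u2 u" using span_sum_exists[OF u1(1) u2(1)] by blast
  obtain w1 where w1: "is_span G X Z w1" "span_pullback G u1 v w1" using pullback_exists[OF u1(1) v(1)] by blast
  obtain w2 where w2: "is_span G X Z w2" "span_pullback G u2 v w2" using pullback_exists[OF u2(1) v(1)] by blast
  obtain w where w: "is_span G X Z w" "span_pullback G u v w" using pullback_exists[OF u(1) v(1)] by blast
  obtain i j where i: "span_map G u1 u i" "inj_on i (apts u1)" "span_map G u2 u j" "inj_on j (apts u2)"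
    "i ` apts u1 \<union> j ` apts u2 = apts u" "i ` apts u1 \<inter> j ` apts u2 = {}"
    using u(2) unfolding span_sum_iff by blast
  have id: "span_map G v v (\<lambda>x. x)" "inj_on (\<lambda>x. x) (apts v)" by (auto intro: span_mapI)
  have "span_sum G w1 w2 w"
    by (rule pullback_sum[OF w1(1) w2(1) w(1) w1(2) w2(2) w(2) i(1-4) id id]) (use i(5,6) in auto)
  then show ?thesis
    using span_class_sum[OF u1(1) u2(1) u] span_class_sum[OF w1(1) w2(1) w(1)] span_comp_class[OF u1(1) v(1) w1]
      span_comp_class[OF u2(1) v(1) w2] span_comp_class[OF u(1) v(1) w] u1(2) u2(2) v(2) by simp
qed

lemma span_comp_add_left:
  fixes X Y Z :: "('g, 'g gpt) gset"
  assumes "A \<in> carrier (span_monoid G X Y)" "B \<in> carrier (span_monoid G Y Z)" "B' \<in> carrier (span_monoid G Y Z)"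
  shows "span_comp G X Z (B \<otimes>\<^bsub>span_monoid G Y Z\<^esub> B') A =
    span_comp G X Z B A \<otimes>\<^bsub>span_monoid G X Z\<^esub> span_comp G X Z B' A"
proof -
  obtain u where u: "is_span G X Y u" "A = span_class G X Y u" using assms(1) by (rule span_carrierE)
  obtain v1 where v1: "is_span G Y Z v1" "B = span_class G Y Z v1" using assms(2) by (rule span_carrierE)
  obtain v2 where v2: "is_span G Y Z v2" "B' = span_class G Y Z v2" using assms(3) by (rule span_carrierE)
  obtain v where v: "is_span G Y Z v" "span_sum G v1 v2 v" using span_sum_exists[OF v1(1) v2(1)] by blast
  obtain w1 where w1: "is_span G X Z w1" "span_pullback G u v1 w1" using pullback_exists[OF u(1) v1(1)] by blast
  obtain w2 where w2: "is_span G X Z w2" "span_pullback G u v2 w2" using pullback_exists[OF u(1) v2(1)] by blast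
  obtain w where w: "is_span G X Z w" "span_pullback G u v w" using pullback_exists[OF u(1) v(1)] by blast
  obtain i j where i: "span_map G v1 v i" "inj_on i (apts v1)" "span_map G v2 v j" "inj_on j (apts v2)"
    "i ` apts v1 \<union> j ` apts v2 = apts v" "i ` apts v1 \<inter> j ` apts v2 = {}"
    using v(2) unfolding span_sum_iff by blast
  have id: "span_map G u u (\<lambda>x. x)" "inj_on (\<lambda>x. x) (apts u)" by (auto intro: span_mapI)
  have "span_sum G w1 w2 w"
    by (rule pullback_sum[OF w1(1) w2(1) w(1) w1(2) w2(2) w(2) id id i(1-4)]) (use i(5,6) in auto)
  then show ?thesis
    using span_class_sum[OF v1(1) v2(1) v] span_class_sum[OF w1(1) w2(1) w(1)] span_comp_class[OF u(1) v1(1) w1]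
      span_comp_class[OF u(1) v2(1) w2] span_comp_class[OF u(1) v(1) w] v1(2) v2(2) u(2) by simp
qed

text \<open>The union in \<open>burnside_comp\<close> runs over all representing pairs; bilinearity
  shows that each contributes the same class. The two arguments are changed one after the
  other.\<close>

lemma burnside_comp_diff:
  fixes X Y Z :: "('g, 'g gpt) gset"
  assumes a: "a \<in> carrier (span_monoid G X Y)" and b: "b \<in> carrier (span_monoid G X Y)"
    and c: "c \<in> carrier (span_monoid G Y Z)" and d: "d \<in> carrier (span_monoid G Y Z)"
  shows "burnside_comp G X Z (formal_diff (span_monoid G Y Z) c d) (formal_diff (span_monoid G X Y) a b) =
    formal_diff (span_monoid G X Z)
      (span_comp G X Z c a \<otimes>\<^bsub>span_monoid G X Z\<^esub> span_comp G X Z d b)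
      (span_comp G X Z c b \<otimes>\<^bsub>span_monoid G X Z\<^esub> span_comp G X Z d a)"
proof -
  interpret A: comm_monoid "span_monoid G X Y" by (rule comm_monoid_span)
  interpret B: comm_monoid "span_monoid G Y Z" by (rule comm_monoid_span)
  interpret C: comm_monoid "span_monoid G X Z" by (rule comm_monoid_span)
  let ?\<mu> = "span_comp G X Z" and ?plus = "\<lambda>x y. x \<otimes>\<^bsub>span_monoid G X Z\<^esub> y"
  let ?D = "\<lambda>a b c d. formal_diff (span_monoid G X Z) (?plus (?\<mu> c a) (?\<mu> d b)) (?plus (?\<mu> c b) (?\<mu> d a))"
  note cl = span_comp_in_carrier
  \<comment> \<open>\<open>c\<close> and \<open>d\<close> are generalised here because the fact is
    applied after they have been replaced by \<open>c'\<close> and \<open>d'\<close>.\<close>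
  have 1: "?D a' b' c d = ?D a b c d"
    if ab': "(a', b') \<in> formal_diff (span_monoid G X Y) a b" and cd: "c \<in> carrier (span_monoid G Y Z)" "d \<in> carrier (span_monoid G Y Z)"
    for a' b' c d
  proof -
    note m = A.mem_formal_diff[OF ab' a b]
    obtain k where k: "k \<in> carrier (span_monoid G X Y)"
      "a' \<otimes>\<^bsub>span_monoid G X Y\<^esub> b \<otimes>\<^bsub>span_monoid G X Y\<^esub> k = a \<otimes>\<^bsub>span_monoid G X Y\<^esub> b' \<otimes>\<^bsub>span_monoid G X Y\<^esub> k"
      using A.formal_diff_eq_iff[OF m(1,2) a b] m(3) by blast
    have e: "?plus (?plus (?\<mu> e a') (?\<mu> e b)) (?\<mu> e k) = ?plus (?plus (?\<mu> e a) (?\<mu> e b')) (?\<mu> e k)"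
      if "e \<in> carrier (span_monoid G Y Z)" for e
      using arg_cong[OF k(2), of "?\<mu> e"] span_comp_add_right m(1,2) a b k(1) that by simp
    note car = cl[OF m(1) cd(1)] cl[OF m(2) cd(1)] cl[OF a cd(1)] cl[OF b cd(1)] cl[OF k(1) cd(1)]
      cl[OF m(1) cd(2)] cl[OF m(2) cd(2)] cl[OF a cd(2)] cl[OF b cd(2)] cl[OF k(1) cd(2)]
    \<comment> \<open>After regrouping, the relation between the two representing pairs is used
      forwards under \<open>c\<close> and backwards under \<open>d\<close>.\<close>
    have "?plus (?plus (?plus (?\<mu> c a') (?\<mu> d b')) (?plus (?\<mu> c b) (?\<mu> d a))) (?plus (?\<mu> c k) (?\<mu> d k)) =
      ?plus (?plus (?plus (?\<mu> c a') (?\<mu> c b)) (?\<mu> c k)) (?plus (?plus (?\<mu> d a) (?\<mu> d b')) (?\<mu> d k))"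
      using car by (simp add: C.m_ac)
    also have "\<dots> = ?plus (?plus (?plus (?\<mu> c a) (?\<mu> c b')) (?\<mu> c k)) (?plus (?plus (?\<mu> d a') (?\<mu> d b)) (?\<mu> d k))"
      using e[OF cd(1)] e[OF cd(2)] by simp
    also have "\<dots> = ?plus (?plus (?plus (?\<mu> c a) (?\<mu> d b)) (?plus (?\<mu> c b') (?\<mu> d a'))) (?plus (?\<mu> c k) (?\<mu> d k))"
      using car by (simp add: C.m_ac)
    finally show ?thesis using C.formal_diff_eq_iff car by (meson C.m_closed)
  qed
  have 2: "?D a b c' d' = ?D a b c d"
    if cd': "(c', d') \<in> formal_diff (span_monoid G Y Z) c d" for c' d'
  proof -
    note m = B.mem_formal_diff[OF cd' c d]
    obtain k where k: "k \<in> carrier (span_monoid G Y Z)"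
      "c' \<otimes>\<^bsub>span_monoid G Y Z\<^esub> d \<otimes>\<^bsub>span_monoid G Y Z\<^esub> k = c \<otimes>\<^bsub>span_monoid G Y Z\<^esub> d' \<otimes>\<^bsub>span_monoid G Y Z\<^esub> k"
      using B.formal_diff_eq_iff[OF m(1,2) c d] m(3) by blast
    have e: "?plus (?plus (?\<mu> c' e) (?\<mu> d e)) (?\<mu> k e) = ?plus (?plus (?\<mu> c e) (?\<mu> d' e)) (?\<mu> k e)"
      if "e \<in> carrier (span_monoid G X Y)" for e
      using arg_cong[OF k(2), of "\<lambda>z. ?\<mu> z e"] span_comp_add_left m(1,2) c d k(1) that by simp
    note car = cl[OF a m(1)] cl[OF a m(2)] cl[OF a c] cl[OF a d] cl[OF a k(1)]
      cl[OF b m(1)] cl[OF b m(2)] cl[OF b c] cl[OF b d] cl[OF b k(1)]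
    have "?plus (?plus (?plus (?\<mu> c' a) (?\<mu> d' b)) (?plus (?\<mu> c b) (?\<mu> d a))) (?plus (?\<mu> k a) (?\<mu> k b)) =
      ?plus (?plus (?plus (?\<mu> c' a) (?\<mu> d a)) (?\<mu> k a)) (?plus (?plus (?\<mu> c b) (?\<mu> d' b)) (?\<mu> k b))"
      using car by (simp add: C.m_ac)
    also have "\<dots> = ?plus (?plus (?plus (?\<mu> c a) (?\<mu> d' a)) (?\<mu> k a)) (?plus (?plus (?\<mu> c' b) (?\<mu> d b)) (?\<mu> k b))"
      using e[OF a] e[OF b] by simp
    also have "\<dots> = ?plus (?plus (?plus (?\<mu> c a) (?\<mu> d b)) (?plus (?\<mu> c' b) (?\<mu> d' a))) (?plus (?\<mu> k a) (?\<mu> k b))"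
      using car by (simp add: C.m_ac)
    finally show ?thesis using C.formal_diff_eq_iff car by (meson C.m_closed)
  qed
  have "?D a' b' c' d' = ?D a b c d"
    if "(a', b') \<in> formal_diff (span_monoid G X Y) a b" "(c', d') \<in> formal_diff (span_monoid G Y Z) c d" for a' b' c' d'
    using 1[OF that(1) B.mem_formal_diff(1,2)[OF that(2) c d]] 2[OF that(2)] by simp
  then have "burnside_comp G X Z (formal_diff (span_monoid G Y Z) c d) (formal_diff (span_monoid G X Y) a b) =
      (\<Union>(a', b')\<in>formal_diff (span_monoid G X Y) a b. \<Union>(c', d')\<in>formal_diff (span_monoid G Y Z) c d. ?D a b c d)"
    unfolding burnside_comp_def by (intro SUP_cong refl) (auto split: prod.splits)
  also have "\<dots> = ?D a b c d"
    using A.self_mem_formal_diff[OF a b] B.self_mem_formal_diff[OF c d] by auto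
  finally show ?thesis .
qed

end

section \<open>The Mackey functor\<close>

text \<open>
  The theorem asks for groups of functions on points; an SK group is carried by the constant functions.
\<close>

definition const_group :: "('v, 'w) monoid_scheme \<Rightarrow> ('i \<Rightarrow> 'v) monoid" where
  "const_group A = \<lparr>carrier = (\<lambda>s _. s) ` carrier A, mult = (\<lambda>a b _. a undefined \<otimes>\<^bsub>A\<^esub> b undefined), one = (\<lambda>_. \<one>\<^bsub>A\<^esub>)\<rparr>"

lemma const_group_simps [simp]:
  "a \<in> carrier (const_group A) \<longleftrightarrow> (\<exists>s\<in>carrier A. a = (\<lambda>_. s))"
  "a \<otimes>\<^bsub>const_group A\<^esub> b = (\<lambda>_. a undefined \<otimes>\<^bsub>A\<^esub> b undefined)"
  "\<one>\<^bsub>const_group A\<^esub> = (\<lambda>_. \<one>\<^bsub>A\<^esub>)"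
  by (auto simp: const_group_def)

lemma comm_group_const:
  assumes "comm_group A" shows "comm_group (const_group A)"
proof -
  interpret A: comm_group A by fact
  show ?thesis
  proof (rule comm_groupI)
    show "x \<otimes>\<^bsub>const_group A\<^esub> y = y \<otimes>\<^bsub>const_group A\<^esub> x"
      if "x \<in> carrier (const_group A)" "y \<in> carrier (const_group A)" for x y :: "'c \<Rightarrow> 'a"
      using that A.m_comm by auto
    fix a :: "'c \<Rightarrow> 'a" assume "a \<in> carrier (const_group A)"
    then obtain s where "s \<in> carrier A" "a = (\<lambda>_. s)" by auto
    then show "\<exists>b\<in>carrier (const_group A). b \<otimes>\<^bsub>const_group A\<^esub> a = \<one>\<^bsub>const_group A\<^esub>"
      by (intro bexI[of _ "\<lambda>_. inv\<^bsub>A\<^esub> s"]) auto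
  qed (auto simp: A.m_assoc)
qed

text \<open>Source and target group coincide, so the cocycle is tautological: \<open>g\<close> acts
  on a fibre by \<open>g\<close> itself.\<close>

definition span_push ::
  "nat \<Rightarrow> ('g, 'b) monoid_scheme \<Rightarrow> ('g, 'x) gset \<Rightarrow> ('g, 'x) gset \<Rightarrow> ('g, 'x) span \<Rightarrow> 'g sk \<Rightarrow> 'g sk" where
  "span_push n G X Y u = push n G X (label X) G Y (label Y) (apts u) (gact (apex u)) (\<lambda>g _. g) (lleg u) (rleg u)"

abbreviation SKX :: "nat \<Rightarrow> ('g, 'b) monoid_scheme \<Rightarrow> ('g, 'x) gset \<Rightarrow> 'g sk monoid" where
  "SKX n G X \<equiv> lab_SK n G X (label X)"

abbreviation span_transported ::
  "('g, 'b) monoid_scheme \<Rightarrow> ('g, 'x) gset \<Rightarrow> ('g, 'x) gset \<Rightarrow> ('g, 'x) span \<Rightarrow> 'g mfd \<Rightarrow> 'g mfd \<Rightarrow> ('x \<Rightarrow> real \<Rightarrow> real) \<Rightarrow> bool" where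
  "span_transported G X Y u \<equiv>
     transported G (apts u) (gact (apex u)) (\<lambda>g _. g) (lleg u) (rleg u) (label X) (label Y)"

section \<open>The action of a single span\<close>

lemma corresp_span:
  assumes "is_span G X Y u"
  shows "corresp G X G Y (apts u) (gact (apex u)) (\<lambda>g _. g) (lleg u) (rleg u)"
  unfolding corresp_def using is_spanD[OF assms] finite_gsetD(4,5)[OF is_spanD(1)[OF assms]] by auto

lemma span_push:
  assumes "finite_gset G X" "finite_gset G Y" "is_span G X Y u"
  shows "span_push n G X Y u \<in> hom (SKX n G X) (SKX n G Y)"
    "lab_mfd n G X (label X) M \<Longrightarrow> lab_mfd n G Y (label Y) N \<Longrightarrow> span_transported G X Y u M N j \<Longrightarrow>
       span_push n G X Y u (lab_elem n G X (label X) M) = lab_elem n G Y (label Y) N"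
  unfolding span_push_def
  using push[OF labelling_label[OF assms(1)] labelling_label[OF assms(2)] corresp_span[OF assms(3)]] by blast+

lemma span_transported_exists:
  assumes "finite_gset G Y" "is_span G X Y u" "lab_mfd n G X (label X) M"
  obtains N j where "lab_mfd n G Y (label Y) N" "span_transported G X Y u M N j"
  using transported_exists[OF corresp_span[OF assms(2)] assms(3) labelling.ample[OF labelling_label[OF assms(1)]]] by blast

lemma SKX_hom_eq:
  assumes "finite_gset G X" "group B" "h \<in> hom (SKX n G X) B" "h' \<in> hom (SKX n G X) B"
    and "\<And>M. lab_mfd n G X (label X) M \<Longrightarrow> h (lab_elem n G X (label X) M) = h' (lab_elem n G X (label X) M)"
    and "x \<in> carrier (SKX n G X)"
  shows "h x = h' x"
  using labelling.hom_eq[OF labelling_label[OF assms(1)] assms(2-6)] by blast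

lemma comm_group_SKX: "finite_gset G X \<Longrightarrow> comm_group (SKX n G X)"
  by (rule labelling.comm_group_lab_SK[OF labelling_label])

lemma span_push_iso:
  assumes X: "finite_gset G X" and Y: "finite_gset G Y" and u: "is_span G X Y u" and v: "is_span G X Y v"
    and uv: "span_iso G u v" and x: "x \<in> carrier (SKX n G X)"
  shows "span_push n G X Y u x = span_push n G X Y v x"
proof (rule SKX_hom_eq[OF X _ span_push(1)[OF X Y u] span_push(1)[OF X Y v] _ x])
  show "group (SKX n G Y)" using comm_group_SKX[OF Y] comm_group_def by blast
  fix M assume M: "lab_mfd n G X (label X) M"
  obtain N j where N: "lab_mfd n G Y (label Y) N" "span_transported G X Y u M N j" using span_transported_exists[OF Y u M] .
  obtain N' j' where N': "lab_mfd n G Y (label Y) N'" "span_transported G X Y v M N' j'" using span_transported_exists[OF Y v M] .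
  obtain f where f: "span_map G u v f" "bij_betw f (apts u) (apts v)" using uv unfolding span_iso_def by blast
  note F = span_mapD[OF f(1)]
  have "lab_iso G (label Y) N N'"
    by (rule transported_iso[OF corresp_span[OF u] M N(1) N'(1) N(2) N'(2) f(2), where k = "\<lambda>_ x. x"])
      (use F diffeo_id[OF lab_mfdD(2)[OF M]] in auto)
  then show "span_push n G X Y u (lab_elem n G X (label X) M) = span_push n G X Y v (lab_elem n G X (label X) M)"
    using span_push(2)[OF X Y u M N] span_push(2)[OF X Y v M N']
      labelling.elem_iso[OF labelling_label[OF Y] N(1) N'(1)] by simp
qed

text \<open>In a commutative group the product of two homomorphisms is a homomorphism, so both sides
  may be compared on manifolds, where \<open>transported_additive\<close> applies.\<close>

lemma span_push_sum:
  assumes X: "finite_gset G X" and Y: "finite_gset G Y" and u: "is_span G X Y u" and v: "is_span G X Y v" and w: "is_span G X Y w"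
    and s: "span_sum G u v w" and x: "x \<in> carrier (SKX n G X)"
  shows "span_push n G X Y w x = span_push n G X Y u x \<otimes>\<^bsub>SKX n G Y\<^esub> span_push n G X Y v x"
proof -
  interpret Y: comm_group "SKX n G Y" by (rule comm_group_SKX[OF Y])
  note hu = span_push(1)[OF X Y u] and hv = span_push(1)[OF X Y v] and hw = span_push(1)[OF X Y w]
  have h: "(\<lambda>x. span_push n G X Y u x \<otimes>\<^bsub>SKX n G Y\<^esub> span_push n G X Y v x) \<in> hom (SKX n G X) (SKX n G Y)"
  proof (rule homI)
    fix x y assume xy: "x \<in> carrier (SKX n G X)" "y \<in> carrier (SKX n G X)"
    show "span_push n G X Y u (x \<otimes>\<^bsub>SKX n G X\<^esub> y) \<otimes>\<^bsub>SKX n G Y\<^esub> span_push n G X Y v (x \<otimes>\<^bsub>SKX n G X\<^esub> y) =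
      span_push n G X Y u x \<otimes>\<^bsub>SKX n G Y\<^esub> span_push n G X Y v x \<otimes>\<^bsub>SKX n G Y\<^esub>
      (span_push n G X Y u y \<otimes>\<^bsub>SKX n G Y\<^esub> span_push n G X Y v y)"
      unfolding hom_mult[OF hu xy] hom_mult[OF hv xy]
      using hom_in_carrier[OF hu xy(1)] hom_in_carrier[OF hu xy(2)] hom_in_carrier[OF hv xy(1)] hom_in_carrier[OF hv xy(2)]
      by (simp add: Y.m_ac)
  qed (use hom_in_carrier[OF hu] hom_in_carrier[OF hv] in auto)
  show ?thesis
  proof (rule SKX_hom_eq[OF X Y.is_group hw h _ x])
    fix M assume M: "lab_mfd n G X (label X) M"
    obtain N1 j1 where N1: "lab_mfd n G Y (label Y) N1" "span_transported G X Y u M N1 j1" using span_transported_exists[OF Y u M] .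
    obtain N2 j2 where N2: "lab_mfd n G Y (label Y) N2" "span_transported G X Y v M N2 j2" using span_transported_exists[OF Y v M] .
    obtain N j where N: "lab_mfd n G Y (label Y) N" "span_transported G X Y w M N j" using span_transported_exists[OF Y w M] .
    obtain b1 b2 where b: "span_map G u w b1" "inj_on b1 (apts u)" "span_map G v w b2" "inj_on b2 (apts v)"
      "b1 ` apts u \<union> b2 ` apts v = apts w" "b1 ` apts u \<inter> b2 ` apts v = {}"
      using s unfolding span_sum_iff by blast
    have "lab_sum G (label Y) N1 N2 N"
      by (rule transported_additive[OF corresp_span[OF u] corresp_span[OF v] M N1(1) N2(1) N(1) N1(2) N2(2) N(2)
            b(2) _ _ b(4) _ _ b(5,6)]) (use span_mapD[OF b(1)] span_mapD[OF b(3)] in auto)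
    then show "span_push n G X Y w (lab_elem n G X (label X) M) =
        span_push n G X Y u (lab_elem n G X (label X) M) \<otimes>\<^bsub>SKX n G Y\<^esub> span_push n G X Y v (lab_elem n G X (label X) M)"
      using span_push(2)[OF X Y u M N1] span_push(2)[OF X Y v M N2] span_push(2)[OF X Y w M N]
        labelling.elem_sum[OF labelling_label[OF Y] N1(1) N2(1) N(1)] by simp
  qed
qed

text \<open>The apex of the pullback is exactly the index set that
  \<open>transported_compose\<close> assigns to two successive transports.\<close>

lemma span_push_comp:
  assumes X: "finite_gset G X" and Y: "finite_gset G Y" and Z: "finite_gset G Z"
    and u: "is_span G X Y u" and v: "is_span G Y Z v" and w: "is_span G X Z w" "span_pullback G u v w"
    and x: "x \<in> carrier (SKX n G X)"
  shows "span_push n G X Z w x = span_push n G Y Z v (span_push n G X Y u x)"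
proof -
  interpret C: span_category G by (rule span_category.intro[OF is_spanD(2)[OF u]])
  have h: "(\<lambda>x. span_push n G Y Z v (span_push n G X Y u x)) \<in> hom (SKX n G X) (SKX n G Z)"
    using hom_compose[OF span_push(1)[OF X Y u] span_push(1)[OF Y Z v]] by (simp add: o_def)
  show ?thesis
  proof (rule SKX_hom_eq[OF X _ span_push(1)[OF X Z w(1)] h _ x])
    show "group (SKX n G Z)" using comm_group_SKX[OF Z] comm_group_def by blast
    fix M assume M: "lab_mfd n G X (label X) M"
    obtain N j where N: "lab_mfd n G Y (label Y) N" "span_transported G X Y u M N j" using span_transported_exists[OF Y u M] .
    obtain L i where L: "lab_mfd n G Z (label Z) L" "span_transported G Y Z v N L i" using span_transported_exists[OF Z v N(1)] .
    obtain p q where "C.pullback_maps u v w p q" using w(2) unfolding C.span_pullback_iff by blast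
    note pq = C.pullback_mapsD[OF this]
    have "span_transported G X Z w M L (\<lambda>r x. i (q r) (j (p r) x))"
      by (rule transported_compose[OF corresp_span[OF u] corresp_span[OF v] M N(1) L(1) N(2) L(2) pq(10)])
        (use pq is_spanD(8)[OF w(1)] in auto)
    then show "span_push n G X Z w (lab_elem n G X (label X) M) =
        span_push n G Y Z v (span_push n G X Y u (lab_elem n G X (label X) M))"
      using span_push(2)[OF X Y u M N] span_push(2)[OF Y Z v N(1) L] span_push(2)[OF X Z w(1) M L(1)] by simp
  qed
qed

lemma span_push_id:
  assumes X: "finite_gset G X" and x: "x \<in> carrier (SKX n G X)"
  shows "span_push n G X X \<lparr>apex = X, lleg = (\<lambda>x. x), rleg = (\<lambda>x. x)\<rparr> x = x"
proof (rule SKX_hom_eq[OF X _ span_push(1)[OF X X] _ _ x, where h' = "\<lambda>x. x"])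
  show u: "is_span G X X \<lparr>apex = X, lleg = (\<lambda>x. x), rleg = (\<lambda>x. x)\<rparr>"
    using X by (auto simp: is_span_def gset_map_def)
  show "group (SKX n G X)" using comm_group_SKX[OF X] comm_group_def by blast
  show "(\<lambda>x. x) \<in> hom (SKX n G X) (SKX n G X)" by (simp add: hom_def)
  fix M assume M: "lab_mfd n G X (label X) M"
  have "span_transported G X X \<lparr>apex = X, lleg = (\<lambda>x. x), rleg = (\<lambda>x. x)\<rparr> M M (\<lambda>_ x. x)"
    using transported_id[OF M] by simp
  then show "span_push n G X X \<lparr>apex = X, lleg = (\<lambda>x. x), rleg = (\<lambda>x. x)\<rparr> (lab_elem n G X (label X) M) = lab_elem n G X (label X) M"
    using span_push(2)[OF X X u M M] by simp
qed

text \<open>Any representative will do, by \<open>span_push_iso\<close>.\<close>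

definition span_act :: "nat \<Rightarrow> ('g, 'b) monoid_scheme \<Rightarrow> ('g, 'x) gset \<Rightarrow> ('g, 'x) gset \<Rightarrow> ('g, 'x) span set \<Rightarrow> 'g sk \<Rightarrow> 'g sk" where
  "span_act n G X Y A = span_push n G X Y (SOME u. u \<in> A)"

lemma span_act_class:
  assumes X: "finite_gset G X" and Y: "finite_gset G Y" and u: "is_span G X Y u" and x: "x \<in> carrier (SKX n G X)"
  shows "span_act n G X Y (span_class G X Y u) x = span_push n G X Y u x"
proof -
  have "(SOME v. v \<in> span_class G X Y u) \<in> span_class G X Y u"
    by (rule someI[of _ u]) (use u span_iso_refl in \<open>auto simp: span_class_conv\<close>)
  then have v: "is_span G X Y (SOME v. v \<in> span_class G X Y u)" "span_iso G u (SOME v. v \<in> span_class G X Y u)"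
    unfolding span_class_conv by auto
  show ?thesis unfolding span_act_def using span_push_iso[OF X Y u v x] by simp
qed

text \<open>The extension to formal differences is made for each \<open>x\<close> separately, with
  values in the SK group over \<open>Y\<close>; this avoids forming a group of
  homomorphisms.\<close>

definition SK_mor ::
  "nat \<Rightarrow> ('g, 'b) monoid_scheme \<Rightarrow> ('g, 'x) gset \<Rightarrow> ('g, 'x) gset \<Rightarrow> ('g, 'x) bmor \<Rightarrow> 'g sk \<Rightarrow> 'g sk" where
  "SK_mor n G X Y \<alpha> x = completion_lift (SKX n G Y) (\<lambda>A. span_act n G X Y A x) \<alpha>"

section \<open>From spans to morphisms of the Burnside category\<close>

context span_category
begin

lemma span_act_props:
  fixes X Y :: "('g, 'g gpt) gset"
  assumes X: "finite_gset G X" and Y: "finite_gset G Y"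
  shows "A \<in> carrier (span_monoid G X Y) \<Longrightarrow> span_act n G X Y A \<in> hom (SKX n G X) (SKX n G Y)"
    "A \<in> carrier (span_monoid G X Y) \<Longrightarrow> B \<in> carrier (span_monoid G X Y) \<Longrightarrow> x \<in> carrier (SKX n G X) \<Longrightarrow>
      span_act n G X Y (A \<otimes>\<^bsub>span_monoid G X Y\<^esub> B) x = span_act n G X Y A x \<otimes>\<^bsub>SKX n G Y\<^esub> span_act n G X Y B x"
proof -
  interpret HX: comm_group "SKX n G X" by (rule comm_group_SKX[OF X])
  show "span_act n G X Y A \<in> hom (SKX n G X) (SKX n G Y)" if A: "A \<in> carrier (span_monoid G X Y)" for A
  proof -
    obtain u where u: "is_span G X Y u" "A = span_class G X Y u" using A by (rule span_carrierE)
    show ?thesis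
      by (rule homI) (use span_act_class[OF X Y u(1)] u(2) span_push(1)[OF X Y u(1)] hom_in_carrier hom_mult in fastforce)+
  qed
  show "span_act n G X Y (A \<otimes>\<^bsub>span_monoid G X Y\<^esub> B) x = span_act n G X Y A x \<otimes>\<^bsub>SKX n G Y\<^esub> span_act n G X Y B x"
    if A: "A \<in> carrier (span_monoid G X Y)" and B: "B \<in> carrier (span_monoid G X Y)" and x: "x \<in> carrier (SKX n G X)" for A B x
  proof -
    obtain u where u: "is_span G X Y u" "A = span_class G X Y u" using A by (rule span_carrierE)
    obtain v where v: "is_span G X Y v" "B = span_class G X Y v" using B by (rule span_carrierE)
    obtain w where w: "is_span G X Y w" "span_sum G u v w" using span_sum_exists[OF u(1) v(1)] by blast
    show ?thesis using span_class_sum[OF u(1) v(1) w] u v span_act_class[OF X Y _ x] u(1) v(1) w(1)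
        span_push_sum[OF X Y u(1) v(1) w x] by simp
  qed
qed

lemma SK_mor_props:
  fixes X Y :: "('g, 'g gpt) gset"
  assumes X: "finite_gset G X" and Y: "finite_gset G Y"
  shows "a \<in> carrier (span_monoid G X Y) \<Longrightarrow> b \<in> carrier (span_monoid G X Y) \<Longrightarrow> x \<in> carrier (SKX n G X) \<Longrightarrow>
      SK_mor n G X Y (formal_diff (span_monoid G X Y) a b) x =
      span_act n G X Y a x \<otimes>\<^bsub>SKX n G Y\<^esub> inv\<^bsub>SKX n G Y\<^esub> span_act n G X Y b x"
    "\<alpha> \<in> carrier (burnside_hom G X Y) \<Longrightarrow> SK_mor n G X Y \<alpha> \<in> hom (SKX n G X) (SKX n G Y)"
    "\<alpha> \<in> carrier (burnside_hom G X Y) \<Longrightarrow> \<beta> \<in> carrier (burnside_hom G X Y) \<Longrightarrow> x \<in> carrier (SKX n G X) \<Longrightarrow>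
      SK_mor n G X Y (\<alpha> \<otimes>\<^bsub>burnside_hom G X Y\<^esub> \<beta>) x = SK_mor n G X Y \<alpha> x \<otimes>\<^bsub>SKX n G Y\<^esub> SK_mor n G X Y \<beta> x"
    "is_span G X Y u \<Longrightarrow> x \<in> carrier (SKX n G X) \<Longrightarrow> SK_mor n G X Y (burnside_span G X Y u) x = span_push n G X Y u x"
proof -
  interpret A: comm_monoid "span_monoid G X Y" by (rule comm_monoid_span)
  interpret HX: comm_group "SKX n G X" by (rule comm_group_SKX[OF X])
  interpret HY: comm_group "SKX n G Y" by (rule comm_group_SKX[OF Y])
  note act = span_act_props[OF X Y]
  note lift = A.completion_lift[of "SKX n G Y" "\<lambda>A. span_act n G X Y A x" for x, OF HY.comm_group_axioms hom_in_carrier[OF act(1)] act(2)]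
  show 1: "SK_mor n G X Y (formal_diff (span_monoid G X Y) a b) x =
      span_act n G X Y a x \<otimes>\<^bsub>SKX n G Y\<^esub> inv\<^bsub>SKX n G Y\<^esub> span_act n G X Y b x"
    if "a \<in> carrier (span_monoid G X Y)" "b \<in> carrier (span_monoid G X Y)" "x \<in> carrier (SKX n G X)" for a b x
    unfolding SK_mor_def using lift(1)[OF _ that(3) _ _ that(3) that(1,2)] that by blast
  show "SK_mor n G X Y (\<alpha> \<otimes>\<^bsub>burnside_hom G X Y\<^esub> \<beta>) x = SK_mor n G X Y \<alpha> x \<otimes>\<^bsub>SKX n G Y\<^esub> SK_mor n G X Y \<beta> x"
    if "\<alpha> \<in> carrier (burnside_hom G X Y)" "\<beta> \<in> carrier (burnside_hom G X Y)" "x \<in> carrier (SKX n G X)" for \<alpha> \<beta> x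
    unfolding SK_mor_def burnside_hom_def
    by (rule hom_mult[OF lift(2)]) (use that in \<open>auto simp: burnside_hom_def\<close>)
  show "SK_mor n G X Y (burnside_span G X Y u) x = span_push n G X Y u x"
    if "is_span G X Y u" "x \<in> carrier (SKX n G X)" for u x
  proof -
    have "SK_mor n G X Y (burnside_span G X Y u) x = span_act n G X Y (span_class G X Y u) x"
      unfolding SK_mor_def burnside_span_def by (rule lift(3)) (use that span_class_in_carrier in auto)
    then show ?thesis using span_act_class[OF X Y that] by simp
  qed
  show "SK_mor n G X Y \<alpha> \<in> hom (SKX n G X) (SKX n G Y)" if \<alpha>: "\<alpha> \<in> carrier (burnside_hom G X Y)" for \<alpha>
  proof -
    obtain a b where ab: "a \<in> carrier (span_monoid G X Y)" "b \<in> carrier (span_monoid G X Y)" "\<alpha> = formal_diff (span_monoid G X Y) a b"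
      using \<alpha> unfolding burnside_hom_def by (rule A.completion_cases)
    note ha = act(1)[OF ab(1)] and hb = act(1)[OF ab(2)]
    show ?thesis
    proof (rule homI)
      fix x assume x: "x \<in> carrier (SKX n G X)"
      then show "SK_mor n G X Y \<alpha> x \<in> carrier (SKX n G Y)"
        using 1[OF ab(1,2) x] ab(3) hom_in_carrier[OF ha x] hom_in_carrier[OF hb x] by simp
      fix y assume y: "y \<in> carrier (SKX n G X)"
      show "SK_mor n G X Y \<alpha> (x \<otimes>\<^bsub>SKX n G X\<^esub> y) = SK_mor n G X Y \<alpha> x \<otimes>\<^bsub>SKX n G Y\<^esub> SK_mor n G X Y \<alpha> y"
        unfolding ab(3) 1[OF ab(1,2) x] 1[OF ab(1,2) y] 1[OF ab(1,2) HX.m_closed[OF x y]] hom_mult[OF ha x y] hom_mult[OF hb x y]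
        using hom_in_carrier[OF ha x] hom_in_carrier[OF hb x] hom_in_carrier[OF ha y] hom_in_carrier[OF hb y]
        by (simp add: HY.inv_mult HY.m_ac)
    qed
  qed
qed

lemma span_act_comp:
  fixes X Y Z :: "('g, 'g gpt) gset"
  assumes X: "finite_gset G X" and Y: "finite_gset G Y" and Z: "finite_gset G Z"
    and A: "A \<in> carrier (span_monoid G X Y)" and B: "B \<in> carrier (span_monoid G Y Z)" and x: "x \<in> carrier (SKX n G X)"
  shows "span_act n G X Z (span_comp G X Z B A) x = span_act n G Y Z B (span_act n G X Y A x)"
proof -
  obtain u where u: "is_span G X Y u" "A = span_class G X Y u" using A by (rule span_carrierE)
  obtain v where v: "is_span G Y Z v" "B = span_class G Y Z v" using B by (rule span_carrierE)
  obtain w where w: "is_span G X Z w" "span_pullback G u v w" using pullback_exists[OF u(1) v(1)] by blast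
  have "span_push n G X Y u x \<in> carrier (SKX n G Y)" using hom_in_carrier[OF span_push(1)[OF X Y u(1)] x] .
  then show ?thesis
    using span_comp_class[OF u(1) v(1) w] u v span_act_class[OF X Y u(1) x] span_act_class[OF X Z w(1) x]
      span_act_class[OF Y Z v(1)] span_push_comp[OF X Y Z u(1) v(1) w x] by simp
qed

text \<open>Both sides expand into four terms, one for each pair of representatives, and
  \<open>span_act_comp\<close> matches them; the signs are those built into
  \<open>burnside_comp\<close>.\<close>

lemma SK_mor_comp:
  fixes X Y Z :: "('g, 'g gpt) gset"
  assumes X: "finite_gset G X" and Y: "finite_gset G Y" and Z: "finite_gset G Z"
    and \<alpha>: "\<alpha> \<in> carrier (burnside_hom G X Y)" and \<beta>: "\<beta> \<in> carrier (burnside_hom G Y Z)" and x: "x \<in> carrier (SKX n G X)"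
  shows "SK_mor n G X Z (burnside_comp G X Z \<beta> \<alpha>) x = SK_mor n G Y Z \<beta> (SK_mor n G X Y \<alpha> x)"
proof -
  interpret MX: comm_monoid "span_monoid G X Y" by (rule comm_monoid_span)
  interpret MY: comm_monoid "span_monoid G Y Z" by (rule comm_monoid_span)
  interpret MZ: comm_monoid "span_monoid G X Z" by (rule comm_monoid_span)
  interpret HY: comm_group "SKX n G Y" by (rule comm_group_SKX[OF Y])
  interpret HZ: comm_group "SKX n G Z" by (rule comm_group_SKX[OF Z])
  obtain a b where ab: "a \<in> carrier (span_monoid G X Y)" "b \<in> carrier (span_monoid G X Y)" "\<alpha> = formal_diff (span_monoid G X Y) a b"
    using \<alpha> unfolding burnside_hom_def by (rule MX.completion_cases)
  obtain c d where cd: "c \<in> carrier (span_monoid G Y Z)" "d \<in> carrier (span_monoid G Y Z)" "\<beta> = formal_diff (span_monoid G Y Z) c d"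
    using \<beta> unfolding burnside_hom_def by (rule MY.completion_cases)
  let ?C = "span_comp G X Z" and ?s = "\<lambda>A. span_act n G X Z A x" and ?t = "\<lambda>A. span_act n G X Y A x"
  note cc = span_comp_in_carrier
  note hc = span_act_props(1)[OF Y Z cd(1), of n] and hd = span_act_props(1)[OF Y Z cd(2), of n]
  have ta: "?t a \<in> carrier (SKX n G Y)" and tb: "?t b \<in> carrier (SKX n G Y)"
    using hom_in_carrier[OF span_act_props(1)[OF X Y ab(1)] x] hom_in_carrier[OF span_act_props(1)[OF X Y ab(2)] x] by auto
  interpret hc: group_hom "SKX n G Y" "SKX n G Z" "span_act n G Y Z c" by unfold_locales (rule hc)
  interpret hd: group_hom "SKX n G Y" "SKX n G Z" "span_act n G Y Z d" by unfold_locales (rule hd)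
  have "SK_mor n G X Z (burnside_comp G X Z \<beta> \<alpha>) x =
      (?s (?C c a) \<otimes>\<^bsub>SKX n G Z\<^esub> ?s (?C d b)) \<otimes>\<^bsub>SKX n G Z\<^esub> inv\<^bsub>SKX n G Z\<^esub> (?s (?C c b) \<otimes>\<^bsub>SKX n G Z\<^esub> ?s (?C d a))"
    unfolding ab(3) cd(3) burnside_comp_diff[OF ab(1,2) cd(1,2)]
    using SK_mor_props(1)[OF X Z _ _ x] span_act_props(2)[OF X Z _ _ x] cc ab cd MZ.m_closed by simp
  also have "\<dots> = (span_act n G Y Z c (?t a) \<otimes>\<^bsub>SKX n G Z\<^esub> span_act n G Y Z d (?t b)) \<otimes>\<^bsub>SKX n G Z\<^esub>
      inv\<^bsub>SKX n G Z\<^esub> (span_act n G Y Z c (?t b) \<otimes>\<^bsub>SKX n G Z\<^esub> span_act n G Y Z d (?t a))"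
    using span_act_comp[OF X Y Z _ _ x] ab(1,2) cd(1,2) by simp
  also have "\<dots> = span_act n G Y Z c (?t a \<otimes>\<^bsub>SKX n G Y\<^esub> inv\<^bsub>SKX n G Y\<^esub> ?t b) \<otimes>\<^bsub>SKX n G Z\<^esub>
      inv\<^bsub>SKX n G Z\<^esub> span_act n G Y Z d (?t a \<otimes>\<^bsub>SKX n G Y\<^esub> inv\<^bsub>SKX n G Y\<^esub> ?t b)"
    using ta tb by (simp add: HZ.inv_mult HZ.m_ac)
  also have "\<dots> = SK_mor n G Y Z \<beta> (SK_mor n G X Y \<alpha> x)"
    unfolding ab(3) cd(3) SK_mor_props(1)[OF X Y ab(1,2) x]
    by (rule SK_mor_props(1)[OF Y Z cd(1,2), symmetric]) (use ta tb in simp)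
  finally show ?thesis .
qed

lemma mackey_functor_SK:
  "mackey_functor G (\<lambda>X :: ('g, 'g gpt) gset. const_group (SKX n G X) :: ('g gpt \<Rightarrow> 'g sk) monoid)
    (\<lambda>X Y \<alpha> a _. SK_mor n G X Y \<alpha> (a undefined))"
  unfolding mackey_functor_def
proof (intro conjI allI impI, goal_cases)
  case (1 X)
  then show ?case by (intro comm_group_const comm_group_SKX)
next
  case (2 X Y \<alpha>)
  note h = SK_mor_props(2)[OF 2]
  show ?case by (rule homI) (use hom_in_carrier[OF h] hom_mult[OF h] in auto)
next
  case (3 X Y \<alpha> \<beta> a)
  then show ?case using SK_mor_props(3)[OF 3(1-4)] by auto
next
  case (4 X a)
  have u: "is_span G X X \<lparr>apex = X, lleg = (\<lambda>x. x), rleg = (\<lambda>x. x)\<rparr>"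
    using 4 by (auto simp: is_span_def gset_map_def)
  show ?case unfolding burnside_id_def
    using 4(2) SK_mor_props(4)[OF 4(1,1) u] span_push_id[OF 4(1)] by auto
next
  case (5 X Y Z \<alpha> \<beta> a)
  then show ?case using SK_mor_comp[OF 5(1-5)] by auto
qed

end

section \<open>Comparing transported manifolds\<close>

lemma act_fibre:
  assumes M: "lab_mfd n G X \<pi> M" and X: "finite_gset G X" and g: "g \<in> carrier G" and y: "y \<in> pts X"
  shows "diffeo M (fibre \<pi> M y) M (fibre \<pi> M (gact X g y)) (mact M g)"
proof -
  note m = G_manifoldD[OF lab_mfdD(1)[OF M]]
  interpret group G by (rule m(5))
  have "mact M g ` fibre \<pi> M y = fibre \<pi> M (gact X g y)"
  proof
    show "mact M g ` fibre \<pi> M y \<subseteq> fibre \<pi> M (gact X g y)"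
      using lab_mfdD(4)[OF M] m(6) g by auto
    show "fibre \<pi> M (gact X g y) \<subseteq> mact M g ` fibre \<pi> M y"
    proof
      fix z assume z: "z \<in> fibre \<pi> M (gact X g y)"
      have "gact X (inv\<^bsub>G\<^esub> g) (gact X g y) = y"
        using finite_gsetD(5)[OF X inv_closed[OF g] g y] finite_gsetD(4)[OF X y] g by simp
      then have "mact M (inv\<^bsub>G\<^esub> g) z \<in> fibre \<pi> M y" using z g lab_mfdD(4)[OF M] m(6) by auto
      then show "z \<in> mact M g ` fibre \<pi> M y" using m(10)[OF g] z by (metis (mono_tags, lifting) image_eqI mem_Collect_eq)
    qed
  qed
  then show ?thesis using diffeo_act[OF lab_mfdD(1)[OF M] g, of "fibre \<pi> M y"] by auto
qed

text \<open>Cohomologous cocycles give isomorphic manifolds.\<close>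

lemma transported_twist:
  assumes C: "corresp G X H Y P a c f q" and X: "finite_gset G X"
    and M: "lab_mfd n G X \<pi> M" and N: "lab_mfd n H Y \<rho> N" and N': "lab_mfd n H Y \<rho> N'"
    and tr: "transported H P a c f q \<pi> \<rho> M N j" and tr': "transported H P' a' c' f' q' \<pi> \<rho> M N' j'"
    and \<beta>: "bij_betw \<beta> P P'" "\<And>h p. h \<in> carrier H \<Longrightarrow> p \<in> P \<Longrightarrow> \<beta> (a h p) = a' h (\<beta> p)" "\<And>p. p \<in> P \<Longrightarrow> q' (\<beta> p) = q p"
    and f: "\<And>p. p \<in> P \<Longrightarrow> f p \<in> pts X" "\<And>p. p \<in> P \<Longrightarrow> f' (\<beta> p) = gact X (t p) (f p)"
    and t: "\<And>p. p \<in> P \<Longrightarrow> t p \<in> carrier G"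
    and c': "\<And>h p. h \<in> carrier H \<Longrightarrow> p \<in> P \<Longrightarrow> c' h (\<beta> p) \<in> carrier G"
      "\<And>h p. h \<in> carrier H \<Longrightarrow> p \<in> P \<Longrightarrow> t (a h p) \<otimes>\<^bsub>G\<^esub> c h p = c' h (\<beta> p) \<otimes>\<^bsub>G\<^esub> t p"
  shows "lab_iso H \<rho> N N'"
proof (rule transported_iso[OF C M N N' tr tr', where \<beta> = \<beta> and k = "\<lambda>p. mact M (t p)"])
  show "bij_betw \<beta> P P'" by (fact \<beta>(1))
  show "\<beta> (a h p) = a' h (\<beta> p)" if "h \<in> carrier H" "p \<in> P" for h p by (rule \<beta>(2)[OF that])
  show "q' (\<beta> p) = q p" if "p \<in> P" for p by (rule \<beta>(3)[OF that])
next
  fix p assume p: "p \<in> P"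
  show "diffeo M (fibre \<pi> M (f p)) M (fibre \<pi> M (f' (\<beta> p))) (mact M (t p))"
    unfolding f(2)[OF p] by (rule act_fibre[OF M X t[OF p] f(1)[OF p]])
next
  fix h p x assume h: "h \<in> carrier H" and p: "p \<in> P" and x: "x \<in> mspace M"
  note m = G_manifoldD(8)[OF lab_mfdD(1)[OF M] _ _ x]
  show "mact M (t (a h p)) (mact M (c h p) x) = mact M (c' h (\<beta> p)) (mact M (t p) x)"
    using c'(2)[OF h p] m[OF t[OF correspD(6)[OF C h p]] correspD(7)[OF C h p]] m[OF c'(1)[OF h p] t[OF p]] by simp
qed

text \<open>The diffeomorphism is absorbed into \<open>j\<close>. Hence the transports of a given
  manifold are closed under isomorphism, which turns statements up to diffeomorphism into exact
  ones.\<close>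

lemma transported_diffeo:
  assumes N: "lab_mfd n H Y \<rho> N" "lab_mfd n H Y \<rho> N'" and \<phi>: "lab_diffeo H \<rho> N N' (mspace N') \<phi>"
    and tr: "transported H P a c f q \<pi> \<rho> M N j"
  shows "transported H P a c f q \<pi> \<rho> M N' (\<lambda>p x. \<phi> (j p x))"
proof -
  note d = lab_diffeoD[OF \<phi>] and t = transportedD[OF tr]
  note d' = diffeoD[OF d(1)] and p' = piecesD[OF t(1)]
  have "pieces N' P (\<lambda>_. M) (\<lambda>p. fibre \<pi> M (f p)) (\<lambda>p x. \<phi> (j p x))"
    unfolding pieces_def
  proof (intro conjI ballI impI)
    fix p assume p: "p \<in> P"
    have sub: "j p ` fibre \<pi> M (f p) \<subseteq> mspace N" using p'(6)[OF p] by blast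
    have im: "(\<lambda>x. \<phi> (j p x)) ` fibre \<pi> M (f p) = \<phi> ` j p ` fibre \<pi> M (f p)" by (simp only: image_image)
    show "charted M" "openin (mtop M) (fibre \<pi> M (f p))" using p'(1,2)[OF p] by auto
    show "openin (mtop N') ((\<lambda>x. \<phi> (j p x)) ` fibre \<pi> M (f p))"
      unfolding im by (rule diffeo_open_image[OF d(1) openin_topspace p'(3)[OF p] sub])
    show "diffeo M (fibre \<pi> M (f p)) N' ((\<lambda>x. \<phi> (j p x)) ` fibre \<pi> M (f p)) (\<lambda>x. \<phi> (j p x))"
      unfolding im
      by (rule diffeo_compose[OF p'(1)[OF p] lab_mfdD(2)[OF N(1)] lab_mfdD(2)[OF N(2)] p'(4)[OF p]
            diffeo_subset[OF lab_mfdD(2)[OF N(2)] d(1) sub]])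
  next
    fix p p2 x y assume p: "p \<in> P" "p2 \<in> P" "x \<in> fibre \<pi> M (f p)" "y \<in> fibre \<pi> M (f p2)" "\<phi> (j p x) = \<phi> (j p2 y)"
    then have "j p x = j p2 y" using inj_onD[OF d'(2)] p'(6) by blast
    then show "p = p2" using p'(5) p by blast
  next
    have "(\<Union>p\<in>P. (\<lambda>x. \<phi> (j p x)) ` fibre \<pi> M (f p)) = \<phi> ` (\<Union>p\<in>P. j p ` fibre \<pi> M (f p))"
      by (simp only: image_UN image_image)
    also have "\<dots> = mspace N'" using t(1) d'(3) unfolding pieces_def by simp
    finally show "(\<Union>p\<in>P. (\<lambda>x. \<phi> (j p x)) ` fibre \<pi> M (f p)) = mspace N'" .
  qed
  then show ?thesis unfolding transported_def
  proof (intro conjI ballI)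
    fix p x assume p: "p \<in> P" and "x \<in> fibre \<pi> M (f p)"
    then have x: "x \<in> mspace M" "\<pi> x = f p" by auto
    show "\<rho> (\<phi> (j p x)) = q p" using t(2)[OF p x] d(3)[OF t(4)[OF p x]] by simp
    fix h assume h: "h \<in> carrier H"
    show "mact N' h (\<phi> (j p x)) = \<phi> (j (a h p) (mact M (c h p) x))"
      using d(2)[OF h t(4)[OF p x]] t(3)[OF h p x] by simp
  qed
qed

section \<open>Orbits and their points\<close>

abbreviation cpt :: "('g, 'b) monoid_scheme \<Rightarrow> 'g set \<Rightarrow> 'g \<Rightarrow> 'g gpt" where
  "cpt G H a \<equiv> (a <#\<^bsub>G\<^esub> H, 0)"

abbreviation ulabel :: "real \<Rightarrow> unit" where
  "ulabel \<equiv> \<lambda>_. ()"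

context group
begin

lemma lcoset_eq_iff:
  assumes H: "subgroup H G" and a: "a \<in> carrier G" and b: "b \<in> carrier G"
  shows "a <# H = b <# H \<longleftrightarrow> inv b \<otimes> a \<in> H"
proof
  note sH = subgroup.subset[OF H]
  assume "a <# H = b <# H"
  moreover have "a \<in> a <# H" using a subgroup.one_closed[OF H] r_one[OF a] unfolding l_coset_def by force
  ultimately obtain h where h: "h \<in> H" "a = b \<otimes> h" unfolding l_coset_def by blast
  then show "inv b \<otimes> a \<in> H" using b sH by (auto simp: m_assoc[symmetric])
next
  note sH = subgroup.subset[OF H]
  assume h: "inv b \<otimes> a \<in> H"
  then have "inv b \<otimes> a <# H = H" using coset_join3[OF _ H] a b by simp
  then have "b <# (inv b \<otimes> a <# H) = b <# H" by simp
  then show "a <# H = b <# H" using lcos_m_assoc[OF sH b, of "inv b \<otimes> a"] a b by (simp add: m_assoc[symmetric])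
qed

lemma orbit_points:
  assumes H: "subgroup H G"
  shows "a \<in> carrier G \<Longrightarrow> cpt G H a \<in> pts (orbit_gset G H)"
    "p \<in> pts (orbit_gset G H) \<Longrightarrow> \<exists>a\<in>carrier G. p = cpt G H a"
    "g \<in> carrier G \<Longrightarrow> a \<in> carrier G \<Longrightarrow> gact (orbit_gset G H) g (cpt G H a) = cpt G H (g \<otimes> a)"
    "a \<in> carrier G \<Longrightarrow> b \<in> carrier G \<Longrightarrow> cpt G H a = cpt G H b \<longleftrightarrow> inv b \<otimes> a \<in> H"
    "cpt G H \<one> = (H, 0)"
    "h \<in> H \<Longrightarrow> cpt G H h = (H, 0)"
    "h \<in> H \<Longrightarrow> gact (orbit_gset G H) h (H, 0) = (H, 0)"
    "(H, 0) \<in> pts (orbit_gset G H)"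
proof -
  note sH = subgroup.subset[OF H]
  show 1: "cpt G H a \<in> pts (orbit_gset G H)" if "a \<in> carrier G" for a
    using that by (auto simp: orbit_gset_def Let_def)
  show "p \<in> pts (orbit_gset G H) \<Longrightarrow> \<exists>a\<in>carrier G. p = cpt G H a" by (auto simp: orbit_gset_def Let_def)
  show 2: "gact (orbit_gset G H) g (cpt G H a) = cpt G H (g \<otimes> a)" if "g \<in> carrier G" "a \<in> carrier G" for g a
    using 1[OF that(2)] lcos_m_assoc[OF sH that] by (simp add: orbit_gset_def Let_def)
  show 3: "cpt G H a = cpt G H b \<longleftrightarrow> inv b \<otimes> a \<in> H" if "a \<in> carrier G" "b \<in> carrier G" for a b
    using lcoset_eq_iff[OF H that] by simp
  show 4: "cpt G H h = (H, 0)" if "h \<in> H" for h using coset_join3[OF _ H that] sH that by auto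
  then show 5: "cpt G H \<one> = (H, 0)" using subgroup.one_closed[OF H] by blast
  show "gact (orbit_gset G H) h (H, 0) = (H, 0)" if "h \<in> H" for h
    using 2[of h \<one>] 4[OF that] 5 sH that by auto
  show "(H, 0) \<in> pts (orbit_gset G H)" using 1[OF one_closed] 5 by simp
qed

lemma finite_gset_orbit:
  assumes "finite (carrier G)" and H: "subgroup H G"
  shows "finite_gset G (orbit_gset G H)"
  unfolding finite_gset_def
proof
  note o = orbit_points[OF H]
  have "pts (orbit_gset G H) \<subseteq> cpt G H ` carrier G" using o(2) by blast
  then show "finite (pts (orbit_gset G H))" using assms(1) finite_surj by blast
  show "group_action G (pts (orbit_gset G H)) (gact (orbit_gset G H))"
  proof (rule group_actionI[OF is_group])
    show "gact (orbit_gset G H) g \<in> extensional (pts (orbit_gset G H))" for g by (simp add: orbit_gset_def Let_def)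
    fix p assume "p \<in> pts (orbit_gset G H)"
    then obtain b where b: "b \<in> carrier G" "p = cpt G H b" using o(2) by blast
    show "gact (orbit_gset G H) \<one> p = p" using o(3) b by simp
    fix g assume g: "g \<in> carrier G"
    show "gact (orbit_gset G H) g p \<in> pts (orbit_gset G H)" using o(1,3) b g by simp
    fix h assume h: "h \<in> carrier G"
    show "gact (orbit_gset G H) (g \<otimes> h) p = gact (orbit_gset G H) g (gact (orbit_gset G H) h p)"
      using o(3) b g h by (simp add: m_assoc)
  qed
qed

lemma orbit_proj_cpt:
  assumes K: "subgroup K G" and H: "subgroup H G" and KH: "K \<subseteq> H" and a: "a \<in> carrier G"
  shows "orbit_proj G H (cpt G K a) = cpt G H a"
proof -
  have "(a <# K) <#> H = a <# (K <#> H)"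
    using setmult_lcos_assoc[OF subgroup.subset[OF K] subgroup.subset[OF H] a] by simp
  moreover have "K <#> H = H"
  proof
    show "K <#> H \<subseteq> H" using KH subgroup.m_closed[OF H] unfolding set_mult_def by blast
    show "H \<subseteq> K <#> H" using subgroup.one_closed[OF K] subgroup.subset[OF H] l_one unfolding set_mult_def by force
  qed
  ultimately show ?thesis by (simp add: orbit_proj_def)
qed

lemma conj_subgroup_subgroup:
  assumes H: "subgroup H G" and g: "g \<in> carrier G"
  shows "subgroup (conj_subgroup G g H) G"
proof (rule subgroupI)
  note sH = subgroup.subset[OF H]
  show "conj_subgroup G g H \<subseteq> carrier G" using sH g by (auto simp: conj_subgroup_def)
  show "conj_subgroup G g H \<noteq> {}" using subgroup.one_closed[OF H] by (auto simp: conj_subgroup_def)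
  fix a assume "a \<in> conj_subgroup G g H"
  then obtain h where h: "h \<in> H" "a = g \<otimes> h \<otimes> inv g" by (auto simp: conj_subgroup_def)
  have "inv a = g \<otimes> inv h \<otimes> inv g" using h sH g by (auto simp: inv_mult_group m_assoc)
  then show "inv a \<in> conj_subgroup G g H" using subgroup.m_inv_closed[OF H h(1)] by (auto simp: conj_subgroup_def)
  fix b assume "b \<in> conj_subgroup G g H"
  then obtain k where k: "k \<in> H" "b = g \<otimes> k \<otimes> inv g" by (auto simp: conj_subgroup_def)
  have hk: "h \<in> carrier G" "k \<in> carrier G" using h k sH by auto
  have "inv g \<otimes> (g \<otimes> (k \<otimes> inv g)) = k \<otimes> inv g" using hk g by (simp add: m_assoc[symmetric])
  then have "a \<otimes> b = g \<otimes> (h \<otimes> k) \<otimes> inv g" using h k hk g by (simp add: m_assoc)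
  then show "a \<otimes> b \<in> conj_subgroup G g H" using subgroup.m_closed[OF H h(1) k(1)] by (auto simp: conj_subgroup_def)
qed

lemma mem_conj_subgroup_iff:
  assumes H: "subgroup H G" and g: "g \<in> carrier G" and x: "x \<in> carrier G"
  shows "x \<in> conj_subgroup G g H \<longleftrightarrow> inv g \<otimes> x \<otimes> g \<in> H"
proof
  note sH = subgroup.subset[OF H]
  assume "x \<in> conj_subgroup G g H"
  then obtain h where h: "h \<in> H" "x = g \<otimes> h \<otimes> inv g" by (auto simp: conj_subgroup_def)
  have hc: "h \<in> carrier G" using h sH by blast
  have "inv g \<otimes> x \<otimes> g = inv g \<otimes> g \<otimes> h \<otimes> (inv g \<otimes> g)" unfolding h(2) using g hc by (simp only: m_assoc m_closed inv_closed)
  then have "inv g \<otimes> x \<otimes> g = h" using g hc by simp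
  then show "inv g \<otimes> x \<otimes> g \<in> H" using h by simp
next
  assume h: "inv g \<otimes> x \<otimes> g \<in> H"
  have "g \<otimes> (inv g \<otimes> x \<otimes> g) \<otimes> inv g = x" 
  proof -
    have "g \<otimes> (inv g \<otimes> x \<otimes> g) \<otimes> inv g = g \<otimes> inv g \<otimes> x \<otimes> (g \<otimes> inv g)" using g x by (simp only: m_assoc m_closed inv_closed)
    then show ?thesis using g x by simp
  qed
  then show "x \<in> conj_subgroup G g H" using h unfolding conj_subgroup_def by force
qed

text \<open>The set \<open>aH\<close> multiplied on the right by the inverse of \<open>g\<close> is
  a left coset of the conjugate subgroup, since an inner factor \<open>inv g \<otimes> g\<close>
  cancels.\<close>

lemma orbit_conj_cpt:
  assumes H: "subgroup H G" and g: "g \<in> carrier G" and a: "a \<in> carrier G"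
  shows "(\<lambda>(C, k). (C #> inv g, k)) (cpt G H a) = cpt G (conj_subgroup G g H) (a \<otimes> inv g)"
proof -
  note sH = subgroup.subset[OF H]
  have "(a <# H) #> inv g = (\<lambda>h. a \<otimes> h \<otimes> inv g) ` H" by (auto simp: l_coset_def r_coset_def)
  moreover have "(a \<otimes> inv g) <# conj_subgroup G g H = (\<lambda>h. a \<otimes> inv g \<otimes> (g \<otimes> h \<otimes> inv g)) ` H"
    by (auto simp: l_coset_def conj_subgroup_def)
  moreover have "a \<otimes> inv g \<otimes> (g \<otimes> h \<otimes> inv g) = a \<otimes> h \<otimes> inv g" if "h \<in> H" for h
  proof -
    have h: "h \<in> carrier G" using sH that by blast
    have "inv g \<otimes> (g \<otimes> (h \<otimes> inv g)) = h \<otimes> inv g" using g h by (simp add: m_assoc[symmetric])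
    then show ?thesis using a g h by (simp add: m_assoc)
  qed
  ultimately show ?thesis by simp
qed

end

section \<open>The fibre over the base point of an orbit\<close>

text \<open>A single index: \<open>M\<close> is the fibre of \<open>N\<close> over the coset
  \<open>H\<close>, on which the stabiliser \<open>H\<close> acts as part of
  \<open>G\<close>.\<close>

abbreviation base_transported :: "('g, 'b) monoid_scheme \<Rightarrow> 'g set \<Rightarrow> 'g mfd \<Rightarrow> 'g mfd \<Rightarrow> (unit \<Rightarrow> real \<Rightarrow> real) \<Rightarrow> bool" where
  "base_transported G H N M i \<equiv> transported (subgrp G H) {()} (\<lambda>_ _. ()) (\<lambda>h _. h) (\<lambda>_. (H, 0)) (\<lambda>_. ())
     (label (orbit_gset G H)) ulabel N M i"

definition base_push :: "nat \<Rightarrow> ('g, 'b) monoid_scheme \<Rightarrow> 'g set \<Rightarrow> 'g sk \<Rightarrow> 'g sk" where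
  "base_push n G H = push n G (orbit_gset G H) (label (orbit_gset G H)) (subgrp G H) (point :: ('g, unit) gset) ulabel
     {()} (\<lambda>_ _. ()) (\<lambda>h _. h) (\<lambda>_. (H, 0)) (\<lambda>_. ())"

definition coset_rep :: "('g, 'b) monoid_scheme \<Rightarrow> 'g set \<Rightarrow> 'g gpt \<Rightarrow> 'g" where
  "coset_rep G H p = (SOME a. a \<in> carrier G \<and> p = cpt G H a)"

text \<open>This is what \<open>g\<close> becomes when the fibres over all cosets are identified
  with the one over \<open>H\<close> through the chosen representatives.\<close>

definition orbit_cocycle :: "('g, 'b) monoid_scheme \<Rightarrow> 'g set \<Rightarrow> 'g \<Rightarrow> 'g gpt \<Rightarrow> 'g" where
  "orbit_cocycle G H g p =
     inv\<^bsub>G\<^esub> coset_rep G H (gact (orbit_gset G H) g p) \<otimes>\<^bsub>G\<^esub> g \<otimes>\<^bsub>G\<^esub> coset_rep G H p"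

lemma G_manifold_subgrp:
  assumes "G_manifold n G M" "subgroup H G" shows "G_manifold n (subgrp G H) M"
proof -
  note m = G_manifoldD[OF assms(1)] and sH = subgroup.subset[OF assms(2)]
  have "group (subgrp G H)" using subgroup.subgroup_is_group[OF assms(2) m(5)] .
  then have "group_action (subgrp G H) (mspace M) (mact M)"
    by (rule group_actionI) (use m(6,7,8,12) sH in \<open>auto simp: subset_iff\<close>)
  then show ?thesis using assms(1) sH unfolding G_manifold_def by auto
qed

text \<open>The composite of a span into the orbit of \<open>K\<close> with passage to the base
  fibre: only the points of the apex above the base coset remain, and \<open>K\<close> preserves
  them.\<close>

lemma corresp_span_fibre:
  assumes u: "is_span G X (orbit_gset G K) u" and K: "subgroup K G"
  shows "corresp G X (subgrp G K) (point :: ('g, unit) gset) {p \<in> apts u. rleg u p = (K, 0)}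
     (gact (apex u)) (\<lambda>k _. k) (lleg u) (\<lambda>_. ())"
proof -
  interpret group G by (rule is_spanD(2)[OF u])
  note U = is_spanD[OF u] and A = finite_gsetD(4,5)[OF is_spanD(1)[OF u]]
  have k: "k \<in> carrier G" if "k \<in> K" for k using subgroup.subset[OF K] that by blast
  show ?thesis unfolding corresp_def
    using subgroup.subgroup_is_group[OF K is_group] U(3) A U(6,7,8) k orbit_points(7)[OF K] by (auto simp: point_def)
qed

locale finite_group = group +
  assumes finite_carrier: "finite (carrier G)"
begin

abbreviation pt :: "('a, unit) gset" where
  "pt \<equiv> point"

abbreviation orb :: "'a set \<Rightarrow> ('a, 'a gpt) gset" where
  "orb \<equiv> orbit_gset G"

lemma finite_orb: "subgroup H G \<Longrightarrow> finite_gset G (orb H)"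
  by (rule finite_gset_orbit[OF finite_carrier])

lemma group_subgrp: "subgroup H G \<Longrightarrow> group (subgrp G H)"
  by (rule subgroup.subgroup_is_group[OF _ is_group])

lemma coset_rep:
  assumes H: "subgroup H G" and "p \<in> pts (orb H)"
  shows "coset_rep G H p \<in> carrier G" "cpt G H (coset_rep G H p) = p"
proof -
  have "\<exists>a. a \<in> carrier G \<and> p = cpt G H a" using orbit_points(2)[OF assms] by blast
  from someI_ex[OF this] show "coset_rep G H p \<in> carrier G" "cpt G H (coset_rep G H p) = p"
    unfolding coset_rep_def by simp_all
qed

text \<open>The representative of the base coset is an arbitrary choice and may differ from the
  unit, but it lies in \<open>H\<close>; this leaves a harmless conjugation below.\<close>

lemma coset_rep_base: "subgroup H G \<Longrightarrow> coset_rep G H (H, 0) \<in> H"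
  using orbit_points(4)[of H "coset_rep G H (H, 0)" \<one>] orbit_points(5,8)[of H] coset_rep[of H "(H, 0)"] by simp

lemma orbit_cocycle:
  assumes H: "subgroup H G"
  shows "g \<in> carrier G \<Longrightarrow> p \<in> pts (orb H) \<Longrightarrow> orbit_cocycle G H g p \<in> H"
    "p \<in> pts (orb H) \<Longrightarrow> orbit_cocycle G H \<one> p = \<one>"
    "g \<in> carrier G \<Longrightarrow> h \<in> carrier G \<Longrightarrow> p \<in> pts (orb H) \<Longrightarrow>
      orbit_cocycle G H (g \<otimes> h) p = orbit_cocycle G H g (gact (orb H) h p) \<otimes> orbit_cocycle G H h p"
    "g \<in> carrier G \<Longrightarrow> p \<in> pts (orb H) \<Longrightarrow>
      coset_rep G H (gact (orb H) g p) \<otimes> orbit_cocycle G H g p = g \<otimes> coset_rep G H p"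
proof -
  note X = finite_gsetD[OF finite_orb[OF H]] and r = coset_rep[OF H]
  show "orbit_cocycle G H g p \<in> H" if g: "g \<in> carrier G" and p: "p \<in> pts (orb H)" for g p
  proof -
    have "cpt G H (g \<otimes> coset_rep G H p) = cpt G H (coset_rep G H (gact (orb H) g p))"
      using orbit_points(3)[OF H g r(1)[OF p]] r(2)[OF p] r(2)[OF X(3)[OF g p]] by simp
    then show ?thesis
      using orbit_points(4)[OF H _ r(1)[OF X(3)[OF g p]], of "g \<otimes> coset_rep G H p"] g r(1)[OF p] r(1)[OF X(3)[OF g p]]
      by (simp add: orbit_cocycle_def m_assoc)
  qed
  show "orbit_cocycle G H \<one> p = \<one>" if "p \<in> pts (orb H)" for p
    using X(4)[OF that] r(1)[OF that] by (simp add: orbit_cocycle_def)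
  show "coset_rep G H (gact (orb H) g p) \<otimes> orbit_cocycle G H g p = g \<otimes> coset_rep G H p"
    if "g \<in> carrier G" "p \<in> pts (orb H)" for g p
    using that r(1)[OF that(2)] r(1)[OF X(3)[OF that]] by (simp add: orbit_cocycle_def m_assoc[symmetric])
  show "orbit_cocycle G H (g \<otimes> h) p = orbit_cocycle G H g (gact (orb H) h p) \<otimes> orbit_cocycle G H h p"
    if g: "g \<in> carrier G" and h: "h \<in> carrier G" and p: "p \<in> pts (orb H)" for g h p
  proof -
    define x y z where "x = coset_rep G H (gact (orb H) g (gact (orb H) h p))" "y = coset_rep G H (gact (orb H) h p)" "z = coset_rep G H p"
    have c: "x \<in> carrier G" "y \<in> carrier G" "z \<in> carrier G" using r(1) X(3) g h p by (simp_all add: x_y_z_def)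
    have "inv x \<otimes> (g \<otimes> h) \<otimes> z = inv x \<otimes> g \<otimes> (y \<otimes> inv y) \<otimes> h \<otimes> z" using c g h by (simp add: m_assoc)
    also have "\<dots> = (inv x \<otimes> g \<otimes> y) \<otimes> (inv y \<otimes> h \<otimes> z)" using c g h by (simp only: m_assoc m_closed inv_closed)
    finally show ?thesis unfolding orbit_cocycle_def X(5)[OF g h p] x_y_z_def .
  qed
qed

lemma corresp_base:
  assumes "subgroup H G"
  shows "corresp G (orb H) (subgrp G H) pt {()} (\<lambda>_ _. ()) (\<lambda>h _. h) (\<lambda>_. (H, 0)) (\<lambda>_. ())"
  unfolding corresp_def
  using group_subgrp[OF assms] orbit_points(7)[OF assms] subgroup.subset[OF assms] by (auto simp: point_def)

text \<open>Induction as a transport: one copy of the H-manifold for each coset, permuted by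
  \<open>G\<close> and twisted by the cocycle of the representatives.\<close>

lemma corresp_induction:
  assumes H: "subgroup H G"
  shows "corresp (subgrp G H) pt G (orb H) (pts (orb H)) (gact (orb H)) (orbit_cocycle G H) (\<lambda>_. ()) (\<lambda>p. p)"
  unfolding corresp_def
  using is_group finite_gsetD[OF finite_orb[OF H]] orbit_cocycle[OF H] by auto

abbreviation orb_label :: "'a set \<Rightarrow> real \<Rightarrow> 'a gpt" where
  "orb_label H \<equiv> label (orb H)"

lemma base_push:
  assumes H: "subgroup H G"
  shows "base_push n G H \<in> hom (SKX n G (orb H)) (SK n (subgrp G H))"
    "lab_mfd n G (orb H) (orb_label H) N \<Longrightarrow> G_manifold n (subgrp G H) M \<Longrightarrow> base_transported G H N M i \<Longrightarrow>
       base_push n G H (lab_elem n G (orb H) (orb_label H) N) = SK_elem n (subgrp G H) (mfd_class n (subgrp G H) M)"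
  using push[OF labelling_label[OF finite_orb[OF H]] labelling_point[OF group_subgrp[OF H]] corresp_base[OF H], of n]
  unfolding base_push_def[symmetric] lab_SK_point[OF group_subgrp[OF H]] lab_mfd_point by blast+

text \<open>The composite is a transport over one point whose cocycle is conjugation by the
  representative \<open>?r\<close> of the base coset. The element \<open>?r\<close> itself, which
  lies in \<open>H\<close>, exhibits this as cohomologous to the identity cocycle.\<close>

lemma base_of_induced:
  fixes M L :: "'a mfd"
  assumes H: "subgroup H G" and M: "G_manifold n (subgrp G H) M" and N: "lab_mfd n G (orb H) (orb_label H) N"
    and L: "G_manifold n (subgrp G H) L"
    and j: "transported G (pts (orb H)) (gact (orb H)) (orbit_cocycle G H) (\<lambda>_. ()) (\<lambda>p. p) ulabel (orb_label H) M N j"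
    and i: "base_transported G H N L i"
  shows "lab_iso (subgrp G H) ulabel L M"
proof -
  have M': "lab_mfd n (subgrp G H) pt ulabel M" using M by (simp add: lab_mfd_point)
  have L': "lab_mfd n (subgrp G H) pt ulabel L" using L by (simp add: lab_mfd_point)
  have X: "finite_gset (subgrp G H) pt" using labelling_point[OF group_subgrp[OF H]] by (simp add: labelling_def)
  note o = orbit_points[OF H] and sH = subgroup.subset[OF H]
  let ?r = "coset_rep G H (H, 0)"
  have cR: "orbit_cocycle G H h (H, 0) = inv ?r \<otimes> h \<otimes> ?r" if "h \<in> H" for h using o(7)[OF that] by (simp add: orbit_cocycle_def)
  have comp: "transported (subgrp G H) {()} (\<lambda>_ _. ()) (\<lambda>h _. orbit_cocycle G H h (H, 0)) (\<lambda>_. ()) (\<lambda>_. ()) ulabel ulabel M L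
      (\<lambda>r x. i ((\<lambda>u. u) r) (j ((\<lambda>_. (H, 0)) r) x))"
    by (rule transported_compose[OF corresp_induction[OF H] corresp_base[OF H] M' N L' j i])
      (use o(7,8) in \<open>auto simp: bij_betw_def\<close>)
  have C: "corresp (subgrp G H) point (subgrp G H) pt {()} (\<lambda>_ _. ()) (\<lambda>h _. orbit_cocycle G H h (H, 0)) (\<lambda>_. ()) (\<lambda>_. ())"
    unfolding corresp_def using group_subgrp[OF H] orbit_cocycle[OF H] o(7,8) sH by (auto simp: point_def subset_iff)
  have "lab_iso (subgrp G H) ulabel L M"
    by (rule transported_twist[where \<beta> = "\<lambda>u. u" and t = "\<lambda>_. ?r", OF C X M' L' M' comp transported_id[OF M']])
      (use coset_rep_base[OF H] sH cR in \<open>auto simp: point_def m_assoc[symmetric] subset_iff bij_betw_def\<close>)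
  then show ?thesis .
qed

text \<open>Inducing and taking the base fibre returns \<open>M\<close> up to diffeomorphism, and
  \<open>transported_diffeo\<close> replaces that copy by \<open>M\<close> itself.\<close>

lemma base_preimage:
  fixes M :: "'a mfd"
  assumes H: "subgroup H G" and M: "G_manifold n (subgrp G H) M"
  obtains N i where "lab_mfd n G (orb H) (orb_label H) N" "base_transported G H N M i"
proof -
  have M': "lab_mfd n (subgrp G H) pt ulabel M" using M by (simp add: lab_mfd_point)
  obtain N j where N: "lab_mfd n G (orb H) (orb_label H) N"
    "transported G (pts (orb H)) (gact (orb H)) (orbit_cocycle G H) (\<lambda>_. ()) (\<lambda>p. p) ulabel (orb_label H) M N j"
    using transported_exists[OF corresp_induction[OF H] M' labelling.ample[OF labelling_label[OF finite_orb[OF H]]]] by blast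
  obtain L i where L: "lab_mfd n (subgrp G H) pt ulabel L" "base_transported G H N L i"
    using transported_exists[OF corresp_base[OF H] N(1) labelling.ample[OF labelling_point[OF group_subgrp[OF H]]]] by blast
  obtain \<phi> where "lab_diffeo (subgrp G H) ulabel L M (mspace M) \<phi>"
    using base_of_induced[OF H M N(1) _ N(2) L(2)] L(1) unfolding lab_iso_def lab_mfd_point by blast
  from transported_diffeo[OF L(1) M' this L(2)] show thesis using that N(1) by blast
qed

lemma base_push_iso:
  assumes H: "subgroup H G"
  shows "base_push n G H \<in> iso (SKX n G (orb H)) (SK n (subgrp G H))"
proof -
  let ?P = pt
  note gH = group_subgrp[OF H] and fX = finite_orb[OF H] and o = orbit_points[OF H]
  \<comment> \<open>The candidate inverse is induction from \<open>H\<close> to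
    \<open>G\<close>.\<close>
  define \<iota> where "\<iota> = push n (subgrp G H) ?P ulabel G (orb H) (orb_label H) (pts (orb H)) (gact (orb H)) (orbit_cocycle G H) (\<lambda>_. ()) (\<lambda>p. p)"
  note \<iota> = push[OF labelling_point[OF gH] labelling_label[OF fX] corresp_induction[OF H], of n, folded \<iota>_def]
  note h\<iota> = \<iota>(1)[unfolded lab_SK_point(1)[OF gH]] and hb = base_push(1)[OF H, of n]
  have cX: "comm_group (SKX n G (orb H))" by (rule comm_group_SKX[OF fX])
  have cS: "comm_group (SK n (subgrp G H))"
    using labelling.comm_group_lab_SK[OF labelling_point[OF gH], of n] unfolding lab_SK_point(1)[OF gH] .
  have left: "\<iota> (base_push n G H x) = x" if x: "x \<in> carrier (SKX n G (orb H))" for x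
  proof (rule SKX_hom_eq[OF fX, where h = "\<lambda>x. \<iota> (base_push n G H x)" and h' = "\<lambda>x. x" and B = "SKX n G (orb H)" and n = n])
    show "(\<lambda>x. \<iota> (base_push n G H x)) \<in> hom (SKX n G (orb H)) (SKX n G (orb H))"
      using Group.hom_compose[OF hb h\<iota>] by (simp add: o_def)
    fix N assume N: "lab_mfd n G (orb H) (orb_label H) N"
    obtain M i where M: "lab_mfd n (subgrp G H) ?P ulabel M" "base_transported G H N M i"
      using transported_exists[OF corresp_base[OF H] N labelling.ample[OF labelling_point[OF gH]]] by blast
    obtain N' j where N': "lab_mfd n G (orb H) (orb_label H) N'"
      "transported G (pts (orb H)) (gact (orb H)) (orbit_cocycle G H) (\<lambda>_. ()) (\<lambda>p. p) ulabel (orb_label H) M N' j"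
      using transported_exists[OF corresp_induction[OF H] M(1) labelling.ample[OF labelling_label[OF fX]]] by blast
    have comp: "transported G (pts (orb H)) (gact (orb H)) (orbit_cocycle G H) (\<lambda>_. (H, 0)) (\<lambda>p. p) (orb_label H) (orb_label H) N N'
        (\<lambda>r x. j ((\<lambda>p. p) r) (i ((\<lambda>_. ()) r) x))"
      by (rule transported_compose[OF corresp_base[OF H] corresp_induction[OF H] N M(1) N'(1) M(2) N'(2)])
        (use finite_gsetD(3)[OF fX] in \<open>auto simp: bij_betw_def inj_on_def\<close>)
    have C: "corresp G (orb H) G (orb H) (pts (orb H)) (gact (orb H)) (orbit_cocycle G H) (\<lambda>_. (H, 0)) (\<lambda>p. p)"
      unfolding corresp_def using is_group finite_gsetD[OF fX] orbit_cocycle[OF H] o(7) subgroup.subset[OF H] by auto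
    \<comment> \<open>The composite takes the base fibre once for every coset. Translation by
      \<open>coset_rep G H p\<close> moves it to the fibre over \<open>p\<close> and turns the
      cocycle into the tautological one, so the identity transport results.\<close>
    have "lab_iso G (orb_label H) N' N"
    proof (rule transported_twist[where \<beta> = "\<lambda>p. p" and t = "coset_rep G H", OF C fX N N'(1) N comp transported_id[OF N]])
      fix p assume p: "p \<in> pts (orb H)"
      show "p = gact (orb H) (coset_rep G H p) (H, 0)"
        using o(3)[OF coset_rep(1)[OF H p] one_closed] coset_rep[OF H p] o(5) by simp
      show "coset_rep G H p \<in> carrier G" by (rule coset_rep(1)[OF H p])
      fix g assume "g \<in> carrier G"
      then show "coset_rep G H (gact (orb H) g p) \<otimes> orbit_cocycle G H g p = g \<otimes> coset_rep G H p"
        using orbit_cocycle(4)[OF H] p by blast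
    qed (use o(8) in \<open>auto simp: bij_betw_def\<close>)
    then show "\<iota> (base_push n G H (lab_elem n G (orb H) (orb_label H) N)) = lab_elem n G (orb H) (orb_label H) N"
      using base_push(2)[OF H N _ M(2)] M(1) \<iota>(2)[OF M(1) N'] labelling.elem_iso[OF labelling_label[OF fX] N'(1) N]
      by (simp add: lab_mfd_point lab_SK_point(2)[OF gH])
  qed (use cX x in \<open>auto simp: hom_def comm_group_def\<close>)
  have right: "base_push n G H (\<iota> y) = y" if y: "y \<in> carrier (SK n (subgrp G H))" for y
  proof (rule labelling.hom_eq[OF labelling_point[OF gH], where h = "\<lambda>y. base_push n G H (\<iota> y)" and h' = "\<lambda>y. y" and n = n and B = "SK n (subgrp G H)",
        unfolded lab_SK_point[OF gH] lab_mfd_point])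
    show "(\<lambda>y. base_push n G H (\<iota> y)) \<in> hom (SK n (subgrp G H)) (SK n (subgrp G H))"
      using Group.hom_compose[OF h\<iota> hb] by (simp add: o_def)
    fix M :: "'a mfd" assume M: "G_manifold n (subgrp G H) M"
    then have M': "lab_mfd n (subgrp G H) ?P ulabel M" by (simp add: lab_mfd_point)
    obtain N j where N: "lab_mfd n G (orb H) (orb_label H) N"
      "transported G (pts (orb H)) (gact (orb H)) (orbit_cocycle G H) (\<lambda>_. ()) (\<lambda>p. p) ulabel (orb_label H) M N j"
      using transported_exists[OF corresp_induction[OF H] M' labelling.ample[OF labelling_label[OF fX]]] by blast
    obtain L i where L: "lab_mfd n (subgrp G H) ?P ulabel L" "base_transported G H N L i"
      using transported_exists[OF corresp_base[OF H] N(1) labelling.ample[OF labelling_point[OF gH]]] by blast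
    have "lab_iso (subgrp G H) ulabel L M" using base_of_induced[OF H M N(1) _ N(2) L(2)] L(1) by (simp add: lab_mfd_point)
    then have "SK_elem n (subgrp G H) (mfd_class n (subgrp G H) L) = SK_elem n (subgrp G H) (mfd_class n (subgrp G H) M)"
      using labelling.elem_iso[OF labelling_point[OF gH] L(1) M'] by (simp add: lab_SK_point(2)[OF gH])
    then show "base_push n G H (\<iota> (SK_elem n (subgrp G H) (mfd_class n (subgrp G H) M))) = SK_elem n (subgrp G H) (mfd_class n (subgrp G H) M)"
      using \<iota>(2)[OF M' N] base_push(2)[OF H N(1) _ L(2)] L(1) by (simp add: lab_mfd_point lab_SK_point(2)[OF gH])
  qed (use cS y in \<open>auto simp: hom_def comm_group_def\<close>)
  have "bij_betw (base_push n G H) (carrier (SKX n G (orb H))) (carrier (SK n (subgrp G H)))"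
    by (rule bij_betw_byWitness[where f' = \<iota>]) (use left right hom_in_carrier[OF hb] hom_in_carrier[OF h\<iota>] in auto)
  then show ?thesis using hb by (simp add: iso_def)
qed

end

section \<open>Restriction, transfer and conjugation\<close>

lemma act_open_image:
  assumes M: "G_manifold n G M" and g: "g \<in> carrier G" and U: "openin (mtop M) U"
  shows "openin (mtop M) (mact M g ` U)"
proof (rule diffeo_open_image[OF diffeo_act[OF M g subset_refl] _ U openin_subset[OF U]])
  note m = G_manifoldD[OF M]
  interpret group G by (rule m(5))
  have "mact M g ` mspace M = mspace M"
  proof
    show "mspace M \<subseteq> mact M g ` mspace M"
    proof
      fix x assume x: "x \<in> mspace M"
      from m(10)[OF g x, symmetric] m(6)[OF inv_closed[OF g] x] show "x \<in> mact M g ` mspace M" by (rule image_eqI)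
    qed
  qed (use m(6) g in auto)
  then show "openin (mtop M) (mact M g ` mspace M)" by simp
qed

text \<open>Conjugation changes the action only, so everything about topology and smooth structure
  is literally unchanged.\<close>

lemma conj_mfd_simps [simp]:
  "mtop (conj_mfd G g M) = mtop M"
  "mdim (conj_mfd G g M) = mdim M"
  "mact (conj_mfd G g M) = (\<lambda>x. mact M (inv\<^bsub>G\<^esub> g \<otimes>\<^bsub>G\<^esub> x \<otimes>\<^bsub>G\<^esub> g))"
  "smooth_manifold (conj_mfd G g M) \<longleftrightarrow> smooth_manifold M"
  "smooth_map (conj_mfd G g M) A (conj_mfd G g M) f \<longleftrightarrow> smooth_map M A M f"
  "diffeo N A (conj_mfd G g M) B f \<longleftrightarrow> diffeo N A M B f"
  by (simp_all add: conj_mfd_def diffeo_def smooth_map_def smooth_manifold_def)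

lemma (in group) G_manifold_conj:
  assumes M: "G_manifold n (subgrp G H) M" and H: "subgroup H G" and g: "g \<in> carrier G"
  shows "G_manifold n (subgrp G (conj_subgroup G g H)) (conj_mfd G g M)"
proof -
  note m = G_manifoldD[OF M] and K = conj_subgroup_subgroup[OF H g]
  have c: "inv g \<otimes> x \<otimes> g \<in> H" if "x \<in> conj_subgroup G g H" for x
    using mem_conj_subgroup_iff[OF H g] subgroup.subset[OF K] that by blast
  have "group_action (subgrp G (conj_subgroup G g H)) (mspace M) (\<lambda>x. mact M (inv g \<otimes> x \<otimes> g))"
  proof (rule group_actionI[OF subgroup.subgroup_is_group[OF K is_group]])
    fix x y assume "y \<in> mspace M"
    then show "mact M (inv g \<otimes> \<one>\<^bsub>subgrp G (conj_subgroup G g H)\<^esub> \<otimes> g) y = y" using m(7) g by simp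
    assume "x \<in> carrier (subgrp G (conj_subgroup G g H))"
    then show "mact M (inv g \<otimes> x \<otimes> g) y \<in> mspace M" using m(6) c \<open>y \<in> mspace M\<close> by simp
  next
    fix x y z assume xy: "x \<in> carrier (subgrp G (conj_subgroup G g H))" "y \<in> carrier (subgrp G (conj_subgroup G g H))" and z: "z \<in> mspace M"
    then have xyG: "x \<in> carrier G" "y \<in> carrier G" using subgroup.subset[OF K] by auto
    have "inv g \<otimes> (x \<otimes> y) \<otimes> g = inv g \<otimes> x \<otimes> (g \<otimes> inv g) \<otimes> y \<otimes> g" using xyG g by (simp add: m_assoc)
    also have "\<dots> = (inv g \<otimes> x \<otimes> g) \<otimes> (inv g \<otimes> y \<otimes> g)" using xyG g by (simp only: m_assoc m_closed inv_closed)
    finally show "mact M (inv g \<otimes> (x \<otimes>\<^bsub>subgrp G (conj_subgroup G g H)\<^esub> y) \<otimes> g) z = mact M (inv g \<otimes> x \<otimes> g) (mact M (inv g \<otimes> y \<otimes> g) z)"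
      using m(8)[OF _ _ z] c xy by simp
  qed (use m(12) c in auto)
  then show ?thesis using M c
    unfolding G_manifold_def by simp
qed

section \<open>Mackey structure maps computed on base fibres\<close>

context finite_group
begin

text \<open>Injectivity of \<open>base_push\<close> allows \<open>x\<close> to be replaced by the
  class of a manifold \<open>N\<close> whose base fibre is \<open>M\<close>. The span then acts on
  \<open>N\<close> geometrically, and the base fibre \<open>L\<close> of the result consists of
  fibres of \<open>N\<close> indexed by the apex points above the coset \<open>K\<close>.\<close>

lemma base_push_span:
  fixes M :: "'a mfd"
  assumes H: "subgroup H G" and K: "subgroup K G" and u: "is_span G (orb H) (orb K) u"
    and M: "G_manifold n (subgrp G H) M" and x: "x \<in> carrier (SKX n G (orb H))"
    and xM: "base_push n G H x = SK_elem n (subgrp G H) (mfd_class n (subgrp G H) M)"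
  obtains N i L J where "lab_mfd n G (orb H) (orb_label H) N" "base_transported G H N M i" "G_manifold n (subgrp G K) L"
    "transported (subgrp G K) {p \<in> apts u. rleg u p = (K, 0)} (gact (apex u)) (\<lambda>k _. k) (lleg u) (\<lambda>_. ()) (orb_label H) ulabel N L J"
    "base_push n G K (SK_mor n G (orb H) (orb K) (burnside_span G (orb H) (orb K) u) x) = SK_elem n (subgrp G K) (mfd_class n (subgrp G K) L)"
proof -
  interpret S: span_category G by (rule span_category.intro[OF is_group])
  note X = finite_orb[OF H] and Y = finite_orb[OF K]
  obtain N i where N: "lab_mfd n G (orb H) (orb_label H) N" "base_transported G H N M i" using base_preimage[OF H M] .
  have xN: "x = lab_elem n G (orb H) (orb_label H) N"
  proof (rule inj_onD[where f = "base_push n G H" and A = "carrier (SKX n G (orb H))"])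
    show "inj_on (base_push n G H) (carrier (SKX n G (orb H)))"
      using base_push_iso[OF H, of n] by (simp add: iso_def bij_betw_def)
    show "base_push n G H x = base_push n G H (lab_elem n G (orb H) (orb_label H) N)"
      using xM base_push(2)[OF H N(1) M N(2)] by simp
  qed (use x labelling.elem_in_carrier[OF labelling_label[OF X] N(1)] in auto)
  obtain N1 j where N1: "lab_mfd n G (orb K) (orb_label K) N1" "span_transported G (orb H) (orb K) u N N1 j"
    using span_transported_exists[OF Y u N(1)] .
  obtain L l where L: "lab_mfd n (subgrp G K) pt ulabel L" "base_transported G K N1 L l"
    using transported_exists[OF corresp_base[OF K] N1(1) labelling.ample[OF labelling_point[OF group_subgrp[OF K]]]] by blast
  have J: "transported (subgrp G K) {p \<in> apts u. rleg u p = (K, 0)} (gact (apex u)) (\<lambda>k _. k) (lleg u) (\<lambda>_. ()) (orb_label H) ulabel N L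
      (\<lambda>p x. l ((\<lambda>_. ()) p) (j ((\<lambda>p. p) p) x))"
    by (rule transported_compose[OF corresp_span[OF u] corresp_base[OF K] N(1) N1(1) L(1) N1(2) L(2)])
      (use is_spanD(7,8)[OF u] orbit_points(7)[OF K] subgroup.subset[OF K] in \<open>auto simp: bij_betw_def inj_on_def\<close>)
  have "SK_mor n G (orb H) (orb K) (burnside_span G (orb H) (orb K) u) x = lab_elem n G (orb K) (orb_label K) N1"
    using S.SK_mor_props(4)[OF X Y u x] span_push(2)[OF X Y u N(1) N1] xN by simp
  then have "base_push n G K (SK_mor n G (orb H) (orb K) (burnside_span G (orb H) (orb K) u) x) = SK_elem n (subgrp G K) (mfd_class n (subgrp G K) L)"
    using base_push(2)[OF K N1(1) _ L(2)] L(1) by (simp add: lab_mfd_point)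
  from that[OF N _ J this] show thesis using L(1) by (simp add: lab_mfd_point)
qed

text \<open>The comparison needed for each structure map: a matching of indices and a single
  translation \<open>t\<close> common to all of them.\<close>

lemma span_fibre_iso:
  fixes L L' :: "'a mfd"
  assumes H: "subgroup H G" and K: "subgroup K G" and u: "is_span G (orb H) (orb K) u"
    and N: "lab_mfd n G (orb H) (orb_label H) N" and L: "G_manifold n (subgrp G K) L" and L': "G_manifold n (subgrp G K) L'"
    and J: "transported (subgrp G K) {p \<in> apts u. rleg u p = (K, 0)} (gact (apex u)) (\<lambda>k _. k) (lleg u) (\<lambda>_. ()) (orb_label H) ulabel N L J"
    and J': "transported (subgrp G K) P' a' c' f' (\<lambda>_. ()) (orb_label H) ulabel N L' J'"
    and \<beta>: "bij_betw \<beta> {p \<in> apts u. rleg u p = (K, 0)} P'"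
      "\<And>k p. k \<in> K \<Longrightarrow> p \<in> apts u \<Longrightarrow> rleg u p = (K, 0) \<Longrightarrow> \<beta> (gact (apex u) k p) = a' k (\<beta> p)"
    and t: "t \<in> carrier G" "\<And>p. p \<in> apts u \<Longrightarrow> rleg u p = (K, 0) \<Longrightarrow> f' (\<beta> p) = gact (orb H) t (lleg u p)"
    and c': "\<And>k p. k \<in> K \<Longrightarrow> p \<in> apts u \<Longrightarrow> rleg u p = (K, 0) \<Longrightarrow> c' k (\<beta> p) \<in> carrier G"
      "\<And>k p. k \<in> K \<Longrightarrow> p \<in> apts u \<Longrightarrow> rleg u p = (K, 0) \<Longrightarrow> t \<otimes> k = c' k (\<beta> p) \<otimes> t"
  shows "lab_iso (subgrp G K) ulabel L L'"
    "SK_elem n (subgrp G K) (mfd_class n (subgrp G K) L) = SK_elem n (subgrp G K) (mfd_class n (subgrp G K) L')"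
proof -
  have L1: "lab_mfd n (subgrp G K) pt ulabel L" using L by (simp add: lab_mfd_point)
  have L2: "lab_mfd n (subgrp G K) pt ulabel L'" using L' by (simp add: lab_mfd_point)
  show iso: "lab_iso (subgrp G K) ulabel L L'"
    by (rule transported_twist[where \<beta> = \<beta> and t = "\<lambda>_. t", OF corresp_span_fibre[OF u K] finite_orb[OF H] N L1 L2 J J' \<beta>(1)])
      (use \<beta>(2) t c' is_spanD(4)[OF u] in auto)
  show "SK_elem n (subgrp G K) (mfd_class n (subgrp G K) L) = SK_elem n (subgrp G K) (mfd_class n (subgrp G K) L')"
    using labelling.elem_iso[OF labelling_point[OF group_subgrp[OF K]] L1 L2 iso] by (simp add: lab_SK_point(2)[OF group_subgrp[OF K]])
qed

section \<open>Restriction and conjugation\<close>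

lemma gset_map_proj:
  assumes K: "subgroup K G" and H: "subgroup H G" and KH: "K \<subseteq> H"
  shows "gset_map G (orb K) (orb H) (orbit_proj G H)"
  unfolding gset_map_def
proof (intro conjI ballI image_subsetI)
  fix p assume "p \<in> pts (orb K)"
  then obtain a where a: "a \<in> carrier G" "p = cpt G K a" using orbit_points(2)[OF K] by blast
  show "orbit_proj G H p \<in> pts (orb H)" unfolding a(2) orbit_proj_cpt[OF K H KH a(1)] by (rule orbit_points(1)[OF H a(1)])
  fix g assume g: "g \<in> carrier G"
  show "orbit_proj G H (gact (orb K) g p) = gact (orb H) g (orbit_proj G H p)"
    unfolding a(2) using orbit_points(3)[OF K g a(1)] orbit_points(3)[OF H g a(1)]
      orbit_proj_cpt[OF K H KH a(1)] orbit_proj_cpt[OF K H KH m_closed[OF g a(1)]] by simp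
qed

lemma gset_map_id: "gset_map G X X (\<lambda>x. x)"
  by (simp add: gset_map_def)

lemma SK_restriction:
  fixes M :: "'a mfd"
  assumes H: "subgroup H G" and K: "subgroup K G" and KH: "K \<subseteq> H"
    and M: "G_manifold n (subgrp G H) M" and x: "x \<in> carrier (SKX n G (orb H))"
    and xM: "base_push n G H x = SK_elem n (subgrp G H) (mfd_class n (subgrp G H) M)"
  shows "base_push n G K (SK_mor n G (orb H) (orb K) (restriction_mor G H K) x) = SK_elem n (subgrp G K) (mfd_class n (subgrp G K) M)"
proof -
  let ?u = "\<lparr>apex = orb K, lleg = orbit_proj G H, rleg = (\<lambda>x. x)\<rparr>"
  have u: "is_span G (orb H) (orb K) ?u"
    using finite_orb[OF K] gset_map_proj[OF K H KH] gset_map_id by (simp add: is_span_def)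
  obtain N i L J where N: "lab_mfd n G (orb H) (orb_label H) N" "base_transported G H N M i" and L: "G_manifold n (subgrp G K) L"
    and J: "transported (subgrp G K) {p \<in> apts ?u. rleg ?u p = (K, 0)} (gact (apex ?u)) (\<lambda>k _. k) (lleg ?u) (\<lambda>_. ()) (orb_label H) ulabel N L J"
    and e: "base_push n G K (SK_mor n G (orb H) (orb K) (burnside_span G (orb H) (orb K) ?u) x) = SK_elem n (subgrp G K) (mfd_class n (subgrp G K) L)"
    using base_push_span[OF H K u M x xM] .
  have "subgroup K (subgrp G H)" using subgroup_incl[OF K H KH] .
  from G_manifold_subgrp[OF M this] have MK: "G_manifold n (subgrp G K) M" by simp
  \<comment> \<open>The identification \<open>i\<close> of \<open>M\<close> with the base fibre is
    reused, with the group cut down from \<open>H\<close> to \<open>K\<close>.\<close>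
  have tr: "transported (subgrp G K) {()} (\<lambda>_ _. ()) (\<lambda>k _. k) (\<lambda>_. (H, 0)) (\<lambda>_. ()) (orb_label H) ulabel N M i"
    using N(2) KH unfolding transported_def by auto
  have pr: "orbit_proj G H (K, 0) = (H, 0)" using orbit_proj_cpt[OF K H KH one_closed] orbit_points(5)[OF K] orbit_points(5)[OF H] by simp
  have b: "bij_betw (\<lambda>_. ()) {p \<in> apts ?u. rleg ?u p = (K, 0)} {()}"
    using orbit_points(8)[OF K] by (auto simp: bij_betw_def inj_on_def)
  have "SK_elem n (subgrp G K) (mfd_class n (subgrp G K) L) = SK_elem n (subgrp G K) (mfd_class n (subgrp G K) M)"
    by (rule span_fibre_iso(2)[OF H K u N(1) L MK J tr b _ one_closed])
      (use subgroup.subset[OF K] pr finite_gsetD(4)[OF finite_orb[OF H] orbit_points(8)[OF H]] in auto)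
  then show ?thesis using e by (simp add: restriction_mor_def)
qed

text \<open>The only apex point above the base coset of the conjugate is the coset of
  \<open>g\<close>. Translation by the inverse of \<open>g\<close> moves its fibre to the base
  fibre, which turns the action of \<open>k\<close> into that of its conjugate, as in
  \<open>conj_mfd\<close>.\<close>

lemma SK_conjugation:
  fixes M :: "'a mfd"
  assumes H: "subgroup H G" and g: "g \<in> carrier G"
    and M: "G_manifold n (subgrp G H) M" and x: "x \<in> carrier (SKX n G (orb H))"
    and xM: "base_push n G H x = SK_elem n (subgrp G H) (mfd_class n (subgrp G H) M)"
  shows "base_push n G (conj_subgroup G g H) (SK_mor n G (orb H) (orb (conj_subgroup G g H)) (conjugation_mor G g H) x) =
    SK_elem n (subgrp G (conj_subgroup G g H)) (mfd_class n (subgrp G (conj_subgroup G g H)) (conj_mfd G g M))"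
proof -
  define K where "K = conj_subgroup G g H"
  have K: "subgroup K G" unfolding K_def by (rule conj_subgroup_subgroup[OF H g])
  note sK = subgroup.subset[OF K]
  let ?r = "\<lambda>(C, k::nat). (C #> inv g, k)"
  let ?u = "\<lparr>apex = orb H, lleg = (\<lambda>x. x), rleg = ?r\<rparr>"
  have r: "?r (cpt G H a) = cpt G K (a \<otimes> inv g)" if "a \<in> carrier G" for a
    unfolding K_def by (rule orbit_conj_cpt[OF H g that])
  have "gset_map G (orb H) (orb K) ?r"
    unfolding gset_map_def
  proof (intro conjI ballI image_subsetI)
    fix p assume "p \<in> pts (orb H)"
    then obtain a where a: "a \<in> carrier G" "p = cpt G H a" using orbit_points(2)[OF H] by blast
    show "?r p \<in> pts (orb K)" unfolding a(2) r[OF a(1)] using orbit_points(1)[OF K] a(1) g by simp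
    fix h assume h: "h \<in> carrier G"
    show "?r (gact (orb H) h p) = gact (orb K) h (?r p)"
      unfolding a(2) orbit_points(3)[OF H h a(1)] r[OF a(1)] r[OF m_closed[OF h a(1)]]
      using orbit_points(3)[OF K h, of "a \<otimes> inv g"] a(1) g h by (simp add: m_assoc)
  qed
  then have u: "is_span G (orb H) (orb K) ?u"
    using finite_orb[OF H] gset_map_id by (simp add: is_span_def)
  obtain N i L J where N: "lab_mfd n G (orb H) (orb_label H) N" "base_transported G H N M i" and L: "G_manifold n (subgrp G K) L"
    and J: "transported (subgrp G K) {p \<in> apts ?u. rleg ?u p = (K, 0)} (gact (apex ?u)) (\<lambda>k _. k) (lleg ?u) (\<lambda>_. ()) (orb_label H) ulabel N L J"
    and e: "base_push n G K (SK_mor n G (orb H) (orb K) (burnside_span G (orb H) (orb K) ?u) x) = SK_elem n (subgrp G K) (mfd_class n (subgrp G K) L)"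
    using base_push_span[OF H K u M x xM] .
  have MK: "G_manifold n (subgrp G K) (conj_mfd G g M)" unfolding K_def by (rule G_manifold_conj[OF M H g])
  have c: "inv g \<otimes> k \<otimes> g \<in> H" if "k \<in> K" for k
    using mem_conj_subgroup_iff[OF H g] sK that unfolding K_def by blast
  have tr: "transported (subgrp G K) {()} (\<lambda>_ _. ()) (\<lambda>k _. inv g \<otimes> k \<otimes> g) (\<lambda>_. (H, 0)) (\<lambda>_. ()) (orb_label H) ulabel N (conj_mfd G g M) i"
    using N(2) c unfolding transported_def pieces_def by auto
  \<comment> \<open>The coset of \<open>a\<close> goes to the base coset iff
    \<open>a \<otimes> inv g\<close> lies in \<open>K\<close>, that is, iff
    \<open>inv g \<otimes> a\<close> lies in \<open>H\<close>.\<close>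
  have fib: "{p \<in> pts (orb H). ?r p = (K, 0)} = {cpt G H g}"
  proof
    show "{cpt G H g} \<subseteq> {p \<in> pts (orb H). ?r p = (K, 0)}"
      using r[OF g] orbit_points(1)[OF H g] orbit_points(5)[OF K] g by simp
    show "{p \<in> pts (orb H). ?r p = (K, 0)} \<subseteq> {cpt G H g}"
    proof
      fix p assume p: "p \<in> {p \<in> pts (orb H). ?r p = (K, 0)}"
      then obtain a where a: "a \<in> carrier G" "p = cpt G H a" using orbit_points(2)[OF H] by blast
      have "cpt G K (a \<otimes> inv g) = cpt G K \<one>" using p r[OF a(1)] orbit_points(5)[OF K] unfolding a(2) by simp
      then have "a \<otimes> inv g \<in> K" using orbit_points(4)[OF K, of "a \<otimes> inv g" \<one>] a(1) g by simp
      then have "inv g \<otimes> (a \<otimes> inv g) \<otimes> g \<in> H" by (rule c)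
      then have "inv g \<otimes> a \<in> H" using a(1) g by (simp add: m_assoc)
      then show "p \<in> {cpt G H g}" using orbit_points(4)[OF H a(1) g] a(2) by simp
    qed
  qed
  have fib': "p = cpt G H g" if "p \<in> apts ?u" "rleg ?u p = (K, 0)" for p using fib that by auto
  have b: "bij_betw (\<lambda>_. ()) {p \<in> apts ?u. rleg ?u p = (K, 0)} {()}"
    using fib by (simp add: bij_betw_def)
  have "SK_elem n (subgrp G K) (mfd_class n (subgrp G K) L) = SK_elem n (subgrp G K) (mfd_class n (subgrp G K) (conj_mfd G g M))"
  proof (rule span_fibre_iso(2)[OF H K u N(1) L MK J tr b _ inv_closed[OF g]])
    fix p assume p: "p \<in> apts ?u" "rleg ?u p = (K, 0)"
    show "(H, 0) = gact (orb H) (inv g) (lleg ?u p)"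
      using fib'[OF p] orbit_points(3)[OF H inv_closed[OF g] g] orbit_points(5)[OF H] g by simp
    fix k assume "k \<in> K"
    then have k: "k \<in> carrier G" using sK by blast
    show "inv g \<otimes> k \<otimes> g \<in> carrier G" using k g by simp
    show "inv g \<otimes> k = inv g \<otimes> k \<otimes> g \<otimes> inv g" using k g by (simp add: m_assoc)
  qed simp
  then show ?thesis using e by (simp add: conjugation_mor_def K_def)
qed

subsection \<open>Transfers are inductions\<close>

text \<open>The index set is the set of cosets of \<open>K\<close> contained in \<open>H\<close>. A
  translate of the embedded copy of \<open>M\<close> corresponds to the fibre of \<open>N\<close>
  over such a coset, and the condition that translates meet only for \<open>h \<in> K\<close> is
  disjointness of the pieces.\<close>

lemma induced_from_iff:
  fixes M N L :: "'a mfd"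
  assumes K: "subgroup K G" and H: "subgroup H G" and KH: "K \<subseteq> H"
    and M: "G_manifold n (subgrp G K) M" and N: "lab_mfd n G (orb K) (orb_label K) N" and i: "base_transported G K N M i"
    and L: "G_manifold n (subgrp G H) L"
  shows "induced_from G K H M L \<longleftrightarrow>
    (\<exists>J. transported (subgrp G H) {p \<in> pts (orb K). orbit_proj G H p = (H, 0)} (gact (orb K)) (\<lambda>h _. h) (\<lambda>p. p) (\<lambda>_. ()) (orb_label K) ulabel N L J)"
    (is "_ \<longleftrightarrow> (\<exists>J. ?T J)")
proof
  note sH = subgroup.subset[OF H] and sK = subgroup.subset[OF K] and mN = G_manifoldD[OF lab_mfdD(1)[OF N]]
    and mL = G_manifoldD[OF L, simplified] and oK = orbit_points[OF K] and oH = orbit_points[OF H] and ti = transportedD[OF i] and pL = lab_mfdD[OF N]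
  let ?R = "{p \<in> pts (orb K). orbit_proj G H p = (H, 0)}" and ?F = "\<lambda>p. fibre (orb_label K) N p" and ?s = "coset_rep G K"
  have kG: "k \<in> H" "k \<in> carrier G" if "k \<in> K" for k using that KH sK by auto
  have hG: "h \<in> carrier G" if "h \<in> H" for h using that sH by blast
  have R: "cpt G K a \<in> ?R \<longleftrightarrow> a \<in> H" if "a \<in> carrier G" for a
    using oK(1)[OF that] orbit_proj_cpt[OF K H KH that] oH(4)[OF that one_closed] oH(5) that by simp
  have base: "(K, 0) \<in> ?R" using R[OF one_closed] oK(5) subgroup.one_closed[OF H] by simp
  have s: "?s p \<in> H" "cpt G K (?s p) = p" if "p \<in> ?R" for p
    using coset_rep[OF K, of p] R[of "?s p"] that by auto
  have gR: "gact (orb K) h p \<in> ?R" if "h \<in> H" "p \<in> ?R" for h p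
  proof -
    have "gact (orb K) h p = cpt G K (h \<otimes> ?s p)" using oK(3)[of h "?s p"] s[OF that(2)] hG that(1) by simp
    then show ?thesis using R[of "h \<otimes> ?s p"] subgroup.m_closed[OF H that(1) s(1)[OF that(2)]] hG by simp
  qed
  have iF: "i () ` ?F (K, 0) = mspace M" using ti(1) unfolding pieces_def by simp
  have di: "diffeo N (?F (K, 0)) M (mspace M) (i ())" using piecesD(4)[OF ti(1), of "()"] unfolding iF by simp
  note di' = diffeoD[OF di]
  have ik: "i () (mact N k x) = mact M k (i () x)" if "k \<in> K" "x \<in> ?F (K, 0)" for k x
    using ti(3)[of k "()" x] that by simp
  {
    assume "\<exists>J. ?T J"
    then obtain J where J: "?T J" by blast
    note tJ = transportedD[OF J, simplified] and p' = piecesD[OF transportedD(1)[OF J]]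
    \<comment> \<open>The copy of \<open>M\<close> is the piece indexed by the base coset, reached
      through the inverse of \<open>i ()\<close>.\<close>
    let ?U = "J (K, 0) ` ?F (K, 0)" and ?j = "\<lambda>y. J (K, 0) (inv_into (?F (K, 0)) (i ()) y)"
    have d: "diffeo M (mspace M) L ?U ?j"
      by (rule diffeo_compose[OF G_manifoldD(2)[OF M] pL(2) mL(2) diffeo_inv[OF pL(2) di] p'(4)[OF base]])
    have MK: "lab_mfd n (subgrp G K) pt ulabel M" using M by (simp add: lab_mfd_point)
    have "lab_diffeo (subgrp G K) ulabel M L ?U ?j"
    proof (rule lab_diffeoI[OF M d])
      fix k y assume k: "k \<in> carrier (subgrp G K)" and y: "y \<in> mspace M"
      then have kK: "k \<in> K" by simp
      let ?x = "inv_into (?F (K, 0)) (i ()) y"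
      have x: "?x \<in> ?F (K, 0)" "i () ?x = y" using di'(9,10) y by auto
      have kx: "mact N k ?x \<in> ?F (K, 0)" using x(1) mN(6) pL(4) oK(7) kG[OF kK] kK by auto
      have "inv_into (?F (K, 0)) (i ()) (mact M k y) = mact N k ?x" using di'(8)[OF kx] ik[OF kK x(1)] x(2) by simp
      then show "?j (mact M k y) = mact L k (?j y)" using tJ(3)[of k "(K, 0)" ?x] x base kG[OF kK] oK(7)[OF kK] by simp
    qed simp
    then have "G_diffeo (subgrp G K) M (mspace M) L ?U ?j" by (simp add: lab_diffeo_def)
    moreover have "openin (mtop L) ?U" by (rule p'(3)[OF base])
    moreover have act: "mact L h (J (K, 0) x) = J (gact (orb K) h (K, 0)) (mact N h x)" "mact N h x \<in> ?F (gact (orb K) h (K, 0))"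
      if "h \<in> H" "x \<in> ?F (K, 0)" for h x
      using tJ(3)[of h "(K, 0)" x] base that hG mN(6) pL(4) by auto
    have "(\<Union>h\<in>H. mact L h ` ?U) = mspace L"
    proof
      show "(\<Union>h\<in>H. mact L h ` ?U) \<subseteq> mspace L" using mL(6) p'(6)[OF base] by blast
      show "mspace L \<subseteq> (\<Union>h\<in>H. mact L h ` ?U)"
      proof
        fix y assume y: "y \<in> mspace L"
        show "y \<in> (\<Union>h\<in>H. mact L h ` ?U)"
        proof (rule pieces_cases[OF transportedD(1)[OF J] y])
          fix p x assume p: "p \<in> ?R" "x \<in> ?F p" "y = J p x"
          \<comment> \<open>This element carries the base coset to \<open>p\<close>, so moving back
            by its inverse brings the point into the base piece.\<close>
          let ?h = "?s p"
          have h: "?h \<in> H" "?h \<in> carrier G" using s(1)[OF p(1)] hG by auto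
          have hp: "gact (orb K) ?h (K, 0) = p" using oK(3)[OF h(2) one_closed] oK(5) s(2)[OF p(1)] h(2) by simp
          have hp': "gact (orb K) (inv ?h) p = (K, 0)"
            using oK(3)[OF inv_closed[OF h(2)] h(2)] oK(5) s(2)[OF p(1)] h(2) by simp
          have z: "mact N (inv ?h) x \<in> ?F (K, 0)" using p(2) hp' mN(6) pL(4) h(2) by auto
          have "mact L ?h (J (K, 0) (mact N (inv ?h) x)) = y" using act(1)[OF h(1) z] hp mN(10)[OF h(2)] p(2,3) by simp
          then show ?thesis using z h(1) by blast
        qed
      qed
    qed
    moreover have "h \<in> K" if h: "h \<in> H" and ne: "mact L h ` ?U \<inter> ?U \<noteq> {}" for h
    proof -
      obtain z where "z \<in> mact L h ` ?U" "z \<in> ?U" using ne by auto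
      then obtain x y where xy: "x \<in> ?F (K, 0)" "y \<in> ?F (K, 0)" "mact L h (J (K, 0) x) = J (K, 0) y"
        by (elim imageE) simp
      have "gact (orb K) h (K, 0) = (K, 0)"
        using p'(5)[OF gR[OF h base] base act(2)[OF h xy(1)] xy(2)] act(1)[OF h xy(1)] xy(3) by simp
      then have "cpt G K h = cpt G K \<one>" using oK(3)[OF hG[OF h] one_closed] oK(5) hG[OF h] by simp
      then show ?thesis using oK(4)[OF hG[OF h] one_closed] hG[OF h] by simp
    qed
    then have "\<forall>h\<in>H. mact L h ` ?U \<inter> ?U \<noteq> {} \<longrightarrow> h \<in> K" by blast
    ultimately show "induced_from G K H M L" unfolding induced_from_def
      by (intro exI[of _ ?U] exI[of _ ?j] conjI)
  }
  assume "induced_from G K H M L"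
  then obtain U j where Uj: "openin (mtop L) U \<and> G_diffeo (subgrp G K) M (mspace M) L U j \<and>
      (\<Union>h\<in>H. mact L h ` U) = mspace L \<and> (\<forall>h\<in>H. mact L h ` U \<inter> U \<noteq> {} \<longrightarrow> h \<in> K)"
    unfolding induced_from_def by (elim exE)
  then have U: "openin (mtop L) U" and j: "G_diffeo (subgrp G K) M (mspace M) L U j"
    and cov: "(\<Union>h\<in>H. mact L h ` U) = mspace L" by simp_all
  have dj: "h \<in> K" if "h \<in> H" "mact L h ` U \<inter> U \<noteq> {}" for h using Uj that by simp
  have dj': "diffeo M (mspace M) L U j" and jk: "\<And>k y. k \<in> K \<Longrightarrow> y \<in> mspace M \<Longrightarrow> j (mact M k y) = mact L k (j y)"
    using j unfolding G_diffeo_def by auto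
  have US: "U \<subseteq> mspace L" using openin_subset[OF U] .
  define e where "e x = j (i () x)" for x
  have de: "diffeo N (?F (K, 0)) L U e"
    using diffeo_compose[OF pL(2) G_manifoldD(2)[OF M] mL(2) di dj'] by (simp add: e_def[abs_def])
  have ek: "e (mact N k x) = mact L k (e x)" if "k \<in> K" "x \<in> ?F (K, 0)" for k x
    using ik[OF that] jk[OF that(1)] that(2) di'(3) unfolding e_def by auto
  \<comment> \<open>The fibre over \<open>p\<close> is moved to the base fibre by the inverse of the
    chosen representative, embedded there by \<open>e\<close>, and moved out again by that
    representative in \<open>L\<close>.\<close>
  define J where "J p x = mact L (?s p) (e (mact N (inv ?s p) x))" for p x
  have sx: "mact N (inv ?s p) ` ?F p = ?F (K, 0)" "diffeo N (?F p) N (?F (K, 0)) (mact N (inv ?s p))" if p: "p \<in> ?R" for p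
  proof -
    have c: "?s p \<in> carrier G" using s(1)[OF p] hG by blast
    have "gact (orb K) (inv ?s p) p = (K, 0)"
      using oK(3)[OF inv_closed[OF c] c] oK(5) s(2)[OF p] c by simp
    then show "diffeo N (?F p) N (?F (K, 0)) (mact N (inv ?s p))"
      using act_fibre[OF N finite_orb[OF K] inv_closed[OF c], of p] p by simp
    from diffeoD(3)[OF this] show "mact N (inv ?s p) ` ?F p = ?F (K, 0)" .
  qed
  have dJ: "diffeo N (?F p) L (mact L (?s p) ` U) (J p)" if p: "p \<in> ?R" for p
    unfolding J_def[abs_def]
    by (rule diffeo_compose[OF pL(2) mL(2) mL(2) diffeo_compose[OF pL(2) pL(2) mL(2) sx(2)[OF p] de] diffeo_act[OF L _ US]])
      (use s(1)[OF p] in simp)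
  have imJ: "J p ` ?F p = mact L (?s p) ` U" if "p \<in> ?R" for p using diffeoD(3)[OF dJ[OF that]] .
  have pcs: "pieces L ?R (\<lambda>_. N) ?F J"
    unfolding pieces_def
  proof (intro conjI ballI impI)
    fix p assume p: "p \<in> ?R"
    show "charted N" "openin (mtop N) (?F p)" by (fact pL(2), fact pL(5))
    show "openin (mtop L) (J p ` ?F p)" unfolding imJ[OF p]
      by (rule act_open_image[OF L _ U]) (use s(1)[OF p] in simp)
    show "diffeo N (?F p) L (J p ` ?F p) (J p)" unfolding imJ[OF p] by (rule dJ[OF p])
  next
    fix p q x y assume p: "p \<in> ?R" and q: "q \<in> ?R" and x: "x \<in> ?F p" and y: "y \<in> ?F q" and eq: "J p x = J q y"
    have sp: "?s p \<in> H" and sq: "?s q \<in> H" using s(1) p q by auto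
    have "J p x \<in> mact L (?s p) ` U" "J q y \<in> mact L (?s q) ` U" using imJ[OF p] imJ[OF q] x y by blast+
    then obtain v w where vw: "v \<in> U" "w \<in> U" "mact L (?s p) v = mact L (?s q) w" using eq by auto
    have iq: "inv ?s q \<in> H" by (rule subgroup.m_inv_closed[OF H sq])
    have vL: "v \<in> mspace L" and wL: "w \<in> mspace L" using vw US by auto
    have "mact L (inv ?s q \<otimes> ?s p) v = mact L (inv ?s q \<otimes> ?s q) w"
      using mL(8)[OF iq sp vL] mL(8)[OF iq sq wL] vw(3) by simp
    then have "mact L (inv ?s q \<otimes> ?s p) v = w" using mL(7)[OF wL] hG[OF sq] by simp
    then have "mact L (inv ?s q \<otimes> ?s p) ` U \<inter> U \<noteq> {}" using vw by blast
    \<comment> \<open>Two translates of \<open>U\<close> that meet differ by an element of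
      \<open>K\<close>, so the representatives belong to the same coset.\<close>
    then have "inv ?s q \<otimes> ?s p \<in> K" using dj subgroup.m_closed[OF H subgroup.m_inv_closed[OF H sq] sp] by blast
    then have "cpt G K (?s p) = cpt G K (?s q)" using oK(4) hG sp sq by blast
    then show "p = q" using s(2)[OF p] s(2)[OF q] by simp
  next
    \<comment> \<open>A translate by \<open>h\<close> lies in the translate by the representative of
      its coset, because the two elements differ by some element of \<open>K\<close> and
      \<open>U\<close> is invariant under \<open>K\<close>.\<close>
    have tr: "mact L h ` U \<subseteq> (\<Union>p\<in>?R. mact L (?s p) ` U)" if h: "h \<in> H" for h
    proof -
      have p: "cpt G K h \<in> ?R" using R hG h by blast
      let ?t = "?s (cpt G K h)"
      have t: "?t \<in> H" "?t \<in> carrier G" using s(1)[OF p] hG by auto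
      have k: "inv ?t \<otimes> h \<in> K" using oK(4)[OF hG[OF h] t(2)] s(2)[OF p] by simp
      have "mact L h v \<in> mact L ?t ` U" if v: "v \<in> U" for v
      proof -
        have "mact L (inv ?t \<otimes> h) v \<in> U" using j k v unfolding G_diffeo_def invariant_under_def by simp
        moreover have "mact L ?t (mact L (inv ?t \<otimes> h) v) = mact L h v"
          using mL(8)[OF t(1) kG(1)[OF k], of v] v US t(2) hG[OF h] by (auto simp: m_assoc[symmetric])
        ultimately show ?thesis by (rule rev_image_eqI[OF _ sym])
      qed
      then show ?thesis using p by blast
    qed
    have "mspace L \<subseteq> (\<Union>p\<in>?R. mact L (?s p) ` U)" unfolding cov[symmetric] by (rule UN_least) (rule tr)
    moreover have "(\<Union>p\<in>?R. mact L (?s p) ` U) \<subseteq> mspace L" using s(1) US mL(6) by blast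
    ultimately show "(\<Union>p\<in>?R. J p ` ?F p) = mspace L" using imJ by auto
  qed
  have eqv: "mact L h (J p x) = J (gact (orb K) h p) (mact N h x)" if h: "h \<in> H" and p: "p \<in> ?R" and x: "x \<in> ?F p" for h p x
  proof -
    let ?q = "gact (orb K) h p"
    have q: "?q \<in> ?R" by (rule gR[OF h p])
    define a b where "a = ?s p" "b = ?s ?q"
    have ab: "a \<in> H" "b \<in> H" "a \<in> carrier G" "b \<in> carrier G" using s(1)[OF p] s(1)[OF q] hG by (auto simp: a_b_def)
    have hc: "h \<in> carrier G" by (rule hG[OF h])
    \<comment> \<open>\<open>k\<close> measures by how much \<open>h\<close> times the
      representative of \<open>p\<close> misses the representative of the new coset. It lies in
      \<open>K\<close>, where \<open>e\<close> is equivariant, so it can be moved across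
      \<open>e\<close>.\<close>
    define k where "k = inv b \<otimes> (h \<otimes> a)"
    have "cpt G K (h \<otimes> a) = cpt G K b" using oK(3)[OF hc ab(3)] s(2)[OF p] s(2)[OF q] unfolding a_b_def by simp
    then have k: "k \<in> K" unfolding k_def using oK(4)[of "h \<otimes> a" b] ab hc by simp
    let ?x = "mact N (inv a) x"
    have x': "?x \<in> ?F (K, 0)" using sx(1)[OF p] x unfolding a_b_def by blast
    have ex: "e ?x \<in> mspace L" using diffeoD(3)[OF de] x' US by blast
    have "mact L h (J p x) = mact L (h \<otimes> a) (e ?x)"
      using mL(8)[OF h ab(1) ex] by (simp add: J_def a_b_def)
    also have "h \<otimes> a = b \<otimes> k" using ab hc unfolding k_def by (simp add: m_assoc[symmetric])
    also have "mact L (b \<otimes> k) (e ?x) = mact L b (mact L k (e ?x))" by (rule mL(8)[OF ab(2) kG(1)[OF k] ex])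
    also have "\<dots> = mact L b (e (mact N k ?x))" using ek[OF k x'] by simp
    also have "mact N k ?x = mact N (inv b) (mact N h x)"
    proof -
      have "k \<otimes> inv a = inv b \<otimes> h \<otimes> (a \<otimes> inv a)" unfolding k_def using ab hc by (simp only: m_assoc m_closed inv_closed)
      then have "k \<otimes> inv a = inv b \<otimes> h" using ab hc by simp
      then show ?thesis using mN(8)[of k "inv a" x] mN(8)[of "inv b" h x] kG(2)[OF k] ab hc x by simp
    qed
    finally show ?thesis by (simp add: J_def a_b_def)
  qed
  have "?T J" unfolding transported_def
  proof (intro conjI ballI pcs)
    fix p x h assume "p \<in> ?R" "x \<in> ?F p" "h \<in> carrier (subgrp G H)"
    then show "mact L h (J p x) = J (gact (orb K) h p) (mact N h x)" using eqv[of h p x] by simp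
  qed simp
  then show "\<exists>J. ?T J" by blast
qed

text \<open>By \<open>induced_from_iff\<close> the induced manifolds are exactly the transports of
  \<open>N\<close> over the apex points above the base coset. These form a single diffeomorphism
  class, that of \<open>L\<close>, since transports are unique up to isomorphism and closed under
  it.\<close>

lemma SK_transfer:
  fixes M :: "'a mfd"
  assumes H: "subgroup H G" and K: "subgroup K G" and KH: "K \<subseteq> H"
    and M: "G_manifold n (subgrp G K) M" and x: "x \<in> carrier (SKX n G (orb K))"
    and xM: "base_push n G K x = SK_elem n (subgrp G K) (mfd_class n (subgrp G K) M)"
  shows "base_push n G H (SK_mor n G (orb K) (orb H) (transfer_mor G K H) x) = SK_elem n (subgrp G H) (induced_class n G K H M)"
proof -
  let ?u = "\<lparr>apex = orb K, lleg = (\<lambda>x. x), rleg = orbit_proj G H\<rparr>"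
  have u: "is_span G (orb K) (orb H) ?u"
    using finite_orb[OF K] gset_map_proj[OF K H KH] gset_map_id by (simp add: is_span_def)
  obtain N i L J where N: "lab_mfd n G (orb K) (orb_label K) N" "base_transported G K N M i" and L: "G_manifold n (subgrp G H) L"
    and J: "transported (subgrp G H) {p \<in> apts ?u. rleg ?u p = (H, 0)} (gact (apex ?u)) (\<lambda>k _. k) (lleg ?u) (\<lambda>_. ()) (orb_label K) ulabel N L J"
    and e: "base_push n G H (SK_mor n G (orb K) (orb H) (burnside_span G (orb K) (orb H) ?u) x) = SK_elem n (subgrp G H) (mfd_class n (subgrp G H) L)"
    using base_push_span[OF K H u M x xM] .
  have "induced_from G K H M L' \<longleftrightarrow> (\<exists>f. G_diffeo (subgrp G H) L (mspace L) L' (mspace L') f)"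
    if L': "G_manifold n (subgrp G H) L'" for L' :: "'a mfd"
    unfolding induced_from_iff[OF K H KH M N L'] lab_iso_point[symmetric]
  proof
    assume "\<exists>J. transported (subgrp G H) {p \<in> pts (orb K). orbit_proj G H p = (H, 0)} (gact (orb K)) (\<lambda>h _. h) (\<lambda>p. p) (\<lambda>_. ()) (orb_label K) ulabel N L' J"
    then obtain J' where J': "transported (subgrp G H) {p \<in> pts (orb K). orbit_proj G H p = (H, 0)} (gact (orb K)) (\<lambda>h _. h) (\<lambda>p. p) (\<lambda>_. ()) (orb_label K) ulabel N L' J'"
      by blast
    show "lab_iso (subgrp G H) ulabel L L'"
      by (rule span_fibre_iso(1)[where \<beta> = "\<lambda>p. p" and t = \<one>, OF K H u N(1) L L' J J'])
        (use subgroup.subset[OF H] finite_gsetD(4)[OF finite_orb[OF K]] in \<open>auto simp: bij_betw_def\<close>)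
  next
    assume "lab_iso (subgrp G H) ulabel L L'"
    then obtain \<phi> where \<phi>: "lab_diffeo (subgrp G H) ulabel L L' (mspace L') \<phi>" unfolding lab_iso_def by blast
    have "lab_mfd n (subgrp G H) pt ulabel L" "lab_mfd n (subgrp G H) pt ulabel L'"
      using L L' by (simp_all add: lab_mfd_point)
    from transported_diffeo[OF this \<phi> J]
    show "\<exists>J. transported (subgrp G H) {p \<in> pts (orb K). orbit_proj G H p = (H, 0)} (gact (orb K)) (\<lambda>h _. h) (\<lambda>p. p) (\<lambda>_. ()) (orb_label K) ulabel N L' J"
      by auto
  qed
  then have "induced_class n G K H M = mfd_class n (subgrp G H) L" unfolding induced_class_def mfd_class_def by blast
  then show ?thesis using e by (simp add: transfer_mor_def)
qed

lemma iso_const_group: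
  assumes "h \<in> iso A B" shows "(\<lambda>a. h (a undefined)) \<in> iso (const_group A) B"
proof -
  have h: "h \<in> hom A B" "bij_betw h (carrier A) (carrier B)" using assms by (auto simp: iso_def)
  have "bij_betw (\<lambda>a. h (a undefined)) (carrier (const_group A)) (carrier B)"
    using h(2) by (fastforce simp: const_group_def bij_betw_def inj_on_def image_image)
  moreover have "(\<lambda>a. h (a undefined)) \<in> hom (const_group A) B"
    using h(1) by (auto simp: hom_def)
  ultimately show ?thesis by (simp add: iso_def)
qed

end

theorem theorem1:
  fixes G :: "('g, 'b) monoid_scheme" and n :: nat
  assumes "group G" and "finite (carrier G)"
  shows "\<exists>(F :: ('g, 'g gpt) gset \<Rightarrow> ('g gpt \<Rightarrow> 'g sk) monoid) T
            (\<theta> :: 'g set \<Rightarrow> ('g gpt \<Rightarrow> 'g sk) \<Rightarrow> 'g sk).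
     mackey_functor G F T \<and>
     (\<forall>H. subgroup H G \<longrightarrow> \<theta> H \<in> iso (F (orbit_gset G H)) (SK n (subgrp G H))) \<and>
     (\<forall>H K M a. subgroup H G \<longrightarrow> subgroup K G \<longrightarrow> K \<subseteq> H \<longrightarrow>
        G_manifold n (subgrp G H) M \<longrightarrow> a \<in> carrier (F (orbit_gset G H)) \<longrightarrow>
        \<theta> H a = SK_elem n (subgrp G H) (mfd_class n (subgrp G H) M) \<longrightarrow>
        \<theta> K (T (orbit_gset G H) (orbit_gset G K) (restriction_mor G H K) a) =
          SK_elem n (subgrp G K) (mfd_class n (subgrp G K) M)) \<and>
     (\<forall>H K M a. subgroup H G \<longrightarrow> subgroup K G \<longrightarrow> K \<subseteq> H \<longrightarrow>
        G_manifold n (subgrp G K) M \<longrightarrow> a \<in> carrier (F (orbit_gset G K)) \<longrightarrow>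
        \<theta> K a = SK_elem n (subgrp G K) (mfd_class n (subgrp G K) M) \<longrightarrow>
        \<theta> H (T (orbit_gset G K) (orbit_gset G H) (transfer_mor G K H) a) =
          SK_elem n (subgrp G H) (induced_class n G K H M)) \<and>
     (\<forall>H g M a. subgroup H G \<longrightarrow> g \<in> carrier G \<longrightarrow>
        G_manifold n (subgrp G H) M \<longrightarrow> a \<in> carrier (F (orbit_gset G H)) \<longrightarrow>
        \<theta> H a = SK_elem n (subgrp G H) (mfd_class n (subgrp G H) M) \<longrightarrow>
        \<theta> (conj_subgroup G g H)
          (T (orbit_gset G H) (orbit_gset G (conj_subgroup G g H)) (conjugation_mor G g H) a) =
          SK_elem n (subgrp G (conj_subgroup G g H))
            (mfd_class n (subgrp G (conj_subgroup G g H)) (conj_mfd G g M)))"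
proof -
  interpret finite_group G using assms by (simp add: finite_group_def finite_group_axioms_def)
  interpret S: span_category G by (rule span_category.intro[OF assms(1)])
  show ?thesis
  \<comment> \<open>Evaluation at \<open>undefined\<close> recovers an SK element from the constant
    function that carries it.\<close>
  proof (intro exI[of _ "\<lambda>X. const_group (SKX n G X)"] exI[of _ "\<lambda>X Y \<alpha> a _. SK_mor n G X Y \<alpha> (a undefined)"]
      exI[of _ "\<lambda>H a. base_push n G H (a undefined)"] conjI allI impI, goal_cases)
    case 1
    show ?case by (rule S.mackey_functor_SK)
  next
    case (2 H)
    show ?case by (rule iso_const_group[OF base_push_iso[OF 2]])
  next
    case (3 H K M a)
    then show ?case using SK_restriction[OF 3(1-4)] by auto
  next
    case (4 H K M a)
    then show ?case using SK_transfer[OF 4(1-4)] by auto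
  next
    case (5 H g M a)
    then show ?case using SK_conjugation[OF 5(1-3)] by auto
  qed
qed

end
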